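(* Let $\mathbb Z[\varepsilon]=\mathbb Z[T]/(T^2)$. The following three categories are equivalent: (a) the stable category $\underline{\operatorname{G-proj}}\,\mathbb Z[\varepsilon]$ of (finitely generated) Gorenstein-projective $\mathbb Z[\varepsilon]$-modules modulo projectives; (b) the stable category $\underline{\operatorname{sub}}(\mathbb Z[\varepsilon])$ of all submodules of finitely generated free $\mathbb Z[\varepsilon]$-modules, modulo projectives; (c) the orbit category $\mathcal D^b(\mathbb Z)/[1]$ of the bounded derived category of the integers.
   Context: All modules are finitely generated right modules. For a ring $\Lambda$, a module $M$ is Gorenstein-projective if there is a doubly infinite exact sequence $P^\bullet:\cdots\to P^{-1}\to P^0\xrightarrow{d^0}P^1\to\cdots$ of finitely generated projective $\Lambda$-modules such that $\operatorname{Hom}_\Lambda(P^\bullet,\Lambda)$ is exact and $M\cong\operatorname{Ker}d^0$; $\operatorname{G-proj}\Lambda$ is the full subcategory of $\operatorname{mod}\Lambda$ of such modules. A $\mathbb Z[\varepsilon]$-module is torsionless if it is (isomorphic to) a submodule of $\mathbb Z[\varepsilon]^n$ for some $n$; $\operatorname{sub}(\mathbb Z[\varepsilon])$ is the full subcategory of $\operatorname{mod}\mathbb Z[\varepsilon]$ of torsionless modules. The stable category of either has the same objects, and its morphism groups are the quotients by the subgroups of morphisms factoring through a finitely generated projective $\mathbb Z[\varepsilon]$-module. $\mathcal D^b(\mathbb Z)$ is the bounded derived category of finitely generated abelian groups, with shift $[1]$. For a category $\mathcal T$ with shift $[1]$, the orbit category $\mathcal T/[1]$ has the same objects as $\mathcal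 T$ and $\operatorname{Hom}_{\mathcal T/[1]}(X,Y)=\bigoplus_{i\in\mathbb Z}\operatorname{Hom}_{\mathcal T}(X,Y[i])$, with composition of $f:X\to Y[i]$ and $g:Y\to Z[k]$ given by $g[i]\circ f$. *)

theory Defs
  imports "HOL-Library.Infinite_Typeclass" "HOL-Algebra.IntRing" "HOL-Algebra.UnivPoly"
begin

section \<open>Categories with Hom groups\<close>

text \<open>
  \<open>Hom C X Y\<close> is written additively; only its carrier, zero and addition are meaningful, the
  multiplicative fields of the record are junk. Morphisms do not determine their domain
  and codomain, so \<open>Cmp C X Y Z g f\<close> (the composite of \<open>f : X \<rightarrow> Y\<close> and \<open>g : Y \<rightarrow> Z\<close>) takes the
  objects as arguments.
\<close>

record ('o, 'm) precat =
  Obj :: "'o set"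
  Hom :: "'o \<Rightarrow> 'o \<Rightarrow> 'm ring"
  Ident :: "'o \<Rightarrow> 'm"
  Cmp :: "'o \<Rightarrow> 'o \<Rightarrow> 'o \<Rightarrow> 'm \<Rightarrow> 'm \<Rightarrow> 'm"

locale category =
  fixes C :: "('o, 'm) precat"
  assumes Ident_closed: "X \<in> Obj C \<Longrightarrow> Ident C X \<in> carrier (Hom C X X)"
    and Cmp_closed:
      "\<lbrakk>X \<in> Obj C; Y \<in> Obj C; Z \<in> Obj C; f \<in> carrier (Hom C X Y); g \<in> carrier (Hom C Y Z)\<rbrakk>
        \<Longrightarrow> Cmp C X Y Z g f \<in> carrier (Hom C X Z)"
    and Cmp_Ident_left:
      "\<lbrakk>X \<in> Obj C; Y \<in> Obj C; f \<in> carrier (Hom C X Y)\<rbrakk> \<Longrightarrow> Cmp C X Y Y (Ident C Y) f = f"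
    and Cmp_Ident_right:
      "\<lbrakk>X \<in> Obj C; Y \<in> Obj C; f \<in> carrier (Hom C X Y)\<rbrakk> \<Longrightarrow> Cmp C X X Y f (Ident C X) = f"
    and Cmp_assoc:
      "\<lbrakk>W \<in> Obj C; X \<in> Obj C; Y \<in> Obj C; Z \<in> Obj C;
        f \<in> carrier (Hom C W X); g \<in> carrier (Hom C X Y); h \<in> carrier (Hom C Y Z)\<rbrakk>
        \<Longrightarrow> Cmp C W Y Z h (Cmp C W X Y g f) = Cmp C W X Z (Cmp C X Y Z h g) f"

locale cat_functor = dom: category C + cod: category D
  for C :: "('o, 'm) precat" and D :: "('p, 'n) precat" +
  fixes Fo :: "'o \<Rightarrow> 'p" and Fm :: "'o \<Rightarrow> 'o \<Rightarrow> 'm \<Rightarrow> 'n"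
  assumes Fo_closed: "X \<in> Obj C \<Longrightarrow> Fo X \<in> Obj D"
    and Fm_closed:
      "\<lbrakk>X \<in> Obj C; Y \<in> Obj C; f \<in> carrier (Hom C X Y)\<rbrakk>
        \<Longrightarrow> Fm X Y f \<in> carrier (Hom D (Fo X) (Fo Y))"
    and Fm_Ident: "X \<in> Obj C \<Longrightarrow> Fm X X (Ident C X) = Ident D (Fo X)"
    and Fm_Cmp:
      "\<lbrakk>X \<in> Obj C; Y \<in> Obj C; Z \<in> Obj C; f \<in> carrier (Hom C X Y); g \<in> carrier (Hom C Y Z)\<rbrakk>
        \<Longrightarrow> Fm X Z (Cmp C X Y Z g f) = Cmp D (Fo X) (Fo Y) (Fo Z) (Fm Y Z g) (Fm X Y f)"

definition iso_in :: "('o, 'm) precat \<Rightarrow> 'o \<Rightarrow> 'o \<Rightarrow> 'm \<Rightarrow> bool" where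
  "iso_in C X Y f \<longleftrightarrow> f \<in> carrier (Hom C X Y) \<and>
     (\<exists>g \<in> carrier (Hom C Y X). Cmp C X Y X g f = Ident C X \<and> Cmp C Y X Y f g = Ident C Y)"

definition naturally_isomorphic ::
  "('o, 'm) precat \<Rightarrow> ('p, 'n) precat \<Rightarrow> ('o \<Rightarrow> 'p) \<Rightarrow> ('o \<Rightarrow> 'o \<Rightarrow> 'm \<Rightarrow> 'n)
    \<Rightarrow> ('o \<Rightarrow> 'p) \<Rightarrow> ('o \<Rightarrow> 'o \<Rightarrow> 'm \<Rightarrow> 'n) \<Rightarrow> bool" where
  "naturally_isomorphic C D Fo Fm Go Gm \<longleftrightarrow>
     (\<exists>\<eta>. (\<forall>X \<in> Obj C. iso_in D (Fo X) (Go X) (\<eta> X)) \<and>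
       (\<forall>X \<in> Obj C. \<forall>Y \<in> Obj C. \<forall>f \<in> carrier (Hom C X Y).
          Cmp D (Fo X) (Fo Y) (Go Y) (\<eta> Y) (Fm X Y f)
            = Cmp D (Fo X) (Go X) (Go Y) (Gm X Y f) (\<eta> X)))"

definition equivalent_categories :: "('o, 'm) precat \<Rightarrow> ('p, 'n) precat \<Rightarrow> bool" where
  "equivalent_categories C D \<longleftrightarrow>
     (\<exists>Fo Fm Go Gm. cat_functor C D Fo Fm \<and> cat_functor D C Go Gm \<and>
        naturally_isomorphic C C
          (\<lambda>X. Go (Fo X)) (\<lambda>X Y f. Gm (Fo X) (Fo Y) (Fm X Y f)) (\<lambda>X. X) (\<lambda>X Y f. f) \<and>
        naturally_isomorphic D D
          (\<lambda>X. Fo (Go X)) (\<lambda>X Y f. Fm (Go X) (Go Y) (Gm X Y f)) (\<lambda>X. X) (\<lambda>X Y f. f))"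

definition full_subcat :: "('o, 'm) precat \<Rightarrow> 'o set \<Rightarrow> ('o, 'm) precat" where
  "full_subcat C Q = C\<lparr>Obj := Obj C \<inter> Q\<rparr>"

text \<open>
  The quotient of \<open>C\<close> by a two-sided ideal: \<open>I X Y\<close> is a subgroup of \<open>Hom C X Y\<close>, and the new
  Hom groups are the groups of cosets.
\<close>

definition quotient_cat ::
  "('o, 'm) precat \<Rightarrow> ('o \<Rightarrow> 'o \<Rightarrow> 'm set) \<Rightarrow> ('o, 'm set) precat" where
  "quotient_cat C I =
     \<lparr>Obj = Obj C,
      Hom = (\<lambda>X Y. \<lparr>carrier = a_rcosets\<^bsub>Hom C X Y\<^esub> (I X Y), mult = undefined, one = undefined,
                    zero = I X Y, add = (\<lambda>F G. F <+>\<^bsub>Hom C X Y\<^esub> G)\<rparr>),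
      Ident = (\<lambda>X. I X X +>\<^bsub>Hom C X X\<^esub> Ident C X),
      Cmp = (\<lambda>X Y Z G F. \<Union>g\<in>G. \<Union>f\<in>F. I X Z +>\<^bsub>Hom C X Z\<^esub> Cmp C X Y Z g f)\<rparr>"


section \<open>Localization by right fractions\<close>

text \<open>
  A triple \<open>(W, s, f)\<close> stands for the roof \<open>X \<leftarrow> W \<rightarrow> Y\<close> with legs \<open>s \<in> S W X\<close> and \<open>f : W \<rightarrow> Y\<close>,
  that is, for the fraction \<open>f \<circ> s\<^sup>-\<^sup>1\<close>. Sums and composites of classes are collected over all
  choices of common denominators and Ore squares; when \<open>S\<close> admits a calculus of right
  fractions the result is a single class.
\<close>

definition roofs ::
  "('o, 'm) precat \<Rightarrow> ('o \<Rightarrow> 'o \<Rightarrow> 'm set) \<Rightarrow> 'o \<Rightarrow> 'o \<Rightarrow> ('o \<times> 'm \<times> 'm) set" where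
  "roofs C S X Y = {(W, s, f). W \<in> Obj C \<and> s \<in> S W X \<and> f \<in> carrier (Hom C W Y)}"

definition roof_rel ::
  "('o, 'm) precat \<Rightarrow> ('o \<Rightarrow> 'o \<Rightarrow> 'm set) \<Rightarrow> 'o \<Rightarrow> 'o
    \<Rightarrow> (('o \<times> 'm \<times> 'm) \<times> ('o \<times> 'm \<times> 'm)) set" where
  "roof_rel C S X Y =
     {((W, s, f), (W', s', f')). (W, s, f) \<in> roofs C S X Y \<and> (W', s', f') \<in> roofs C S X Y \<and>
        (\<exists>V \<in> Obj C. \<exists>u \<in> carrier (Hom C V W). \<exists>u' \<in> carrier (Hom C V W').
           Cmp C V W X s u = Cmp C V W' X s' u' \<and>
           Cmp C V W X s u \<in> S V X \<and>
           Cmp C V W Y f u = Cmp C V W' Y f' u')}"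

definition localization ::
  "('o, 'm) precat \<Rightarrow> ('o \<Rightarrow> 'o \<Rightarrow> 'm set) \<Rightarrow> ('o, ('o \<times> 'm \<times> 'm) set) precat" where
  "localization C S =
     \<lparr>Obj = Obj C,
      Hom = (\<lambda>X Y. \<lparr>carrier = roofs C S X Y // roof_rel C S X Y,
                    mult = undefined, one = undefined,
                    zero = roof_rel C S X Y `` {(X, Ident C X, \<zero>\<^bsub>Hom C X Y\<^esub>)},
                    add = (\<lambda>F G. roof_rel C S X Y ``
                             {(W, s, f \<oplus>\<^bsub>Hom C W Y\<^esub> g) | W s f g. (W, s, f) \<in> F \<and> (W, s, g) \<in> G})\<rparr>),
      Ident = (\<lambda>X. roof_rel C S X X `` {(X, Ident C X, Ident C X)}),
      Cmp = (\<lambda>X Y Z G F. roof_rel C S X Z ``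
               {(U, Cmp C U V X s u, Cmp C U W Z g h) | U u h V s f W t g.
                  (V, s, f) \<in> F \<and> (W, t, g) \<in> G \<and>
                  U \<in> Obj C \<and> u \<in> S U V \<and> h \<in> carrier (Hom C U W) \<and>
                  Cmp C U W Y t h = Cmp C U V Y f u})\<rparr>"


section \<open>Orbit categories\<close>

text \<open>
  The shift is given by its powers: \<open>sh i X\<close> is \<open>X[i]\<close> and \<open>shm i f\<close> is \<open>f[i] : X[i] \<rightarrow> Y[i]\<close>. It is
  assumed strict, \<open>X[i][j] = X[i + j]\<close>, so that \<open>g[i] \<circ> f\<close> literally makes sense.
\<close>

definition orbit_cat ::
  "('o, 'm) precat \<Rightarrow> (int \<Rightarrow> 'o \<Rightarrow> 'o) \<Rightarrow> (int \<Rightarrow> 'm \<Rightarrow> 'm) \<Rightarrow> ('o, int \<Rightarrow> 'm) precat" where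
  "orbit_cat T sh shm =
     \<lparr>Obj = Obj T,
      Hom = (\<lambda>X Y. \<lparr>carrier = {\<phi>. (\<forall>i. \<phi> i \<in> carrier (Hom T X (sh i Y))) \<and>
                                  finite {i. \<phi> i \<noteq> \<zero>\<^bsub>Hom T X (sh i Y)\<^esub>}},
                    mult = undefined, one = undefined,
                    zero = (\<lambda>i. \<zero>\<^bsub>Hom T X (sh i Y)\<^esub>),
                    add = (\<lambda>\<phi> \<psi> i. \<phi> i \<oplus>\<^bsub>Hom T X (sh i Y)\<^esub> \<psi> i)\<rparr>),
      Ident = (\<lambda>X i. if i = 0 then Ident T X else \<zero>\<^bsub>Hom T X (sh i X)\<^esub>),
      Cmp = (\<lambda>X Y Z \<psi> \<phi> n.
               \<Oplus>\<^bsub>Hom T X (sh n Z)\<^esub>i\<in>{i. \<phi> i \<noteq> \<zero>\<^bsub>Hom T X (sh i Y)\<^esub>}.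
                 Cmp T X (sh i Y) (sh n Z) (shm i (\<psi> (n - i))) (\<phi> i))\<rparr>"


section \<open>Finitely generated modules\<close>

text \<open>
  Over a commutative ring left and right modules agree. The objects of \<open>mod_cat R\<close> are the
  finitely generated modules whose carrier lies in the type \<^typ>\<open>'a\<close>, which acts as a universe: if
  \<open>R\<close> is countable and \<^typ>\<open>'a\<close> is infinite, then every finitely generated \<open>R\<close>-module is isomorphic
  to such a module. Homomorphisms are extensional functions, so that equality of
  morphisms is equality on the carrier.
\<close>

definition fg_module :: "('r, 'k) ring_scheme \<Rightarrow> ('r, 'a) module \<Rightarrow> bool" where
  "fg_module R M \<longleftrightarrow> module R M \<and>
     (\<exists>A. finite A \<and> A \<subseteq> carrier M \<and> (\<forall>N. submodule N R M \<and> A \<subseteq> N \<longrightarrow> N = carrier M))"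

definition mod_hom ::
  "('r, 'k) ring_scheme \<Rightarrow> ('r, 'a, 'x) module_scheme \<Rightarrow> ('r, 'b, 'y) module_scheme
    \<Rightarrow> ('a \<Rightarrow> 'b) set" where
  "mod_hom R M N =
     {f \<in> carrier M \<rightarrow>\<^sub>E carrier N.
        (\<forall>x \<in> carrier M. \<forall>y \<in> carrier M. f (x \<oplus>\<^bsub>M\<^esub> y) = f x \<oplus>\<^bsub>N\<^esub> f y) \<and>
        (\<forall>a \<in> carrier R. \<forall>x \<in> carrier M. f (a \<odot>\<^bsub>M\<^esub> x) = a \<odot>\<^bsub>N\<^esub> f x)}"

definition mod_isomorphic ::
  "('r, 'k) ring_scheme \<Rightarrow> ('r, 'a, 'x) module_scheme \<Rightarrow> ('r, 'b, 'y) module_scheme \<Rightarrow> bool" where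
  "mod_isomorphic R M N \<longleftrightarrow> (\<exists>f \<in> mod_hom R M N. bij_betw f (carrier M) (carrier N))"

definition mod_cat :: "('r, 'k) ring_scheme \<Rightarrow> (('r, 'a) module, 'a \<Rightarrow> 'a) precat" where
  "mod_cat R =
     \<lparr>Obj = {M. fg_module R M},
      Hom = (\<lambda>M N. \<lparr>carrier = mod_hom R M N, mult = undefined, one = undefined,
                    zero = (\<lambda>x\<in>carrier M. \<zero>\<^bsub>N\<^esub>),
                    add = (\<lambda>f g. \<lambda>x\<in>carrier M. f x \<oplus>\<^bsub>N\<^esub> g x)\<rparr>),
      Ident = (\<lambda>M. \<lambda>x\<in>carrier M. x),
      Cmp = (\<lambda>L M N g f. compose (carrier L) g f)\<rparr>"

definition regular_module :: "('r, 'k) ring_scheme \<Rightarrow> ('r, 'r) module" where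
  "regular_module R =
     \<lparr>carrier = carrier R, mult = mult R, one = one R, zero = zero R, add = add R,
      smult = mult R\<rparr>"

definition free_module :: "('r, 'k) ring_scheme \<Rightarrow> nat \<Rightarrow> ('r, nat \<Rightarrow> 'r) module" where
  "free_module R n =
     \<lparr>carrier = {..<n} \<rightarrow>\<^sub>E carrier R, mult = undefined, one = undefined,
      zero = (\<lambda>i\<in>{..<n}. \<zero>\<^bsub>R\<^esub>),
      add = (\<lambda>v w. \<lambda>i\<in>{..<n}. v i \<oplus>\<^bsub>R\<^esub> w i),
      smult = (\<lambda>a v. \<lambda>i\<in>{..<n}. a \<otimes>\<^bsub>R\<^esub> v i)\<rparr>"

text \<open>
  Direct summands of finite free modules. This form of finitely generated projectivity is
  preferred to the lifting property because it does not quantify over a universe of modules.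
\<close>

definition fg_projective :: "('r, 'k) ring_scheme \<Rightarrow> ('r, 'a) module \<Rightarrow> bool" where
  "fg_projective R P \<longleftrightarrow> module R P \<and>
     (\<exists>n. \<exists>\<iota> \<in> mod_hom R P (free_module R n). \<exists>\<pi> \<in> mod_hom R (free_module R n) P.
        \<forall>x \<in> carrier P. \<pi> (\<iota> x) = x)"

definition torsionless :: "('r, 'k) ring_scheme \<Rightarrow> ('r, 'a) module set" where
  "torsionless R =
     {M. \<exists>n N. submodule N R (free_module R n) \<and>
               mod_isomorphic R M ((free_module R n)\<lparr>carrier := N\<rparr>)}"

text \<open>
  The last condition on \<open>P\<close> and \<open>d\<close> is exactness of \<open>Hom\<^sub>R(P, R)\<close> at \<open>Hom\<^sub>R(P (n + 1), R)\<close>.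
\<close>

definition complete_resolution ::
  "('r, 'k) ring_scheme \<Rightarrow> (int \<Rightarrow> ('r, 'a) module) \<Rightarrow> (int \<Rightarrow> 'a \<Rightarrow> 'a) \<Rightarrow> bool" where
  "complete_resolution R P d \<longleftrightarrow>
     (\<forall>n. fg_projective R (P n)) \<and>
     (\<forall>n. d n \<in> mod_hom R (P n) (P (n + 1))) \<and>
     (\<forall>n. {x \<in> carrier (P (n + 1)). d (n + 1) x = \<zero>\<^bsub>P (n + 2)\<^esub>} = d n ` carrier (P n)) \<and>
     (\<forall>n. {\<phi> \<in> mod_hom R (P (n + 1)) (regular_module R).
              compose (carrier (P n)) \<phi> (d n) = (\<lambda>x\<in>carrier (P n). \<zero>\<^bsub>R\<^esub>)}
          = (\<lambda>\<psi>. compose (carrier (P (n + 1))) \<psi> (d (n + 1)))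
              ` mod_hom R (P (n + 2)) (regular_module R))"

definition Gorenstein_projective :: "('r, 'k) ring_scheme \<Rightarrow> ('r, 'a) module set" where
  "Gorenstein_projective R =
     {M. \<exists>(P :: int \<Rightarrow> ('r, 'a) module) d. complete_resolution R P d \<and>
           mod_isomorphic R M ((P 0)\<lparr>carrier := {x \<in> carrier (P 0). d 0 x = \<zero>\<^bsub>P 1\<^esub>}\<rparr>)}"

definition factoring_through_projective ::
  "('r, 'k) ring_scheme \<Rightarrow> ('r, 'a) module \<Rightarrow> ('r, 'a) module \<Rightarrow> ('a \<Rightarrow> 'a) set" where
  "factoring_through_projective R M N =
     {compose (carrier M) h g | g h (P :: ('r, 'a) module).
        fg_projective R P \<and> g \<in> mod_hom R M P \<and> h \<in> mod_hom R P N}"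

definition stable_cat ::
  "('r, 'k) ring_scheme \<Rightarrow> ('r, 'a) module set \<Rightarrow> (('r, 'a) module, ('a \<Rightarrow> 'a) set) precat" where
  "stable_cat R Q = quotient_cat (full_subcat (mod_cat R) Q) (factoring_through_projective R)"


section \<open>The bounded derived category of finitely generated modules\<close>

record ('r, 'a) cochain =
  cob :: "int \<Rightarrow> ('r, 'a) module"
  cdiff :: "int \<Rightarrow> 'a \<Rightarrow> 'a"

definition bounded_complex :: "('r, 'k) ring_scheme \<Rightarrow> ('r, 'a) cochain \<Rightarrow> bool" where
  "bounded_complex R X \<longleftrightarrow>
     (\<forall>n. fg_module R (cob X n)) \<and>
     (\<forall>n. cdiff X n \<in> mod_hom R (cob X n) (cob X (n + 1))) \<and>
     (\<forall>n. \<forall>x \<in> carrier (cob X n). cdiff X (n + 1) (cdiff X n x) = \<zero>\<^bsub>cob X (n + 2)\<^esub>) \<and>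
     finite {n. carrier (cob X n) \<noteq> {\<zero>\<^bsub>cob X n\<^esub>}}"

definition chain_maps ::
  "('r, 'k) ring_scheme \<Rightarrow> ('r, 'a) cochain \<Rightarrow> ('r, 'a) cochain \<Rightarrow> (int \<Rightarrow> 'a \<Rightarrow> 'a) set" where
  "chain_maps R X Y =
     {f. (\<forall>n. f n \<in> mod_hom R (cob X n) (cob Y n)) \<and>
         (\<forall>n. \<forall>x \<in> carrier (cob X n). f (n + 1) (cdiff X n x) = cdiff Y n (f n x))}"

definition complex_cat ::
  "('r, 'k) ring_scheme \<Rightarrow> (('r, 'a) cochain, int \<Rightarrow> 'a \<Rightarrow> 'a) precat" where
  "complex_cat R =
     \<lparr>Obj = {X. bounded_complex R X},
      Hom = (\<lambda>X Y. \<lparr>carrier = chain_maps R X Y, mult = undefined, one = undefined,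
                    zero = (\<lambda>n. \<lambda>x\<in>carrier (cob X n). \<zero>\<^bsub>cob Y n\<^esub>),
                    add = (\<lambda>f g n. \<lambda>x\<in>carrier (cob X n). f n x \<oplus>\<^bsub>cob Y n\<^esub> g n x)\<rparr>),
      Ident = (\<lambda>X n. \<lambda>x\<in>carrier (cob X n). x),
      Cmp = (\<lambda>X Y Z g f n. compose (carrier (cob X n)) (g n) (f n))\<rparr>"

definition null_homotopic ::
  "('r, 'k) ring_scheme \<Rightarrow> ('r, 'a) cochain \<Rightarrow> ('r, 'a) cochain \<Rightarrow> (int \<Rightarrow> 'a \<Rightarrow> 'a) set" where
  "null_homotopic R X Y =
     {f \<in> chain_maps R X Y.
        \<exists>h. (\<forall>n. h n \<in> mod_hom R (cob X n) (cob Y (n - 1))) \<and>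
            (\<forall>n. \<forall>x \<in> carrier (cob X n).
               f n x = cdiff Y (n - 1) (h n x) \<oplus>\<^bsub>cob Y n\<^esub> h (n + 1) (cdiff X n x))}"

definition homotopy_cat ::
  "('r, 'k) ring_scheme \<Rightarrow> (('r, 'a) cochain, (int \<Rightarrow> 'a \<Rightarrow> 'a) set) precat" where
  "homotopy_cat R = quotient_cat (complex_cat R) (null_homotopic R)"

definition cocycles :: "('r, 'a) cochain \<Rightarrow> int \<Rightarrow> 'a set" where
  "cocycles X n = {x \<in> carrier (cob X n). cdiff X n x = \<zero>\<^bsub>cob X (n + 1)\<^esub>}"

definition coboundaries :: "('r, 'a) cochain \<Rightarrow> int \<Rightarrow> 'a set" where
  "coboundaries X n = cdiff X (n - 1) ` carrier (cob X (n - 1))"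

definition cohomology :: "('r, 'a) cochain \<Rightarrow> int \<Rightarrow> 'a set set" where
  "cohomology X n = (\<lambda>z. coboundaries X n +>\<^bsub>cob X n\<^esub> z) ` cocycles X n"

text \<open>
  The induced map on cohomology is a homomorphism, so it is an isomorphism iff it is bijective.
\<close>

definition quasi_iso :: "('r, 'a) cochain \<Rightarrow> ('r, 'a) cochain \<Rightarrow> (int \<Rightarrow> 'a \<Rightarrow> 'a) \<Rightarrow> bool" where
  "quasi_iso X Y f \<longleftrightarrow>
     (\<forall>n. bij_betw (\<lambda>K. \<Union>z\<in>K. coboundaries Y n +>\<^bsub>cob Y n\<^esub> f n z) (cohomology X n) (cohomology Y n))"

definition quasi_isos ::
  "('r, 'k) ring_scheme \<Rightarrow> ('r, 'a) cochain \<Rightarrow> ('r, 'a) cochain \<Rightarrow> (int \<Rightarrow> 'a \<Rightarrow> 'a) set set" where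
  "quasi_isos R X Y = {F \<in> carrier (Hom (homotopy_cat R) X Y). \<exists>f \<in> F. quasi_iso X Y f}"

type_synonym ('r, 'a) derived_mor =
  "(('r, 'a) cochain \<times> (int \<Rightarrow> 'a \<Rightarrow> 'a) set \<times> (int \<Rightarrow> 'a \<Rightarrow> 'a) set) set"

definition derived_cat ::
  "('r, 'k) ring_scheme \<Rightarrow> (('r, 'a) cochain, ('r, 'a) derived_mor) precat" where
  "derived_cat R = localization (homotopy_cat R) (quasi_isos R)"

definition shift :: "int \<Rightarrow> ('r, 'a) cochain \<Rightarrow> ('r, 'a) cochain" where
  "shift k X =
     \<lparr>cob = (\<lambda>n. cob X (n + k)),
      cdiff = (\<lambda>n. \<lambda>x\<in>carrier (cob X (n + k)).
                 if even k then cdiff X (n + k) x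
                 else \<ominus>\<^bsub>cob X (n + k + 1)\<^esub> cdiff X (n + k) x)\<rparr>"

text \<open>
  The shift is a strict automorphism of the category of complexes that preserves homotopy and
  quasi-isomorphisms in both directions. It therefore acts on homotopy classes, and on
  equivalence classes of roofs, simply by taking images.
\<close>

definition shift_map :: "int \<Rightarrow> (int \<Rightarrow> 'a \<Rightarrow> 'a) \<Rightarrow> int \<Rightarrow> 'a \<Rightarrow> 'a" where
  "shift_map k f = (\<lambda>n. f (n + k))"

definition shift_class :: "int \<Rightarrow> (int \<Rightarrow> 'a \<Rightarrow> 'a) set \<Rightarrow> (int \<Rightarrow> 'a \<Rightarrow> 'a) set" where
  "shift_class k F = shift_map k ` F"

definition shift_derived :: "int \<Rightarrow> ('r, 'a) derived_mor \<Rightarrow> ('r, 'a) derived_mor" where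
  "shift_derived k F = (\<lambda>(W, s, f). (shift k W, shift_class k s, shift_class k f)) ` F"

definition derived_orbit_cat ::
  "('r, 'k) ring_scheme \<Rightarrow> (('r, 'a) cochain, int \<Rightarrow> ('r, 'a) derived_mor) precat" where
  "derived_orbit_cat R = orbit_cat (derived_cat R) shift shift_derived"


section \<open>The ring of dual numbers over the integers\<close>

definition Z_eps :: "(nat \<Rightarrow> int) set ring" where
  "Z_eps = UP \<Z> Quot (PIdl\<^bsub>UP \<Z>\<^esub> (up_ring.monom (UP \<Z>) 1 2))"

end

theory Submission
  imports Defs "HOL-Library.Countable_Set"
begin

text \<open>
  Let \<open>T\<close> be the class of \<open>\<int>[\<epsilon>]\<close>-modules \<open>M\<close> whose additive group is free of finite rank. With coordinates
  \<open>c\<^sub>j\<close> of \<open>M\<close>, the map \<open>m \<mapsto> (c\<^sub>j(\<epsilon>m) + c\<^sub>j(m)\<epsilon>)\<^sub>j\<close> embeds \<open>M\<close> into a free module, and the modules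
  \<open>M \<otimes> \<int>[\<epsilon>]\<close> form a complete resolution of \<open>M\<close>. Hence \<open>T\<close> consists of the torsionless modules as well as
  of the finitely generated Gorenstein-projective ones, and (a) and (b) are the same category. A map in \<open>T\<close>
  factors through a projective iff it has the form \<open>\<epsilon>h + h\<epsilon>\<close> with \<open>h\<close> additive.

  A bounded complex \<open>R\<close> of free groups of finite rank is folded into the module \<open>M = \<Oplus>\<^sub>n R\<^sup>n\<close> in \<open>T\<close> on which
  \<open>\<epsilon>\<close> acts by \<open>\<plusminus>d\<close>, and every module in \<open>T\<close> arises in this way. The components \<open>R\<^sup>n \<rightarrow> Q\<^sup>n\<^sup>+\<^sup>i\<close> of a linear
  map between the modules of \<open>R\<close> and \<open>Q\<close> form a chain map \<open>R \<rightarrow> Q[i]\<close> for each \<open>i\<close>, and the additive maps \<open>h\<close>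
  above become homotopies. If \<open>R\<close> and \<open>Q\<close> resolve \<open>X\<close> and \<open>Y\<close>, the stable maps are therefore
  \<open>\<Oplus>\<^sub>i Hom(R, Q[i])\<close> taken up to homotopy, that is, \<open>\<Oplus>\<^sub>i Hom(X, Y[i])\<close> in the derived category.
\<close>

text \<open>The equivalence is not built from resolutions made functorial. It is indexed by
  foldings: a module M, a complex X and one bounded complex of free groups that folds to M and
  resolves X. Both projections are onto and morphisms correspond functorially, which is all that
  \<open>equivalent_categories_span\<close> asks for. The formula \<epsilon>h + h\<epsilon>
  originates in the ring: the additive map sending a + b\<epsilon> to b contracts it with respect to
  \<epsilon>, and so every projective is contractible. Every module of T is folded because
  \<epsilon>M, a subgroup of a free group, is free, so that \<epsilon> splits additively over its
  image. Two constraints shape the details. All modules must live in the type \<open>'a\<close>, so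
  constructions on pairs or families are made elsewhere and copied along an injection; it exists
  because free groups of finite rank are countable and \<open>'a\<close> is infinite. And each
  lifting problem is posed as an additive relation, solved on cocycles and then extended, which
  works in all degrees at once because coboundaries are free as well.\<close>

abbreviation mor :: "('o, 'm) precat \<Rightarrow> 'o \<Rightarrow> 'o \<Rightarrow> 'm set" where
  "mor C X Y \<equiv> carrier (Hom C X Y)"

abbreviation Lam where "Lam \<equiv> regular_module Z_eps"
abbreviation Cpx where "Cpx \<equiv> complex_cat \<Z>"
abbreviation Htp where "Htp \<equiv> homotopy_cat \<Z>"
abbreviation Der where "Der \<equiv> derived_cat \<Z>"

abbreviation elts :: "('r, 'a) cochain \<Rightarrow> int \<Rightarrow> 'a set" where
  "elts X n \<equiv> carrier (cob X n)"

abbreviation hmap where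
  "hmap P X h n x \<equiv> cdiff X (n - 1) (h n x) \<oplus>\<^bsub>cob X n\<^esub> h (n + 1) (cdiff P n x)"

type_synonym 'a eps_module = "((nat \<Rightarrow> int) set, 'a) module"

section \<open>Equivalences from spans\<close>

text \<open>Stated symmetrically in \<open>C\<close> and \<open>D\<close>, so that every construction is carried out in one direction only.\<close>

locale cat_span = C: category C + D: category D for C :: "('o, 'm) precat" and D :: "('p, 'n) precat" +
  fixes E :: "'e set" and U V \<Phi> \<Psi>
  assumes U: "e \<in> E \<Longrightarrow> U e \<in> Obj C" and U_onto: "X \<in> Obj C \<Longrightarrow> \<exists>e\<in>E. U e = X"
    and V: "e \<in> E \<Longrightarrow> V e \<in> Obj D" and V_onto: "Y \<in> Obj D \<Longrightarrow> \<exists>e\<in>E. V e = Y"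
    and Phi_closed: "\<lbrakk>e \<in> E; e' \<in> E; f \<in> mor C (U e) (U e')\<rbrakk> \<Longrightarrow> \<Phi> e e' f \<in> mor D (V e) (V e')"
    and Psi_closed: "\<lbrakk>e \<in> E; e' \<in> E; f' \<in> mor D (V e) (V e')\<rbrakk> \<Longrightarrow> \<Psi> e e' f' \<in> mor C (U e) (U e')"
    and Psi_Phi: "\<lbrakk>e \<in> E; e' \<in> E; f \<in> mor C (U e) (U e')\<rbrakk> \<Longrightarrow> \<Psi> e e' (\<Phi> e e' f) = f"
    and Phi_Psi: "\<lbrakk>e \<in> E; e' \<in> E; f' \<in> mor D (V e) (V e')\<rbrakk> \<Longrightarrow> \<Phi> e e' (\<Psi> e e' f') = f'"
    and Phi_Ident: "e \<in> E \<Longrightarrow> \<Phi> e e (Ident C (U e)) = Ident D (V e)"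
    and Psi_Ident: "e \<in> E \<Longrightarrow> \<Psi> e e (Ident D (V e)) = Ident C (U e)"
    and Phi_Cmp: "\<lbrakk>a \<in> E; b \<in> E; c \<in> E; f \<in> mor C (U a) (U b); g \<in> mor C (U b) (U c)\<rbrakk>
      \<Longrightarrow> \<Phi> a c (Cmp C (U a) (U b) (U c) g f) = Cmp D (V a) (V b) (V c) (\<Phi> b c g) (\<Phi> a b f)"
    and Psi_Cmp: "\<lbrakk>a \<in> E; b \<in> E; c \<in> E; f' \<in> mor D (V a) (V b); g' \<in> mor D (V b) (V c)\<rbrakk>
      \<Longrightarrow> \<Psi> a c (Cmp D (V a) (V b) (V c) g' f') = Cmp C (U a) (U b) (U c) (\<Psi> b c g') (\<Psi> a b f')"
begin

lemma swap: "cat_span D C E V U \<Psi> \<Phi>"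
  by unfold_locales (fact U U_onto V V_onto Phi_closed Psi_closed Psi_Phi Phi_Psi Phi_Ident Psi_Ident Phi_Cmp Psi_Cmp)+

text \<open>An arbitrary index over each object. The choice is harmless, because indices with a
  common image are linked by canonical isomorphisms, see \<open>span_iso\<close>.\<close>

definition u where "u X = (SOME e. e \<in> E \<and> U e = X)"
definition v where "v Y = (SOME e. e \<in> E \<and> V e = Y)"

lemma u: "X \<in> Obj C \<Longrightarrow> u X \<in> E" "X \<in> Obj C \<Longrightarrow> U (u X) = X"
  using someI_ex[of "\<lambda>e. e \<in> E \<and> U e = X"] U_onto[of X] by (auto simp: u_def)

lemma v: "Y \<in> Obj D \<Longrightarrow> v Y \<in> E" "Y \<in> Obj D \<Longrightarrow> V (v Y) = Y"
  using someI_ex[of "\<lambda>e. e \<in> E \<and> V e = Y"] V_onto[of Y] by (auto simp: v_def)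

lemma span_functor: "cat_functor C D (\<lambda>X. V (u X)) (\<lambda>X Y. \<Phi> (u X) (u Y))"
proof
  show "V (u X) \<in> Obj D" if "X \<in> Obj C" for X by (rule V[OF u(1)[OF that]])
  show "\<Phi> (u X) (u Y) f \<in> mor D (V (u X)) (V (u Y))" if "X \<in> Obj C" "Y \<in> Obj C" "f \<in> mor C X Y" for X Y f
    using that Phi_closed[of "u X" "u Y" f] u by simp
  show "\<Phi> (u X) (u X) (Ident C X) = Ident D (V (u X))" if "X \<in> Obj C" for X
    using that Phi_Ident[of "u X"] u by simp
  show "\<Phi> (u X) (u Z) (Cmp C X Y Z g f) = Cmp D (V (u X)) (V (u Y)) (V (u Z)) (\<Phi> (u Y) (u Z) g) (\<Phi> (u X) (u Y) f)"
    if "X \<in> Obj C" "Y \<in> Obj C" "Z \<in> Obj C" "f \<in> mor C X Y" "g \<in> mor C Y Z" for X Y Z f g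
    using that Phi_Cmp[of "u X" "u Y" "u Z" f g] u by simp
qed

text \<open>Two indices with the same image in \<open>D\<close> may have different images in
  \<open>C\<close>. Lifting the identity of the common image along \<Psi> in both directions gives
  mutually inverse maps, since \<Psi> respects composites and identities.\<close>

lemma span_iso:
  assumes ab: "a \<in> E" "b \<in> E" "V a = V b" shows "iso_in C (U a) (U b) (\<Psi> a b (Ident D (V a)))"
  unfolding iso_in_def
proof (intro conjI bexI)
  have i: "Ident D (V a) \<in> mor D (V a) (V a)" using D.Ident_closed V ab by simp
  show "\<Psi> a b (Ident D (V a)) \<in> mor C (U a) (U b)" "\<Psi> b a (Ident D (V a)) \<in> mor C (U b) (U a)"
    using Psi_closed[of a b "Ident D (V a)"] Psi_closed[of b a "Ident D (V a)"] i ab by simp_all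
  show "Cmp C (U a) (U b) (U a) (\<Psi> b a (Ident D (V a))) (\<Psi> a b (Ident D (V a))) = Ident C (U a)"
    using Psi_Cmp[of a b a "Ident D (V a)" "Ident D (V a)"] ab i V Psi_Ident[of a] by (simp add: D.Cmp_Ident_left)
  show "Cmp C (U b) (U a) (U b) (\<Psi> a b (Ident D (V a))) (\<Psi> b a (Ident D (V a))) = Ident C (U b)"
    using Psi_Cmp[of b a b "Ident D (V a)" "Ident D (V a)"] ab i V Psi_Ident[of b] by (simp add: D.Cmp_Ident_left)
qed

text \<open>The round trip replaces \<open>u X\<close> by another index with the same image under
  \<open>V\<close>, so \<open>span_iso\<close> supplies the component at \<open>X\<close>.
  Naturality is \<open>Psi_Cmp\<close> for one morphism of \<open>D\<close>, composed once with the
  identity after it and once with the identity before it.\<close>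

lemma natural:
  "naturally_isomorphic C C (\<lambda>X. U (v (V (u X)))) (\<lambda>X Y f. \<Psi> (v (V (u X))) (v (V (u Y))) (\<Phi> (u X) (u Y) f)) (\<lambda>X. X) (\<lambda>X Y f. f)"
  unfolding naturally_isomorphic_def
proof (intro exI conjI ballI)
  fix X assume X: "X \<in> Obj C"
  show "iso_in C (U (v (V (u X)))) X (\<Psi> (v (V (u X))) (u X) (Ident D (V (u X))))"
    using span_iso[of "v (V (u X))" "u X"] u[OF X] v[OF V[OF u(1)[OF X]]] by simp
next
  fix X Y f assume X: "X \<in> Obj C" and Y: "Y \<in> Obj C" and f: "f \<in> mor C X Y"
  let ?a = "v (V (u X))" and ?b = "v (V (u Y))"
  note VX = V[OF u(1)[OF X]] and VY = V[OF u(1)[OF Y]]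
  note E = v(1)[OF VX] v(1)[OF VY] u(1)[OF X] u(1)[OF Y] and [simp] = u(2)[OF X] u(2)[OF Y] v(2)[OF VX] v(2)[OF VY]
  have h: "\<Phi> (u X) (u Y) f \<in> mor D (V (u X)) (V (u Y))" using Phi_closed[of "u X" "u Y" f] E f by simp
  show "Cmp C (U ?a) (U ?b) Y (\<Psi> ?b (u Y) (Ident D (V (u Y)))) (\<Psi> ?a ?b (\<Phi> (u X) (u Y) f))
      = Cmp C (U ?a) X Y f (\<Psi> ?a (u X) (Ident D (V (u X))))"
    using Psi_Cmp[of ?a ?b "u Y" "\<Phi> (u X) (u Y) f" "Ident D (V (u Y))"]
      Psi_Cmp[of ?a "u X" "u Y" "Ident D (V (u X))" "\<Phi> (u X) (u Y) f"] Psi_Phi[of "u X" "u Y" f] E h f VX VY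
      D.Ident_closed[OF VX] D.Ident_closed[OF VY] D.Cmp_Ident_left[OF VX VY h] D.Cmp_Ident_right[OF VX VY h] by simp
qed

lemma equivalent: "equivalent_categories C D"
proof -
  interpret S: cat_span D C E V U \<Psi> \<Phi> by (rule swap)
  \<comment> \<open>In the swapped span the two choice functions trade places, so its functor is the
    second functor of the equivalence.\<close>
  have "S.u = v" "S.v = u" by (simp_all add: fun_eq_iff S.u_def S.v_def u_def v_def)
  then show ?thesis unfolding equivalent_categories_def using span_functor S.span_functor natural S.natural by auto
qed

end

text \<open>Since \<open>V\<close> is onto and each \<Phi> is a bijection that respects composites
  and identities, the category axioms of \<open>D\<close> are carried over from \<open>C\<close>.
  This spares a direct proof of associativity in the orbit category, whose composites are sums over
  degrees.\<close>

lemma equivalent_categories_span: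
  assumes C: "category C"
    and U: "\<And>e. e \<in> E \<Longrightarrow> U e \<in> Obj C" and U_onto: "\<And>X. X \<in> Obj C \<Longrightarrow> \<exists>e\<in>E. U e = X"
    and V: "\<And>e. e \<in> E \<Longrightarrow> V e \<in> Obj D" and V_onto: "\<And>X. X \<in> Obj D \<Longrightarrow> \<exists>e\<in>E. V e = X"
    and bij: "\<And>e e'. \<lbrakk>e \<in> E; e' \<in> E\<rbrakk> \<Longrightarrow> bij_betw (\<Phi> e e') (mor C (U e) (U e')) (mor D (V e) (V e'))"
    and Id: "\<And>e. e \<in> E \<Longrightarrow> \<Phi> e e (Ident C (U e)) = Ident D (V e)"
    and Comp: "\<And>e e' e'' f g. \<lbrakk>e \<in> E; e' \<in> E; e'' \<in> E; f \<in> mor C (U e) (U e'); g \<in> mor C (U e') (U e'')\<rbrakk>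
      \<Longrightarrow> \<Phi> e e'' (Cmp C (U e) (U e') (U e'') g f) = Cmp D (V e) (V e') (V e'') (\<Phi> e' e'' g) (\<Phi> e e' f)"
  shows "equivalent_categories C D"
proof -
  interpret C: category C by fact
  define \<Psi> where "\<Psi> e e' = inv_into (mor C (U e) (U e')) (\<Phi> e e')" for e e'
  have cl: "\<Phi> e e' f \<in> mor D (V e) (V e')"
    if "e \<in> E" "e' \<in> E" "f \<in> mor C (U e) (U e')" for e e' f
    using bij that by (auto simp: bij_betw_def)
  have cl': "\<Psi> e e' f \<in> mor C (U e) (U e')"
    if "e \<in> E" "e' \<in> E" "f \<in> mor D (V e) (V e')" for e e' f
    using bij[OF that(1,2)] that(3) unfolding \<Psi>_def
    by (metis bij_betw_imp_surj_on inv_into_into)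
  have PhiPsi: "\<Phi> e e' (\<Psi> e e' f) = f"
    if "e \<in> E" "e' \<in> E" "f \<in> mor D (V e) (V e')" for e e' f
    using bij[OF that(1,2)] that(3) unfolding \<Psi>_def
    by (metis bij_betw_imp_surj_on f_inv_into_f)
  have inj: "f = g" if "\<Phi> e e' f = \<Phi> e e' g" "e \<in> E" "e' \<in> E"
    "f \<in> mor C (U e) (U e')" "g \<in> mor C (U e) (U e')" for e e' f g
    using bij[OF that(2,3)] that unfolding bij_betw_def inj_on_def by blast
  have IdD: "Ident D (V e) \<in> mor D (V e) (V e)" if "e \<in> E" for e
    using cl[OF that that C.Ident_closed[OF U[OF that]]] Id[OF that] by simp
  \<comment> \<open>Every axiom is pulled back: choose indices over the objects, lift the morphisms
    by \<Psi>, use the law in \<open>C\<close> and apply \<Phi>.\<close>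
  have D: "category D"
  proof
    fix X assume "X \<in> Obj D" then show "Ident D X \<in> mor D X X"
      using V_onto IdD by blast
  next
    fix X Y Z f g assume "X \<in> Obj D" "Y \<in> Obj D" "Z \<in> Obj D"
      "f \<in> mor D X Y" "g \<in> mor D Y Z"
    moreover from this obtain a b c where "a \<in> E" "b \<in> E" "c \<in> E" "V a = X" "V b = Y" "V c = Z"
      using V_onto by meson
    ultimately show "Cmp D X Y Z g f \<in> mor D X Z"
      using Comp[of a b c "\<Psi> a b f" "\<Psi> b c g"] PhiPsi[of a b f] PhiPsi[of b c g]
        cl'[of a b f] cl'[of b c g]
        cl[of a c "Cmp C (U a) (U b) (U c) (\<Psi> b c g) (\<Psi> a b f)"]
        C.Cmp_closed[of "U a" "U b" "U c" "\<Psi> a b f" "\<Psi> b c g"] U by simp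
  next
    fix X Y f assume "X \<in> Obj D" "Y \<in> Obj D" "f \<in> mor D X Y"
    moreover from this obtain a b where "a \<in> E" "b \<in> E" "V a = X" "V b = Y"
      using V_onto by meson
    ultimately show "Cmp D X Y Y (Ident D Y) f = f" "Cmp D X X Y f (Ident D X) = f"
      using Comp[of a b b "\<Psi> a b f" "Ident C (U b)"] Comp[of a a b "Ident C (U a)" "\<Psi> a b f"]
        PhiPsi[of a b f] cl'[of a b f] Id U
        C.Cmp_Ident_left[of "U a" "U b" "\<Psi> a b f"] C.Cmp_Ident_right[of "U a" "U b" "\<Psi> a b f"]
        C.Ident_closed[of "U a"] C.Ident_closed[of "U b"] by simp_all
  next
    fix W X Y Z f g h assume A: "W \<in> Obj D" "X \<in> Obj D" "Y \<in> Obj D" "Z \<in> Obj D"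
      "f \<in> mor D W X" "g \<in> mor D X Y" "h \<in> mor D Y Z"
    moreover from this obtain a b c d where E: "a \<in> E" "b \<in> E" "c \<in> E" "d \<in> E"
      and [simp]: "V a = W" "V b = X" "V c = Y" "V d = Z"
      using V_onto by meson
    define f' where "f' = \<Psi> a b f"
    define g' where "g' = \<Psi> b c g"
    define h' where "h' = \<Psi> c d h"
    have H: "f' \<in> mor C (U a) (U b)" "g' \<in> mor C (U b) (U c)"
      "h' \<in> mor C (U c) (U d)" "f = \<Phi> a b f'" "g = \<Phi> b c g'" "h = \<Phi> c d h'"
      using A E cl'[of a b f] cl'[of b c g] cl'[of c d h] PhiPsi[of a b f] PhiPsi[of b c g]
        PhiPsi[of c d h] by (simp_all add: f'_def g'_def h'_def)
    have "\<Phi> a d (Cmp C (U a) (U c) (U d) h' (Cmp C (U a) (U b) (U c) g' f'))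
        = \<Phi> a d (Cmp C (U a) (U b) (U d) (Cmp C (U b) (U c) (U d) h' g') f')"
      using C.Cmp_assoc[of "U a" "U b" "U c" "U d"] U E H by simp
    then show "Cmp D W Y Z h (Cmp D W X Y g f) = Cmp D W X Z (Cmp D X Y Z h g) f"
      using Comp[of a c d "Cmp C (U a) (U b) (U c) g' f'" h'] Comp[of a b c f' g']
        Comp[of a b d f' "Cmp C (U b) (U c) (U d) h' g'"] Comp[of b c d g' h'] E H U
        C.Cmp_closed[of "U a" "U b" "U c" f' g'] C.Cmp_closed[of "U b" "U c" "U d" g' h'] by simp
  qed
  interpret D: category D by (rule D)
  have PsiId: "\<Psi> e e (Ident D (V e)) = Ident C (U e)" if "e \<in> E" for e
    using that Id PhiPsi[of e e "Ident D (V e)"] IdD[OF that] cl'[of e e]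
    by (intro inj[of e e]) (auto intro: C.Ident_closed U)
  \<comment> \<open>As \<Phi> is injective, compatibility of its inverse with composition may be
    tested after applying \<Phi>.\<close>
  have PsiComp: "\<Psi> a c (Cmp D (V a) (V b) (V c) g f) = Cmp C (U a) (U b) (U c) (\<Psi> b c g) (\<Psi> a b f)"
    if "a \<in> E" "b \<in> E" "c \<in> E" "f \<in> mor D (V a) (V b)"
      "g \<in> mor D (V b) (V c)" for a b c f g
    by (rule inj[of a c]) (use that in \<open>simp_all add: Comp PhiPsi cl' U V C.Cmp_closed D.Cmp_closed\<close>)
  have Psi_Phi: "\<Psi> a b (\<Phi> a b f) = f" if "a \<in> E" "b \<in> E" "f \<in> mor C (U a) (U b)" for a b f
    unfolding \<Psi>_def by (rule inv_into_f_f[OF bij_betw_imp_inj_on[OF bij[OF that(1,2)]] that(3)])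
  have "cat_span C D E U V \<Phi> \<Psi>"
    by unfold_locales (fact U U_onto V V_onto cl cl' Psi_Phi PhiPsi Id PsiId Comp PsiComp)+
  then show ?thesis by (rule cat_span.equivalent)
qed

section \<open>Preadditive categories and their quotients\<close>

locale preadditive = category C for C :: "('o, 'm) precat" +
  assumes Hom_abelian_group: "\<lbrakk>X \<in> Obj C; Y \<in> Obj C\<rbrakk> \<Longrightarrow> abelian_group (Hom C X Y)"
    and Cmp_add_left: "\<lbrakk>X \<in> Obj C; Y \<in> Obj C; Z \<in> Obj C; f \<in> mor C X Y;
        g \<in> mor C Y Z; g' \<in> mor C Y Z\<rbrakk>
      \<Longrightarrow> Cmp C X Y Z (g \<oplus>\<^bsub>Hom C Y Z\<^esub> g') f = Cmp C X Y Z g f \<oplus>\<^bsub>Hom C X Z\<^esub> Cmp C X Y Z g' f"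
    and Cmp_add_right: "\<lbrakk>X \<in> Obj C; Y \<in> Obj C; Z \<in> Obj C; f \<in> mor C X Y;
        f' \<in> mor C X Y; g \<in> mor C Y Z\<rbrakk>
      \<Longrightarrow> Cmp C X Y Z g (f \<oplus>\<^bsub>Hom C X Y\<^esub> f') = Cmp C X Y Z g f \<oplus>\<^bsub>Hom C X Z\<^esub> Cmp C X Y Z g f'"
begin

text \<open>By additivity the composite z satisfies z + z = z, and z cancels.\<close>

lemma Cmp_zero_left:
  assumes "X \<in> Obj C" "Y \<in> Obj C" "Z \<in> Obj C" "f \<in> mor C X Y"
  shows "Cmp C X Y Z \<zero>\<^bsub>Hom C Y Z\<^esub> f = \<zero>\<^bsub>Hom C X Z\<^esub>"
proof -
  interpret YZ: abelian_group "Hom C Y Z" using assms by (simp add: Hom_abelian_group)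
  interpret XZ: abelian_group "Hom C X Z" using assms by (simp add: Hom_abelian_group)
  let ?z = "Cmp C X Y Z \<zero>\<^bsub>Hom C Y Z\<^esub> f"
  have "?z \<in> mor C X Z" using assms by (simp add: Cmp_closed)
  moreover have "?z \<oplus>\<^bsub>Hom C X Z\<^esub> ?z = ?z"
    using Cmp_add_left[of X Y Z f "\<zero>\<^bsub>Hom C Y Z\<^esub>" "\<zero>\<^bsub>Hom C Y Z\<^esub>"] assms by simp
  ultimately show ?thesis by (simp add: XZ.add.r_cancel_one')
qed

lemma Cmp_minus_right:
  assumes "X \<in> Obj C" "Y \<in> Obj C" "Z \<in> Obj C" "g \<in> mor C Y Z"
    "f \<in> mor C X Y" "f' \<in> mor C X Y"
  shows "Cmp C X Y Z g (f \<ominus>\<^bsub>Hom C X Y\<^esub> f') = Cmp C X Y Z g f \<ominus>\<^bsub>Hom C X Z\<^esub> Cmp C X Y Z g f'"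
proof -
  interpret XY: abelian_group "Hom C X Y" using assms by (simp add: Hom_abelian_group)
  interpret XZ: abelian_group "Hom C X Z" using assms by (simp add: Hom_abelian_group)
  have "(f \<ominus>\<^bsub>Hom C X Y\<^esub> f') \<oplus>\<^bsub>Hom C X Y\<^esub> f' = f"
    using assms by (simp add: XY.minus_eq XY.a_assoc XY.l_neg)
  then have "Cmp C X Y Z g (f \<ominus>\<^bsub>Hom C X Y\<^esub> f') \<oplus>\<^bsub>Hom C X Z\<^esub> Cmp C X Y Z g f' = Cmp C X Y Z g f"
    using Cmp_add_right[of X Y Z "f \<ominus>\<^bsub>Hom C X Y\<^esub> f'" f' g] assms by simp
  then show ?thesis
    using assms by (simp add: Cmp_closed XZ.minus_eq XZ.add.inv_solve_right)
qed

lemma Cmp_minus_left: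
  assumes "X \<in> Obj C" "Y \<in> Obj C" "Z \<in> Obj C" "f \<in> mor C X Y"
    "g \<in> mor C Y Z" "g' \<in> mor C Y Z"
  shows "Cmp C X Y Z (g \<ominus>\<^bsub>Hom C Y Z\<^esub> g') f = Cmp C X Y Z g f \<ominus>\<^bsub>Hom C X Z\<^esub> Cmp C X Y Z g' f"
proof -
  interpret YZ: abelian_group "Hom C Y Z" using assms by (simp add: Hom_abelian_group)
  interpret XZ: abelian_group "Hom C X Z" using assms by (simp add: Hom_abelian_group)
  have "(g \<ominus>\<^bsub>Hom C Y Z\<^esub> g') \<oplus>\<^bsub>Hom C Y Z\<^esub> g' = g"
    using assms by (simp add: YZ.minus_eq YZ.a_assoc YZ.l_neg)
  then have "Cmp C X Y Z (g \<ominus>\<^bsub>Hom C Y Z\<^esub> g') f \<oplus>\<^bsub>Hom C X Z\<^esub> Cmp C X Y Z g' f = Cmp C X Y Z g f"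
    using Cmp_add_left[of X Y Z f "g \<ominus>\<^bsub>Hom C Y Z\<^esub> g'" g'] assms by simp
  then show ?thesis
    using assms by (simp add: Cmp_closed XZ.minus_eq XZ.add.inv_solve_right)
qed

end

lemma preadditive_full_subcat:
  assumes "preadditive C" shows "preadditive (full_subcat C Q)"
proof -
  interpret preadditive C by fact
  show ?thesis
    unfolding preadditive_def preadditive_axioms_def category_def
    by (auto simp: full_subcat_def Ident_closed Cmp_closed Cmp_Ident_left Cmp_Ident_right
        Cmp_assoc Hom_abelian_group Cmp_add_left Cmp_add_right)
qed

locale cat_ideal = preadditive C for C :: "('o, 'm) precat" +
  fixes I :: "'o \<Rightarrow> 'o \<Rightarrow> 'm set"
  assumes I_subgroup: "\<lbrakk>X \<in> Obj C; Y \<in> Obj C\<rbrakk> \<Longrightarrow> subgroup (I X Y) (add_monoid (Hom C X Y))"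
    and I_Cmp_left: "\<lbrakk>X \<in> Obj C; Y \<in> Obj C; Z \<in> Obj C; f \<in> I X Y; g \<in> mor C Y Z\<rbrakk>
      \<Longrightarrow> Cmp C X Y Z g f \<in> I X Z"
    and I_Cmp_right: "\<lbrakk>X \<in> Obj C; Y \<in> Obj C; Z \<in> Obj C; f \<in> mor C X Y; g \<in> I Y Z\<rbrakk>
      \<Longrightarrow> Cmp C X Y Z g f \<in> I X Z"
begin

text \<open>The objects are explicit arguments because a morphism does not determine its domain and
  codomain.\<close>

definition cls :: "'o \<Rightarrow> 'o \<Rightarrow> 'm \<Rightarrow> 'm set" where
  "cls X Y f = I X Y +>\<^bsub>Hom C X Y\<^esub> f"

abbreviation Q where "Q \<equiv> quotient_cat C I"

lemma I_abelian_subgroup: "\<lbrakk>X \<in> Obj C; Y \<in> Obj C\<rbrakk> \<Longrightarrow> abelian_subgroup (I X Y) (Hom C X Y)"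
  by (intro abelian_subgroupI3 additive_subgroup.intro I_subgroup Hom_abelian_group)

lemma Obj_Q [simp]: "Obj Q = Obj C" by (simp add: quotient_cat_def)

lemma carrier_Hom_Q:
  assumes "X \<in> Obj C" "Y \<in> Obj C"
  shows "mor Q X Y = cls X Y ` mor C X Y"
  by (auto simp: quotient_cat_def cls_def A_RCOSETS_def' )

lemma cls_closed:
  assumes "X \<in> Obj C" "Y \<in> Obj C" "f \<in> mor C X Y"
  shows "cls X Y f \<in> mor Q X Y"
  using assms by (simp add: carrier_Hom_Q)

lemma cls_eq_iff:
  assumes "X \<in> Obj C" "Y \<in> Obj C" "f \<in> mor C X Y" "g \<in> mor C X Y"
  shows "cls X Y g = cls X Y f \<longleftrightarrow> g \<ominus>\<^bsub>Hom C X Y\<^esub> f \<in> I X Y"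
proof -
  interpret abelian_subgroup "I X Y" "Hom C X Y" using assms I_abelian_subgroup by simp
  show ?thesis
    unfolding cls_def using assms a_rcos_module[of f g] a_rcos_self[of g]
      a_repr_independence[OF _ _ a_subgroup, of g f] by (metis minus_eq)
qed

lemma mem_cls_iff:
  assumes "X \<in> Obj C" "Y \<in> Obj C" "f \<in> mor C X Y"
  shows "g \<in> cls X Y f \<longleftrightarrow> g \<in> mor C X Y \<and> cls X Y g = cls X Y f"
proof -
  interpret abelian_subgroup "I X Y" "Hom C X Y" using assms I_abelian_subgroup by simp
  show ?thesis
    using assms a_rcos_self[of g] a_repr_independence[OF _ _ a_subgroup, of g f]
      a_r_coset_subset_G[of "I X Y" f] a_subset
    unfolding cls_def by blast
qed

lemma cls_self:
  assumes "X \<in> Obj C" "Y \<in> Obj C" "f \<in> mor C X Y"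
  shows "f \<in> cls X Y f"
  using assms by (simp add: mem_cls_iff)

lemma cls_zero_iff:
  assumes "X \<in> Obj C" "Y \<in> Obj C" "f \<in> mor C X Y"
  shows "cls X Y f = \<zero>\<^bsub>Hom Q X Y\<^esub> \<longleftrightarrow> f \<in> I X Y"
proof -
  interpret abelian_subgroup "I X Y" "Hom C X Y" using assms I_abelian_subgroup by simp
  show ?thesis
    using assms a_rcos_self[of f] a_rcos_const[of f]
    by (auto simp: quotient_cat_def cls_def)
qed

lemma zero_Q:
  assumes "X \<in> Obj C" "Y \<in> Obj C"
  shows "\<zero>\<^bsub>Hom Q X Y\<^esub> = cls X Y \<zero>\<^bsub>Hom C X Y\<^esub>"
proof -
  interpret abelian_subgroup "I X Y" "Hom C X Y" using assms I_abelian_subgroup by simp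
  show ?thesis using assms cls_zero_iff[of X Y "\<zero>\<^bsub>Hom C X Y\<^esub>"] by simp
qed

lemma add_Q:
  assumes "X \<in> Obj C" "Y \<in> Obj C" "f \<in> mor C X Y" "g \<in> mor C X Y"
  shows "cls X Y f \<oplus>\<^bsub>Hom Q X Y\<^esub> cls X Y g = cls X Y (f \<oplus>\<^bsub>Hom C X Y\<^esub> g)"
proof -
  interpret abelian_subgroup "I X Y" "Hom C X Y" using assms I_abelian_subgroup by simp
  show ?thesis
    using assms by (simp add: quotient_cat_def cls_def a_rcos_sum)
qed

lemma Ident_Q: "Ident Q X = cls X X (Ident C X)"
  by (simp add: quotient_cat_def cls_def)

text \<open>The composite in \<open>quotient_cat\<close> is a union over all pairs of
  representatives. Replacing one representative changes the composite by an element of the ideal, so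
  all the cosets in the union coincide.\<close>

lemma Cmp_Q:
  assumes "X \<in> Obj C" "Y \<in> Obj C" "Z \<in> Obj C" "f \<in> mor C X Y" "g \<in> mor C Y Z"
  shows "Cmp Q X Y Z (cls Y Z g) (cls X Y f) = cls X Z (Cmp C X Y Z g f)"
proof -
  interpret XY: abelian_subgroup "I X Y" "Hom C X Y" using assms I_abelian_subgroup by simp
  interpret YZ: abelian_subgroup "I Y Z" "Hom C Y Z" using assms I_abelian_subgroup by simp
  interpret XZ: abelian_subgroup "I X Z" "Hom C X Z" using assms I_abelian_subgroup by simp
  have "cls X Z (Cmp C X Y Z g' f') = cls X Z (Cmp C X Y Z g f)"
    if "f' \<in> cls X Y f" "g' \<in> cls Y Z g" for f' g'
  proof -
    have f': "f' \<in> mor C X Y" "f' \<ominus>\<^bsub>Hom C X Y\<^esub> f \<in> I X Y"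
      using that(1) mem_cls_iff[of X Y f f'] cls_eq_iff[of X Y f f'] assms by simp_all
    have g': "g' \<in> mor C Y Z" "g' \<ominus>\<^bsub>Hom C Y Z\<^esub> g \<in> I Y Z"
      using that(2) mem_cls_iff[of Y Z g g'] cls_eq_iff[of Y Z g g'] assms by simp_all
    have "cls X Z (Cmp C X Y Z g' f') = cls X Z (Cmp C X Y Z g' f)"
      using I_Cmp_left[OF _ _ _ f'(2) g'(1)] assms f' g'
      by (simp add: Cmp_minus_right cls_eq_iff Cmp_closed)
    also have "\<dots> = cls X Z (Cmp C X Y Z g f)"
      using I_Cmp_right[OF _ _ _ _ g'(2)] assms f' g'
      by (simp add: Cmp_minus_left cls_eq_iff Cmp_closed)
    finally show ?thesis .
  qed
  then have "(\<Union>g'\<in>cls Y Z g. \<Union>f'\<in>cls X Y f. cls X Z (Cmp C X Y Z g' f'))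
    = (\<Union>g'\<in>cls Y Z g. \<Union>f'\<in>cls X Y f. cls X Z (Cmp C X Y Z g f))"
    by (intro SUP_cong refl)
  also have "\<dots> = cls X Z (Cmp C X Y Z g f)"
  proof -
    have "cls X Y f \<noteq> {}" "cls Y Z g \<noteq> {}"
      using cls_self[of X Y f] cls_self[of Y Z g] assms by blast+
    then show ?thesis by simp
  qed
  finally show ?thesis unfolding quotient_cat_def precat.simps cls_def .
qed

lemma Hom_Q_cases:
  assumes "X \<in> Obj C" "Y \<in> Obj C" "F \<in> mor Q X Y"
  obtains f where "f \<in> mor C X Y" "F = cls X Y f"
  using assms by (auto simp: carrier_Hom_Q)

lemma abelian_group_Hom_Q:
  assumes XY: "X \<in> Obj C" "Y \<in> Obj C"
  shows "abelian_group (Hom Q X Y)"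
proof -
  interpret abelian_group "Hom C X Y" using XY by (rule Hom_abelian_group)
  show ?thesis
  proof (rule abelian_groupI)
    fix F G assume "F \<in> mor Q X Y" "G \<in> mor Q X Y"
    then show "F \<oplus>\<^bsub>Hom Q X Y\<^esub> G \<in> mor Q X Y" "F \<oplus>\<^bsub>Hom Q X Y\<^esub> G = G \<oplus>\<^bsub>Hom Q X Y\<^esub> F"
      using XY by (auto elim!: Hom_Q_cases[OF XY] simp: add_Q cls_closed a_comm)
  next
    show "\<zero>\<^bsub>Hom Q X Y\<^esub> \<in> mor Q X Y" using XY by (simp add: zero_Q cls_closed)
  next
    fix F G H assume "F \<in> mor Q X Y" "G \<in> mor Q X Y" "H \<in> mor Q X Y"
    then show "F \<oplus>\<^bsub>Hom Q X Y\<^esub> G \<oplus>\<^bsub>Hom Q X Y\<^esub> H = F \<oplus>\<^bsub>Hom Q X Y\<^esub> (G \<oplus>\<^bsub>Hom Q X Y\<^esub> H)"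
      using XY by (auto elim!: Hom_Q_cases[OF XY] simp: add_Q a_assoc)
  next
    fix F assume "F \<in> mor Q X Y"
    then obtain f where f: "f \<in> mor C X Y" "F = cls X Y f" by (rule Hom_Q_cases[OF XY])
    then show "\<zero>\<^bsub>Hom Q X Y\<^esub> \<oplus>\<^bsub>Hom Q X Y\<^esub> F = F"
      using XY by (simp add: zero_Q add_Q)
    show "\<exists>G\<in>mor Q X Y. G \<oplus>\<^bsub>Hom Q X Y\<^esub> F = \<zero>\<^bsub>Hom Q X Y\<^esub>"
      using XY f by (intro bexI[of _ "cls X Y (\<ominus>\<^bsub>Hom C X Y\<^esub> f)"]) (simp_all add: zero_Q add_Q l_neg cls_closed)
  qed
qed

lemma preadditive_Q: "preadditive Q"
proof (intro preadditive.intro category.intro preadditive_axioms.intro)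
  show "Ident Q X \<in> mor Q X X" if "X \<in> Obj Q" for X
    using that by (simp add: Ident_Q cls_closed Ident_closed)
next
  fix X Y Z F G assume "X \<in> Obj Q" "Y \<in> Obj Q" "Z \<in> Obj Q"
    "F \<in> mor Q X Y" "G \<in> mor Q Y Z"
  then show "Cmp Q X Y Z G F \<in> mor Q X Z"
    by (auto elim!: Hom_Q_cases[rotated 2] simp: Cmp_Q Cmp_closed cls_closed)
next
  fix X Y F assume "X \<in> Obj Q" "Y \<in> Obj Q" "F \<in> mor Q X Y"
  then show "Cmp Q X Y Y (Ident Q Y) F = F" "Cmp Q X X Y F (Ident Q X) = F"
    by (auto elim!: Hom_Q_cases[rotated 2] simp: Cmp_Q Ident_Q Ident_closed Cmp_Ident_left Cmp_Ident_right)
next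
  fix W X Y Z F G H assume "W \<in> Obj Q" "X \<in> Obj Q" "Y \<in> Obj Q" "Z \<in> Obj Q"
    "F \<in> mor Q W X" "G \<in> mor Q X Y" "H \<in> mor Q Y Z"
  then show "Cmp Q W Y Z H (Cmp Q W X Y G F) = Cmp Q W X Z (Cmp Q X Y Z H G) F"
    by (auto elim!: Hom_Q_cases[rotated 2] simp: Cmp_Q Cmp_closed Cmp_assoc)
next
  show "abelian_group (Hom Q X Y)" if "X \<in> Obj Q" "Y \<in> Obj Q" for X Y
    using that by (simp add: abelian_group_Hom_Q)
next
  fix X Y Z F G G' assume "X \<in> Obj Q" "Y \<in> Obj Q" "Z \<in> Obj Q" "F \<in> mor Q X Y"
    "G \<in> mor Q Y Z" "G' \<in> mor Q Y Z"
  moreover from this have "abelian_group (Hom C Y Z)" using Hom_abelian_group by simp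
  ultimately show "Cmp Q X Y Z (G \<oplus>\<^bsub>Hom Q Y Z\<^esub> G') F = Cmp Q X Y Z G F \<oplus>\<^bsub>Hom Q X Z\<^esub> Cmp Q X Y Z G' F"
    by (auto elim!: Hom_Q_cases[rotated 2] simp: Cmp_Q add_Q Cmp_closed Cmp_add_left abelian_groupE(1))
next
  fix X Y Z F F' G assume "X \<in> Obj Q" "Y \<in> Obj Q" "Z \<in> Obj Q" "F \<in> mor Q X Y"
    "F' \<in> mor Q X Y" "G \<in> mor Q Y Z"
  moreover from this have "abelian_group (Hom C X Y)" using Hom_abelian_group by simp
  ultimately show "Cmp Q X Y Z G (F \<oplus>\<^bsub>Hom Q X Y\<^esub> F') = Cmp Q X Y Z G F \<oplus>\<^bsub>Hom Q X Z\<^esub> Cmp Q X Y Z G F'"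
    by (auto elim!: Hom_Q_cases[rotated 2] simp: Cmp_Q add_Q Cmp_closed Cmp_add_right abelian_groupE(1))
qed

end

section \<open>Localizations with enough projectives\<close>

text \<open>\<open>lift_unique\<close> says that composition with any member of \<open>S\<close> is
  bijective on maps out of an object of \<open>Pr\<close>. As every object has a resolution by such
  an object, the Hom groups of the localization are Hom groups of \<open>C\<close>, and sums and
  composites of fractions are computed by lifting.\<close>

locale enough_projectives = preadditive C for C :: "('o, 'm) precat" +
  fixes S :: "'o \<Rightarrow> 'o \<Rightarrow> 'm set" and Pr :: "'o set"
  assumes S_Hom: "\<lbrakk>X \<in> Obj C; Y \<in> Obj C; s \<in> S X Y\<rbrakk> \<Longrightarrow> s \<in> mor C X Y"
    and S_Ident: "X \<in> Obj C \<Longrightarrow> Ident C X \<in> S X X"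
    and S_Cmp: "\<lbrakk>X \<in> Obj C; Y \<in> Obj C; Z \<in> Obj C; s \<in> S X Y; t \<in> S Y Z\<rbrakk> \<Longrightarrow> Cmp C X Y Z t s \<in> S X Z"
    and Pr_Obj: "P \<in> Pr \<Longrightarrow> P \<in> Obj C"
    and enough: "X \<in> Obj C \<Longrightarrow> \<exists>P\<in>Pr. \<exists>p. p \<in> S P X"
    and lift_unique: "\<lbrakk>P \<in> Pr; W \<in> Obj C; X \<in> Obj C; s \<in> S W X; f \<in> mor C P X\<rbrakk>
      \<Longrightarrow> \<exists>!u. u \<in> mor C P W \<and> Cmp C P W X s u = f"
begin

abbreviation D where "D \<equiv> localization C S"

text \<open>The fraction f s^-1 composed with \<open>p\<close>: the map \<open>p\<close> lifts
  through \<open>s\<close> in exactly one way, and \<open>a\<close> is \<open>f\<close> after that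
  lift. It turns out to be a complete invariant of the roof.\<close>

definition represents :: "'o \<Rightarrow> 'm \<Rightarrow> 'o \<Rightarrow> 'o \<Rightarrow> 'o \<times> 'm \<times> 'm \<Rightarrow> 'm \<Rightarrow> bool" where
  "represents P p X Y r a \<longleftrightarrow> (case r of (W, s, f) \<Rightarrow>
     \<exists>u \<in> mor C P W. Cmp C P W X s u = p \<and> Cmp C P W Y f u = a)"

text \<open>The class of the fraction a p^-1.\<close>

definition frac :: "'o \<Rightarrow> 'm \<Rightarrow> 'o \<Rightarrow> 'o \<Rightarrow> 'm \<Rightarrow> ('o \<times> 'm \<times> 'm) set" where
  "frac P p X Y a = roof_rel C S X Y `` {(P, p, a)}"

lemma Obj_D [simp]: "Obj D = Obj C"
  by (simp add: localization_def)

lemma represents_ex1: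
  assumes "P \<in> Pr" "X \<in> Obj C" "Y \<in> Obj C" "p \<in> S P X" "r \<in> roofs C S X Y"
  shows "\<exists>!a. represents P p X Y r a"
proof -
  obtain W s f where r: "r = (W, s, f)" "W \<in> Obj C" "s \<in> S W X" "f \<in> mor C W Y"
    using assms by (auto simp: roofs_def)
  have "\<exists>!u. u \<in> mor C P W \<and> Cmp C P W X s u = p"
    using lift_unique[of P W X s p] assms r S_Hom[of P X p] Pr_Obj by simp
  then show ?thesis unfolding represents_def r(1) prod.case by metis
qed

lemma represents_closed:
  assumes "P \<in> Pr" "X \<in> Obj C" "Y \<in> Obj C" "r \<in> roofs C S X Y" "represents P p X Y r a"
  shows "a \<in> mor C P Y"
  using assms by (auto simp: represents_def roofs_def Cmp_closed Pr_Obj)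

text \<open>A common refinement of two roofs is dominated by \<open>P\<close>, because
  \<open>p\<close> lifts through its leg to \<open>X\<close>; conversely \<open>P\<close> itself can
  serve as the common refinement. Hence equivalence of roofs is equality of the represented maps,
  and in particular transitive.\<close>

lemma roof_rel_iff:
  assumes P: "P \<in> Pr" and X: "X \<in> Obj C" and Y: "Y \<in> Obj C" and p: "p \<in> S P X"
  shows "(r, r') \<in> roof_rel C S X Y \<longleftrightarrow> r \<in> roofs C S X Y \<and> r' \<in> roofs C S X Y \<and>
     (\<exists>a. represents P p X Y r a \<and> represents P p X Y r' a)" (is "?L \<longleftrightarrow> ?R")
proof
  note PO = Pr_Obj[OF P] and pH = S_Hom[OF Pr_Obj[OF P] X p]
  assume ?L
  then obtain W s f W' s' f' V u u' where r: "r = (W, s, f)" "r' = (W', s', f')"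
    "r \<in> roofs C S X Y" "r' \<in> roofs C S X Y" and V: "V \<in> Obj C"
    and u: "u \<in> mor C V W" "u' \<in> mor C V W'"
    and eq: "Cmp C V W X s u = Cmp C V W' X s' u'" "Cmp C V W X s u \<in> S V X"
      "Cmp C V W Y f u = Cmp C V W' Y f' u'"
    by (auto simp: roof_rel_def)
  have W: "W \<in> Obj C" "s \<in> mor C W X" "f \<in> mor C W Y"
    "W' \<in> Obj C" "s' \<in> mor C W' X" "f' \<in> mor C W' Y"
    using r X S_Hom by (auto simp: roofs_def)
  \<comment> \<open>The leg of the common refinement belongs to \<open>S\<close>, so
    \<open>p\<close> lifts through it; everything is then compared along \<open>w\<close>.\<close>
  obtain w where w: "w \<in> mor C P V" "Cmp C P V X (Cmp C V W X s u) w = p"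
    using lift_unique[OF P V X eq(2) pH] by blast
  have "represents P p X Y r (Cmp C P V Y (Cmp C V W Y f u) w)"
    unfolding represents_def r(1) prod.case using w u V W PO X Y
    by (intro bexI[of _ "Cmp C P V W u w"] conjI) (simp_all add: Cmp_assoc Cmp_closed)
  moreover have "represents P p X Y r' (Cmp C P V Y (Cmp C V W Y f u) w)"
    unfolding represents_def r(2) prod.case using w u V W PO X Y eq
    by (intro bexI[of _ "Cmp C P V W' u' w"] conjI) (simp_all add: Cmp_assoc Cmp_closed)
  ultimately show ?R using r by blast
next
  assume ?R
  then obtain W s f W' s' f' a u u' where r: "r = (W, s, f)" "r' = (W', s', f')"
    "r \<in> roofs C S X Y" "r' \<in> roofs C S X Y"
    "u \<in> mor C P W" "Cmp C P W X s u = p" "Cmp C P W Y f u = a"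
    "u' \<in> mor C P W'" "Cmp C P W' X s' u' = p" "Cmp C P W' Y f' u' = a"
    by (auto simp: represents_def)
  \<comment> \<open>The object \<open>P\<close> with the two lifts of \<open>p\<close> is the
    refinement, since its leg to \<open>X\<close> is \<open>p\<close> itself.\<close>
  moreover have "\<exists>V\<in>Obj C. \<exists>u\<in>mor C V W. \<exists>u'\<in>mor C V W'.
      Cmp C V W X s u = Cmp C V W' X s' u' \<and> Cmp C V W X s u \<in> S V X \<and>
      Cmp C V W Y f u = Cmp C V W' Y f' u'"
    using calculation Pr_Obj[OF P] p by (intro bexI[of _ P] bexI[of _ u] bexI[of _ u']) simp_all
  ultimately show ?L unfolding roof_rel_def by simp
qed

lemma frac_roof:
  assumes "P \<in> Pr" "p \<in> S P X" "a \<in> mor C P Y"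
  shows "(P, p, a) \<in> roofs C S X Y"
  using assms by (simp add: roofs_def Pr_Obj)

lemma represents_self:
  assumes "P \<in> Pr" "X \<in> Obj C" "Y \<in> Obj C" "p \<in> S P X" "a \<in> mor C P Y"
  shows "represents P p X Y (P, p, a) a"
  unfolding represents_def using assms S_Hom[of P X p] Pr_Obj[of P]
  by (auto intro!: bexI[of _ "Ident C P"] simp: Cmp_Ident_right Ident_closed)

lemma mem_frac_iff:
  assumes "P \<in> Pr" "X \<in> Obj C" "Y \<in> Obj C" "p \<in> S P X" "a \<in> mor C P Y"
  shows "r \<in> frac P p X Y a \<longleftrightarrow> r \<in> roofs C S X Y \<and> represents P p X Y r a"
proof -
  have "represents P p X Y (P, p, a) b \<longleftrightarrow> b = a" for b
    using represents_ex1[of P X Y p "(P, p, a)"] represents_self[of P X Y p a] assms frac_roof by blast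
  then show ?thesis
    using assms frac_roof by (auto simp: frac_def roof_rel_iff)
qed

text \<open>The operations of \<open>localization\<close> collect roofs over all admissible choices
  and saturate. Once all the collected roofs represent one and the same map, the saturation is a
  single class; zero, identity, sum and composite are all handled in this way.\<close>

lemma Image_roof_rel:
  assumes "P \<in> Pr" "X \<in> Obj C" "Y \<in> Obj C" "p \<in> S P X"
    and "A \<noteq> {}" "\<And>r. r \<in> A \<Longrightarrow> r \<in> roofs C S X Y \<and> represents P p X Y r a"
  shows "roof_rel C S X Y `` A = frac P p X Y a"
proof -
  obtain r where r: "r \<in> A" using assms by blast
  have a: "a \<in> mor C P Y" using represents_closed[of P X Y r p a] assms r by blast
  have "(r, r') \<in> roof_rel C S X Y \<longleftrightarrow> r' \<in> frac P p X Y a" if "r \<in> A" for r r'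
    using assms(1-4) assms(6)[OF that] a represents_ex1[OF assms(1-4), of r]
    by (simp add: mem_frac_iff roof_rel_iff) blast
  then show ?thesis using r by blast
qed

lemma frac_inj:
  assumes "P \<in> Pr" "X \<in> Obj C" "Y \<in> Obj C" "p \<in> S P X"
    "a \<in> mor C P Y" "b \<in> mor C P Y"
  shows "frac P p X Y a = frac P p X Y b \<longleftrightarrow> a = b"
proof
  assume "frac P p X Y a = frac P p X Y b"
  then have "(P, p, a) \<in> frac P p X Y b"
    using mem_frac_iff[of P X Y p a "(P, p, a)"] assms frac_roof represents_self by simp
  then show "a = b"
    using represents_ex1[of P X Y p "(P, p, a)"] assms frac_roof represents_self
    by (auto simp: mem_frac_iff)
qed simp

text \<open>Together with \<open>frac_inj\<close> this identifies the maps from \<open>X\<close> to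
  \<open>Y\<close> in the localization with the maps from \<open>P\<close> to \<open>Y\<close> in
  \<open>C\<close>.\<close>

lemma carrier_Hom_D:
  assumes "P \<in> Pr" "X \<in> Obj C" "Y \<in> Obj C" "p \<in> S P X"
  shows "mor D X Y = frac P p X Y ` mor C P Y"
proof -
  have "roof_rel C S X Y `` {r} \<in> frac P p X Y ` mor C P Y" if r: "r \<in> roofs C S X Y" for r
  proof -
    obtain a where "represents P p X Y r a" using represents_ex1[OF assms r] by blast
    then show ?thesis
      using Image_roof_rel[OF assms, of "{r}" a] r represents_closed[OF assms(1-3) r] by blast
  qed
  moreover have "frac P p X Y a \<in> roofs C S X Y // roof_rel C S X Y" if "a \<in> mor C P Y" for a
    unfolding frac_def by (rule quotientI) (rule frac_roof[OF assms(1,4) that])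
  ultimately show ?thesis by (auto simp: localization_def quotient_def)
qed

lemma zero_D:
  assumes "P \<in> Pr" "X \<in> Obj C" "Y \<in> Obj C" "p \<in> S P X"
  shows "\<zero>\<^bsub>Hom D X Y\<^esub> = frac P p X Y \<zero>\<^bsub>Hom C P Y\<^esub>"
proof -
  interpret abelian_group "Hom C X Y" using assms Hom_abelian_group by simp
  have "represents P p X Y (X, Ident C X, \<zero>\<^bsub>Hom C X Y\<^esub>) \<zero>\<^bsub>Hom C P Y\<^esub>"
    using assms S_Hom[of P X p] Pr_Obj[of P]
    by (auto simp: represents_def intro!: bexI[of _ p] simp: Cmp_Ident_left Cmp_zero_left)
  then show ?thesis
    using Image_roof_rel[OF assms, of "{(X, Ident C X, \<zero>\<^bsub>Hom C X Y\<^esub>)}"] S_Ident assms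
    by (simp add: localization_def roofs_def)
qed

lemma Ident_D:
  assumes "P \<in> Pr" "X \<in> Obj C" "p \<in> S P X"
  shows "Ident D X = frac P p X X p"
proof -
  have "represents P p X X (X, Ident C X, Ident C X) p"
    using assms S_Hom[of P X p] Pr_Obj[of P]
    by (auto simp: represents_def intro!: bexI[of _ p] simp: Cmp_Ident_left)
  then show ?thesis
    using Image_roof_rel[of P X X p "{(X, Ident C X, Ident C X)}"] S_Ident assms Ident_closed
    by (simp add: localization_def roofs_def)
qed

lemma add_D:
  assumes "P \<in> Pr" "X \<in> Obj C" "Y \<in> Obj C" "p \<in> S P X"
    and ab: "a \<in> mor C P Y" "b \<in> mor C P Y"
  shows "frac P p X Y a \<oplus>\<^bsub>Hom D X Y\<^esub> frac P p X Y b = frac P p X Y (a \<oplus>\<^bsub>Hom C P Y\<^esub> b)"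
proof -
  let ?A = "{(W, s, f \<oplus>\<^bsub>Hom C W Y\<^esub> g) | W s f g. (W, s, f) \<in> frac P p X Y a \<and> (W, s, g) \<in> frac P p X Y b}"
  have "roof_rel C S X Y `` ?A = frac P p X Y (a \<oplus>\<^bsub>Hom C P Y\<^esub> b)"
  proof (rule Image_roof_rel[OF assms(1-4)])
    have "(P, p, a) \<in> frac P p X Y a" "(P, p, b) \<in> frac P p X Y b"
      using assms frac_roof represents_self by (auto simp: mem_frac_iff)
    then show "?A \<noteq> {}" by blast
  next
    fix r assume "r \<in> ?A"
    then obtain W s f g where r: "r = (W, s, f \<oplus>\<^bsub>Hom C W Y\<^esub> g)" and
      m: "(W, s, f) \<in> roofs C S X Y" "(W, s, g) \<in> roofs C S X Y"
      "represents P p X Y (W, s, f) a" "represents P p X Y (W, s, g) b"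
      using assms by (auto simp: mem_frac_iff)
    then have W: "W \<in> Obj C" "s \<in> S W X" "f \<in> mor C W Y" "g \<in> mor C W Y"
      by (auto simp: roofs_def)
    interpret abelian_group "Hom C W Y" using assms W Hom_abelian_group by simp
    obtain u v where u: "u \<in> mor C P W" "Cmp C P W X s u = p" "Cmp C P W Y f u = a"
      and v: "v \<in> mor C P W" "Cmp C P W X s v = p" "Cmp C P W Y g v = b"
      using m by (auto simp: represents_def)
    \<comment> \<open>Both summands have the denominator \<open>s\<close>, so uniqueness of lifts
      forces one common lift of \<open>p\<close>.\<close>
    have "u = v" using lift_unique[of P W X s p] assms S_Hom Pr_Obj W u v by blast
    then show "r \<in> roofs C S X Y \<and> represents P p X Y r (a \<oplus>\<^bsub>Hom C P Y\<^esub> b)"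
      using W u v assms Pr_Obj r by (auto simp: roofs_def represents_def Cmp_add_left intro!: bexI[of _ v])
  qed
  then show ?thesis by (simp add: localization_def)
qed

lemma Cmp_D:
  assumes P: "P \<in> Pr" "X \<in> Obj C" "Y \<in> Obj C" "p \<in> S P X" and Q: "Q \<in> Pr" "Z \<in> Obj C" "q \<in> S Q Y"
    and c: "c \<in> mor C P Q" and b: "b \<in> mor C Q Z"
  shows "Cmp D X Y Z (frac Q q Y Z b) (frac P p X Y (Cmp C P Q Y q c)) = frac P p X Z (Cmp C P Q Z b c)"
proof -
  note PO = Pr_Obj[OF P(1)] and QO = Pr_Obj[OF Q(1)]
  note qH = S_Hom[OF QO P(3) Q(3)] and pH = S_Hom[OF PO P(2) P(4)]
  define a where "a = Cmp C P Q Y q c"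
  have a: "a \<in> mor C P Y" using assms PO QO qH by (simp add: a_def Cmp_closed)
  let ?F = "frac P p X Y a" and ?G = "frac Q q Y Z b"
  let ?A = "{(U, Cmp C U V X s u, Cmp C U W Z g h) | U u h V s f W t g.
                  (V, s, f) \<in> ?F \<and> (W, t, g) \<in> ?G \<and>
                  U \<in> Obj C \<and> u \<in> S U V \<and> h \<in> mor C U W \<and>
                  Cmp C U W Y t h = Cmp C U V Y f u}"
  have "roof_rel C S X Z `` ?A = frac P p X Z (Cmp C P Q Z b c)"
  proof (rule Image_roof_rel[OF P(1,2) Q(2) P(4)])
    have "(P, p, a) \<in> ?F" "(Q, q, b) \<in> ?G"
      using assms a frac_roof represents_self by (auto simp: mem_frac_iff)
    \<comment> \<open>The square with vertex \<open>P\<close> and sides the identity and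
      \<open>c\<close> shows that at least one composite is formed.\<close>
    moreover have "Ident C P \<in> S P P" "Cmp C P Q Y q c = Cmp C P P Y a (Ident C P)"
      using a P PO S_Ident by (simp_all add: a_def[symmetric] Cmp_Ident_right)
    ultimately show "?A \<noteq> {}" using PO c by blast
  next
    fix r assume "r \<in> ?A"
    then obtain U u h V s f W t g where r: "r = (U, Cmp C U V X s u, Cmp C U W Z g h)"
      and F: "(V, s, f) \<in> ?F" and G: "(W, t, g) \<in> ?G"
      and U: "U \<in> Obj C" "u \<in> S U V" "h \<in> mor C U W"
        "Cmp C U W Y t h = Cmp C U V Y f u"
      by blast
    have V: "V \<in> Obj C" "s \<in> S V X" "f \<in> mor C V Y" "represents P p X Y (V, s, f) a"
      using F P a by (auto simp: mem_frac_iff roofs_def)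
    have W: "W \<in> Obj C" "t \<in> S W Y" "g \<in> mor C W Z" "represents Q q Y Z (W, t, g) b"
      using G P Q b by (auto simp: mem_frac_iff roofs_def)
    have sH: "s \<in> mor C V X" and tH: "t \<in> mor C W Y" and uH: "u \<in> mor C U V"
      using V W U P Q S_Hom by auto
    have su: "Cmp C U V X s u \<in> S U X" using S_Cmp U V P by simp
    obtain x where x: "x \<in> mor C P U" "Cmp C P U X (Cmp C U V X s u) x = p"
      using lift_unique[OF P(1) U(1) P(2) su pH] by blast
    obtain y where y: "y \<in> mor C P V" "Cmp C P V X s y = p" "Cmp C P V Y f y = a"
      using V(4) by (auto simp: represents_def)
    obtain z where z: "z \<in> mor C Q W" "Cmp C Q W Y t z = q" "Cmp C Q W Z g z = b"
      using W(4) by (auto simp: represents_def)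
    \<comment> \<open>Both sides are lifts of \<open>p\<close> through \<open>s\<close>.\<close>
    have "Cmp C P U V u x = y"
      using lift_unique[OF P(1) V(1) P(2) V(2) pH] x y uH sH PO P(2) U(1) V(1)
      by (metis Cmp_closed Cmp_assoc)
    then have "Cmp C P W Y t (Cmp C P U W h x) = a"
      using x y z U V W P PO tH uH Cmp_assoc[of P U W Y x h t] Cmp_assoc[of P U V Y x u f] by simp
    moreover have "Cmp C P W Y t (Cmp C P Q W z c) = a"
      using z W P PO QO tH c Cmp_assoc[of P Q W Y c z t] by (simp add: a_def)
    \<comment> \<open>Both sides are lifts of \<open>a\<close> through \<open>t\<close>.\<close>
    ultimately have "Cmp C P U W h x = Cmp C P Q W z c"
      using lift_unique[OF P(1) W(1) P(3) W(2) a] x z c U W PO QO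
      by (metis Cmp_closed)
    then have "Cmp C P U Z (Cmp C U W Z g h) x = Cmp C P Q Z b c"
      using x z U V W P Q PO QO c Cmp_assoc[of P U W Z x h g] Cmp_assoc[of P Q W Z c z g] by simp
    then show "r \<in> roofs C S X Z \<and> represents P p X Z r (Cmp C P Q Z b c)"
      using r su U W x Q by (auto simp: roofs_def represents_def Cmp_closed)
  qed
  then show ?thesis by (simp add: localization_def a_def)
qed

lemma abelian_group_Hom_D:
  assumes "X \<in> Obj C" "Y \<in> Obj C"
  shows "abelian_group (Hom D X Y)"
proof -
  obtain P p where P: "P \<in> Pr" "p \<in> S P X" using enough assms by blast
  note A = P(1) assms P(2)
  interpret abelian_group "Hom C P Y" using assms P Pr_Obj Hom_abelian_group by simp
  show ?thesis
  proof (rule abelian_groupI)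
    fix F assume "F \<in> mor D X Y"
    then obtain a where a: "a \<in> mor C P Y" "F = frac P p X Y a"
      using carrier_Hom_D[OF A] by auto
    then show "\<exists>G\<in>mor D X Y. G \<oplus>\<^bsub>Hom D X Y\<^esub> F = \<zero>\<^bsub>Hom D X Y\<^esub>"
      by (intro bexI[of _ "frac P p X Y (\<ominus>\<^bsub>Hom C P Y\<^esub> a)"])
        (simp_all add: carrier_Hom_D[OF A] add_D[OF A] zero_D[OF A] l_neg)
  qed (auto simp: carrier_Hom_D[OF A] add_D[OF A] zero_D[OF A] a_ac)
qed

end

section \<open>Additive maps and torsion-free groups\<close>

text \<open>One notion of additive map for all records with an addition, whatever ring acts on them.
  The functions are extensional so as to agree with \<open>mod_hom\<close>.\<close>

definition ahom :: "('a, 'x) ring_scheme \<Rightarrow> ('b, 'y) ring_scheme \<Rightarrow> ('a \<Rightarrow> 'b) set" where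
  "ahom A B = {f \<in> carrier A \<rightarrow>\<^sub>E carrier B. \<forall>x\<in>carrier A. \<forall>y\<in>carrier A. f (x \<oplus>\<^bsub>A\<^esub> y) = f x \<oplus>\<^bsub>B\<^esub> f y}"

lemma ahomI:
  assumes "\<And>x. x \<in> carrier A \<Longrightarrow> f x \<in> carrier B"
    and "\<And>x y. \<lbrakk>x \<in> carrier A; y \<in> carrier A\<rbrakk> \<Longrightarrow> f (x \<oplus>\<^bsub>A\<^esub> y) = f x \<oplus>\<^bsub>B\<^esub> f y"
    and "f \<in> extensional (carrier A)"
  shows "f \<in> ahom A B"
  using assms by (simp add: ahom_def PiE_def Pi_def)

lemma ahom_restrictI:
  assumes "abelian_group A" "\<And>x. x \<in> carrier A \<Longrightarrow> f x \<in> carrier B"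
    and "\<And>x y. \<lbrakk>x \<in> carrier A; y \<in> carrier A\<rbrakk> \<Longrightarrow> f (x \<oplus>\<^bsub>A\<^esub> y) = f x \<oplus>\<^bsub>B\<^esub> f y"
  shows "(\<lambda>x\<in>carrier A. f x) \<in> ahom A B"
  by (rule ahomI) (simp_all add: assms abelian_groupE(1)[OF assms(1)])

lemma ahom_closed: "\<lbrakk>f \<in> ahom A B; x \<in> carrier A\<rbrakk> \<Longrightarrow> f x \<in> carrier B"
  by (auto simp: ahom_def)

lemma ahom_add: "\<lbrakk>f \<in> ahom A B; x \<in> carrier A; y \<in> carrier A\<rbrakk> \<Longrightarrow> f (x \<oplus>\<^bsub>A\<^esub> y) = f x \<oplus>\<^bsub>B\<^esub> f y"
  by (auto simp: ahom_def)

lemma ahom_extensional: "f \<in> ahom A B \<Longrightarrow> f \<in> extensional (carrier A)"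
  by (auto simp: ahom_def PiE_def)

lemma ahom_eqI:
  assumes "f \<in> ahom A B" "g \<in> ahom A C" "\<And>x. x \<in> carrier A \<Longrightarrow> f x = g x"
  shows "f = g"
  using extensionalityI[OF ahom_extensional[OF assms(1)] ahom_extensional[OF assms(2)]] assms(3) by blast

lemma (in abelian_group) add_idem_zero: "\<lbrakk>x \<in> carrier G; x \<oplus> x = x\<rbrakk> \<Longrightarrow> x = \<zero>"
  by (metis add.r_cancel_one')

lemma ahom_zero:
  fixes A (structure)
  assumes "f \<in> ahom A B" "abelian_group A" "abelian_group B" shows "f \<zero> = \<zero>\<^bsub>B\<^esub>"
proof -
  interpret A: abelian_group A by fact
  interpret B: abelian_group B by fact
  show ?thesis
  proof (rule B.add_idem_zero)
    show "f \<zero> \<in> carrier B" by (rule ahom_closed[OF assms(1) A.zero_closed])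
    have "f \<zero> \<oplus>\<^bsub>B\<^esub> f \<zero> = f (\<zero> \<oplus> \<zero>)"
      by (rule ahom_add[OF assms(1) A.zero_closed A.zero_closed, symmetric])
    then show "f \<zero> \<oplus>\<^bsub>B\<^esub> f \<zero> = f \<zero>" by (simp only: A.l_zero A.zero_closed)
  qed
qed

lemma ahom_neg:
  assumes "f \<in> ahom A B" "abelian_group A" "abelian_group B" "x \<in> carrier A"
  shows "f (\<ominus>\<^bsub>A\<^esub> x) = \<ominus>\<^bsub>B\<^esub> f x"
proof -
  interpret A: abelian_group A by fact
  interpret B: abelian_group B by fact
  have "f (\<ominus>\<^bsub>A\<^esub> x) \<oplus>\<^bsub>B\<^esub> f x = \<zero>\<^bsub>B\<^esub>"
    using assms ahom_zero[OF assms(1-3)] by (simp add: ahom_add[OF assms(1), symmetric] A.l_neg)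
  then show ?thesis using B.minus_equality ahom_closed[OF assms(1)] assms(4) by simp
qed

lemma ahom_minus:
  assumes "f \<in> ahom A B" "abelian_group A" "abelian_group B" "x \<in> carrier A" "y \<in> carrier A"
  shows "f (x \<ominus>\<^bsub>A\<^esub> y) = f x \<ominus>\<^bsub>B\<^esub> f y"
  using assms by (simp add: a_minus_def ahom_add ahom_neg abelian_group.a_inv_closed)

lemma (in abelian_group) int_pow_Suc:
  assumes "x \<in> carrier G" shows "[(i + 1 :: int)] \<cdot> x = [i] \<cdot> x \<oplus> x" "[(i - 1 :: int)] \<cdot> x = [i] \<cdot> x \<oplus> \<ominus> x"
proof -
  show "[(i + 1)] \<cdot> x = [i] \<cdot> x \<oplus> x"
    using add.int_pow_mult[OF assms, of i 1] add.int_pow_1[OF assms] by (simp only:)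
  have "[(i + - 1)] \<cdot> x = [i] \<cdot> x \<oplus> [(- 1 :: int)] \<cdot> x" by (rule add.int_pow_mult[OF assms])
  then show "[(i - 1)] \<cdot> x = [i] \<cdot> x \<oplus> \<ominus> x"
    using add.int_pow_neg[OF assms, of 1] add.int_pow_1[OF assms] by (simp only: uminus_add_conv_diff diff_conv_add_uminus)
qed

text \<open>Formulated on a subset \<open>S\<close> closed under the group operations. With
  \<open>S\<close> the whole carrier it shows that additive maps commute with integer multiples, and
  with \<open>f\<close> the identity it shows that subgroups are closed under them.\<close>

lemma additive_int_pow:
  fixes A (structure)
  assumes A: "abelian_group A" and B: "abelian_group B" and f: "\<And>x. x \<in> S \<Longrightarrow> f x \<in> carrier B"
    and fadd: "\<And>x y. \<lbrakk>x \<in> S; y \<in> S\<rbrakk> \<Longrightarrow> f (x \<oplus> y) = f x \<oplus>\<^bsub>B\<^esub> f y"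
    and S: "S \<subseteq> carrier A" "\<zero> \<in> S" "\<And>x y. \<lbrakk>x \<in> S; y \<in> S\<rbrakk> \<Longrightarrow> x \<oplus> y \<in> S" "\<And>x. x \<in> S \<Longrightarrow> \<ominus> x \<in> S"
    and x: "x \<in> S"
  shows "[k] \<cdot> x \<in> S \<and> f ([(k::int)] \<cdot> x) = [k] \<cdot>\<^bsub>B\<^esub> f x"
proof -
  interpret A: abelian_group A by fact
  interpret B: abelian_group B by fact
  have z: "f \<zero> = \<zero>\<^bsub>B\<^esub>"
    using B.add_idem_zero[OF f[OF S(2)]] fadd[OF S(2) S(2)] A.l_zero[OF A.zero_closed] by metis
  have n: "f (\<ominus> y) = \<ominus>\<^bsub>B\<^esub> f y" if y: "y \<in> S" for y
  proof -
    have "f (\<ominus> y) \<oplus>\<^bsub>B\<^esub> f y = \<zero>\<^bsub>B\<^esub>"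
      using fadd[OF S(4)[OF y] y] z A.l_neg[of y] S(1) y by (metis subsetD)
    then show ?thesis using B.minus_equality f[OF y] f[OF S(4)[OF y]] by metis
  qed
  have xA: "x \<in> carrier A" using x S(1) by blast
  show ?thesis
  proof (induction k rule: int_induct[where k = 0])
    case base then show ?case using S(2) z by (simp add: add_pow_def)
  next
    case (step1 i)
    then show ?case using A.int_pow_Suc(1)[OF xA, of i] B.int_pow_Suc(1)[OF f[OF x], of i]
        S(3)[of "[i] \<cdot> x" x] fadd[of "[i] \<cdot> x" x] x by metis
  next
    case (step2 i)
    then show ?case using A.int_pow_Suc(2)[OF xA, of i] B.int_pow_Suc(2)[OF f[OF x], of i]
        S(3)[of "[i] \<cdot> x" "\<ominus> x"] fadd[of "[i] \<cdot> x" "\<ominus> x"] n[OF x] S(4)[OF x] by metis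
  qed
qed

lemma ahom_int_pow:
  assumes "f \<in> ahom A B" "abelian_group A" "abelian_group B" "x \<in> carrier A"
  shows "f ([(k::int)] \<cdot>\<^bsub>A\<^esub> x) = [k] \<cdot>\<^bsub>B\<^esub> f x"
proof -
  interpret A: abelian_group A by fact
  show ?thesis
    using additive_int_pow[OF assms(2,3), of "carrier A" f x k] assms(4)
      ahom_closed[OF assms(1)] ahom_add[OF assms(1)] by simp
qed

lemma ahom_compose:
  assumes "f \<in> ahom A B" "g \<in> ahom B C" "abelian_group A" shows "compose (carrier A) g f \<in> ahom A C"
  using assms abelian_groupE(1)[OF assms(3)]
  by (intro ahomI) (auto simp: compose_def ahom_closed ahom_add)

lemma ahom_finsum:
  assumes "f \<in> ahom A B" "abelian_group A" "abelian_group B" "\<And>i. i \<in> I \<Longrightarrow> x i \<in> carrier A"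
  shows "f (finsum A x I) = finsum B (\<lambda>i. f (x i)) I"
proof -
  interpret A: abelian_group A by fact
  interpret B: abelian_group B by fact
  show ?thesis
  proof (cases "finite I")
    case True
    then show ?thesis using assms(4)
    proof induction
      case (insert i I)
      then have "x \<in> I \<rightarrow> carrier A" "(\<lambda>i. f (x i)) \<in> I \<rightarrow> carrier B" "f (x i) \<in> carrier B"
        using ahom_closed[OF assms(1)] by auto
      with insert show ?case
        by (simp add: A.finsum_insert B.finsum_insert ahom_add[OF assms(1)] A.finsum_closed)
    qed (simp add: ahom_zero[OF assms(1-3)])
  qed (simp add: ahom_zero[OF assms(1-3)] A.finsum_infinite B.finsum_infinite)
qed

lemma (in abelian_group) finsum_single:
  assumes "finite I" "\<And>i. \<lbrakk>i \<in> I; i \<noteq> j\<rbrakk> \<Longrightarrow> f i = \<zero>" "f j \<in> carrier G" "j \<notin> I \<Longrightarrow> f j = \<zero>"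
  shows "finsum G f I = f j"
proof (cases "j \<in> I")
  case True
  then have "finsum G f I = finsum G (\<lambda>i. if j = i then f i else \<zero>) I"
    using assms by (intro add.finprod_cong') auto
  also have "\<dots> = f j"
    using add.finprod_singleton[OF True assms(1), of f] assms(2,3) by fastforce
  finally show ?thesis .
next
  case False
  then have "f i = \<zero>" if "i \<in> I" for i using assms(2) that by metis
  then have "finsum G f I = finsum G (\<lambda>i. \<zero>) I"
    by (intro add.finprod_cong') auto
  then show ?thesis using False assms by (simp add: finsum_zero)
qed

section \<open>Subgroups, and abelian groups as modules over the integers\<close>

definition asub :: "'a set \<Rightarrow> ('a, 'x) ring_scheme \<Rightarrow> bool" where
  "asub A G \<longleftrightarrow> A \<subseteq> carrier G \<and> \<zero>\<^bsub>G\<^esub> \<in> A \<and> (\<forall>x\<in>A. \<forall>y\<in>A. x \<oplus>\<^bsub>G\<^esub> y \<in> A) \<and> (\<forall>x\<in>A. \<ominus>\<^bsub>G\<^esub> x \<in> A)"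

text \<open>Sum and zero remain literally those of \<open>G\<close>, so no translation between a
  subgroup and the group is needed; the scalar multiplication makes the subgroup usable as a term of
  a complex.\<close>

definition zmod :: "('a, 'x) ring_scheme \<Rightarrow> 'a set \<Rightarrow> (int, 'a) module" where
  "zmod G A = \<lparr>carrier = A, mult = undefined, one = undefined, zero = \<zero>\<^bsub>G\<^esub>, add = add G,
     smult = (\<lambda>k x. [k] \<cdot>\<^bsub>G\<^esub> x)\<rparr>"

lemma zmod_simps [simp]: "carrier (zmod G A) = A" "zero (zmod G A) = zero G" "add (zmod G A) = add G"
  "smult (zmod G A) k x = [k] \<cdot>\<^bsub>G\<^esub> x"
  by (simp_all add: zmod_def)

lemma asub_carrier: "abelian_group G \<Longrightarrow> asub (carrier G) G"
  by (simp add: asub_def abelian_groupE(1,2) abelian_group.a_inv_closed)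

lemma asub_zero: "abelian_group G \<Longrightarrow> asub {\<zero>\<^bsub>G\<^esub>} G"
  by (simp add: asub_def abelian_groupE abelian_group.minus_equality)

lemma abelian_group_zmod:
  fixes G (structure)
  assumes "abelian_group G" "asub A G" shows "abelian_group (zmod G A)"
proof -
  interpret abelian_group G by fact
  have A: "x \<in> carrier G" if "x \<in> A" for x using assms that by (auto simp: asub_def)
  show ?thesis
  proof (rule abelian_groupI)
    fix x assume x: "x \<in> carrier (zmod G A)"
    then have "\<ominus> x \<in> A" using assms(2) by (simp add: asub_def)
    moreover have "\<ominus> x \<oplus> x = \<zero>" using A[of x] x by (simp add: l_neg)
    ultimately show "\<exists>y\<in>carrier (zmod G A). y \<oplus>\<^bsub>zmod G A\<^esub> x = \<zero>\<^bsub>zmod G A\<^esub>" by auto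
  qed (use assms(2) A in \<open>simp_all add: asub_def a_ac\<close>)
qed

lemma a_inv_zmod:
  assumes "abelian_group G" "asub A G" "x \<in> A" shows "\<ominus>\<^bsub>zmod G A\<^esub> x = \<ominus>\<^bsub>G\<^esub> x"
proof -
  interpret abelian_group G by fact
  interpret Z: abelian_group "zmod G A" using assms by (intro abelian_group_zmod)
  show ?thesis using assms Z.minus_equality[of "\<ominus>\<^bsub>G\<^esub> x" x] by (auto simp: asub_def subset_iff l_neg)
qed

lemma asub_int_pow:
  assumes "abelian_group G" "asub A G" "x \<in> A" shows "[(k::int)] \<cdot>\<^bsub>G\<^esub> x \<in> A"
  using additive_int_pow[of G G A "\<lambda>x. x" x k] assms by (auto simp: asub_def)

lemma module_zmod:
  assumes "abelian_group G" "asub A G" shows "module \<Z> (zmod G A)"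
proof -
  interpret abelian_group G by fact
  have "A \<subseteq> carrier G" using assms by (simp add: asub_def)
  then show ?thesis
    using assms
    by (intro moduleI abelian_group_zmod int_is_cring)
      (auto simp: asub_int_pow subset_iff add.int_pow_mult add.int_pow_distrib add.int_pow_pow mult.commute)
qed

lemma module_int_smult:
  fixes M (structure)
  assumes "module \<Z> M" "x \<in> carrier M" shows "k \<odot> x = [k] \<cdot> x"
proof -
  interpret module \<Z> M by fact
  show ?thesis
  proof (induction k rule: int_induct[where k = 0])
    case base show ?case using smult_l_null[OF assms(2)] by (simp add: add_pow_def)
  next
    case (step1 i)
    then show ?case using assms(2) smult_l_distr[of i 1 x] smult_one[of x]
      by (simp add: M.int_pow_Suc)
  next
    case (step2 i)
    have "(i - 1) \<odot> x = i \<odot> x \<oplus> \<ominus> x"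
      using assms(2) smult_l_distr[of i "-1" x] smult_one[of x] smult_l_minus[of 1 x] by simp
    then show ?case using assms(2) step2 by (simp add: M.int_pow_Suc)
  qed
qed

text \<open>Integer scalars act by iterated sums, so additivity is linearity. Chain maps and
  homotopies over the integers can therefore be produced by \<open>select\<close>.\<close>

lemma mod_hom_int:
  assumes "module \<Z> M" "module \<Z> N" shows "mod_hom \<Z> M N = ahom M N"
proof -
  interpret M: module \<Z> M by fact
  interpret N: module \<Z> N by fact
  have "f (k \<odot>\<^bsub>M\<^esub> x) = k \<odot>\<^bsub>N\<^esub> f x" if "f \<in> ahom M N" "x \<in> carrier M" for f k x
    using that assms ahom_int_pow[OF that(1) M.abelian_group_axioms N.abelian_group_axioms that(2)]
    by (simp add: module_int_smult ahom_closed)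
  then show ?thesis by (auto simp: mod_hom_def ahom_def)
qed

section \<open>Integer coordinates and splittings of free groups of finite rank\<close>

definition int_hom :: "('a, 'x) ring_scheme \<Rightarrow> 'a set \<Rightarrow> ('a \<Rightarrow> int) \<Rightarrow> bool" where
  "int_hom G A c \<longleftrightarrow> (\<forall>x\<in>A. \<forall>y\<in>A. c (x \<oplus>\<^bsub>G\<^esub> y) = c x + c y)"

text \<open>Freeness of finite rank, expressed as an additive embedding into Z^n. In this form the
  property visibly passes to subgroups, which is how the hereditarity of the integers enters; a
  basis is recovered in \<open>tff_coordinates\<close>.\<close>

definition tff :: "('a, 'x) ring_scheme \<Rightarrow> 'a set \<Rightarrow> bool" where
  "tff G A \<longleftrightarrow> (\<exists>n::nat. \<exists>c. (\<forall>j<n. int_hom G A (c j)) \<and> (\<forall>x\<in>A. (\<forall>j<n. c j x = 0) \<longrightarrow> x = \<zero>\<^bsub>G\<^esub>))"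

lemma int_hom_mono: "int_hom G A c \<Longrightarrow> B \<subseteq> A \<Longrightarrow> int_hom G B c"
  by (auto simp: int_hom_def)

lemma tff_mono:
  assumes "tff G A" "B \<subseteq> A" shows "tff G B"
proof -
  obtain n :: nat and c where c: "\<forall>j<n. int_hom G A (c j)" "\<forall>x\<in>A. (\<forall>j<n. c j x = 0) \<longrightarrow> x = \<zero>\<^bsub>G\<^esub>"
    using assms(1) unfolding tff_def by blast
  have "\<forall>j<n. int_hom G B (c j)" using c(1) int_hom_mono assms(2) by blast
  moreover have "\<forall>x\<in>B. (\<forall>j<n. c j x = 0) \<longrightarrow> x = \<zero>\<^bsub>G\<^esub>" using c(2) assms(2) by blast
  ultimately show ?thesis unfolding tff_def by blast
qed

lemma tff_zmod [simp]: "tff (zmod G A) B = tff G B"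
  by (simp add: tff_def int_hom_def)

lemma int_hom_int_pow:
  fixes G (structure)
  assumes "abelian_group G" "asub A G" "int_hom G A c" "x \<in> A"
  shows "c ([k] \<cdot> x) = k * c x"
proof -
  interpret abelian_group G by fact
  have z: "c \<zero> = 0"
  proof -
    have "c (\<zero> \<oplus> \<zero>) = c \<zero> + c \<zero>" using assms(2,3) unfolding asub_def int_hom_def by blast
    then show ?thesis by simp
  qed
  have A: "A \<subseteq> carrier G" "\<And>y. y \<in> A \<Longrightarrow> \<ominus> y \<in> A" using assms by (auto simp: asub_def)
  have n: "c (\<ominus> x) = - c x"
  proof -
    have "c (\<ominus> x \<oplus> x) = c (\<ominus> x) + c x" using assms(3,4) A(2) unfolding int_hom_def by blast
    moreover have "\<ominus> x \<oplus> x = \<zero>" using assms(4) A by (simp add: l_neg subsetD)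
    ultimately show ?thesis using z by simp
  qed
  show ?thesis
  proof (induction k rule: int_induct[where k = 0])
    case base then show ?case using z by (simp add: add_pow_def)
  next
    case (step1 i) then show ?case using A asub_int_pow[OF assms(1,2,4), of i] assms(3,4)
      by (simp add: int_pow_Suc subsetD int_hom_def distrib_right)
  next
    case (step2 i)
    have "[(i - 1)] \<cdot> x = [i] \<cdot> x \<oplus> \<ominus> x" using assms(4) A
      by (simp add: int_pow_Suc subsetD)
    then show ?case using step2 A asub_int_pow[OF assms(1,2,4), of i] assms(3,4) n
      by (simp add: int_hom_def left_diff_distrib)
  qed
qed

lemma int_hom_facts:
  fixes G (structure)
  assumes "abelian_group G" "asub A G" "int_hom G A c"
  shows "x \<in> A \<Longrightarrow> y \<in> A \<Longrightarrow> c (x \<oplus> y) = c x + c y" "c \<zero> = 0" "x \<in> A \<Longrightarrow> c (\<ominus> x) = - c x"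
proof -
  interpret abelian_group G by fact
  show "x \<in> A \<Longrightarrow> y \<in> A \<Longrightarrow> c (x \<oplus> y) = c x + c y" using assms by (simp add: int_hom_def)
  show "c \<zero> = 0" using int_hom_int_pow[OF assms, of "\<zero>" 0] assms(2) by (simp add: asub_def add_pow_def)
  show "x \<in> A \<Longrightarrow> c (\<ominus> x) = - c x"
    using int_hom_int_pow[OF assms, of x "-1"] assms(2) by (auto simp: asub_def add.int_pow_neg add.int_pow_1 subset_iff)
qed

lemma asub_ker:
  assumes "abelian_group G" "asub A G" "int_hom G A c" shows "asub {x \<in> A. c x = 0} G"
  using assms int_hom_facts[OF assms] by (auto simp: asub_def)

text \<open>The image of \<open>c\<close> is an ideal gZ, so \<open>A\<close> is the direct sum of
  the kernel of \<open>c\<close> and a cyclic group: \<open>x0\<close> has value g, and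
  \<open>k\<close> is \<open>c\<close> divided by g. If \<open>c\<close> vanishes on
  \<open>A\<close>, the cyclic summand and \<open>k\<close> are zero.\<close>

lemma cyclic_split:
  fixes G (structure)
  assumes G: "abelian_group G" and A: "asub A G" and c: "int_hom G A c"
  obtains x0 k where "x0 \<in> A" "int_hom G A k" "\<And>x. x \<in> A \<Longrightarrow> c (x \<oplus> \<ominus> ([k x] \<cdot> x0)) = 0"
    "\<And>x. x \<in> A \<Longrightarrow> c x = 0 \<Longrightarrow> k x = 0" "k x0 = 1 \<or> (\<forall>x\<in>A. k x = 0 \<and> c x = 0)"
proof -
  interpret abelian_group G by fact
  have AG: "A \<subseteq> carrier G" "\<zero> \<in> A" "\<And>x y. x \<in> A \<Longrightarrow> y \<in> A \<Longrightarrow> x \<oplus> y \<in> A" "\<And>x. x \<in> A \<Longrightarrow> \<ominus> x \<in> A"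
    using A by (auto simp: asub_def)
  note cf = int_hom_facts[OF assms] and cp = int_hom_int_pow[OF assms] and pc = asub_int_pow[OF G A]
  show ?thesis
  proof (cases "\<forall>x\<in>A. c x = 0")
    case True
    have "\<zero> \<oplus> \<zero> = \<zero>" by simp
    show ?thesis
      by (rule that[of "\<zero>" "\<lambda>_. 0"]) (use True AG pc in \<open>auto simp: int_hom_def\<close>)
  next
    case False
    then obtain y where y: "y \<in> A" "c y \<noteq> 0" by blast
    \<comment> \<open>The generator g of the image is found as the least positive value of
      \<open>c\<close>.\<close>
    let ?P = "\<lambda>n. n > 0 \<and> (\<exists>x\<in>A. c x = int n)"
    have "?P (nat \<bar>c y\<bar>)"
    proof (cases "c y > 0")
      case True then show ?thesis using y by (intro conjI bexI[of _ y]) auto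
    next
      case False then show ?thesis using y AG cf by (intro conjI bexI[of _ "\<ominus> y"]) auto
    qed
    then have P: "?P (LEAST n. ?P n)" by (rule LeastI)
    define g where "g = int (LEAST n. ?P n)"
    obtain x0 where x0: "x0 \<in> A" "c x0 = g" "g > 0" using P by (auto simp: g_def)
    have least: "g \<le> c x" if "x \<in> A" "c x > 0" for x
      using Least_le[of ?P "nat (c x)"] that unfolding g_def by force
    have dv: "g dvd c x" if x: "x \<in> A" for x
    proof -
      \<comment> \<open>Division with remainder: the value of \<open>c\<close> at \<open>?y\<close>
        is c x mod g, which is below g and hence cannot be positive.\<close>
      let ?y = "x \<oplus> \<ominus> ([(c x div g)] \<cdot> x0)"
      have "c ?y = c x mod g" using x x0 AG pc cf cp by (simp add: minus_div_mult_eq_mod)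
      moreover have "?y \<in> A" using x x0 AG pc by simp
      ultimately have "c x mod g > 0 \<Longrightarrow> g \<le> c x mod g"
        using least[of ?y] by (simp only:)
      then have "c x mod g = 0"
        using pos_mod_sign[OF x0(3), of "c x"] pos_mod_bound[OF x0(3), of "c x"] by linarith
      then show ?thesis by auto
    qed
    show ?thesis
    proof (rule that[of x0 "\<lambda>x. c x div g"])
      show "int_hom G A (\<lambda>x. c x div g)"
        unfolding int_hom_def
        by (simp add: cf(1) dv div_plus_div_distrib_dvd_left)
      show "c (x \<oplus> \<ominus> ([(c x div g)] \<cdot> x0)) = 0" if "x \<in> A" for x
        using that x0 AG pc cf cp dv[of x] by simp
    qed (use x0 in auto)
  qed
qed

text \<open>Projectivity, in a form that turns diagram chases into homomorphisms.\<close>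

lemma select:
  fixes G (structure)
  assumes G: "abelian_group G" and A: "asub A G" "tff G A"
    and Y1: "abelian_group Y1" and Y2: "abelian_group Y2"
    and dom: "\<And>x y z. \<lbrakk>x \<in> A; R x y z\<rbrakk> \<Longrightarrow> y \<in> carrier Y1 \<and> z \<in> carrier Y2"
    and tot: "\<And>x. x \<in> A \<Longrightarrow> \<exists>y z. R x y z"
    and add: "\<And>x y z x' y' z'. \<lbrakk>x \<in> A; x' \<in> A; R x y z; R x' y' z'\<rbrakk>
      \<Longrightarrow> R (x \<oplus> x') (y \<oplus>\<^bsub>Y1\<^esub> y') (z \<oplus>\<^bsub>Y2\<^esub> z')"
    and neg: "\<And>x y z. \<lbrakk>x \<in> A; R x y z\<rbrakk> \<Longrightarrow> R (\<ominus> x) (\<ominus>\<^bsub>Y1\<^esub> y) (\<ominus>\<^bsub>Y2\<^esub> z)"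
  obtains f g where "f \<in> ahom (zmod G A) Y1" "g \<in> ahom (zmod G A) Y2" "\<And>x. x \<in> A \<Longrightarrow> R x (f x) (g x)"
proof -
  interpret G: abelian_group G by fact
  interpret Y1: abelian_group Y1 by fact
  interpret Y2: abelian_group Y2 by fact
  have AG: "A \<subseteq> carrier G" "\<zero> \<in> A" "\<And>x y. x \<in> A \<Longrightarrow> y \<in> A \<Longrightarrow> x \<oplus> y \<in> A" "\<And>x. x \<in> A \<Longrightarrow> \<ominus> x \<in> A"
    using A by (auto simp: asub_def)
  obtain y0 z0 where "R \<zero> y0 z0" using tot AG by blast
  \<comment> \<open>A triple of the relation added to its own negative.\<close>
  then have R0: "R \<zero> \<zero>\<^bsub>Y1\<^esub> \<zero>\<^bsub>Y2\<^esub>"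
    using add[OF _ _ _ neg, of "\<zero>" "\<zero>" y0 z0 y0 z0] AG dom[of "\<zero>" y0 z0] by (simp add: G.r_neg Y1.r_neg Y2.r_neg)
  have pow: "R ([k] \<cdot> x) ([k] \<cdot>\<^bsub>Y1\<^esub> y) ([k] \<cdot>\<^bsub>Y2\<^esub> z)" if x: "x \<in> A" and R: "R x y z" for x y z and k :: int
  proof -
    have yz: "y \<in> carrier Y1" "z \<in> carrier Y2" "x \<in> carrier G" using dom x R AG by blast+
    note pc = asub_int_pow[OF G A(1) x]
    show ?thesis
    proof (induction k rule: int_induct[where k = 0])
      case base then show ?case using R0 by (simp add: add_pow_def)
    next
      case (step1 i) then show ?case using add[OF pc[of i] x step1(2) R] yz
        by (simp add: G.int_pow_Suc Y1.int_pow_Suc Y2.int_pow_Suc)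
    next
      case (step2 i)
      then show ?case using add[OF pc[of i] AG(4)[OF x] step2(2) neg[OF x R]] yz

        by (simp add: G.int_pow_Suc Y1.int_pow_Suc Y2.int_pow_Suc)
    qed
  qed
  obtain n :: nat and c where c: "\<forall>j<n. int_hom G A (c j)" "\<forall>x\<in>A. (\<forall>j<n. c j x = 0) \<longrightarrow> x = \<zero>"
    using A(2) by (auto simp: tff_def)
  \<comment> \<open>Induction on the number of coordinates, for all subgroups at once. Splitting off
    the last coordinate leaves its kernel, to which the induction hypothesis applies, and one
    generator, for which a single choice of values suffices.\<close>
  have "\<exists>f g. f \<in> ahom (zmod G B) Y1 \<and> g \<in> ahom (zmod G B) Y2 \<and> (\<forall>x\<in>B. R x (f x) (g x))"
    if "asub B G" "B \<subseteq> A" "\<forall>x\<in>B. (\<forall>j<n. c j x = 0) \<longrightarrow> x = \<zero>" "\<forall>j<n. int_hom G B (c j)" for B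
    using that
  proof (induction n arbitrary: B)
    case 0
    then have B: "B = {\<zero>}" by (auto simp: asub_def)
    show ?case unfolding B
      by (intro exI[of _ "\<lambda>x\<in>{\<zero>}. \<zero>\<^bsub>Y1\<^esub>"] exI[of _ "\<lambda>x\<in>{\<zero>}. \<zero>\<^bsub>Y2\<^esub>"] conjI ahomI) (auto simp: R0 extensional_def)
  next
    case (Suc n)
    have cn: "int_hom G B (c n)" using Suc.prems by simp
    obtain x0 k where k: "x0 \<in> B" "int_hom G B k"
      "\<And>x. x \<in> B \<Longrightarrow> c n (x \<oplus> \<ominus> ([k x] \<cdot> x0)) = 0"
      by (rule cyclic_split[OF G Suc.prems(1) cn]) blast
    let ?K = "{x \<in> B. c n x = 0}"
    have sK: "asub ?K G" by (rule asub_ker[OF G Suc.prems(1) cn])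
    have BG: "B \<subseteq> carrier G" "\<And>x y. x \<in> B \<Longrightarrow> y \<in> B \<Longrightarrow> x \<oplus> y \<in> B" "\<And>x. x \<in> B \<Longrightarrow> \<ominus> x \<in> B"
      "\<And>(i::int) x. x \<in> B \<Longrightarrow> [i] \<cdot> x \<in> B"
      using Suc.prems(1) asub_int_pow[OF G Suc.prems(1)] by (auto simp: asub_def)
    have "\<exists>f g. f \<in> ahom (zmod G ?K) Y1 \<and> g \<in> ahom (zmod G ?K) Y2 \<and> (\<forall>x\<in>?K. R x (f x) (g x))"
      using sK Suc.prems by (intro Suc.IH) (auto simp: less_Suc_eq int_hom_def)
    then obtain f g where f: "f \<in> ahom (zmod G ?K) Y1" and g: "g \<in> ahom (zmod G ?K) Y2"
      and R: "\<And>x. x \<in> ?K \<Longrightarrow> R x (f x) (g x)" by blast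
    obtain y0 z0 where yz: "R x0 y0 z0" using tot k Suc.prems by blast
    have yz': "y0 \<in> carrier Y1" "z0 \<in> carrier Y2" "x0 \<in> carrier G" using dom yz k Suc.prems AG by blast+
    \<comment> \<open>The projection onto the kernel of the last coordinate along the generator
      \<open>x0\<close>.\<close>
    define r where "r x = x \<oplus> \<ominus> ([k x] \<cdot> x0)" for x
    have rK: "r x \<in> ?K" if "x \<in> B" for x using k BG that by (auto simp: r_def)
    have radd: "r (x \<oplus> y) = r x \<oplus> r y" if "x \<in> B" "y \<in> B" for x y
      using that BG k yz' unfolding r_def
      by (simp add: int_hom_def subsetD G.add.int_pow_mult G.minus_add G.a_ac)
    let ?f = "\<lambda>x\<in>B. f (r x) \<oplus>\<^bsub>Y1\<^esub> [k x] \<cdot>\<^bsub>Y1\<^esub> y0" and ?g = "\<lambda>x\<in>B. g (r x) \<oplus>\<^bsub>Y2\<^esub> [k x] \<cdot>\<^bsub>Y2\<^esub> z0"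
    have fc: "f (r x) \<in> carrier Y1" "g (r x) \<in> carrier Y2" if "x \<in> B" for x
      using rK[OF that] ahom_closed[OF f] ahom_closed[OF g] by simp_all
    have fr: "f (r (x \<oplus> y)) = f (r x) \<oplus>\<^bsub>Y1\<^esub> f (r y)" "g (r (x \<oplus> y)) = g (r x) \<oplus>\<^bsub>Y2\<^esub> g (r y)"
      if "x \<in> B" "y \<in> B" for x y
      using radd[OF that] rK that ahom_add[OF f, of "r x" "r y"] ahom_add[OF g, of "r x" "r y"] by simp_all
    have 1: "?f \<in> ahom (zmod G B) Y1"
      by (rule ahomI) (use fc fr BG k yz' in \<open>auto simp: int_hom_def Y1.add.int_pow_mult Y1.a_ac\<close>)
    have 2: "?g \<in> ahom (zmod G B) Y2"
      by (rule ahomI) (use fc fr BG k yz' in \<open>auto simp: int_hom_def Y2.add.int_pow_mult Y2.a_ac\<close>)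
    have 3: "R x (?f x) (?g x)" if x: "x \<in> B" for x
    proof -
      have "R (r x \<oplus> [k x] \<cdot> x0) (f (r x) \<oplus>\<^bsub>Y1\<^esub> [k x] \<cdot>\<^bsub>Y1\<^esub> y0) (g (r x) \<oplus>\<^bsub>Y2\<^esub> [k x] \<cdot>\<^bsub>Y2\<^esub> z0)"
        using add[OF _ _ R[OF rK[OF x]] pow[OF _ yz]] rK[OF x] k(1) Suc.prems(2) BG by (simp add: subset_iff)
      moreover have "r x \<oplus> [k x] \<cdot> x0 = x"
        using x BG yz' unfolding r_def by (simp add: subsetD G.a_assoc G.l_neg)
      ultimately show ?thesis using x by simp
    qed
    show ?case using 1 2 3 by blast
  qed
  from this[OF A(1) subset_refl] c show ?thesis using that by blast
qed

text \<open>A subgroup of Z^n is free, and the maps \<open>b\<close> are the coordinate functions of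
  a basis. As in \<open>select\<close> the given coordinates are split off one at a time; one that
  vanishes on what is left contributes no basis element.\<close>

lemma tff_coordinates:
  fixes G (structure)
  assumes G: "abelian_group G" and A: "asub A G" "tff G A"
  obtains r :: nat and b where "\<And>j. j < r \<Longrightarrow> int_hom G A (b j)"
    "\<And>v. \<exists>!x. x \<in> A \<and> (\<forall>j<r. b j x = v j)"
proof -
  interpret G: abelian_group G by fact
  obtain n :: nat and c where c: "\<forall>j<n. int_hom G A (c j)" "\<forall>x\<in>A. (\<forall>j<n. c j x = 0) \<longrightarrow> x = \<zero>"
    using A(2) by (auto simp: tff_def)
  have "\<exists>(r::nat) b. (\<forall>j<r. int_hom G B (b j)) \<and> (\<forall>v. \<exists>!x. x \<in> B \<and> (\<forall>j<r. b j x = v j))"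
    if "asub B G" "\<forall>x\<in>B. (\<forall>j<n. c j x = 0) \<longrightarrow> x = \<zero>" "\<forall>j<n. int_hom G B (c j)" for B
    using that
  proof (induction n arbitrary: B)
    case 0
    then have B: "B = {\<zero>}" by (auto simp: asub_def)
    show ?case unfolding B by (intro exI[of _ 0]) simp
  next
    case (Suc n)
    have cn: "int_hom G B (c n)" using Suc.prems by simp
    obtain x0 k where k: "x0 \<in> B" "int_hom G B k"
      "\<And>x. x \<in> B \<Longrightarrow> c n (x \<oplus> \<ominus> ([k x] \<cdot> x0)) = 0"
      "\<And>x. x \<in> B \<Longrightarrow> c n x = 0 \<Longrightarrow> k x = 0" "k x0 = 1 \<or> (\<forall>x\<in>B. k x = 0 \<and> c n x = 0)"
      by (rule cyclic_split[OF G Suc.prems(1) cn]) blast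
    let ?K = "{x \<in> B. c n x = 0}"
    have sK: "asub ?K G" by (rule asub_ker[OF G Suc.prems(1) cn])
    have BG: "B \<subseteq> carrier G" "\<And>x y. x \<in> B \<Longrightarrow> y \<in> B \<Longrightarrow> x \<oplus> y \<in> B" "\<And>x. x \<in> B \<Longrightarrow> \<ominus> x \<in> B"
      "\<And>(i::int) x. x \<in> B \<Longrightarrow> [i] \<cdot> x \<in> B"
      using Suc.prems(1) asub_int_pow[OF G Suc.prems(1)] by (auto simp: asub_def)
    have "\<exists>(r::nat) b. (\<forall>j<r. int_hom G ?K (b j)) \<and> (\<forall>v. \<exists>!x. x \<in> ?K \<and> (\<forall>j<r. b j x = v j))"
      using sK Suc.prems by (intro Suc.IH) (auto simp: less_Suc_eq int_hom_def)
    then obtain r :: nat and b where b: "\<And>j. j < r \<Longrightarrow> int_hom G ?K (b j)"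
      "\<And>v. \<exists>!x. x \<in> ?K \<and> (\<forall>j<r. b j x = v j)" by blast
    show ?case
    proof (cases "\<forall>x\<in>B. k x = 0 \<and> c n x = 0")
      case True
      then have "?K = B" by auto
      then show ?thesis using b by auto
    next
      case False
      then have k1: "k x0 = 1" using k by blast
      define \<rho> where "\<rho> x = x \<oplus> \<ominus> ([k x] \<cdot> x0)" for x
      have x0: "x0 \<in> carrier G" using k BG by auto
      have rK: "\<rho> x \<in> ?K" if "x \<in> B" for x using k BG that by (auto simp: \<rho>_def)
      have radd: "\<rho> (x \<oplus> y) = \<rho> x \<oplus> \<rho> y" if "x \<in> B" "y \<in> B" for x y
        using that BG k x0 unfolding \<rho>_def
        by (simp add: int_hom_def subsetD G.add.int_pow_mult G.minus_add G.a_ac)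
      have rx: "\<rho> x \<oplus> [k x] \<cdot> x0 = x" if "x \<in> B" for x
        using that BG x0 unfolding \<rho>_def by (simp add: subsetD G.a_assoc G.l_neg)
      \<comment> \<open>The old coordinates are evaluated on the kernel part, and \<open>k\<close>
        becomes the new coordinate with index \<open>r\<close>.\<close>
      define b' where "b' j x = (if j < r then b j (\<rho> x) else k x)" for j x
      have "int_hom G B (b' j)" for j
        unfolding int_hom_def
      proof (intro ballI)
        fix x y assume xy: "x \<in> B" "y \<in> B"
        show "b' j (x \<oplus> y) = b' j x + b' j y"
        proof (cases "j < r")
          case True
          then show ?thesis
            using b(1)[OF True] rK[OF xy(1)] rK[OF xy(2)] radd[OF xy] by (simp add: b'_def int_hom_def)
        next
          case False then show ?thesis using k(2) xy by (simp add: b'_def int_hom_def)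
        qed
      qed
      moreover have "\<exists>!x. x \<in> B \<and> (\<forall>j<Suc r. b' j x = v j)" for v
      proof -
        obtain y where y: "y \<in> ?K" "\<forall>j<r. b j y = v j" and u: "\<And>y'. y' \<in> ?K \<Longrightarrow> \<forall>j<r. b j y' = v j \<Longrightarrow> y' = y"
          using b(2)[of v] by blast
        let ?x = "y \<oplus> [v r] \<cdot> x0"
        have xB: "?x \<in> B" using y BG k by simp
        have kx: "k ?x = v r"
          using y k BG int_hom_int_pow[OF G Suc.prems(1) k(2) k(1)] k1 by (simp add: int_hom_def)
        have "\<rho> ?x = y" using y x0 BG unfolding \<rho>_def kx by (simp add: subsetD G.a_assoc G.r_neg)
        then have "?x \<in> B \<and> (\<forall>j<Suc r. b' j ?x = v j)" using xB kx y by (simp add: b'_def less_Suc_eq)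
        moreover have "x' = ?x" if "x' \<in> B \<and> (\<forall>j<Suc r. b' j x' = v j)" for x'
        proof -
          have "k x' = v r" using that by (auto simp: b'_def dest: spec[of _ r])
          moreover have "\<rho> x' = y" using that by (intro u rK) (auto simp: b'_def less_Suc_eq)
          ultimately show ?thesis using rx[of x'] that by simp
        qed
        ultimately show ?thesis by blast
      qed
      ultimately show ?thesis by blast
    qed
  qed
  from this[OF A(1) c(2,1)]
  obtain r :: nat and b where b: "\<forall>j<r. int_hom G A (b j)" "\<forall>v. \<exists>!x. x \<in> A \<and> (\<forall>j<r. b j x = v j)"
    by (elim exE conjE)
  show ?thesis by (rule that[of r b]) (use b in simp_all)
qed

text \<open>The image of \<open>D\<close> is free, so \<open>D\<close> splits over it and
  \<open>G\<close> is the kernel plus a copy of the image. The relation can be solved on that copy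
  independently of the solution prescribed on the kernel. In the applications \<open>D\<close> is a
  differential and the kernel consists of the cocycles.\<close>

lemma select_extend:
  fixes G (structure)
  assumes G: "abelian_group G" and tG: "tff G (carrier G)" and H: "abelian_group H"
    and D: "D \<in> ahom G H" and tH: "tff H (D ` carrier G)"
    and Y1: "abelian_group Y1" and Y2: "abelian_group Y2"
    and f0: "f0 \<in> ahom (zmod G {x \<in> carrier G. D x = \<zero>\<^bsub>H\<^esub>}) Y1"
    and g0: "g0 \<in> ahom (zmod G {x \<in> carrier G. D x = \<zero>\<^bsub>H\<^esub>}) Y2"
    and R0: "\<And>x. \<lbrakk>x \<in> carrier G; D x = \<zero>\<^bsub>H\<^esub>\<rbrakk> \<Longrightarrow> R x (f0 x) (g0 x)"
    and dom: "\<And>x y z. \<lbrakk>x \<in> carrier G; R x y z\<rbrakk> \<Longrightarrow> y \<in> carrier Y1 \<and> z \<in> carrier Y2"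
    and tot: "\<And>x. x \<in> carrier G \<Longrightarrow> \<exists>y z. R x y z"
    and add: "\<And>x y z x' y' z'. \<lbrakk>x \<in> carrier G; x' \<in> carrier G; R x y z; R x' y' z'\<rbrakk>
      \<Longrightarrow> R (x \<oplus> x') (y \<oplus>\<^bsub>Y1\<^esub> y') (z \<oplus>\<^bsub>Y2\<^esub> z')"
    and neg: "\<And>x y z. \<lbrakk>x \<in> carrier G; R x y z\<rbrakk> \<Longrightarrow> R (\<ominus> x) (\<ominus>\<^bsub>Y1\<^esub> y) (\<ominus>\<^bsub>Y2\<^esub> z)"
  obtains f g where "f \<in> ahom G Y1" "g \<in> ahom G Y2" "\<And>x. x \<in> carrier G \<Longrightarrow> R x (f x) (g x)"
    "\<And>x. \<lbrakk>x \<in> carrier G; D x = \<zero>\<^bsub>H\<^esub>\<rbrakk> \<Longrightarrow> f x = f0 x \<and> g x = g0 x"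
proof -
  interpret G: abelian_group G by fact
  interpret H: abelian_group H by fact
  interpret Y1: abelian_group Y1 by fact
  interpret Y2: abelian_group Y2 by fact
  let ?B = "D ` carrier G" and ?K = "{x \<in> carrier G. D x = \<zero>\<^bsub>H\<^esub>}"
  note Dc = ahom_closed[OF D] and Da = ahom_add[OF D] and Dn = ahom_neg[OF D G H] and Dz = ahom_zero[OF D G H]
  have B: "asub ?B H"
    unfolding asub_def
  proof (intro conjI ballI)
    show "?B \<subseteq> carrier H" using Dc by auto
    show "\<zero>\<^bsub>H\<^esub> \<in> ?B" using imageI[OF G.zero_closed, of D] Dz by simp
  next
    fix x y assume "x \<in> ?B" "y \<in> ?B"
    then obtain a b where "a \<in> carrier G" "b \<in> carrier G" "x = D a" "y = D b" by blast
    then show "x \<oplus>\<^bsub>H\<^esub> y \<in> ?B" by (intro image_eqI[of _ _ "a \<oplus> b"]) (simp_all add: Da)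
  next
    fix x assume "x \<in> ?B"
    then obtain a where "a \<in> carrier G" "x = D a" by blast
    then show "\<ominus>\<^bsub>H\<^esub> x \<in> ?B" by (intro image_eqI[of _ _ "\<ominus> a"]) (simp_all add: Dn)
  qed
  have K: "asub ?K G" using Da Dn Dz by (auto simp: asub_def)
  \<comment> \<open>An additive section of \<open>D\<close> over its image, again by
    \<open>select\<close>.\<close>
  obtain \<sigma> \<tau> where \<sigma>: "\<sigma> \<in> ahom (zmod H ?B) G" and "\<tau> \<in> ahom (zmod H ?B) G"
    and D\<sigma>: "\<And>k. k \<in> ?B \<Longrightarrow> D (\<sigma> k) = k"
  proof (rule select[OF H B tH G G, where R = "\<lambda>k x z. x \<in> carrier G \<and> z \<in> carrier G \<and> D x = k"])
    fix k assume "k \<in> ?B"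
    then obtain a where "a \<in> carrier G" "k = D a" by blast
    then show "\<exists>y z. y \<in> carrier G \<and> z \<in> carrier G \<and> D y = k" by blast
  next
    fix k y z assume "y \<in> carrier G \<and> z \<in> carrier G \<and> D y = k"
    then show "\<ominus> y \<in> carrier G \<and> \<ominus> z \<in> carrier G \<and> D (\<ominus> y) = \<ominus>\<^bsub>H\<^esub> k" using Dn by simp
  next
    fix x y z x' y' z' assume "y \<in> carrier G \<and> z \<in> carrier G \<and> D y = x" "y' \<in> carrier G \<and> z' \<in> carrier G \<and> D y' = x'"
    then show "y \<oplus> y' \<in> carrier G \<and> z \<oplus> z' \<in> carrier G \<and> D (y \<oplus> y') = x \<oplus>\<^bsub>H\<^esub> x'" using Da by simp
  next
    fix f g assume "f \<in> ahom (zmod H ?B) G" "g \<in> ahom (zmod H ?B) G"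
      "\<And>k. k \<in> ?B \<Longrightarrow> f k \<in> carrier G \<and> g k \<in> carrier G \<and> D (f k) = k"
    then show thesis using that by blast
  qed blast
  note \<sigma>c = ahom_closed[OF \<sigma>, simplified] and \<sigma>a = ahom_add[OF \<sigma>, simplified]
  \<comment> \<open>The relation is solved on the complement of the kernel, transported to the image
    of \<open>D\<close> by \<sigma>.\<close>
  obtain f1 g1 where f1: "f1 \<in> ahom (zmod H ?B) Y1" and g1: "g1 \<in> ahom (zmod H ?B) Y2"
    and R1: "\<And>k. k \<in> ?B \<Longrightarrow> R (\<sigma> k) (f1 k) (g1 k)"
  proof (rule select[OF H B tH Y1 Y2, where R = "\<lambda>k. R (\<sigma> k)"])
    fix k y z assume "k \<in> ?B" "R (\<sigma> k) y z"
    then show "R (\<sigma> (\<ominus>\<^bsub>H\<^esub> k)) (\<ominus>\<^bsub>Y1\<^esub> y) (\<ominus>\<^bsub>Y2\<^esub> z)"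
      using neg[of "\<sigma> k" y z] \<sigma>c[of k] ahom_neg[OF \<sigma> abelian_group_zmod[OF H B] G, of k] a_inv_zmod[OF H B, of k] by simp
  next
    fix x y z x' y' z' assume "x \<in> ?B" "x' \<in> ?B" "R (\<sigma> x) y z" "R (\<sigma> x') y' z'"
    then show "R (\<sigma> (x \<oplus>\<^bsub>H\<^esub> x')) (y \<oplus>\<^bsub>Y1\<^esub> y') (z \<oplus>\<^bsub>Y2\<^esub> z')"
      using \<sigma>a[of x x'] add \<sigma>c by simp
  next
    fix x y z assume "x \<in> ?B" "R (\<sigma> x) y z"
    then show "y \<in> carrier Y1 \<and> z \<in> carrier Y2" using dom[of "\<sigma> x" y z] \<sigma>c[of x] by simp
  next
    fix x assume "x \<in> ?B"
    then show "\<exists>y z. R (\<sigma> x) y z" using tot[of "\<sigma> x"] \<sigma>c[of x] by simp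
  next
    fix f g assume "f \<in> ahom (zmod H ?B) Y1" "g \<in> ahom (zmod H ?B) Y2" "\<And>k. k \<in> ?B \<Longrightarrow> R (\<sigma> k) (f k) (g k)"
    then show thesis by (rule that)
  qed
  \<comment> \<open>The projection onto the kernel that belongs to the section \<sigma>.\<close>
  define r where "r x = x \<oplus> \<ominus> \<sigma> (D x)" for x
  have s: "\<sigma> (D x) \<in> carrier G" if "x \<in> carrier G" for x using \<sigma>c that by simp
  have rK: "r x \<in> ?K" if x: "x \<in> carrier G" for x
    using s[OF x] x D\<sigma>[of "D x"] Dc[OF x] by (simp add: r_def Da Dn H.r_neg)
  have radd: "r (x \<oplus> y) = r x \<oplus> r y" if "x \<in> carrier G" "y \<in> carrier G" for x y
    using that s by (simp add: r_def Da \<sigma>a G.minus_add G.a_ac)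
  have rx: "r x \<oplus> \<sigma> (D x) = x" if "x \<in> carrier G" for x
    using that s by (simp add: r_def G.a_assoc G.l_neg)
  define f where "f = (\<lambda>x\<in>carrier G. f0 (r x) \<oplus>\<^bsub>Y1\<^esub> f1 (D x))"
  define g where "g = (\<lambda>x\<in>carrier G. g0 (r x) \<oplus>\<^bsub>Y2\<^esub> g1 (D x))"
  have cl: "f0 (r x) \<in> carrier Y1" "g0 (r x) \<in> carrier Y2" "f1 (D x) \<in> carrier Y1" "g1 (D x) \<in> carrier Y2"
    if "x \<in> carrier G" for x
    using rK[OF that] ahom_closed[OF f0] ahom_closed[OF g0] ahom_closed[OF f1] ahom_closed[OF g1] that by simp_all
  have ad: "f0 (r (x \<oplus> y)) = f0 (r x) \<oplus>\<^bsub>Y1\<^esub> f0 (r y)" "g0 (r (x \<oplus> y)) = g0 (r x) \<oplus>\<^bsub>Y2\<^esub> g0 (r y)"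
    "f1 (D (x \<oplus> y)) = f1 (D x) \<oplus>\<^bsub>Y1\<^esub> f1 (D y)" "g1 (D (x \<oplus> y)) = g1 (D x) \<oplus>\<^bsub>Y2\<^esub> g1 (D y)"
    if "x \<in> carrier G" "y \<in> carrier G" for x y
    using that rK[of x] rK[of y] ahom_add[OF f0, of "r x" "r y"] ahom_add[OF g0, of "r x" "r y"]
      ahom_add[OF f1, of "D x" "D y"] ahom_add[OF g1, of "D x" "D y"] by (simp_all add: radd Da)
  show ?thesis
  proof (rule that)
    show "f \<in> ahom G Y1" unfolding f_def
      by (rule ahom_restrictI[OF G]) (simp_all add: cl ad Y1.a_ac)
    show "g \<in> ahom G Y2" unfolding g_def
      by (rule ahom_restrictI[OF G]) (simp_all add: cl ad Y2.a_ac)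
    show "R x (f x) (g x)" if x: "x \<in> carrier G" for x
    proof -
      have "R (r x \<oplus> \<sigma> (D x)) (f0 (r x) \<oplus>\<^bsub>Y1\<^esub> f1 (D x)) (g0 (r x) \<oplus>\<^bsub>Y2\<^esub> g1 (D x))"
        by (rule add) (use rK[OF x] s[OF x] x R0[of "r x"] R1[of "D x"] in simp_all)
      then show ?thesis unfolding rx[OF x] using x by (simp add: f_def g_def)
    qed
    show "f x = f0 x \<and> g x = g0 x" if x: "x \<in> carrier G" "D x = \<zero>\<^bsub>H\<^esub>" for x
    proof -
      have z: "\<sigma> \<zero>\<^bsub>H\<^esub> = \<zero>" "f1 \<zero>\<^bsub>H\<^esub> = \<zero>\<^bsub>Y1\<^esub>" "g1 \<zero>\<^bsub>H\<^esub> = \<zero>\<^bsub>Y2\<^esub>"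
        using ahom_zero[OF \<sigma> abelian_group_zmod[OF H B] G] ahom_zero[OF f1 abelian_group_zmod[OF H B] Y1]
          ahom_zero[OF g1 abelian_group_zmod[OF H B] Y2] by simp_all
      have "r x = x" using x z by (simp add: r_def)
      then show ?thesis using x z cl[OF x(1)] by (simp add: f_def g_def)
    qed
  qed
qed

section \<open>Countable groups and their copies in the universe type\<close>

lemma countable_tff:
  assumes G: "abelian_group G" and A: "asub A G" "tff G A" shows "countable A"
proof (rule tff_coordinates[OF assms])
  fix r :: nat and b :: "nat \<Rightarrow> 'a \<Rightarrow> int" assume b: "\<And>v. \<exists>!x. x \<in> A \<and> (\<forall>j<r. b j x = v j)"
  have "inj_on (\<lambda>x. map (\<lambda>j. b j x) [0..<r]) A"
  proof (rule inj_onI)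
    fix x y assume "x \<in> A" "y \<in> A" "map (\<lambda>j. b j x) [0..<r] = map (\<lambda>j. b j y) [0..<r]"
    moreover from this(3) have "\<forall>j<r. b j y = b j x" by (simp add: map_eq_conv)
    ultimately show "x = y" using b[of "\<lambda>j. b j x"] by blast
  qed
  then show ?thesis by (rule countableI')
qed

lemma ex_inj_on_infinite:
  assumes "countable (S :: 'b set)" shows "\<exists>e :: 'b \<Rightarrow> 'a::infinite. inj_on e S"
proof -
  obtain f :: "nat \<Rightarrow> 'a" where f: "inj f" using infinite_countable_subset[OF infinite_UNIV] by blast
  have "inj_on (f \<circ> to_nat_on S) S"
    by (rule comp_inj_on[OF inj_on_to_nat_on[OF assms] inj_on_subset[OF f]]) simp
  then show ?thesis by blast
qed

text \<open>The copy of \<open>M\<close> along a map that is injective on its carrier. Modules built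
  on pairs or families are brought into \<open>'a\<close> in this way.\<close>

definition transport :: "('b \<Rightarrow> 'a) \<Rightarrow> ('r, 'b) module \<Rightarrow> ('r, 'a) module" where
  "transport e M = (let i = inv_into (carrier M) e in
     \<lparr>carrier = e ` carrier M, mult = undefined, one = undefined, zero = e \<zero>\<^bsub>M\<^esub>,
      add = (\<lambda>x y. e (i x \<oplus>\<^bsub>M\<^esub> i y)), smult = (\<lambda>a x. e (a \<odot>\<^bsub>M\<^esub> i x))\<rparr>)"

lemma transport_simps:
  assumes "inj_on e (carrier M)"
  shows "carrier (transport e M) = e ` carrier M" "\<zero>\<^bsub>transport e M\<^esub> = e \<zero>\<^bsub>M\<^esub>"
    and "\<lbrakk>x \<in> carrier M; y \<in> carrier M\<rbrakk> \<Longrightarrow> e x \<oplus>\<^bsub>transport e M\<^esub> e y = e (x \<oplus>\<^bsub>M\<^esub> y)"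
    and "x \<in> carrier M \<Longrightarrow> a \<odot>\<^bsub>transport e M\<^esub> e x = e (a \<odot>\<^bsub>M\<^esub> x)"
  using assms by (simp_all add: transport_def Let_def)

lemma module_transport:
  assumes M: "module R M" and e: "inj_on e (carrier M)"
  shows "module R (transport e M)"
proof -
  interpret module R M by fact
  note t = transport_simps[OF e]
  have "abelian_group (transport e M)"
  proof (rule abelian_groupI)
    fix x assume "x \<in> carrier (transport e M)"
    then obtain a where a: "a \<in> carrier M" "x = e a" by (auto simp: t)
    then have "e (\<ominus>\<^bsub>M\<^esub> a) \<oplus>\<^bsub>transport e M\<^esub> x = \<zero>\<^bsub>transport e M\<^esub>" by (simp add: t M.l_neg)
    then show "\<exists>y\<in>carrier (transport e M). y \<oplus>\<^bsub>transport e M\<^esub> x = \<zero>\<^bsub>transport e M\<^esub>"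
      using a by (intro bexI[of _ "e (\<ominus>\<^bsub>M\<^esub> a)"]) (simp_all add: t)
  qed (auto simp: t M.a_ac)
  then show ?thesis
    by (intro moduleI R.is_cring) (auto simp: t smult_l_distr smult_r_distr smult_assoc1)
qed

section \<open>Modules as preadditive categories\<close>

lemma mod_homI:
  assumes "f \<in> ahom M N" "\<And>a x. \<lbrakk>a \<in> carrier R; x \<in> carrier M\<rbrakk> \<Longrightarrow> f (a \<odot>\<^bsub>M\<^esub> x) = a \<odot>\<^bsub>N\<^esub> f x"
  shows "f \<in> mod_hom R M N"
  using assms by (simp add: mod_hom_def ahom_def)

lemma mod_hom_ahom: "f \<in> mod_hom R M N \<Longrightarrow> f \<in> ahom M N"
  by (simp add: mod_hom_def ahom_def)

lemma mod_hom_smult: "\<lbrakk>f \<in> mod_hom R M N; a \<in> carrier R; x \<in> carrier M\<rbrakk> \<Longrightarrow> f (a \<odot>\<^bsub>M\<^esub> x) = a \<odot>\<^bsub>N\<^esub> f x"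
  by (simp add: mod_hom_def)

lemma mod_hom_compose:
  assumes "f \<in> mod_hom R L M" "g \<in> mod_hom R M N" "module R L"
  shows "compose (carrier L) g f \<in> mod_hom R L N"
proof -
  interpret L: module R L by fact
  note f = mod_hom_ahom[OF assms(1)] and g = mod_hom_ahom[OF assms(2)]
  show ?thesis
  proof (rule mod_homI)
    show "compose (carrier L) g f \<in> ahom L N" by (rule ahom_compose[OF f g L.abelian_group_axioms])
    fix a x assume "a \<in> carrier R" "x \<in> carrier L"
    then show "compose (carrier L) g f (a \<odot>\<^bsub>L\<^esub> x) = a \<odot>\<^bsub>N\<^esub> compose (carrier L) g f x"
      by (simp add: compose_def mod_hom_smult[OF assms(1)] mod_hom_smult[OF assms(2)] ahom_closed[OF f])
  qed
qed

context
  fixes R :: "('r, 'k) ring_scheme" assumes R: "cring R"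
begin

lemma mod_hom_zero:
  assumes "module R M" "module R N" shows "(\<lambda>x\<in>carrier M. \<zero>\<^bsub>N\<^esub>) \<in> mod_hom R M N"
proof -
  interpret M: module R M by fact
  interpret N: module R N by fact
  show ?thesis by (auto simp: mod_hom_def)
qed

lemma mod_hom_add:
  assumes "module R M" "module R N" "f \<in> mod_hom R M N" "g \<in> mod_hom R M N"
  shows "(\<lambda>x\<in>carrier M. f x \<oplus>\<^bsub>N\<^esub> g x) \<in> mod_hom R M N"
proof -
  interpret M: module R M by fact
  interpret N: module R N by fact
  note f = mod_hom_ahom[OF assms(3)] mod_hom_smult[OF assms(3)]
  note g = mod_hom_ahom[OF assms(4)] mod_hom_smult[OF assms(4)]
  show ?thesis
  proof (rule mod_homI)
    show "(\<lambda>x\<in>carrier M. f x \<oplus>\<^bsub>N\<^esub> g x) \<in> ahom M N"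
      by (rule ahom_restrictI[OF M.abelian_group_axioms])
        (simp_all add: ahom_closed[OF f(1)] ahom_closed[OF g(1)] ahom_add[OF f(1)] ahom_add[OF g(1)] N.a_ac)
  qed (simp add: f(2) g(2) N.smult_r_distr ahom_closed[OF f(1)] ahom_closed[OF g(1)])
qed

lemma mod_hom_neg:
  assumes "module R M" "module R N" "f \<in> mod_hom R M N"
  shows "(\<lambda>x\<in>carrier M. \<ominus>\<^bsub>N\<^esub> f x) \<in> mod_hom R M N"
proof -
  interpret M: module R M by fact
  interpret N: module R N by fact
  note f = mod_hom_ahom[OF assms(3)] mod_hom_smult[OF assms(3)]
  show ?thesis
  proof (rule mod_homI)
    show "(\<lambda>x\<in>carrier M. \<ominus>\<^bsub>N\<^esub> f x) \<in> ahom M N"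
      by (rule ahom_restrictI[OF M.abelian_group_axioms])
        (simp_all add: ahom_closed[OF f(1)] ahom_add[OF f(1)] N.minus_add)
  qed (simp add: f(2) N.smult_r_minus ahom_closed[OF f(1)])
qed

lemma mod_hom_eqI:
  assumes "f \<in> mod_hom R M N" "g \<in> mod_hom R M N'" "\<And>x. x \<in> carrier M \<Longrightarrow> f x = g x"
  shows "f = g"
  using ahom_eqI[OF mod_hom_ahom[OF assms(1)] mod_hom_ahom[OF assms(2)]] assms(3) .

lemma abelian_group_mod_hom:
  assumes M: "module R M" and N: "module R N"
  shows "abelian_group \<lparr>carrier = mod_hom R M N, mult = undefined, one = undefined,
                    zero = (\<lambda>x\<in>carrier M. \<zero>\<^bsub>N\<^esub>),
                    add = (\<lambda>f g. \<lambda>x\<in>carrier M. f x \<oplus>\<^bsub>N\<^esub> g x)\<rparr>" (is "abelian_group ?H")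
proof -
  interpret M: module R M by fact
  interpret N: module R N by fact
  note cl = ahom_closed[OF mod_hom_ahom]
  note ext = ahom_extensional[OF mod_hom_ahom]
  show ?thesis
  proof (rule abelian_groupI)
    fix f assume "f \<in> carrier ?H"
    then have f: "f \<in> mod_hom R M N" by simp
    then show "\<exists>g\<in>carrier ?H. g \<oplus>\<^bsub>?H\<^esub> f = \<zero>\<^bsub>?H\<^esub>"
      using mod_hom_neg[OF M N f]
      by (intro bexI[of _ "\<lambda>x\<in>carrier M. \<ominus>\<^bsub>N\<^esub> f x"]) (auto intro!: restrict_ext simp: N.l_neg cl)
    show "\<zero>\<^bsub>?H\<^esub> \<oplus>\<^bsub>?H\<^esub> f = f"
      using f ext[OF f] by (auto intro!: extensionalityI[of _ "carrier M"] simp: cl)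
  next
    fix f g h assume "f \<in> carrier ?H" "g \<in> carrier ?H" "h \<in> carrier ?H"
    then show "f \<oplus>\<^bsub>?H\<^esub> g \<oplus>\<^bsub>?H\<^esub> h = f \<oplus>\<^bsub>?H\<^esub> (g \<oplus>\<^bsub>?H\<^esub> h)"
      by (auto intro!: restrict_ext simp: N.a_assoc cl)
  next
    fix f g assume "f \<in> carrier ?H" "g \<in> carrier ?H"
    then show "f \<oplus>\<^bsub>?H\<^esub> g = g \<oplus>\<^bsub>?H\<^esub> f" by (auto intro!: restrict_ext simp: N.a_comm cl)
  qed (simp_all add: mod_hom_add[OF M N] mod_hom_zero[OF M N])
qed

lemma fg_module_module: "fg_module R M \<Longrightarrow> module R M"
  by (simp add: fg_module_def)

lemma preadditive_mod_cat: "preadditive (mod_cat R :: (('r, 'a) module, 'a \<Rightarrow> 'a) precat)"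
proof (intro preadditive.intro category.intro preadditive_axioms.intro)
  note cl = ahom_closed[OF mod_hom_ahom] and ad = ahom_add[OF mod_hom_ahom]
  note ext = ahom_extensional[OF mod_hom_ahom]
  let ?C = "mod_cat R :: (('r, 'a) module, 'a \<Rightarrow> 'a) precat"
  show "Ident ?C M \<in> mor ?C M M" if "M \<in> Obj ?C" for M
  proof -
    interpret module R M using that by (simp add: mod_cat_def fg_module_module)
    show ?thesis by (simp add: mod_cat_def mod_hom_def)
  qed
next
  let ?C = "mod_cat R :: (('r, 'a) module, 'a \<Rightarrow> 'a) precat"
  show "Cmp ?C X Y Z g f \<in> mor ?C X Z" if "X \<in> Obj ?C" "f \<in> mor ?C X Y" "g \<in> mor ?C Y Z" for X Y Z f g
    using that by (simp add: mod_cat_def fg_module_module mod_hom_compose)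
next
  note cl = ahom_closed[OF mod_hom_ahom] and ad = ahom_add[OF mod_hom_ahom]
  note ext = ahom_extensional[OF mod_hom_ahom]
  let ?C = "mod_cat R :: (('r, 'a) module, 'a \<Rightarrow> 'a) precat"
  fix X Y f assume "X \<in> Obj ?C" "Y \<in> Obj ?C" "f \<in> mor ?C X Y"
  then have f: "f \<in> mod_hom R X Y" by (simp add: mod_cat_def)
  show "Cmp ?C X Y Y (Ident ?C Y) f = f" "Cmp ?C X X Y f (Ident ?C X) = f"
    using cl[OF f] ext[OF f]
    by (auto intro!: extensionalityI[of _ "carrier X"] simp: mod_cat_def compose_def)
next
  note cl = ahom_closed[OF mod_hom_ahom]
  let ?C = "mod_cat R :: (('r, 'a) module, 'a \<Rightarrow> 'a) precat"
  fix W X Y Z f g h assume "f \<in> mor ?C W X" "g \<in> mor ?C X Y" "h \<in> mor ?C Y Z"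
  then show "Cmp ?C W Y Z h (Cmp ?C W X Y g f) = Cmp ?C W X Z (Cmp ?C X Y Z h g) f"
    by (auto intro!: restrict_ext simp: mod_cat_def compose_def cl)
next
  let ?C = "mod_cat R :: (('r, 'a) module, 'a \<Rightarrow> 'a) precat"
  show "abelian_group (Hom ?C X Y)" if "X \<in> Obj ?C" "Y \<in> Obj ?C" for X Y
    using that abelian_group_mod_hom[of X Y] by (simp add: mod_cat_def fg_module_module)
next
  note cl = ahom_closed[OF mod_hom_ahom]
  let ?C = "mod_cat R :: (('r, 'a) module, 'a \<Rightarrow> 'a) precat"
  fix X Y Z f g g' assume "f \<in> mor ?C X Y" "g \<in> mor ?C Y Z" "g' \<in> mor ?C Y Z"
  then show "Cmp ?C X Y Z (g \<oplus>\<^bsub>Hom ?C Y Z\<^esub> g') f = Cmp ?C X Y Z g f \<oplus>\<^bsub>Hom ?C X Z\<^esub> Cmp ?C X Y Z g' f"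
    by (auto intro!: restrict_ext simp: mod_cat_def compose_def cl)
next
  note cl = ahom_closed[OF mod_hom_ahom] and ad = ahom_add[OF mod_hom_ahom]
  let ?C = "mod_cat R :: (('r, 'a) module, 'a \<Rightarrow> 'a) precat"
  fix X Y Z f f' g assume "f \<in> mor ?C X Y" "f' \<in> mor ?C X Y" "g \<in> mor ?C Y Z"
  then show "Cmp ?C X Y Z g (f \<oplus>\<^bsub>Hom ?C X Y\<^esub> f') = Cmp ?C X Y Z g f \<oplus>\<^bsub>Hom ?C X Z\<^esub> Cmp ?C X Y Z g f'"
    by (auto intro!: restrict_ext simp: mod_cat_def compose_def cl ad)
qed

end

section \<open>The dual numbers\<close>

lemma carrier_UP_int: "p \<in> carrier (UP \<Z>) \<longleftrightarrow> (\<exists>n. \<forall>m>n. p m = 0)"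
  by (auto simp: UP_def up_def bound_def)

lemma add_UP_int: "\<lbrakk>p \<in> carrier (UP \<Z>); q \<in> carrier (UP \<Z>)\<rbrakk> \<Longrightarrow> (p \<oplus>\<^bsub>UP \<Z>\<^esub> q) n = p n + q n"
  by (simp add: UP_def)

lemma mult_UP_int:
  assumes "p \<in> carrier (UP \<Z>)" "q \<in> carrier (UP \<Z>)"
  shows "(p \<otimes>\<^bsub>UP \<Z>\<^esub> q) n = (\<Sum>i\<le>n. p i * q (n - i))"
  using assms by (simp add: UP_def int_finsum_eq)

abbreviation eps_ideal where "eps_ideal \<equiv> PIdl\<^bsub>UP \<Z>\<^esub> (up_ring.monom (UP \<Z>) 1 2)"

lemma monom_UP_int: "up_ring.monom (UP \<Z>) a n = (\<lambda>i. if i = n then a else 0)"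
  by (simp add: UP_def int_zero_eq fun_eq_iff)

lemma monom_UP_int_closed: "(\<lambda>i. if i = n then a else 0) \<in> carrier (UP \<Z>)"
  by (auto simp: carrier_UP_int)

lemma cring_UP_int: "cring (UP \<Z>)"
proof -
  interpret UP_cring \<Z> "UP \<Z>" by (intro UP_cring.intro int_is_cring)
  show ?thesis by (rule UP_cring)
qed

lemma eps_ideal_ideal: "ideal eps_ideal (UP \<Z>)"
proof -
  interpret cring "UP \<Z>" by (rule cring_UP_int)
  show ?thesis by (rule cgenideal_ideal) (simp add: monom_UP_int monom_UP_int_closed)
qed

text \<open>Division by T^2 shifts the coefficients down by two places, which is possible exactly
  when the two lowest ones vanish.\<close>

lemma mem_eps_ideal: "p \<in> eps_ideal \<longleftrightarrow> p \<in> carrier (UP \<Z>) \<and> p 0 = 0 \<and> p 1 = 0" (is "?L \<longleftrightarrow> ?R")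
proof -
  interpret UPZ: cring "UP \<Z>" by (rule cring_UP_int)
  show ?thesis
  proof
  assume "p \<in> eps_ideal"
  then obtain q where q: "q \<in> carrier (UP \<Z>)" "p = q \<otimes>\<^bsub>UP \<Z>\<^esub> (\<lambda>i. if i = 2 then 1 else 0)"
    by (auto simp: cgenideal_def monom_UP_int)
  then show "p \<in> carrier (UP \<Z>) \<and> p 0 = 0 \<and> p 1 = 0"
    using mult_UP_int[OF q(1) monom_UP_int_closed[of 2 1]] UPZ.m_closed[OF q(1) monom_UP_int_closed[of 2 1]]
    by simp
next
  assume p: "p \<in> carrier (UP \<Z>) \<and> p 0 = 0 \<and> p 1 = 0"
  then obtain n where n: "\<forall>m>n. p m = 0" by (auto simp: carrier_UP_int)
  define q where "q i = p (i + 2)" for i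
  have q: "q \<in> carrier (UP \<Z>)" using n by (auto simp: carrier_UP_int q_def intro!: exI[of _ n])
  have "(q \<otimes>\<^bsub>UP \<Z>\<^esub> (\<lambda>i. if i = 2 then 1 else 0)) n = p n" for n
  proof -
    have "(q \<otimes>\<^bsub>UP \<Z>\<^esub> (\<lambda>i. if i = 2 then 1 else 0)) n = (\<Sum>i\<le>n. q i * (if n - i = 2 then 1 else 0))"
      by (rule mult_UP_int[OF q monom_UP_int_closed])
    also have "\<dots> = (\<Sum>i\<le>n. if i = n - 2 \<and> n \<ge> 2 then p n else 0)"
      by (intro sum.cong) (auto simp: q_def intro!: arg_cong[of _ _ p])
    also have "\<dots> = p n"
    proof (cases "n \<ge> 2")
      case False
      then have "n = 0 \<or> n = 1" by auto
      then show ?thesis using p False by auto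
    qed simp
    finally show ?thesis .
  qed
  then have "p = q \<otimes>\<^bsub>UP \<Z>\<^esub> up_ring.monom (UP \<Z>) 1 2" by (simp add: monom_UP_int fun_eq_iff)
  then show "p \<in> eps_ideal" using q by (auto simp: cgenideal_def)
  qed
qed

text \<open>The dual number a + b\<epsilon>.\<close>

definition ze :: "int \<Rightarrow> int \<Rightarrow> (nat \<Rightarrow> int) set" where
  "ze a b = eps_ideal +>\<^bsub>UP \<Z>\<^esub> (\<lambda>i. if i = 0 then a else if i = 1 then b else 0)"

lemma ze_rep_closed: "(\<lambda>i::nat. if i = 0 then a else if i = 1 then b else 0) \<in> carrier (UP \<Z>)"
  by (auto simp: carrier_UP_int intro!: exI[of _ 1])

text \<open>Cosets agree when the difference lies in the ideal, and by \<open>mem_eps_ideal\<close>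
  this concerns two coefficients only. So \<open>ze\<close> names each dual number exactly
  once.\<close>

lemma eps_coset_eq:
  assumes "p \<in> carrier (UP \<Z>)" "q \<in> carrier (UP \<Z>)"
  shows "eps_ideal +>\<^bsub>UP \<Z>\<^esub> p = eps_ideal +>\<^bsub>UP \<Z>\<^esub> q \<longleftrightarrow> p 0 = q 0 \<and> p 1 = q 1"
proof -
  interpret UPZ: cring "UP \<Z>" by (rule cring_UP_int)
  interpret eps: ideal eps_ideal "UP \<Z>" by (rule eps_ideal_ideal)
  have m: "(p \<ominus>\<^bsub>UP \<Z>\<^esub> q) n = p n - q n" for n
  proof -
    have "p = (p \<ominus>\<^bsub>UP \<Z>\<^esub> q) \<oplus>\<^bsub>UP \<Z>\<^esub> q"
      using assms by (simp add: UPZ.minus_eq UPZ.a_assoc UPZ.l_neg)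
    then have "p n = (p \<ominus>\<^bsub>UP \<Z>\<^esub> q) n + q n" using add_UP_int[OF UPZ.minus_closed[OF assms] assms(2)] by simp
    then show ?thesis by simp
  qed
  have "eps_ideal +>\<^bsub>UP \<Z>\<^esub> p = eps_ideal +>\<^bsub>UP \<Z>\<^esub> q \<longleftrightarrow> p \<ominus>\<^bsub>UP \<Z>\<^esub> q \<in> eps_ideal"
    using UPZ.quotient_eq_iff_same_a_r_cos[OF eps.ideal_axioms assms] by simp
  then show ?thesis using assms by (simp add: mem_eps_ideal m)
qed

lemma ze_coset: "p \<in> carrier (UP \<Z>) \<Longrightarrow> eps_ideal +>\<^bsub>UP \<Z>\<^esub> p = ze (p 0) (p 1)"
  unfolding ze_def by (subst eps_coset_eq) (simp_all add: ze_rep_closed)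

lemma ze_inject [simp]: "ze a b = ze c d \<longleftrightarrow> a = c \<and> b = d"
  unfolding ze_def by (subst eps_coset_eq) (simp_all add: ze_rep_closed)

lemma cring_Z_eps: "cring Z_eps"
  unfolding Z_eps_def by (rule ideal.quotient_is_cring[OF eps_ideal_ideal cring_UP_int])

lemma carrier_Z_eps: "z \<in> carrier Z_eps \<longleftrightarrow> (\<exists>a b. z = ze a b)"
proof
  assume "z \<in> carrier Z_eps"
  then obtain p where "p \<in> carrier (UP \<Z>)" "z = eps_ideal +>\<^bsub>UP \<Z>\<^esub> p"
    by (auto simp: Z_eps_def FactRing_def A_RCOSETS_def')
  then show "\<exists>a b. z = ze a b" using ze_coset by blast
next
  assume "\<exists>a b. z = ze a b"
  then show "z \<in> carrier Z_eps"
    using ze_rep_closed by (auto simp: Z_eps_def FactRing_def A_RCOSETS_def' ze_def)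
qed

lemma ze_closed [simp]: "ze a b \<in> carrier Z_eps"
  by (auto simp: carrier_Z_eps)

lemma add_Z_eps [simp]: "ze a b \<oplus>\<^bsub>Z_eps\<^esub> ze c d = ze (a + c) (b + d)"
proof -
  interpret UPZ: cring "UP \<Z>" by (rule cring_UP_int)
  interpret eps: ideal eps_ideal "UP \<Z>" by (rule eps_ideal_ideal)
  have "ze a b \<oplus>\<^bsub>Z_eps\<^esub> ze c d = eps_ideal +>\<^bsub>UP \<Z>\<^esub> ((\<lambda>i. if i = 0 then a else if i = 1 then b else 0)
      \<oplus>\<^bsub>UP \<Z>\<^esub> (\<lambda>i. if i = 0 then c else if i = 1 then d else 0))"
    by (simp add: Z_eps_def FactRing_def ze_def eps.a_rcos_sum ze_rep_closed)
  also have "\<dots> = ze (a + c) (b + d)"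
    by (subst ze_coset) (simp_all add: ze_rep_closed add_UP_int)
  finally show ?thesis .
qed

lemma mult_Z_eps [simp]: "ze a b \<otimes>\<^bsub>Z_eps\<^esub> ze c d = ze (a * c) (a * d + b * c)"
proof -
  interpret UPZ: cring "UP \<Z>" by (rule cring_UP_int)
  interpret eps: ideal eps_ideal "UP \<Z>" by (rule eps_ideal_ideal)
  have "ze a b \<otimes>\<^bsub>Z_eps\<^esub> ze c d = eps_ideal +>\<^bsub>UP \<Z>\<^esub> ((\<lambda>i. if i = 0 then a else if i = 1 then b else 0)
      \<otimes>\<^bsub>UP \<Z>\<^esub> (\<lambda>i. if i = 0 then c else if i = 1 then d else 0))"
    by (simp add: Z_eps_def FactRing_def ze_def eps.rcoset_mult_add ze_rep_closed)
  also have "\<dots> = ze (a * c) (a * d + b * c)"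
    by (subst ze_coset) (simp_all add: ze_rep_closed mult_UP_int atMost_Suc)
  finally show ?thesis .
qed

lemma one_Z_eps: "\<one>\<^bsub>Z_eps\<^esub> = ze 1 0"
proof -
  interpret UPZ: cring "UP \<Z>" by (rule cring_UP_int)
  have "\<one>\<^bsub>UP \<Z>\<^esub> 0 = 1" "\<one>\<^bsub>UP \<Z>\<^esub> 1 = 0" by (simp_all add: UP_def)
  then show ?thesis using ze_coset[OF UPZ.one_closed] by (simp add: Z_eps_def FactRing_def)
qed

lemma zero_Z_eps: "\<zero>\<^bsub>Z_eps\<^esub> = ze 0 0"
proof -
  interpret cring Z_eps by (rule cring_Z_eps)
  obtain a b where "\<zero>\<^bsub>Z_eps\<^esub> = ze a b" using carrier_Z_eps[of "\<zero>\<^bsub>Z_eps\<^esub>"] by auto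
  then show ?thesis using l_zero[of "\<zero>\<^bsub>Z_eps\<^esub>"] by simp
qed

section \<open>Modules over the dual numbers as groups with an endomorphism of square zero\<close>

definition ep :: "'a eps_module \<Rightarrow> 'a \<Rightarrow> 'a" where
  "ep M x = ze 0 1 \<odot>\<^bsub>M\<^esub> x"

text \<open>The action is determined by the additive endomorphism \<open>ep\<close>, whose square is
  zero because \<epsilon>^2 = 0; \<open>ze_smult\<close> recovers the action of a general scalar
  from it.\<close>

lemma module_ep:
  fixes M (structure)
  assumes M: "module Z_eps M"
  shows ep_closed: "x \<in> carrier M \<Longrightarrow> ep M x \<in> carrier M"
    and ep_add: "\<lbrakk>x \<in> carrier M; y \<in> carrier M\<rbrakk> \<Longrightarrow> ep M (x \<oplus> y) = ep M x \<oplus> ep M y"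
    and ep_ep: "x \<in> carrier M \<Longrightarrow> ep M (ep M x) = \<zero>"
    and ep_zero: "ep M \<zero> = \<zero>"
    and ep_neg: "x \<in> carrier M \<Longrightarrow> ep M (\<ominus> x) = \<ominus> ep M x"
    and ze_smult: "x \<in> carrier M \<Longrightarrow> ze a b \<odot> x = [a] \<cdot> x \<oplus> [b] \<cdot> ep M x"
proof -
  interpret module Z_eps M by fact
  show c: "x \<in> carrier M \<Longrightarrow> ep M x \<in> carrier M" for x by (simp add: ep_def)
  show "\<lbrakk>x \<in> carrier M; y \<in> carrier M\<rbrakk> \<Longrightarrow> ep M (x \<oplus> y) = ep M x \<oplus> ep M y"
    by (simp add: ep_def smult_r_distr)
  show "x \<in> carrier M \<Longrightarrow> ep M (ep M x) = \<zero>"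
    using smult_assoc1[of "ze 0 1" "ze 0 1" x] smult_l_null[of x] by (simp add: ep_def zero_Z_eps)
  show "ep M \<zero> = \<zero>" by (simp add: ep_def)
  show "x \<in> carrier M \<Longrightarrow> ep M (\<ominus> x) = \<ominus> ep M x" by (simp add: ep_def smult_r_minus)
  have neg: "(\<ominus>\<^bsub>Z_eps\<^esub> ze p q) = ze (- p) (- q)" for p q
    by (rule R.minus_equality) (simp_all add: zero_Z_eps)
  have int: "ze k 0 \<odot> y = [k] \<cdot> y" if y: "y \<in> carrier M" for k y
  proof (induction k rule: int_induct[where k = 0])
    case base show ?case using smult_l_null[OF y] by (simp add: add_pow_def zero_Z_eps)
  next
    case (step1 i)
    have "ze (i + 1) 0 \<odot> y = ze i 0 \<odot> y \<oplus> y"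
      using smult_l_distr[of "ze i 0" "ze 1 0" y] smult_one[OF y] y by (simp add: one_Z_eps)
    then show ?case using step1 y by (simp add: M.int_pow_Suc)
  next
    case (step2 i)
    have "ze (i - 1) 0 \<odot> y = ze i 0 \<odot> y \<oplus> \<ominus> y"
      using smult_l_distr[of "ze i 0" "ze (-1) 0" y] smult_one[OF y] y smult_l_minus[of "ze 1 0" y]
      by (simp add: one_Z_eps neg)
    then show ?case using step2 y by (simp add: M.int_pow_Suc)
  qed
  show "ze a b \<odot> x = [a] \<cdot> x \<oplus> [b] \<cdot> ep M x" if x: "x \<in> carrier M"
    using smult_l_distr[of "ze a 0" "ze 0 b" x] smult_assoc1[of "ze b 0" "ze 0 1" x] x int[OF x] int[OF c[OF x]]
    by (simp add: ep_def)
qed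

text \<open>A scalar a + b\<epsilon> acts through integer multiples and \<open>ep\<close>, and
  additive maps respect integer multiples automatically.\<close>

lemma mod_hom_Z_eps:
  assumes M: "module Z_eps M" and N: "module Z_eps N"
  shows "f \<in> mod_hom Z_eps M N \<longleftrightarrow> f \<in> ahom M N \<and> (\<forall>x\<in>carrier M. f (ep M x) = ep N (f x))"
proof -
  interpret M: module Z_eps M by fact
  interpret N: module Z_eps N by fact
  show ?thesis
  proof (intro iffI conjI ballI)
    assume "f \<in> mod_hom Z_eps M N"
    then show "f \<in> ahom M N" by (rule mod_hom_ahom)
    fix x assume "x \<in> carrier M"
    then show "f (ep M x) = ep N (f x)" using \<open>f \<in> mod_hom Z_eps M N\<close> by (simp add: ep_def mod_hom_smult)
  next
    assume f: "f \<in> ahom M N \<and> (\<forall>x\<in>carrier M. f (ep M x) = ep N (f x))"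
    show "f \<in> mod_hom Z_eps M N"
    proof (rule mod_homI)
      fix z x assume z: "z \<in> carrier Z_eps" and x: "x \<in> carrier M"
      obtain a b where ab: "z = ze a b" using z by (auto simp: carrier_Z_eps)
      have fx: "f x \<in> carrier N" using ahom_closed[of f M N x] f x by simp
      show "f (z \<odot>\<^bsub>M\<^esub> x) = z \<odot>\<^bsub>N\<^esub> f x"
        unfolding ab ze_smult[OF M x] ze_smult[OF N fx]
        using f x ep_closed[OF M x]
          ahom_add[of f M N "[a] \<cdot>\<^bsub>M\<^esub> x" "[b] \<cdot>\<^bsub>M\<^esub> ep M x"]
        by (simp add: ahom_int_pow[OF _ M.abelian_group_axioms N.abelian_group_axioms])
    qed (use f in blast)
  qed
qed

text \<open>The converse passage, from an endomorphism \<open>e\<close> of square zero to a module.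
  The choice operator merely decodes the two coefficients of a scalar, which are unique on the
  carrier of \<open>Z_eps\<close>.\<close>

definition emod :: "('a, 'x) ring_scheme \<Rightarrow> ('a \<Rightarrow> 'a) \<Rightarrow> 'a eps_module" where
  "emod G e = \<lparr>carrier = carrier G, mult = undefined, one = undefined, zero = \<zero>\<^bsub>G\<^esub>, add = add G,
     smult = (\<lambda>z x. case (SOME (a, b). z = ze a b) of (a, b) \<Rightarrow> [a] \<cdot>\<^bsub>G\<^esub> x \<oplus>\<^bsub>G\<^esub> [b] \<cdot>\<^bsub>G\<^esub> e x)\<rparr>"

lemma emod_simps [simp]: "carrier (emod G e) = carrier G" "\<zero>\<^bsub>emod G e\<^esub> = \<zero>\<^bsub>G\<^esub>" "add (emod G e) = add G"
  "ze a b \<odot>\<^bsub>emod G e\<^esub> x = [a] \<cdot>\<^bsub>G\<^esub> x \<oplus>\<^bsub>G\<^esub> [b] \<cdot>\<^bsub>G\<^esub> e x"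
proof -
  have "(SOME (c, d). ze a b = ze c d) = (a, b)" by (rule some_equality) auto
  then show "ze a b \<odot>\<^bsub>emod G e\<^esub> x = [a] \<cdot>\<^bsub>G\<^esub> x \<oplus>\<^bsub>G\<^esub> [b] \<cdot>\<^bsub>G\<^esub> e x" by (simp add: emod_def)
qed (simp_all add: emod_def)

lemma abelian_group_cong:
  assumes "abelian_group G" "carrier H = carrier G" "\<zero>\<^bsub>H\<^esub> = \<zero>\<^bsub>G\<^esub>" "add H = add G"
  shows "abelian_group H"
  using assms abelian_groupE[OF assms(1)] by (intro abelian_groupI) simp_all

lemma module_emod:
  assumes G: "abelian_group G" and e: "\<And>x. x \<in> carrier G \<Longrightarrow> e x \<in> carrier G"
    and eadd: "\<And>x y. \<lbrakk>x \<in> carrier G; y \<in> carrier G\<rbrakk> \<Longrightarrow> e (x \<oplus>\<^bsub>G\<^esub> y) = e x \<oplus>\<^bsub>G\<^esub> e y"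
    and ee: "\<And>x. x \<in> carrier G \<Longrightarrow> e (e x) = \<zero>\<^bsub>G\<^esub>"
  shows "module Z_eps (emod G e)" and "x \<in> carrier G \<Longrightarrow> ep (emod G e) x = e x"
proof -
  interpret G: abelian_group G by fact
  have E: "(\<lambda>x\<in>carrier G. e x) \<in> ahom G G" by (rule ahom_restrictI[OF G]) (use e eadd in auto)
  have epow: "e ([(k::int)] \<cdot>\<^bsub>G\<^esub> x) = [k] \<cdot>\<^bsub>G\<^esub> e x" if "x \<in> carrier G" for k x
    using ahom_int_pow[OF E G G that, of k] that by simp
  have pow0: "[(0::int)] \<cdot>\<^bsub>G\<^esub> x = \<zero>\<^bsub>G\<^esub>" for x by (simp add: add_pow_def)
  have abg: "abelian_group (emod G e)" by (rule abelian_group_cong[OF G]) simp_all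
  show "module Z_eps (emod G e)"
  proof (rule moduleI[OF cring_Z_eps abg])
    fix z x assume "z \<in> carrier Z_eps" "x \<in> carrier (emod G e)"
    then show "z \<odot>\<^bsub>emod G e\<^esub> x \<in> carrier (emod G e)" using e by (auto simp: carrier_Z_eps)
  next
    fix z w x assume "z \<in> carrier Z_eps" "w \<in> carrier Z_eps" "x \<in> carrier (emod G e)"
    then obtain a b c d where "z = ze a b" "w = ze c d" and x: "x \<in> carrier G" by (auto simp: carrier_Z_eps)
    then show "(z \<oplus>\<^bsub>Z_eps\<^esub> w) \<odot>\<^bsub>emod G e\<^esub> x = z \<odot>\<^bsub>emod G e\<^esub> x \<oplus>\<^bsub>emod G e\<^esub> w \<odot>\<^bsub>emod G e\<^esub> x"
      using G.add.int_pow_mult[OF x, of a c] G.add.int_pow_mult[OF e[OF x], of b d] e[OF x]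
      by (simp add: G.a_ac)
  next
    fix z x y assume "z \<in> carrier Z_eps" "x \<in> carrier (emod G e)" "y \<in> carrier (emod G e)"
    then obtain a b where "z = ze a b" "x \<in> carrier G" "y \<in> carrier G" by (auto simp: carrier_Z_eps)
    moreover from this e have "e x \<in> carrier G" "e y \<in> carrier G" by simp_all
    ultimately show "z \<odot>\<^bsub>emod G e\<^esub> (x \<oplus>\<^bsub>emod G e\<^esub> y) = z \<odot>\<^bsub>emod G e\<^esub> x \<oplus>\<^bsub>emod G e\<^esub> z \<odot>\<^bsub>emod G e\<^esub> y"
      by (simp add: eadd G.add.int_pow_distrib G.a_ac)
  next
    fix z w x assume z: "z \<in> carrier Z_eps" "w \<in> carrier Z_eps" and x: "x \<in> carrier (emod G e)"
    obtain a b c d where ab: "z = ze a b" "w = ze c d" using z by (auto simp: carrier_Z_eps)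
    have x': "x \<in> carrier G" using x by simp
    have z0: "[k] \<cdot>\<^bsub>G\<^esub> \<zero>\<^bsub>G\<^esub> = \<zero>\<^bsub>G\<^esub>" for k :: int by (rule G.add.int_pow_one)
    have "e ([c] \<cdot>\<^bsub>G\<^esub> x \<oplus>\<^bsub>G\<^esub> [d] \<cdot>\<^bsub>G\<^esub> e x) = [c] \<cdot>\<^bsub>G\<^esub> e x"
      using e x' ee[OF x'] by (simp add: eadd epow z0)
    moreover have "[(a * d + b * c)] \<cdot>\<^bsub>G\<^esub> e x = [a] \<cdot>\<^bsub>G\<^esub> ([d] \<cdot>\<^bsub>G\<^esub> e x) \<oplus>\<^bsub>G\<^esub> [b] \<cdot>\<^bsub>G\<^esub> ([c] \<cdot>\<^bsub>G\<^esub> e x)"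
      using e[OF x'] by (simp add: G.add.int_pow_mult G.add.int_pow_pow mult.commute)
    moreover have "[(a * c)] \<cdot>\<^bsub>G\<^esub> x = [a] \<cdot>\<^bsub>G\<^esub> ([c] \<cdot>\<^bsub>G\<^esub> x)"
      using x' by (simp add: G.add.int_pow_pow mult.commute)
    ultimately show "(z \<otimes>\<^bsub>Z_eps\<^esub> w) \<odot>\<^bsub>emod G e\<^esub> x = z \<odot>\<^bsub>emod G e\<^esub> (w \<odot>\<^bsub>emod G e\<^esub> x)"
      unfolding ab using x' e[OF x'] by (simp add: G.add.int_pow_distrib G.a_assoc)
  next
    fix x assume "x \<in> carrier (emod G e)"
    then show "\<one>\<^bsub>Z_eps\<^esub> \<odot>\<^bsub>emod G e\<^esub> x = x" by (simp add: one_Z_eps G.add.int_pow_1 pow0)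
  qed
  show "x \<in> carrier G \<Longrightarrow> ep (emod G e) x = e x"
    using e[of x] by (simp add: ep_def G.add.int_pow_1 pow0)
qed

section \<open>Torsion-free modules over the dual numbers\<close>

text \<open>In \<open>tff\<close> coordinates are numbered by an initial segment of the naturals;
  here they may be indexed by pairs or by a disjoint union.\<close>

lemma tff_finite:
  assumes J: "finite J" and c: "\<And>j. j \<in> J \<Longrightarrow> int_hom G A (c j)"
    and inj: "\<And>x. \<lbrakk>x \<in> A; \<And>j. j \<in> J \<Longrightarrow> c j x = 0\<rbrakk> \<Longrightarrow> x = \<zero>\<^bsub>G\<^esub>"
  shows "tff G A"
proof -
  obtain h where h: "bij_betw h {0..<card J} J" using ex_bij_betw_nat_finite[OF J] by blast
  have hJ: "h i \<in> J" if "i < card J" for i using h that by (auto simp: bij_betw_def)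
  show ?thesis
    unfolding tff_def
  proof (intro exI conjI allI impI ballI)
    show "int_hom G A (c (h i))" if "i < card J" for i using c hJ that by blast
    fix x assume x: "x \<in> A" "\<forall>i<card J. c (h i) x = 0"
    show "x = \<zero>\<^bsub>G\<^esub>"
    proof (rule inj[OF x(1)])
      fix j assume "j \<in> J"
      then obtain i where "i \<in> {0..<card J}" "j = h i" using bij_betw_imp_surj_on[OF h] by blast
      then show "c j x = 0" using x(2) by simp
    qed
  qed
qed

text \<open>Coordinates are pulled back along an additive map with trivial kernel.\<close>

lemma tff_inj:
  assumes "tff H B" "\<And>x. x \<in> A \<Longrightarrow> f x \<in> B"
    and "\<And>x y. \<lbrakk>x \<in> A; y \<in> A\<rbrakk> \<Longrightarrow> f (x \<oplus>\<^bsub>G\<^esub> y) = f x \<oplus>\<^bsub>H\<^esub> f y"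
    and "\<And>x. \<lbrakk>x \<in> A; f x = \<zero>\<^bsub>H\<^esub>\<rbrakk> \<Longrightarrow> x = \<zero>\<^bsub>G\<^esub>"
  shows "tff G A"
proof -
  obtain n :: nat and c where c: "\<forall>j<n. int_hom H B (c j)" "\<forall>x\<in>B. (\<forall>j<n. c j x = 0) \<longrightarrow> x = \<zero>\<^bsub>H\<^esub>"
    using assms(1) unfolding tff_def by blast
  show ?thesis
    unfolding tff_def
  proof (intro exI conjI allI impI ballI)
    show "int_hom G A (c j \<circ> f)" if "j < n" for j
      using c(1) that assms(2,3) by (simp add: int_hom_def)
    show "x = \<zero>\<^bsub>G\<^esub>" if "x \<in> A" "\<forall>j<n. (c j \<circ> f) x = 0" for x
      using c(2) that assms(2,4) by simp
  qed
qed

text \<open>The elements dual to the functions of \<open>tff_coordinates\<close> form a basis, and a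
  basis generates.\<close>

lemma tff_generated:
  fixes G (structure)
  assumes G: "abelian_group G" and A: "asub A G" "tff G A"
  obtains F where "finite F" "F \<subseteq> A" "\<And>N. \<lbrakk>asub N G; F \<subseteq> N\<rbrakk> \<Longrightarrow> A \<subseteq> N"
proof (rule tff_coordinates[OF assms])
  fix r :: nat and b :: "nat \<Rightarrow> 'a \<Rightarrow> int"
  assume b: "\<And>j. j < r \<Longrightarrow> int_hom G A (b j)" and ex1: "\<And>v. \<exists>!x. x \<in> A \<and> (\<forall>j<r. b j x = v j)"
  interpret G: abelian_group G by fact
  have AG: "A \<subseteq> carrier G" "\<zero> \<in> A" "\<And>x y. x \<in> A \<Longrightarrow> y \<in> A \<Longrightarrow> x \<oplus> y \<in> A" "\<And>x. x \<in> A \<Longrightarrow> \<ominus> x \<in> A"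
    using A by (auto simp: asub_def)
  have "\<exists>x. x \<in> A \<and> (\<forall>j<r. b j x = (if j = k then 1 else 0))" for k
    using ex1[of "\<lambda>j. if j = k then 1 else 0"] by blast
  then obtain e where e: "\<And>k. e k \<in> A" "\<And>k j. j < r \<Longrightarrow> b j (e k) = (if j = k then 1 else 0)" by metis
  show thesis
  proof (rule that)
    show "finite (e ` {..<r})" "e ` {..<r} \<subseteq> A" using e by auto
    fix N assume N: "asub N G" "e ` {..<r} \<subseteq> N"
    have NG: "\<And>x y. x \<in> N \<Longrightarrow> y \<in> N \<Longrightarrow> x \<oplus> y \<in> N" "\<zero> \<in> N" using N by (auto simp: asub_def)
    \<comment> \<open>Elimination from the top: if all coordinates of x above index k vanish,
      subtracting the multiple b_k(x) of e_k also kills coordinate k.\<close>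
    have key: "x \<in> N" if "k \<le> r" "x \<in> A" "\<forall>j<r. j \<ge> k \<longrightarrow> b j x = 0" for k x
      using that
    proof (induction k arbitrary: x)
      case 0
      have "x = \<zero>" using ex1[of "\<lambda>_. 0"] 0 AG int_hom_facts(2)[OF G A(1) b] by auto
      then show ?case using NG by simp
    next
      case (Suc k)
      define y where "y = [(b k x)] \<cdot> e k"
      have "e k \<in> N" using N(2) Suc.prems(1) by auto
      then have y: "y \<in> A" "y \<in> N" using e asub_int_pow[OF G A(1)] asub_int_pow[OF G N(1)] N(2) Suc.prems(1) by (auto simp: y_def)
      have bjy: "b j y = b k x * b j (e k)" if "j < r" for j
        unfolding y_def using int_hom_int_pow[OF G A(1) b[OF that] e(1)] .
      have "x \<oplus> \<ominus> y \<in> N"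
      proof (rule Suc.IH)
        show "\<forall>j<r. k \<le> j \<longrightarrow> b j (x \<oplus> \<ominus> y) = 0"
        proof (intro allI impI)
          fix j assume j: "j < r" "k \<le> j"
          have "b j (x \<oplus> \<ominus> y) = b j x - b j y"
            using int_hom_facts[OF G A(1) b[OF j(1)]] y AG Suc.prems(2) by simp
          then show "b j (x \<oplus> \<ominus> y) = 0"
            using bjy[OF j(1)] e(2)[OF j(1), of k] Suc.prems(3) j by (cases "j = k") auto
        qed
      qed (use Suc.prems y AG in auto)
      then have "(x \<oplus> \<ominus> y) \<oplus> y \<in> N" using NG y by blast
      moreover have "x \<in> carrier G" "y \<in> carrier G" using Suc.prems(2) y AG(1) by auto
      ultimately show ?case by (simp add: G.a_assoc G.l_neg)
    qed
    show "A \<subseteq> N" using key[of r] by auto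
  qed
qed

lemma asub_submodule:
  assumes "module R M" "submodule N R M" shows "asub N M"
proof -
  interpret M: module R M by fact
  note s = M.submoduleE[OF assms(2)]
  obtain x where x: "x \<in> N" using s(2) by blast
  then have "x \<oplus>\<^bsub>M\<^esub> \<ominus>\<^bsub>M\<^esub> x \<in> N" using s by blast
  then have "\<zero>\<^bsub>M\<^esub> \<in> N" using x s(1) by (simp add: M.r_neg subsetD)
  then show ?thesis using s by (auto simp: asub_def)
qed

text \<open>Submodules are in particular subgroups, so a finite set that generates the additive
  group generates the module as well, over any ring.\<close>

lemma fg_module_tff:
  assumes M: "module R M" and t: "tff M (carrier M)" shows "fg_module R M"
proof -
  interpret M: module R M by fact
  obtain F where F: "finite F" "F \<subseteq> carrier M" "\<And>N. \<lbrakk>asub N M; F \<subseteq> N\<rbrakk> \<Longrightarrow> carrier M \<subseteq> N"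
    by (rule tff_generated[OF M.abelian_group_axioms asub_carrier[OF M.abelian_group_axioms] t]) blast
  have "N = carrier M" if "submodule N R M" "F \<subseteq> N" for N
    using F(3)[OF asub_submodule[OF M that(1)] that(2)] M.submoduleE(1)[OF that(1)] by blast
  then show ?thesis unfolding fg_module_def using M F(1,2) by blast
qed

section \<open>Free modules over the dual numbers\<close>

lemma free_module_simps:
  "carrier (free_module R n) = {..<n} \<rightarrow>\<^sub>E carrier R" "\<zero>\<^bsub>free_module R n\<^esub> = (\<lambda>i\<in>{..<n}. \<zero>\<^bsub>R\<^esub>)"
  "v \<oplus>\<^bsub>free_module R n\<^esub> w = (\<lambda>i\<in>{..<n}. v i \<oplus>\<^bsub>R\<^esub> w i)"
  "a \<odot>\<^bsub>free_module R n\<^esub> v = (\<lambda>i\<in>{..<n}. a \<otimes>\<^bsub>R\<^esub> v i)"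
  by (simp_all add: free_module_def)

lemma PiE_restrict_eqI:
  assumes "v \<in> A \<rightarrow>\<^sub>E B" "\<And>i. i \<in> A \<Longrightarrow> f i = v i" shows "restrict f A = v"
proof
  fix i show "restrict f A i = v i" using assms by (cases "i \<in> A") (auto simp: PiE_def extensional_def)
qed

lemma module_free_module:
  fixes R (structure)
  assumes "cring R" shows "module R (free_module R n)"
proof -
  interpret cring R by fact
  let ?F = "free_module R n"
  have c: "v i \<in> carrier R" if "v \<in> carrier ?F" "i \<in> {..<n}" for v i
    using that by (auto simp: free_module_simps)
  have "abelian_group ?F"
  proof (rule abelian_groupI)
    fix x assume x: "x \<in> carrier ?F"
    have "(\<lambda>i\<in>{..<n}. \<ominus> x i) \<oplus>\<^bsub>?F\<^esub> x = \<zero>\<^bsub>?F\<^esub>"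
      unfolding free_module_simps by (rule restrict_ext) (simp add: l_neg c[OF x])
    moreover have "(\<lambda>i\<in>{..<n}. \<ominus> x i) \<in> carrier ?F" by (simp add: free_module_simps(1) c[OF x])
    ultimately show "\<exists>y\<in>carrier ?F. y \<oplus>\<^bsub>?F\<^esub> x = \<zero>\<^bsub>?F\<^esub>" by blast
    show "\<zero>\<^bsub>?F\<^esub> \<oplus>\<^bsub>?F\<^esub> x = x"
      unfolding free_module_simps using x
      by (intro PiE_restrict_eqI[where B = "carrier R"]) (simp_all add: free_module_simps(1) c[OF x])
  next
    fix x y z assume x: "x \<in> carrier ?F" and y: "y \<in> carrier ?F" and z: "z \<in> carrier ?F"
    show "x \<oplus>\<^bsub>?F\<^esub> y \<oplus>\<^bsub>?F\<^esub> z = x \<oplus>\<^bsub>?F\<^esub> (y \<oplus>\<^bsub>?F\<^esub> z)"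
      unfolding free_module_simps by (rule restrict_ext) (simp add: a_assoc c[OF x] c[OF y] c[OF z])
  next
    fix x y assume x: "x \<in> carrier ?F" and y: "y \<in> carrier ?F"
    show "x \<oplus>\<^bsub>?F\<^esub> y = y \<oplus>\<^bsub>?F\<^esub> x"
      unfolding free_module_simps by (rule restrict_ext) (simp add: a_comm c[OF x] c[OF y])
    show "x \<oplus>\<^bsub>?F\<^esub> y \<in> carrier ?F"
      unfolding free_module_simps(1,3) by (simp add: c[OF x] c[OF y])
  qed (simp add: free_module_simps)
  then show ?thesis
  proof (rule moduleI[OF assms])
    fix a x assume a: "a \<in> carrier R" and x: "x \<in> carrier ?F"
    show "a \<odot>\<^bsub>?F\<^esub> x \<in> carrier ?F" unfolding free_module_simps(1,4) by (simp add: c[OF x] a)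
  next
    fix x assume x: "x \<in> carrier ?F"
    show "\<one> \<odot>\<^bsub>?F\<^esub> x = x" unfolding free_module_simps using x
      by (intro PiE_restrict_eqI[where B = "carrier R"]) (simp_all add: free_module_simps(1) c[OF x])
  next
    fix a b x assume ab: "a \<in> carrier R" "b \<in> carrier R" and x: "x \<in> carrier ?F"
    show "(a \<oplus> b) \<odot>\<^bsub>?F\<^esub> x = a \<odot>\<^bsub>?F\<^esub> x \<oplus>\<^bsub>?F\<^esub> b \<odot>\<^bsub>?F\<^esub> x"
      unfolding free_module_simps by (rule restrict_ext) (simp add: ab c[OF x] l_distr)
    show "(a \<otimes> b) \<odot>\<^bsub>?F\<^esub> x = a \<odot>\<^bsub>?F\<^esub> (b \<odot>\<^bsub>?F\<^esub> x)"
      unfolding free_module_simps by (rule restrict_ext) (simp add: ab c[OF x] m_assoc)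
  next
    fix a x y assume a: "a \<in> carrier R" and x: "x \<in> carrier ?F" and y: "y \<in> carrier ?F"
    show "a \<odot>\<^bsub>?F\<^esub> (x \<oplus>\<^bsub>?F\<^esub> y) = a \<odot>\<^bsub>?F\<^esub> x \<oplus>\<^bsub>?F\<^esub> a \<odot>\<^bsub>?F\<^esub> y"
      unfolding free_module_simps by (rule restrict_ext) (simp add: a c[OF x] c[OF y] r_distr)
  qed
qed

text \<open>The coefficients of 1 and of \<epsilon>; both are meaningful on the carrier of
  \<open>Z_eps\<close>.\<close>

definition re :: "(nat \<Rightarrow> int) set \<Rightarrow> int" where "re z = (THE a. \<exists>b. z = ze a b)"
definition im :: "(nat \<Rightarrow> int) set \<Rightarrow> int" where "im z = (THE b. \<exists>a. z = ze a b)"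

lemma re_ze [simp]: "re (ze a b) = a" and im_ze [simp]: "im (ze a b) = b"
  by (auto simp: re_def im_def)

lemma ze_re_im: "z \<in> carrier Z_eps \<Longrightarrow> ze (re z) (im z) = z"
  by (auto simp: carrier_Z_eps)

lemma re_add: "\<lbrakk>z \<in> carrier Z_eps; w \<in> carrier Z_eps\<rbrakk> \<Longrightarrow> re (z \<oplus>\<^bsub>Z_eps\<^esub> w) = re z + re w"
  and im_add: "\<lbrakk>z \<in> carrier Z_eps; w \<in> carrier Z_eps\<rbrakk> \<Longrightarrow> im (z \<oplus>\<^bsub>Z_eps\<^esub> w) = im z + im w"
  by (auto simp: carrier_Z_eps)

abbreviation free_eps where "free_eps \<equiv> free_module Z_eps"

lemma free_eps_simps:
  "carrier (free_eps n) = {..<n} \<rightarrow>\<^sub>E carrier Z_eps" "\<zero>\<^bsub>free_eps n\<^esub> = (\<lambda>i\<in>{..<n}. ze 0 0)"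
  "v \<oplus>\<^bsub>free_eps n\<^esub> w = (\<lambda>i\<in>{..<n}. v i \<oplus>\<^bsub>Z_eps\<^esub> w i)"
  "ep (free_eps n) v = (\<lambda>i\<in>{..<n}. ze 0 1 \<otimes>\<^bsub>Z_eps\<^esub> v i)"
  by (simp_all add: free_module_def zero_Z_eps ep_def)

text \<open>The coefficients of 1 and of \<epsilon> in the n entries are 2n coordinates.\<close>

lemma tff_free_eps: "tff (free_eps n) (carrier (free_eps n))"
proof (rule tff_finite[of "{..<n} \<times> UNIV" _ _ "\<lambda>(i, p) v. if p then re (v i) else im (v i)"])
  show "finite ({..<n} \<times> (UNIV :: bool set))" by simp
next
  fix j :: "nat \<times> bool" assume "j \<in> {..<n} \<times> UNIV"
  then show "int_hom (free_eps n) (carrier (free_eps n)) (case j of (i, p) \<Rightarrow> \<lambda>v. if p then re (v i) else im (v i))"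
    by (auto simp: int_hom_def free_eps_simps intro!: re_add im_add intro: PiE_mem)
next
  fix v assume v: "v \<in> carrier (free_eps n)"
    and z: "\<And>j. j \<in> {..<n} \<times> UNIV \<Longrightarrow> (case j of (i, p) \<Rightarrow> \<lambda>v. if p then re (v i) else im (v i)) v = 0"
  have "v i = ze 0 0" if "i < n" for i
  proof -
    have "re (v i) = 0" "im (v i) = 0" using z[of "(i, True)"] z[of "(i, False)"] that by simp_all
    moreover have "v i \<in> carrier Z_eps" using v that by (auto simp: free_eps_simps)
    ultimately show ?thesis using ze_re_im[of "v i"] by simp
  qed
  then show "v = \<zero>\<^bsub>free_eps n\<^esub>"
    using v PiE_restrict_eqI[of v "{..<n}" "carrier Z_eps" "\<lambda>_. ze 0 0"] by (simp add: free_eps_simps)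
qed

text \<open>The class T of the overview. Finite generation follows by
  \<open>fg_module_tff\<close>.\<close>

definition tmod :: "'a eps_module \<Rightarrow> bool" where
  "tmod M \<longleftrightarrow> module Z_eps M \<and> tff M (carrier M)"

lemma torsionless_tmod:
  fixes M (structure)
  assumes "M \<in> torsionless Z_eps" and M: "module Z_eps M" shows "tmod M"
proof -
  interpret M: module Z_eps M by fact
  obtain n N f where N: "submodule N Z_eps (free_eps n)"
    and f: "f \<in> mod_hom Z_eps M ((free_eps n)\<lparr>carrier := N\<rparr>)" "bij_betw f (carrier M) N"
    using assms(1) by (auto simp: torsionless_def mod_isomorphic_def)
  interpret F: module Z_eps "free_eps n" by (rule module_free_module[OF cring_Z_eps])
  have NF: "N \<subseteq> carrier (free_eps n)" by (rule F.submoduleE(1)[OF N])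
  have fa: "f (x \<oplus> y) = f x \<oplus>\<^bsub>free_eps n\<^esub> f y" if "x \<in> carrier M" "y \<in> carrier M" for x y
    using f(1) that by (simp add: mod_hom_def)
  have fc: "f x \<in> carrier (free_eps n)" if "x \<in> carrier M" for x
    using bij_betwE[OF f(2)] that NF by blast
  have f0: "f \<zero> = \<zero>\<^bsub>free_eps n\<^esub>"
    by (rule F.add_idem_zero[OF fc[OF M.zero_closed]]) (simp add: fa[symmetric])
  have z: "x = \<zero>" if "x \<in> carrier M" "f x = \<zero>\<^bsub>free_eps n\<^esub>" for x
    using inj_onD[OF bij_betw_imp_inj_on[OF f(2)], of x "\<zero>"] that f0 by simp
  have "tff M (carrier M)" by (rule tff_inj[where f = f and B = "carrier (free_eps n)", OF tff_free_eps fc fa z])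
  then show ?thesis using M by (simp add: tmod_def)
qed

text \<open>The inclusion as a direct summand of a free module is injective, so the coordinates of
  the free module restrict.\<close>

lemma fg_projective_tmod:
  assumes "fg_projective Z_eps P" shows "tmod P"
proof -
  obtain n \<iota> \<pi> where P: "module Z_eps P" and \<iota>: "\<iota> \<in> mod_hom Z_eps P (free_eps n)"
    and \<pi>: "\<pi> \<in> mod_hom Z_eps (free_eps n) P" "\<forall>x\<in>carrier P. \<pi> (\<iota> x) = x"
    using assms by (auto simp: fg_projective_def)
  interpret F: module Z_eps "free_eps n" by (rule module_free_module[OF cring_Z_eps])
  interpret P: module Z_eps P by fact
  have "\<pi> \<zero>\<^bsub>free_eps n\<^esub> = \<zero>\<^bsub>P\<^esub>"
    by (rule ahom_zero[OF mod_hom_ahom[OF \<pi>(1)] F.abelian_group_axioms P.abelian_group_axioms])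
  then have z: "x = \<zero>\<^bsub>P\<^esub>" if "x \<in> carrier P" "\<iota> x = \<zero>\<^bsub>free_eps n\<^esub>" for x
    using \<pi>(2) that by metis
  have "tff P (carrier P)"
    by (rule tff_inj[where f = \<iota> and B = "carrier (free_eps n)", OF tff_free_eps ahom_closed[OF mod_hom_ahom[OF \<iota>]] ahom_add[OF mod_hom_ahom[OF \<iota>]] z])
  then show ?thesis using P by (simp add: tmod_def)
qed

text \<open>Such a module is isomorphic to the kernel of \<open>d 0\<close>, a subgroup of the
  projective \<open>P 0\<close>, and the coordinates of \<open>P 0\<close> restrict to it.\<close>

lemma Gorenstein_projective_tmod:
  fixes M (structure)
  assumes "M \<in> Gorenstein_projective Z_eps" and M: "module Z_eps M" shows "tmod M"
proof -
  interpret M: module Z_eps M by fact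
  obtain P :: "int \<Rightarrow> (_, 'a) module" and d where P: "complete_resolution Z_eps P d" and
    iso: "mod_isomorphic Z_eps M ((P 0)\<lparr>carrier := {x \<in> carrier (P 0). d 0 x = \<zero>\<^bsub>P 1\<^esub>}\<rparr>)"
    using assms(1) unfolding Gorenstein_projective_def by blast
  obtain f where
    f: "f \<in> mod_hom Z_eps M ((P 0)\<lparr>carrier := {x \<in> carrier (P 0). d 0 x = \<zero>\<^bsub>P 1\<^esub>}\<rparr>)"
    "bij_betw f (carrier M) {x \<in> carrier (P 0). d 0 x = \<zero>\<^bsub>P 1\<^esub>}"
    using iso unfolding mod_isomorphic_def by auto
  have P0: "module Z_eps (P 0)" "tff (P 0) (carrier (P 0))"
    using P fg_projective_tmod[of "P 0"] by (auto simp: complete_resolution_def tmod_def)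
  interpret P: module Z_eps "P 0" by fact
  have fa: "f (x \<oplus> y) = f x \<oplus>\<^bsub>P 0\<^esub> f y" if "x \<in> carrier M" "y \<in> carrier M" for x y
    using f(1) that by (simp add: mod_hom_def)
  have fc: "f x \<in> carrier (P 0)" if "x \<in> carrier M" for x
    using bij_betwE[OF f(2)] that by blast
  have f0: "f \<zero> = \<zero>\<^bsub>P 0\<^esub>"
    by (rule P.add_idem_zero[OF fc[OF M.zero_closed]]) (simp add: fa[symmetric])
  have z: "x = \<zero>" if "x \<in> carrier M" "f x = \<zero>\<^bsub>P 0\<^esub>" for x
    using inj_onD[OF bij_betw_imp_inj_on[OF f(2)], of x "\<zero>"] that f0 by simp
  have "tff M (carrier M)" by (rule tff_inj[where f = f and B = "carrier (P 0)", OF P0(2) fc fa z])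
  then show ?thesis using M by (simp add: tmod_def)
qed

lemma tmod_torsionless:
  assumes "tmod M" shows "M \<in> torsionless Z_eps"
proof -
  have M: "module Z_eps M" and t: "tff M (carrier M)" using assms by (auto simp: tmod_def)
  interpret M: module Z_eps M by fact
  note ag = M.abelian_group_axioms
  note ca = asub_carrier[OF ag]
  obtain r :: nat and b where b: "\<And>j. j < r \<Longrightarrow> int_hom M (carrier M) (b j)"
    and ex1: "\<And>v. \<exists>!x. x \<in> carrier M \<and> (\<forall>j<r. b j x = v j)"
    by (rule tff_coordinates[OF ag ca t]) blast
  note bf = int_hom_facts[OF ag ca b]
  note epc = ep_closed[OF M]
  interpret F: module Z_eps "free_eps r" by (rule module_free_module[OF cring_Z_eps])
  \<comment> \<open>Linearity: \<epsilon> times b(\<epsilon>x) + b(x)\<epsilon> is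
    b(\<epsilon>x)\<epsilon>, which is the image of \<epsilon>x because \<epsilon>\<epsilon>x =
    0.\<close>
  define f where "f = (\<lambda>x\<in>carrier M. \<lambda>j\<in>{..<r}. ze (b j (ep M x)) (b j x))"
  have f: "f \<in> mod_hom Z_eps M (free_eps r)"
    unfolding mod_hom_Z_eps[OF M F.module_axioms]
  proof (intro conjI ballI)
    show "f \<in> ahom M (free_eps r)"
      unfolding f_def by (rule ahom_restrictI[OF ag])
        (auto simp: free_eps_simps bf ep_add[OF M] epc intro!: restrict_ext)
    show "f (ep M x) = ep (free_eps r) (f x)" if "x \<in> carrier M" for x
      using that epc[OF that] bf(2) by (auto simp: f_def free_eps_simps ep_ep[OF M] intro!: restrict_ext)
  qed
  have inj: "inj_on f (carrier M)"
  proof (rule inj_onI)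
    fix x y assume xy: "x \<in> carrier M" "y \<in> carrier M" "f x = f y"
    \<comment> \<open>The coefficients of \<epsilon> alone already separate the elements of
      \<open>M\<close>.\<close>
    have "b j y = b j x" if "j < r" for j
      using fun_cong[OF xy(3), of j] xy(1,2) that by (simp add: f_def)
    then show "x = y" using ex1[of "\<lambda>j. b j x"] xy by blast
  qed
  let ?N = "f ` carrier M"
  note fa = mod_hom_ahom[OF f]
  have N: "submodule ?N Z_eps (free_eps r)"
  proof (rule F.submoduleI)
    show "?N \<subseteq> carrier (free_eps r)" using ahom_closed[OF fa] by auto
    show "\<zero>\<^bsub>free_eps r\<^esub> \<in> ?N" using imageI[OF M.zero_closed, of f] ahom_zero[OF fa ag F.abelian_group_axioms] by simp
  next
    fix a assume "a \<in> ?N"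
    then obtain x where x: "x \<in> carrier M" "a = f x" by blast
    then show "\<ominus>\<^bsub>free_eps r\<^esub> a \<in> ?N"
      using imageI[of "\<ominus>\<^bsub>M\<^esub> x" "carrier M" f] ahom_neg[OF fa ag F.abelian_group_axioms x(1)] by simp
  next
    fix a c assume "a \<in> ?N" "c \<in> ?N"
    then obtain x y where x: "x \<in> carrier M" "a = f x" "y \<in> carrier M" "c = f y" by blast
    then show "a \<oplus>\<^bsub>free_eps r\<^esub> c \<in> ?N"
      using imageI[of "x \<oplus>\<^bsub>M\<^esub> y" "carrier M" f] ahom_add[OF fa x(1,3)] by simp
  next
    fix z a assume z: "z \<in> carrier Z_eps" and "a \<in> ?N"
    then obtain x where x: "x \<in> carrier M" "a = f x" by blast
    then show "z \<odot>\<^bsub>free_eps r\<^esub> a \<in> ?N"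
      using imageI[of "z \<odot>\<^bsub>M\<^esub> x" "carrier M" f] mod_hom_smult[OF f z x(1)] z by simp
  qed
  have "f \<in> mod_hom Z_eps M ((free_eps r)\<lparr>carrier := ?N\<rparr>)"
    using f by (auto simp: mod_hom_def)
  then have "mod_isomorphic Z_eps M ((free_eps r)\<lparr>carrier := ?N\<rparr>)"
    unfolding mod_isomorphic_def using inj by (auto simp: bij_betw_def intro!: bexI[of _ f])
  then show ?thesis unfolding torsionless_def using N by blast
qed

section \<open>The complete resolution of a module whose additive group is free\<close>

lemma module_regular_module:
  assumes "cring R" shows "module R (regular_module R)"
proof -
  interpret cring R by fact
  have "abelian_group (regular_module R)"
    by (rule abelian_group_cong[OF abelian_group_axioms]) (simp_all add: regular_module_def)
  then show ?thesis
    by (intro moduleI assms) (simp_all add: regular_module_def l_distr r_distr m_assoc)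
qed

text \<open>The module \<open>N \<otimes> \<int>[\<epsilon>]\<close> induced from the additive group of \<open>N\<close>: pairs \<open>(u, v)\<close>, standing for
  \<open>u + \<epsilon>v\<close>, with \<open>\<epsilon>(u, v) = (0, u)\<close>. Only its projections are used, so that it can live in any universe.\<close>

locale double =
  fixes N :: "'a eps_module" (structure) and P :: "'a eps_module" and p1 p2 :: "'a \<Rightarrow> 'a"
  assumes N: "module Z_eps N" and P: "module Z_eps P"
    and p1: "p1 \<in> ahom P N" and p2: "p2 \<in> ahom P N"
    and ex1: "\<lbrakk>u \<in> carrier N; v \<in> carrier N\<rbrakk> \<Longrightarrow> \<exists>!p. p \<in> carrier P \<and> p1 p = u \<and> p2 p = v"
    and p1_ep: "p \<in> carrier P \<Longrightarrow> p1 (ep P p) = \<zero>"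
    and p2_ep: "p \<in> carrier P \<Longrightarrow> p2 (ep P p) = p1 p"
begin

sublocale N: module Z_eps N by (rule N)
sublocale P: module Z_eps P by (rule P)

text \<open>The element u + \<epsilon>v.\<close>

definition dp where "dp u v = (THE p. p \<in> carrier P \<and> p1 p = u \<and> p2 p = v)"

lemma dp:
  assumes "u \<in> carrier N" "v \<in> carrier N"
  shows dp_closed: "dp u v \<in> carrier P" and p1_dp: "p1 (dp u v) = u" and p2_dp: "p2 (dp u v) = v"
  using theI'[OF ex1[OF assms]] by (simp_all add: dp_def)

lemma p1_closed: "p \<in> carrier P \<Longrightarrow> p1 p \<in> carrier N" by (rule ahom_closed[OF p1])
lemma p2_closed: "p \<in> carrier P \<Longrightarrow> p2 p \<in> carrier N" by (rule ahom_closed[OF p2])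

lemma eqI: "\<lbrakk>p \<in> carrier P; q \<in> carrier P; p1 p = p1 q; p2 p = p2 q\<rbrakk> \<Longrightarrow> p = q"
  using ex1[of "p1 q" "p2 q"] p1_closed p2_closed by blast

lemma dp_p: "p \<in> carrier P \<Longrightarrow> dp (p1 p) (p2 p) = p"
  by (rule eqI) (simp_all add: dp p1_closed p2_closed)

lemma dp_add: "\<lbrakk>u \<in> carrier N; v \<in> carrier N; u' \<in> carrier N; v' \<in> carrier N\<rbrakk>
  \<Longrightarrow> dp (u \<oplus> u') (v \<oplus> v') = dp u v \<oplus>\<^bsub>P\<^esub> dp u' v'"
  by (rule eqI) (simp_all add: dp ahom_add[OF p1] ahom_add[OF p2])

lemma ep_dp: "\<lbrakk>u \<in> carrier N; v \<in> carrier N\<rbrakk> \<Longrightarrow> ep P (dp u v) = dp \<zero> u"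
  by (rule eqI) (simp_all add: dp p1_ep p2_ep ep_closed[OF P])

lemma dp_zero: "dp \<zero> \<zero> = \<zero>\<^bsub>P\<^esub>"
  by (rule eqI) (simp_all add: dp ahom_zero[OF p1 P.abelian_group_axioms N.abelian_group_axioms]
      ahom_zero[OF p2 P.abelian_group_axioms N.abelian_group_axioms])

lemma dp_eq_zero: "\<lbrakk>u \<in> carrier N; v \<in> carrier N\<rbrakk> \<Longrightarrow> dp u v = \<zero>\<^bsub>P\<^esub> \<longleftrightarrow> u = \<zero> \<and> v = \<zero>"
  using dp_zero p1_dp p2_dp by (metis N.zero_closed)

text \<open>A basis identifies the additive group of \<open>N\<close> with Z^r, and thereby the
  induced module with the free module of rank r; \<iota> and \<pi> express this in
  coordinates.\<close>

lemma projective: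
  assumes t: "tff N (carrier N)" shows "fg_projective Z_eps P"
proof -
  note ag = N.abelian_group_axioms
  note ca = asub_carrier[OF ag]
  obtain r :: nat and b where b: "\<And>j. j < r \<Longrightarrow> int_hom N (carrier N) (b j)"
    and ex: "\<And>v. \<exists>!x. x \<in> carrier N \<and> (\<forall>j<r. b j x = v j)"
    by (rule tff_coordinates[OF ag ca t]) blast
  note bf = int_hom_facts[OF ag ca b]
  interpret F: module Z_eps "free_eps r" by (rule module_free_module[OF cring_Z_eps])
  define w where "w v = (THE x. x \<in> carrier N \<and> (\<forall>j<r. b j x = v j))" for v
  have w: "w v \<in> carrier N" "j < r \<Longrightarrow> b j (w v) = v j" for v j
    using theI'[OF ex[of v]] by (simp_all add: w_def)
  have w_eq: "w v = x" if "x \<in> carrier N" "\<And>j. j < r \<Longrightarrow> b j x = v j" for v x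
    using ex[of v] w(1)[where v = v] w(2)[where v = v] that by blast
  define \<iota> where "\<iota> = (\<lambda>p\<in>carrier P. \<lambda>j\<in>{..<r}. ze (b j (p1 p)) (b j (p2 p)))"
  define \<pi> where "\<pi> = (\<lambda>v\<in>carrier (free_eps r). dp (w (\<lambda>j. re (v j))) (w (\<lambda>j. im (v j))))"
  have \<iota>: "\<iota> \<in> mod_hom Z_eps P (free_eps r)"
    unfolding mod_hom_Z_eps[OF P F.module_axioms]
  proof (intro conjI ballI)
    show "\<iota> \<in> ahom P (free_eps r)"
      unfolding \<iota>_def by (rule ahom_restrictI[OF P.abelian_group_axioms])
        (auto simp: free_eps_simps bf ahom_add[OF p1] ahom_add[OF p2] p1_closed p2_closed intro!: restrict_ext)
    show "\<iota> (ep P p) = ep (free_eps r) (\<iota> p)" if "p \<in> carrier P" for p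
      using that ep_closed[OF P that] bf(2) by (auto simp: \<iota>_def free_eps_simps p1_ep p2_ep intro!: restrict_ext)
  qed
  have c: "v j \<in> carrier Z_eps" if "v \<in> carrier (free_eps r)" "j < r" for v j
    using that by (auto simp: free_eps_simps)
  have \<pi>: "\<pi> \<in> mod_hom Z_eps (free_eps r) P"
    unfolding mod_hom_Z_eps[OF F.module_axioms P]
  proof (intro conjI ballI)
    show "\<pi> \<in> ahom (free_eps r) P"
      unfolding \<pi>_def
    proof (rule ahom_restrictI[OF F.abelian_group_axioms])
      fix x y assume x: "x \<in> carrier (free_eps r)" and y: "y \<in> carrier (free_eps r)"
      have "w (\<lambda>j. re ((x \<oplus>\<^bsub>free_eps r\<^esub> y) j)) = w (\<lambda>j. re (x j)) \<oplus> w (\<lambda>j. re (y j))"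
        by (rule w_eq) (simp_all add: w bf free_eps_simps(3) re_add c[OF x] c[OF y])
      moreover have "w (\<lambda>j. im ((x \<oplus>\<^bsub>free_eps r\<^esub> y) j)) = w (\<lambda>j. im (x j)) \<oplus> w (\<lambda>j. im (y j))"
        by (rule w_eq) (simp_all add: w bf free_eps_simps(3) im_add c[OF x] c[OF y])
      ultimately show "dp (w (\<lambda>j. re ((x \<oplus>\<^bsub>free_eps r\<^esub> y) j))) (w (\<lambda>j. im ((x \<oplus>\<^bsub>free_eps r\<^esub> y) j)))
        = dp (w (\<lambda>j. re (x j))) (w (\<lambda>j. im (x j))) \<oplus>\<^bsub>P\<^esub> dp (w (\<lambda>j. re (y j))) (w (\<lambda>j. im (y j)))"
        by (simp add: dp_add w)
    qed (simp add: dp_closed w)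
    fix x assume x: "x \<in> carrier (free_eps r)"
    have e: "ep (free_eps r) x j = ze 0 (re (x j))" if "j < r" for j
      using c[OF x that] ze_re_im[OF c[OF x that]] mult_Z_eps[of 0 1 "re (x j)" "im (x j)"]
      by (simp add: free_eps_simps(4) that)
    have "w (\<lambda>j. re (ep (free_eps r) x j)) = \<zero>" by (rule w_eq) (simp_all add: e bf)
    moreover have "w (\<lambda>j. im (ep (free_eps r) x j)) = w (\<lambda>j. re (x j))" by (rule w_eq) (simp_all add: e w)
    ultimately show "\<pi> (ep (free_eps r) x) = ep P (\<pi> x)"
      using x ep_closed[OF F.module_axioms x] by (simp add: \<pi>_def ep_dp w)
  qed
  have "\<pi> (\<iota> p) = p" if p: "p \<in> carrier P" for p
  proof -
    have "\<iota> p \<in> carrier (free_eps r)" by (rule ahom_closed[OF mod_hom_ahom[OF \<iota>] p])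
    moreover have "w (\<lambda>j. re (\<iota> p j)) = p1 p" by (rule w_eq) (simp_all add: \<iota>_def p p1_closed)
    moreover have "w (\<lambda>j. im (\<iota> p j)) = p2 p" by (rule w_eq) (simp_all add: \<iota>_def p p2_closed)
    ultimately show ?thesis using p by (simp add: \<pi>_def dp_p)
  qed
  then show ?thesis unfolding fg_projective_def using P \<iota> \<pi> by blast
qed

end

text \<open>The module is built on pairs and then copied into \<open>'a\<close>, which is possible
  because \<open>N\<close>, and with it the set of pairs, is countable.\<close>

lemma ex_double:
  fixes N :: "((nat \<Rightarrow> int) set, 'a::infinite) module"
  assumes N: "tmod N" obtains P p1 p2 where "double N P p1 p2" "fg_projective Z_eps P"
proof -
  have M: "module Z_eps N" and t: "tff N (carrier N)" using N by (auto simp: tmod_def)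
  interpret N: module Z_eps N by fact
  note ag = N.abelian_group_axioms
  define D :: "('a \<times> 'a) ring" where "D = \<lparr>carrier = carrier N \<times> carrier N, mult = undefined, one = undefined,
    zero = (\<zero>\<^bsub>N\<^esub>, \<zero>\<^bsub>N\<^esub>), add = (\<lambda>(u, v) (u', v'). (u \<oplus>\<^bsub>N\<^esub> u', v \<oplus>\<^bsub>N\<^esub> v'))\<rparr>"
  have Ds: "carrier D = carrier N \<times> carrier N" "\<zero>\<^bsub>D\<^esub> = (\<zero>\<^bsub>N\<^esub>, \<zero>\<^bsub>N\<^esub>)"
    "(u, v) \<oplus>\<^bsub>D\<^esub> (u', v') = (u \<oplus>\<^bsub>N\<^esub> u', v \<oplus>\<^bsub>N\<^esub> v')" for u v u' v' by (simp_all add: D_def)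
  have agD: "abelian_group D"
  proof (rule abelian_groupI)
    fix x assume "x \<in> carrier D"
    then obtain u v where x: "x = (u, v)" "u \<in> carrier N" "v \<in> carrier N" by (auto simp: Ds)
    then have "(\<ominus>\<^bsub>N\<^esub> u, \<ominus>\<^bsub>N\<^esub> v) \<oplus>\<^bsub>D\<^esub> x = \<zero>\<^bsub>D\<^esub>" by (simp add: Ds N.M.l_neg)
    then show "\<exists>y\<in>carrier D. y \<oplus>\<^bsub>D\<^esub> x = \<zero>\<^bsub>D\<^esub>"
      using x by (intro bexI[of _ "(\<ominus>\<^bsub>N\<^esub> u, \<ominus>\<^bsub>N\<^esub> v)"]) (simp_all add: Ds)
  qed (auto simp: Ds N.M.a_ac)
  define E where "E = emod D (\<lambda>(u, v). (\<zero>\<^bsub>N\<^esub>, u))"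
  have E: "module Z_eps E" and epE: "x \<in> carrier D \<Longrightarrow> ep E x = (case x of (u, v) \<Rightarrow> (\<zero>\<^bsub>N\<^esub>, u))" for x
    unfolding E_def by (rule module_emod[OF agD]; auto simp: Ds)+
  have Es: "carrier E = carrier N \<times> carrier N" "\<zero>\<^bsub>E\<^esub> = (\<zero>\<^bsub>N\<^esub>, \<zero>\<^bsub>N\<^esub>)" "add E = add D"
    by (simp_all add: E_def Ds)
  have "countable (carrier N)" by (rule countable_tff[OF ag asub_carrier[OF ag] t])
  then have "countable (carrier E)" by (simp add: Es)
  then obtain e :: "'a \<times> 'a \<Rightarrow> 'a" where e: "inj_on e (carrier E)" using ex_inj_on_infinite by blast
  define P where "P = transport e E"
  have P: "module Z_eps P" unfolding P_def by (rule module_transport[OF E e])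
  note ts = transport_simps[OF e, folded P_def]
  define p1 where "p1 = (\<lambda>y\<in>carrier P. fst (inv_into (carrier E) e y))"
  define p2 where "p2 = (\<lambda>y\<in>carrier P. snd (inv_into (carrier E) e y))"
  have pe: "p1 (e (u, v)) = u" "p2 (e (u, v)) = v" "e (u, v) \<in> carrier P" if "u \<in> carrier N" "v \<in> carrier N" for u v
    using that e by (simp_all add: p1_def p2_def ts Es)
  have Pc: "\<exists>u v. u \<in> carrier N \<and> v \<in> carrier N \<and> y = e (u, v)" if "y \<in> carrier P" for y
    using that by (auto simp: ts Es)
  have add: "e (u, v) \<oplus>\<^bsub>P\<^esub> e (u', v') = e (u \<oplus>\<^bsub>N\<^esub> u', v \<oplus>\<^bsub>N\<^esub> v')"
    if "u \<in> carrier N" "v \<in> carrier N" "u' \<in> carrier N" "v' \<in> carrier N" for u v u' v'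
    using that by (simp add: ts(3) Es Ds)
  have epP: "ep P (e (u, v)) = e (\<zero>\<^bsub>N\<^esub>, u)" if "u \<in> carrier N" "v \<in> carrier N" for u v
    using ts(4)[of "(u, v)" "ze 0 1"] that epE[of "(u, v)"] by (simp add: ep_def Es Ds)
  have dbl: "double N P p1 p2"
  proof (rule double.intro[OF M P])
    show "p1 \<in> ahom P N"
    proof (rule ahomI)
      show "p1 \<in> extensional (carrier P)" by (simp add: p1_def)
    qed (auto simp: pe add dest!: Pc)
    show "p2 \<in> ahom P N"
    proof (rule ahomI)
      show "p2 \<in> extensional (carrier P)" by (simp add: p2_def)
    qed (auto simp: pe add dest!: Pc)
    show "\<exists>!p. p \<in> carrier P \<and> p1 p = u \<and> p2 p = v" if "u \<in> carrier N" "v \<in> carrier N" for u v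
      using that by (intro ex1I[of _ "e (u, v)"]) (auto simp: pe dest!: Pc)
    show "p1 (ep P p) = \<zero>\<^bsub>N\<^esub>" if "p \<in> carrier P" for p
      using Pc[OF that] by (auto simp: epP pe)
    show "p2 (ep P p) = p1 p" if "p \<in> carrier P" for p
      using Pc[OF that] by (auto simp: epP pe)
  qed
  show ?thesis
    using that[OF dbl double.projective[OF dbl t]] .
qed

context double
begin

text \<open>The formula is multiplication by e + \<epsilon>, where \<open>e\<close> acts on
  \<open>N\<close> and \<epsilon> on the new factor: u + \<epsilon>v is sent to e(u) + \<epsilon>(u
  + e(v)).\<close>

lemma twist_hom:
  assumes eN: "\<And>x. x \<in> carrier N \<Longrightarrow> e x \<in> carrier N"
    and eadd: "\<And>x y. \<lbrakk>x \<in> carrier N; y \<in> carrier N\<rbrakk> \<Longrightarrow> e (x \<oplus> y) = e x \<oplus> e y"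
    and e0: "e \<zero> = \<zero>"
  shows "(\<lambda>p\<in>carrier P. dp (e (p1 p)) (p1 p \<oplus> e (p2 p))) \<in> mod_hom Z_eps P P"
  unfolding mod_hom_Z_eps[OF P P]
proof (intro conjI ballI)
  show "(\<lambda>p\<in>carrier P. dp (e (p1 p)) (p1 p \<oplus> e (p2 p))) \<in> ahom P P"
  proof (rule ahom_restrictI[OF P.abelian_group_axioms])
    fix p q assume pq: "p \<in> carrier P" "q \<in> carrier P"
    note c = p1_closed[OF pq(1)] p1_closed[OF pq(2)] p2_closed[OF pq(1)] p2_closed[OF pq(2)]
    show "dp (e (p1 (p \<oplus>\<^bsub>P\<^esub> q))) (p1 (p \<oplus>\<^bsub>P\<^esub> q) \<oplus> e (p2 (p \<oplus>\<^bsub>P\<^esub> q)))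
      = dp (e (p1 p)) (p1 p \<oplus> e (p2 p)) \<oplus>\<^bsub>P\<^esub> dp (e (p1 q)) (p1 q \<oplus> e (p2 q))"
      by (simp add: ahom_add[OF p1 pq] ahom_add[OF p2 pq] c eN eadd dp_add[symmetric] N.M.a_ac)
  qed (simp add: dp_closed p1_closed p2_closed eN)
  fix p assume p: "p \<in> carrier P"
  show "(\<lambda>p\<in>carrier P. dp (e (p1 p)) (p1 p \<oplus> e (p2 p))) (ep P p)
    = ep P ((\<lambda>p\<in>carrier P. dp (e (p1 p)) (p1 p \<oplus> e (p2 p))) p)"
    using p by (simp add: ep_closed[OF P] p1_ep p2_ep e0 ep_dp p1_closed p2_closed eN)
qed

text \<open>Here \<open>d\<close> is multiplication by \<epsilon> + e and \<open>d'\<close>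
  multiplication by \<epsilon> - e, so their composite is \<epsilon>^2 - e^2 = 0. Exactness of the
  complex and of its dual is shown at one place; the neighbouring place is the same statement with
  \<open>e\<close> replaced by its negative.\<close>

lemma twist_exact:
  assumes eN: "\<And>x. x \<in> carrier N \<Longrightarrow> e x \<in> carrier N"
    and eneg: "\<And>x. x \<in> carrier N \<Longrightarrow> e (\<ominus> x) = \<ominus> e x"
    and eadd: "\<And>x y. \<lbrakk>x \<in> carrier N; y \<in> carrier N\<rbrakk> \<Longrightarrow> e (x \<oplus> y) = e x \<oplus> e y"
    and ee: "\<And>x. x \<in> carrier N \<Longrightarrow> e (e x) = \<zero>" and e0: "e \<zero> = \<zero>"
  defines "d \<equiv> (\<lambda>p\<in>carrier P. dp (e (p1 p)) (p1 p \<oplus> e (p2 p)))"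
    and "d' \<equiv> (\<lambda>p\<in>carrier P. dp (\<ominus> e (p1 p)) (p1 p \<oplus> \<ominus> e (p2 p)))"
  shows "{p \<in> carrier P. d p = \<zero>\<^bsub>P\<^esub>} = d' ` carrier P"
    and "{p \<in> carrier P. d p = \<zero>\<^bsub>P\<^esub>} = {p \<in> carrier P. p1 p = \<ominus> e (p2 p)}"
    and "{\<phi> \<in> mod_hom Z_eps P Lam. compose (carrier P) \<phi> d' = (\<lambda>x\<in>carrier P. \<zero>\<^bsub>Z_eps\<^esub>)}
          = (\<lambda>\<psi>. compose (carrier P) \<psi> d) ` mod_hom Z_eps P Lam"
proof -
  note c = p1_closed p2_closed eN
  have d: "p \<in> carrier P \<Longrightarrow> d p = dp (e (p1 p)) (p1 p \<oplus> e (p2 p))"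
    and d': "p \<in> carrier P \<Longrightarrow> d' p = dp (\<ominus> e (p1 p)) (p1 p \<oplus> \<ominus> e (p2 p))" for p
    by (simp_all add: d_def d'_def)
  have dc: "p \<in> carrier P \<Longrightarrow> d p \<in> carrier P" and dc': "p \<in> carrier P \<Longrightarrow> d' p \<in> carrier P" for p
    by (simp_all add: d d' dp_closed c)
  have mz: "\<ominus> \<zero> = \<zero>" by (rule N.M.minus_equality) simp_all
  show K: "{p \<in> carrier P. d p = \<zero>\<^bsub>P\<^esub>} = {p \<in> carrier P. p1 p = \<ominus> e (p2 p)}"
  proof (intro Collect_cong conj_cong refl)
    fix p assume p: "p \<in> carrier P"
    have "p1 p \<oplus> e (p2 p) = \<zero> \<longleftrightarrow> p1 p = \<ominus> e (p2 p)"
      using c(1)[OF p] c(3)[OF c(2)[OF p]] N.M.minus_equality N.M.l_neg by metis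
    moreover have "e (p1 p) = \<zero>" if "p1 p = \<ominus> e (p2 p)"
      using that p by (simp add: eneg c ee)
    ultimately show "d p = \<zero>\<^bsub>P\<^esub> \<longleftrightarrow> p1 p = \<ominus> e (p2 p)"
      using p by (auto simp: d dp_eq_zero c)
  qed
  show "{p \<in> carrier P. d p = \<zero>\<^bsub>P\<^esub>} = d' ` carrier P"
    unfolding K
  proof (intro subset_antisym subsetI)
    fix p assume "p \<in> {p \<in> carrier P. p1 p = \<ominus> e (p2 p)}"
    then have p: "p \<in> carrier P" "p1 p = \<ominus> e (p2 p)" by auto
    \<comment> \<open>An element of the kernel has the form -e(v) + \<epsilon>v, and this is the
      value of \<open>d'\<close> at v.\<close>
    let ?q = "dp (p2 p) \<zero>"
    have "d' ?q = p"
      by (rule eqI) (use p in \<open>simp_all add: d' dp c e0\<close>)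
    then show "p \<in> d' ` carrier P" using p by (metis dp_closed p2_closed N.zero_closed imageI)
  next
    fix p assume "p \<in> d' ` carrier P"
    then obtain q where q: "q \<in> carrier P" "p = d' q" by blast
    then show "p \<in> {p \<in> carrier P. p1 p = \<ominus> e (p2 p)}"
      by (simp add: d' dp c eneg eadd ee mz)
  qed
  have R: "module Z_eps Lam" by (rule module_regular_module[OF cring_Z_eps])
  have Rs: "carrier Lam = carrier Z_eps" "add Lam = add Z_eps"
    "ep Lam z = ze 0 1 \<otimes>\<^bsub>Z_eps\<^esub> z" for z by (simp_all add: regular_module_def ep_def)
  have dd: "d (d' p) = \<zero>\<^bsub>P\<^esub>" if p: "p \<in> carrier P" for p
  proof -
    have "d' p \<in> {p \<in> carrier P. p1 p = \<ominus> e (p2 p)}"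
      using p by (simp add: d' dp c eneg eadd ee mz)
    then show ?thesis unfolding K[symmetric] by simp
  qed
  have dh: "d \<in> mod_hom Z_eps P P" unfolding d_def by (rule twist_hom[OF eN eadd e0])
  show "{\<phi> \<in> mod_hom Z_eps P Lam. compose (carrier P) \<phi> d' = (\<lambda>x\<in>carrier P. \<zero>\<^bsub>Z_eps\<^esub>)}
          = (\<lambda>\<psi>. compose (carrier P) \<psi> d) ` mod_hom Z_eps P Lam"
  proof (intro subset_antisym subsetI)
    fix \<phi> assume "\<phi> \<in> (\<lambda>\<psi>. compose (carrier P) \<psi> d) ` mod_hom Z_eps P Lam"
    then obtain \<psi> where \<psi>: "\<psi> \<in> mod_hom Z_eps P Lam" "\<phi> = compose (carrier P) \<psi> d" by blast
    interpret R: module Z_eps "Lam" by (rule R)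
    have "\<psi> \<zero>\<^bsub>P\<^esub> = \<zero>\<^bsub>Z_eps\<^esub>"
      using ahom_zero[OF mod_hom_ahom[OF \<psi>(1)] P.abelian_group_axioms R.abelian_group_axioms] by (simp add: regular_module_def)
    then have "compose (carrier P) \<phi> d' = (\<lambda>x\<in>carrier P. \<zero>\<^bsub>Z_eps\<^esub>)"
      unfolding \<psi>(2) compose_def by (intro restrict_ext) (simp add: dc' dd)
    then show "\<phi> \<in> {\<phi> \<in> mod_hom Z_eps P Lam. compose (carrier P) \<phi> d' = (\<lambda>x\<in>carrier P. \<zero>\<^bsub>Z_eps\<^esub>)}"
      using mod_hom_compose[OF dh \<psi>(1) P] \<psi>(2) by simp
  next
    fix \<phi> assume "\<phi> \<in> {\<phi> \<in> mod_hom Z_eps P Lam. compose (carrier P) \<phi> d' = (\<lambda>x\<in>carrier P. \<zero>\<^bsub>Z_eps\<^esub>)}"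
    then have \<phi>: "\<phi> \<in> mod_hom Z_eps P Lam" "compose (carrier P) \<phi> d' = (\<lambda>x\<in>carrier P. \<zero>\<^bsub>Z_eps\<^esub>)" by auto
    have \<phi>a: "\<phi> \<in> ahom P Lam" and \<phi>e: "\<And>p. p \<in> carrier P \<Longrightarrow> \<phi> (ep P p) = ze 0 1 \<otimes>\<^bsub>Z_eps\<^esub> \<phi> p"
      using \<phi>(1) mod_hom_Z_eps[OF P R] by (auto simp: Rs)
    have \<phi>c: "\<phi> p \<in> carrier Z_eps" if "p \<in> carrier P" for p using ahom_closed[OF \<phi>a that] by (simp add: Rs)
    have \<phi>add: "\<phi> (p \<oplus>\<^bsub>P\<^esub> q) = \<phi> p \<oplus>\<^bsub>Z_eps\<^esub> \<phi> q" if "p \<in> carrier P" "q \<in> carrier P" for p q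
      using ahom_add[OF \<phi>a that] by (simp add: Rs)
    \<comment> \<open>A linear map is determined by its values \<alpha>(u) + \<beta>(u)\<epsilon> at
      the elements u of \<open>N\<close>, where \<alpha> and \<beta> are additive.\<close>
    define \<alpha> where "\<alpha> u = re (\<phi> (dp u \<zero>))" for u
    define \<beta> where "\<beta> u = im (\<phi> (dp u \<zero>))" for u
    have A: "\<phi> (dp u \<zero>) = ze (\<alpha> u) (\<beta> u)" if "u \<in> carrier N" for u
      using ze_re_im[OF \<phi>c[OF dp_closed[OF that N.zero_closed]]] by (simp add: \<alpha>_def \<beta>_def)
    have B: "\<phi> (dp u v) = ze (\<alpha> u) (\<beta> u + \<alpha> v)" if "u \<in> carrier N" "v \<in> carrier N" for u v
    proof -
      have "dp u v = dp u \<zero> \<oplus>\<^bsub>P\<^esub> ep P (dp v \<zero>)"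
        using that dp_add[of u "\<zero>" "\<zero>" v] by (simp add: ep_dp)
      then show ?thesis using that A[of u] A[of v]
        by (simp add: \<phi>add dp_closed ep_closed[OF P] \<phi>e)
    qed
    have \<alpha>add: "\<alpha> (u \<oplus> v) = \<alpha> u + \<alpha> v" and \<beta>add: "\<beta> (u \<oplus> v) = \<beta> u + \<beta> v" if "u \<in> carrier N" "v \<in> carrier N" for u v
      using that dp_add[of u "\<zero>" v "\<zero>"] A[of u] A[of v] A[of "u \<oplus> v"]
      by (simp_all add: \<phi>add dp_closed)
    have \<beta>0: "\<beta> \<zero> = 0" using \<beta>add[of "\<zero>" "\<zero>"] by simp
    have \<beta>neg: "\<beta> (\<ominus> u) = - \<beta> u" if "u \<in> carrier N" for u
      using \<beta>add[of "\<ominus> u" u] that by (simp add: N.M.l_neg \<beta>0)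
    \<comment> \<open>That \<phi> vanishes on the image of \<open>d'\<close> means that \<alpha> is
      \<beta> after \<open>e\<close>, so \<beta> alone determines \<phi>.\<close>
    have \<alpha>\<beta>: "\<alpha> u = \<beta> (e u)" if u: "u \<in> carrier N" for u
    proof -
      have "\<phi> (d' (dp u \<zero>)) = ze 0 0"
        using fun_cong[OF \<phi>(2), of "dp u \<zero>"] dp_closed[OF u] by (simp add: compose_def zero_Z_eps)
      moreover have "d' (dp u \<zero>) = dp (\<ominus> e u) u" using u by (simp add: d' dp e0 eN mz)
      ultimately show ?thesis using u by (simp add: B eN \<beta>neg)
    qed
    \<comment> \<open>The linear extension of \<beta>. On the image of u + \<epsilon>v under
      \<open>d\<close> its coefficients are \<beta>(e(u)) and \<beta>(u) + \<beta>(e(v)), which are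
      those of \<phi>.\<close>
    define \<psi> where "\<psi> = (\<lambda>p\<in>carrier P. ze (\<beta> (p1 p)) (\<beta> (p2 p)))"
    have "\<psi> \<in> mod_hom Z_eps P Lam"
      unfolding mod_hom_Z_eps[OF P R]
    proof (intro conjI ballI)
      show "\<psi> \<in> ahom P Lam"
        unfolding \<psi>_def by (rule ahom_restrictI[OF P.abelian_group_axioms])
          (simp_all add: Rs ahom_add[OF p1] ahom_add[OF p2] \<beta>add p1_closed p2_closed)
      show "\<psi> (ep P p) = ep Lam (\<psi> p)" if "p \<in> carrier P" for p
        using that by (simp add: \<psi>_def Rs ep_closed[OF P] p1_ep p2_ep \<beta>0)
    qed
    moreover have "\<phi> = compose (carrier P) \<psi> d"
    proof (rule extensionalityI[OF ahom_extensional[OF \<phi>a]])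
      show "compose (carrier P) \<psi> d \<in> extensional (carrier P)" by (simp add: compose_def)
      fix p assume p: "p \<in> carrier P"
      have "\<phi> p = ze (\<alpha> (p1 p)) (\<beta> (p1 p) + \<alpha> (p2 p))" using B[OF p1_closed[OF p] p2_closed[OF p]] by (simp add: dp_p p)
      also have "\<dots> = \<psi> (d p)"
        using p dc[OF p] by (simp add: \<psi>_def d dp c \<beta>add \<alpha>\<beta>)
      finally show "\<phi> p = compose (carrier P) \<psi> d p" using p by (simp add: compose_def)
    qed
    ultimately show "\<phi> \<in> (\<lambda>\<psi>. compose (carrier P) \<psi> d) ` mod_hom Z_eps P Lam" by blast
  qed
qed

end

text \<open>The resolution has period two, with differentials \<epsilon> + e and \<epsilon> - e for
  \<open>e\<close> the action of \<epsilon> on \<open>M\<close>. The kernel of the latter consists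
  of the pairs (\<epsilon>m, m) and is therefore a copy of \<open>M\<close>.\<close>

lemma tmod_Gorenstein_projective:
  fixes M :: "((nat \<Rightarrow> int) set, 'a::infinite) module"
  assumes "tmod M" shows "M \<in> Gorenstein_projective Z_eps"
proof -
  obtain P p1 p2 where "double M P p1 p2" and proj: "fg_projective Z_eps P" using ex_double[OF assms] by blast
  then interpret double M P p1 p2 by simp
  note e = ep_closed[OF N] ep_neg[OF N] ep_add[OF N] ep_ep[OF N] ep_zero[OF N]
  define d1 where "d1 = (\<lambda>p\<in>carrier P. dp (ep M (p1 p)) (p1 p \<oplus>\<^bsub>M\<^esub> ep M (p2 p)))"
  define d0 where "d0 = (\<lambda>p\<in>carrier P. dp (\<ominus>\<^bsub>M\<^esub> ep M (p1 p)) (p1 p \<oplus>\<^bsub>M\<^esub> \<ominus>\<^bsub>M\<^esub> ep M (p2 p)))"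
  have h1: "d1 \<in> mod_hom Z_eps P P"
    unfolding d1_def by (rule twist_hom) (simp_all add: e)
  have h0: "d0 \<in> mod_hom Z_eps P P"
    unfolding d0_def by (rule twist_hom) (simp_all add: e N.M.minus_add)
  \<comment> \<open>With the double negation \<open>d1\<close> is the counterpart of
    \<open>d0\<close> in \<open>twist_exact\<close> for the negative of \<open>e\<close>, so that
    lemma applies with the two differentials exchanged.\<close>
  have d1': "d1 = (\<lambda>p\<in>carrier P. dp (\<ominus>\<^bsub>M\<^esub> (\<ominus>\<^bsub>M\<^esub> ep M (p1 p))) (p1 p \<oplus>\<^bsub>M\<^esub> \<ominus>\<^bsub>M\<^esub> (\<ominus>\<^bsub>M\<^esub> ep M (p2 p))))"
    unfolding d1_def by (rule restrict_ext) (simp add: e p1_closed p2_closed)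
  have x1: "{p \<in> carrier P. d1 p = \<zero>\<^bsub>P\<^esub>} = d0 ` carrier P"
    "{\<phi> \<in> mod_hom Z_eps P Lam. compose (carrier P) \<phi> d0 = (\<lambda>x\<in>carrier P. \<zero>\<^bsub>Z_eps\<^esub>)}
          = (\<lambda>\<psi>. compose (carrier P) \<psi> d1) ` mod_hom Z_eps P Lam"
    unfolding d1_def d0_def by (rule twist_exact(1,3)[of "ep M"]; simp add: e)+
  have x0: "{p \<in> carrier P. d0 p = \<zero>\<^bsub>P\<^esub>} = d1 ` carrier P"
    "{p \<in> carrier P. d0 p = \<zero>\<^bsub>P\<^esub>} = {p \<in> carrier P. p1 p = \<ominus>\<^bsub>M\<^esub> (\<ominus>\<^bsub>M\<^esub> ep M (p2 p))}"
    "{\<phi> \<in> mod_hom Z_eps P Lam. compose (carrier P) \<phi> d1 = (\<lambda>x\<in>carrier P. \<zero>\<^bsub>Z_eps\<^esub>)}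
          = (\<lambda>\<psi>. compose (carrier P) \<psi> d0) ` mod_hom Z_eps P Lam"
    unfolding d1' d0_def by (rule twist_exact[of "\<lambda>x. \<ominus>\<^bsub>M\<^esub> ep M x"]; simp add: e N.M.minus_add)+
  define Ps where "Ps = (\<lambda>n::int. P)"
  define ds where "ds n = (if even n then d0 else d1)" for n :: int
  have cr: "complete_resolution Z_eps Ps ds"
    unfolding complete_resolution_def Ps_def ds_def using proj h0 h1 x0 x1 by simp
  let ?K = "{p \<in> carrier P. d0 p = \<zero>\<^bsub>P\<^esub>}"
  have K: "?K = {p \<in> carrier P. p1 p = ep M (p2 p)}"
    unfolding x0(2) by (auto simp: e p2_closed)
  define f where "f = (\<lambda>m\<in>carrier M. dp (ep M m) m)"
  have fh: "f \<in> mod_hom Z_eps M P"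
    unfolding mod_hom_Z_eps[OF N P]
  proof (intro conjI ballI)
    show "f \<in> ahom M P" unfolding f_def
      by (rule ahom_restrictI[OF N.abelian_group_axioms]) (simp_all add: dp_closed e dp_add)
    show "f (ep M x) = ep P (f x)" if "x \<in> carrier M" for x using that by (simp add: f_def e ep_dp)
  qed
  have fK: "f m \<in> ?K" if "m \<in> carrier M" for m
    unfolding K using that by (simp add: f_def dp e)
  have bij: "bij_betw f (carrier M) ?K"
    unfolding bij_betw_def
  proof (intro conjI inj_onI subset_antisym subsetI)
    show "x = y" if "x \<in> carrier M" "y \<in> carrier M" "f x = f y" for x y
      using that(1,2) arg_cong[OF that(3), of p2] by (simp add: f_def dp e)
    show "p \<in> f ` carrier M" if "p \<in> ?K" for p
    proof -
      have "p \<in> carrier P" "p1 p = ep M (p2 p)" using that unfolding K by auto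
      then have "f (p2 p) = p" using dp_p[of p] by (simp add: f_def p2_closed)
      then show ?thesis using p2_closed[OF \<open>p \<in> carrier P\<close>] by (metis imageI)
    qed
  qed (use fK in blast)
  have "f \<in> mod_hom Z_eps M (P\<lparr>carrier := ?K\<rparr>)"
    using fh fK by (auto simp: mod_hom_def)
  then have "mod_isomorphic Z_eps M ((Ps 0)\<lparr>carrier := {x \<in> carrier (Ps 0). ds 0 x = \<zero>\<^bsub>Ps 1\<^esub>}\<rparr>)"
    unfolding mod_isomorphic_def Ps_def ds_def using bij by (auto intro!: bexI[of _ f])
  then show ?thesis unfolding Gorenstein_projective_def using cr by blast
qed

text \<open>The classes agree on finitely generated modules, and a class enters
  \<open>stable_cat\<close> only through the objects; so the categories are equal and not merely
  equivalent. An infinite \<open>'a\<close> has room for the resolutions.\<close>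

lemma stable_Gorenstein_projective_eq:
  "stable_cat Z_eps (Gorenstein_projective Z_eps :: (_, 'a::infinite) module set)
   = stable_cat Z_eps (torsionless Z_eps :: (_, 'a) module set)"
proof -
  have "M \<in> Gorenstein_projective Z_eps \<longleftrightarrow> M \<in> torsionless Z_eps"
    if "fg_module Z_eps M" for M :: "(_, 'a) module"
    using that Gorenstein_projective_tmod torsionless_tmod tmod_torsionless tmod_Gorenstein_projective
    by (auto simp: fg_module_def)
  then have "Obj (mod_cat Z_eps) \<inter> Gorenstein_projective Z_eps
      = (Obj (mod_cat Z_eps) \<inter> torsionless Z_eps :: (_, 'a) module set)"
    by (auto simp: mod_cat_def)
  then show ?thesis by (simp add: stable_cat_def full_subcat_def)
qed

lemma subgroup_add_monoidI:
  fixes H (structure)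
  assumes "abelian_group H" "I \<subseteq> carrier H" "\<zero> \<in> I" "\<And>x y. \<lbrakk>x \<in> I; y \<in> I\<rbrakk> \<Longrightarrow> x \<oplus> y \<in> I"
    and "\<And>x. x \<in> I \<Longrightarrow> \<exists>y\<in>I. y \<oplus> x = \<zero>"
  shows "subgroup I (add_monoid H)"
proof -
  interpret abelian_group H by fact
  have inv: "\<ominus> x \<in> I" if x: "x \<in> I" for x
  proof -
    obtain y where "y \<in> I" "y \<oplus> x = \<zero>" using assms(5)[OF x] by blast
    then show ?thesis using minus_equality[of y x] assms(2) x by auto
  qed
  show ?thesis
    using assms inv by (intro subgroup.intro) (auto simp: a_inv_def)
qed

section \<open>The stable category as a homotopy category\<close>

text \<open>The null-homotopic maps when \<epsilon> is regarded as a differential on each module,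
  without grading and without sign.\<close>

definition null_maps where
  "null_maps M N = {f \<in> mod_hom Z_eps M N. \<exists>h \<in> ahom M N. \<forall>x\<in>carrier M. f x = ep N (h x) \<oplus>\<^bsub>N\<^esub> h (ep M x)}"

lemma null_mapsI:
  assumes "f \<in> mod_hom Z_eps M N" "h \<in> ahom M N" "\<And>x. x \<in> carrier M \<Longrightarrow> f x = ep N (h x) \<oplus>\<^bsub>N\<^esub> h (ep M x)"
  shows "f \<in> null_maps M N"
  using assms unfolding null_maps_def by blast

lemma null_mapsE:
  assumes "f \<in> null_maps M N"
  obtains h where "f \<in> mod_hom Z_eps M N" "h \<in> ahom M N" "\<forall>x\<in>carrier M. f x = ep N (h x) \<oplus>\<^bsub>N\<^esub> h (ep M x)"
  using assms unfolding null_maps_def by blast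

text \<open>On a free module let k send a + b\<epsilon> to b in each entry. Then \<epsilon>k yields
  b\<epsilon>, and k\<epsilon> yields a, since \<epsilon>(a + b\<epsilon>) = a\<epsilon>; the sum is
  the identity. On a summand this k is composed with inclusion and projection, which commute with
  \<epsilon>.\<close>

lemma projective_contraction:
  assumes "fg_projective Z_eps P"
  obtains k where "k \<in> ahom P P" "\<And>p. p \<in> carrier P \<Longrightarrow> p = ep P (k p) \<oplus>\<^bsub>P\<^esub> k (ep P p)"
proof -
  obtain n \<iota> \<pi> where P: "module Z_eps P" and \<iota>: "\<iota> \<in> mod_hom Z_eps P (free_eps n)"
    and \<pi>: "\<pi> \<in> mod_hom Z_eps (free_eps n) P" "\<forall>x\<in>carrier P. \<pi> (\<iota> x) = x"
    using assms by (auto simp: fg_projective_def)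
  interpret F: module Z_eps "free_eps n" by (rule module_free_module[OF cring_Z_eps])
  interpret P: module Z_eps P by fact
  note F = F.module_axioms
  have c: "v j \<in> carrier Z_eps" if "v \<in> carrier (free_eps n)" "j \<in> {..<n}" for v j
    using that by (auto simp: free_eps_simps)
  define k0 where "k0 = (\<lambda>v\<in>carrier (free_eps n). \<lambda>i\<in>{..<n}. ze (im (v i)) 0)"
  have k0c: "k0 v \<in> carrier (free_eps n)" if "v \<in> carrier (free_eps n)" for v
    using that unfolding k0_def by (simp add: free_eps_simps(1))
  have k0: "k0 \<in> ahom (free_eps n) (free_eps n)"
  proof (rule ahomI[OF k0c])
    fix v w assume v: "v \<in> carrier (free_eps n)" and w: "w \<in> carrier (free_eps n)"
    then have vw: "v \<oplus>\<^bsub>free_eps n\<^esub> w \<in> carrier (free_eps n)" by simp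
    have k0v: "k0 v = (\<lambda>i\<in>{..<n}. ze (im (v i)) 0)" if "v \<in> carrier (free_eps n)" for v
      using that by (simp add: k0_def)
    show "k0 (v \<oplus>\<^bsub>free_eps n\<^esub> w) = k0 v \<oplus>\<^bsub>free_eps n\<^esub> k0 w"
      unfolding k0v[OF v] k0v[OF w] k0v[OF vw]
      unfolding free_eps_simps(3)
      by (rule restrict_ext) (simp add: im_add c[OF v] c[OF w])
  next
    show "k0 \<in> extensional (carrier (free_eps n))" unfolding k0_def by (rule restrict_extensional)
  qed
  have k0_eq: "v = ep (free_eps n) (k0 v) \<oplus>\<^bsub>free_eps n\<^esub> k0 (ep (free_eps n) v)" if v: "v \<in> carrier (free_eps n)" for v
  proof -
    have e: "ep (free_eps n) v i = ze 0 (re (v i))" if "i \<in> {..<n}" for i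
      using ze_re_im[OF c[OF v that]] mult_Z_eps[of 0 1 "re (v i)" "im (v i)"] that
      by (simp add: free_eps_simps(4))
    show ?thesis
      unfolding free_eps_simps(3)
    proof (rule PiE_restrict_eqI[symmetric])
      show "v \<in> {..<n} \<rightarrow>\<^sub>E carrier Z_eps" using v by (simp add: free_eps_simps(1))
      fix i assume i: "i \<in> {..<n}"
      have "ep (free_eps n) (k0 v) i = ze 0 (im (v i))"
        using v i by (simp add: free_eps_simps(4) k0_def)
      moreover have "k0 (ep (free_eps n) v) i = ze (re (v i)) 0"
        using ep_closed[OF F v] i e[OF i] by (simp add: k0_def)
      ultimately show "ep (free_eps n) (k0 v) i \<oplus>\<^bsub>Z_eps\<^esub> k0 (ep (free_eps n) v) i = v i"
        using ze_re_im[OF c[OF v i]] by simp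
    qed
  qed
  note \<iota>a = mod_hom_ahom[OF \<iota>] and \<pi>a = mod_hom_ahom[OF \<pi>(1)]
  have e\<iota>: "\<iota> (ep P p) = ep (free_eps n) (\<iota> p)" if "p \<in> carrier P" for p using \<iota> mod_hom_Z_eps[OF P F] that by blast
  have e\<pi>: "\<pi> (ep (free_eps n) v) = ep P (\<pi> v)" if "v \<in> carrier (free_eps n)" for v using \<pi>(1) mod_hom_Z_eps[OF F P] that by blast
  define k where "k = (\<lambda>p\<in>carrier P. \<pi> (k0 (\<iota> p)))"
  note cl = ahom_closed[OF \<iota>a] k0c ahom_closed[OF \<pi>a]
  show ?thesis
  proof (rule that)
    show "k \<in> ahom P P" unfolding k_def
      by (rule ahom_restrictI[OF P.abelian_group_axioms]) (simp_all add: cl ahom_add[OF \<iota>a] ahom_add[OF k0] ahom_add[OF \<pi>a])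
    fix p assume p: "p \<in> carrier P"
    have "p = \<pi> (ep (free_eps n) (k0 (\<iota> p)) \<oplus>\<^bsub>free_eps n\<^esub> k0 (ep (free_eps n) (\<iota> p)))"
      using \<pi>(2) p k0_eq[of "\<iota> p"] cl(1)[OF p] by simp
    also have "\<dots> = ep P (k p) \<oplus>\<^bsub>P\<^esub> k (ep P p)"
      using p cl ep_closed[OF F] ep_closed[OF P p] by (simp add: k_def ahom_add[OF \<pi>a] e\<pi> e\<iota>)
    finally show "p = ep P (k p) \<oplus>\<^bsub>P\<^esub> k (ep P p)" .
  qed
qed

text \<open>A contraction of the projective in the middle becomes a homotopy when composed with the
  two outer maps. Conversely a homotopy \<open>h\<close> factors its map through the module induced
  from \<open>N\<close>: m goes to the pair (h(\<epsilon>m), h(m)), and a pair (u, v) goes to u +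
  \<epsilon>v computed in \<open>N\<close>.\<close>

lemma factoring_eq_null_maps:
  fixes M N :: "((nat \<Rightarrow> int) set, 'a::infinite) module"
  assumes M: "module Z_eps M" and N: "tmod N"
  shows "factoring_through_projective Z_eps M N = null_maps M N"
proof -
  have mN: "module Z_eps N" using N by (simp add: tmod_def)
  interpret M: module Z_eps M by fact
  interpret N: module Z_eps N by (rule mN)
  show ?thesis
  proof (intro subset_antisym subsetI)
    fix f assume "f \<in> factoring_through_projective Z_eps M N"
    then obtain g h and P :: "'a eps_module" where f: "f = compose (carrier M) h g"
      and P: "fg_projective Z_eps P" and g: "g \<in> mod_hom Z_eps M P" and h: "h \<in> mod_hom Z_eps P N"
      unfolding factoring_through_projective_def by blast
    have mP: "module Z_eps P" using P by (simp add: fg_projective_def)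
    interpret P: module Z_eps P by (rule mP)
    obtain k where k: "k \<in> ahom P P" "\<And>p. p \<in> carrier P \<Longrightarrow> p = ep P (k p) \<oplus>\<^bsub>P\<^esub> k (ep P p)"
      by (rule projective_contraction[OF P]) blast
    have ga: "g \<in> ahom M P" "\<And>x. x \<in> carrier M \<Longrightarrow> g (ep M x) = ep P (g x)"
      and ha: "h \<in> ahom P N" "\<And>x. x \<in> carrier P \<Longrightarrow> h (ep P x) = ep N (h x)"
      using g h mod_hom_Z_eps[OF M mP] mod_hom_Z_eps[OF mP mN] by blast+
    note cl = ahom_closed[OF ga(1)] ahom_closed[OF ha(1)] ahom_closed[OF k(1)]
    show "f \<in> null_maps M N"
    proof (rule null_mapsI)
      show "f \<in> mod_hom Z_eps M N" unfolding f by (rule mod_hom_compose[OF g h M])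
      show "(\<lambda>x\<in>carrier M. h (k (g x))) \<in> ahom M N"
        by (rule ahom_restrictI[OF M.abelian_group_axioms]) (simp_all add: cl ahom_add[OF ga(1)] ahom_add[OF ha(1)] ahom_add[OF k(1)])
      fix x assume x: "x \<in> carrier M"
      have "f x = h (g x)" using x by (simp add: f compose_def)
      also have "\<dots> = h (ep P (k (g x)) \<oplus>\<^bsub>P\<^esub> k (ep P (g x)))" using k(2)[OF cl(1)[OF x]] by simp
      also have "\<dots> = ep N ((\<lambda>x\<in>carrier M. h (k (g x))) x) \<oplus>\<^bsub>N\<^esub> (\<lambda>x\<in>carrier M. h (k (g x))) (ep M x)"
        using x cl ep_closed[OF mP] ep_closed[OF M x] by (simp add: ahom_add[OF ha(1)] ha(2) ga(2))
      finally show "f x = ep N ((\<lambda>x\<in>carrier M. h (k (g x))) x) \<oplus>\<^bsub>N\<^esub> (\<lambda>x\<in>carrier M. h (k (g x))) (ep M x)" .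
    qed
  next
    fix f assume "f \<in> null_maps M N"
    then obtain h where f: "f \<in> mod_hom Z_eps M N" and h: "h \<in> ahom M N"
      and fh: "\<forall>x\<in>carrier M. f x = ep N (h x) \<oplus>\<^bsub>N\<^esub> h (ep M x)" by (rule null_mapsE)
    obtain P p1 p2 where "double N P p1 p2" and proj: "fg_projective Z_eps P" using ex_double[OF N] by blast
    then interpret D: double N P p1 p2 by simp
    note hc = ahom_closed[OF h] and ec = ep_closed[OF M] ep_closed[OF mN]
    define g where "g = (\<lambda>m\<in>carrier M. D.dp (h (ep M m)) (h m))"
    define q where "q = (\<lambda>p\<in>carrier P. p1 p \<oplus>\<^bsub>N\<^esub> ep N (p2 p))"
    have g: "g \<in> mod_hom Z_eps M P"
      unfolding mod_hom_Z_eps[OF M D.P]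
    proof (intro conjI ballI)
      show "g \<in> ahom M P" unfolding g_def
        by (rule ahom_restrictI[OF M.abelian_group_axioms]) (simp_all add: D.dp_closed hc ec ep_add[OF M] ahom_add[OF h] D.dp_add)
      show "g (ep M x) = ep P (g x)" if "x \<in> carrier M" for x
        using that by (simp add: g_def ec ep_ep[OF M] D.ep_dp hc ahom_zero[OF h M.abelian_group_axioms N.abelian_group_axioms])
    qed
    have q: "q \<in> mod_hom Z_eps P N"
      unfolding mod_hom_Z_eps[OF D.P mN]
    proof (intro conjI ballI)
      show "q \<in> ahom P N" unfolding q_def
        by (rule ahom_restrictI[OF D.P.abelian_group_axioms])
          (simp_all add: D.p1_closed D.p2_closed ec ahom_add[OF D.p1] ahom_add[OF D.p2] ep_add[OF mN] N.M.a_ac)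
      show "q (ep P x) = ep N (q x)" if "x \<in> carrier P" for x
        using that by (simp add: q_def ep_closed[OF D.P] D.p1_ep D.p2_ep ep_add[OF mN] ep_ep[OF mN] D.p1_closed D.p2_closed ec)
    qed
    have "f = compose (carrier M) q g"
    proof (rule mod_hom_eqI[OF cring_Z_eps f mod_hom_compose[OF g q M]])
      fix x assume x: "x \<in> carrier M"
      have "h (ep M x) \<in> carrier N" "ep N (h x) \<in> carrier N" using x hc ec by simp_all
      then show "f x = compose (carrier M) q g x"
        using x by (simp add: compose_def q_def g_def D.dp hc ec fh N.M.a_comm)
    qed
    then show "f \<in> factoring_through_projective Z_eps M N"
      unfolding factoring_through_projective_def using proj g q by blast
  qed
qed

section \<open>The stable category as the quotient of a preadditive category by an ideal\<close>

abbreviation torsionless_cat :: "('a eps_module, 'a \<Rightarrow> 'a) precat" where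
  "torsionless_cat \<equiv> full_subcat (mod_cat Z_eps) (torsionless Z_eps)"

lemma torsionless_cat_simps:
  "Hom torsionless_cat M N = \<lparr>carrier = mod_hom Z_eps M N, mult = undefined, one = undefined,
     zero = (\<lambda>x\<in>carrier M. \<zero>\<^bsub>N\<^esub>), add = (\<lambda>f g. \<lambda>x\<in>carrier M. f x \<oplus>\<^bsub>N\<^esub> g x)\<rparr>"
  "Ident torsionless_cat M = (\<lambda>x\<in>carrier M. x)"
  "Cmp torsionless_cat L M N g f = compose (carrier L) g f"
  by (simp_all add: full_subcat_def mod_cat_def)

lemma Obj_torsionless_cat: "M \<in> Obj torsionless_cat \<longleftrightarrow> tmod M"
proof -
  have "M \<in> Obj torsionless_cat \<longleftrightarrow> fg_module Z_eps M \<and> M \<in> torsionless Z_eps"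
    by (simp add: full_subcat_def mod_cat_def)
  moreover have "tmod M \<Longrightarrow> fg_module Z_eps M" by (simp add: tmod_def fg_module_tff)
  moreover have "fg_module Z_eps M \<Longrightarrow> module Z_eps M" by (simp add: fg_module_def)
  ultimately show ?thesis using torsionless_tmod[of M] tmod_torsionless[of M] by argo
qed

text \<open>Two descriptions share the work. Closure under sums is read off from homotopies, which
  simply add, so no direct sum of projectives has to be formed; closure under composition is read
  off from factorizations.\<close>

lemma cat_ideal_stable:
  "cat_ideal (torsionless_cat :: (((nat \<Rightarrow> int) set, 'a::infinite) module, 'a \<Rightarrow> 'a) precat) (factoring_through_projective Z_eps)"
proof (intro cat_ideal.intro cat_ideal_axioms.intro)
  let ?C = "torsionless_cat :: ('a eps_module, 'a \<Rightarrow> 'a) precat"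
  show C: "preadditive ?C"
    by (rule preadditive_full_subcat[OF preadditive_mod_cat[OF cring_Z_eps]])
  fix M N assume MN: "M \<in> Obj ?C" "N \<in> Obj ?C"
  then have tN: "tmod N" and M: "module Z_eps M" and N: "module Z_eps N"
    by (auto simp: Obj_torsionless_cat tmod_def)
  interpret M: module Z_eps M by (rule M)
  interpret N: module Z_eps N by (rule N)
  show "subgroup (factoring_through_projective Z_eps M N) (add_monoid (Hom ?C M N))"
    unfolding factoring_eq_null_maps[OF M tN]
  proof (rule subgroup_add_monoidI[OF preadditive.Hom_abelian_group[OF C MN]])
    show "null_maps M N \<subseteq> mor ?C M N" by (auto simp: torsionless_cat_simps null_maps_def)
    have "(\<lambda>x\<in>carrier M. \<zero>\<^bsub>N\<^esub>) \<in> ahom M N" by (rule mod_hom_ahom[OF mod_hom_zero[OF cring_Z_eps M N]])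
    then show "\<zero>\<^bsub>Hom ?C M N\<^esub> \<in> null_maps M N"
      using mod_hom_zero[OF cring_Z_eps M N] ep_closed[OF M]
      by (intro null_mapsI[where h = "\<lambda>x\<in>carrier M. \<zero>\<^bsub>N\<^esub>"]) (simp_all add: torsionless_cat_simps ep_zero[OF N])
  next
    fix f g assume "f \<in> null_maps M N" "g \<in> null_maps M N"
    then obtain h k where f: "f \<in> mod_hom Z_eps M N" and h: "h \<in> ahom M N" and fh: "\<forall>x\<in>carrier M. f x = ep N (h x) \<oplus>\<^bsub>N\<^esub> h (ep M x)"
      and g: "g \<in> mod_hom Z_eps M N" and k: "k \<in> ahom M N" and gk: "\<forall>x\<in>carrier M. g x = ep N (k x) \<oplus>\<^bsub>N\<^esub> k (ep M x)"
      unfolding null_maps_def by blast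
    note cl = ahom_closed[OF h] ahom_closed[OF k] ep_closed[OF M] ep_closed[OF N]
    show "f \<oplus>\<^bsub>Hom ?C M N\<^esub> g \<in> null_maps M N"
    proof (rule null_mapsI)
      show "f \<oplus>\<^bsub>Hom ?C M N\<^esub> g \<in> mod_hom Z_eps M N"
        using mod_hom_add[OF cring_Z_eps M N f g] by (simp add: torsionless_cat_simps)
      show "(\<lambda>x\<in>carrier M. h x \<oplus>\<^bsub>N\<^esub> k x) \<in> ahom M N"
        by (rule ahom_restrictI[OF M.abelian_group_axioms]) (simp_all add: cl ahom_add[OF h] ahom_add[OF k] N.M.a_ac)
    qed (simp add: torsionless_cat_simps fh gk cl ep_add[OF N] N.M.a_ac)
  next
    fix f assume "f \<in> null_maps M N"
    then obtain h where f: "f \<in> mod_hom Z_eps M N" and h: "h \<in> ahom M N" and fh: "\<forall>x\<in>carrier M. f x = ep N (h x) \<oplus>\<^bsub>N\<^esub> h (ep M x)"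
      by (rule null_mapsE)
    note cl = ahom_closed[OF h] ep_closed[OF M] ep_closed[OF N]
    have "(\<lambda>x\<in>carrier M. \<ominus>\<^bsub>N\<^esub> f x) \<in> null_maps M N"
    proof (rule null_mapsI)
      show "(\<lambda>x\<in>carrier M. \<ominus>\<^bsub>N\<^esub> f x) \<in> mod_hom Z_eps M N" by (rule mod_hom_neg[OF cring_Z_eps M N f])
      show "(\<lambda>x\<in>carrier M. \<ominus>\<^bsub>N\<^esub> h x) \<in> ahom M N"
        by (rule ahom_restrictI[OF M.abelian_group_axioms]) (simp_all add: cl ahom_add[OF h] N.M.minus_add)
    qed (simp add: fh cl ep_neg[OF N] N.M.minus_add)
    moreover have "(\<lambda>x\<in>carrier M. \<ominus>\<^bsub>N\<^esub> f x) \<oplus>\<^bsub>Hom ?C M N\<^esub> f = \<zero>\<^bsub>Hom ?C M N\<^esub>"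
      unfolding torsionless_cat_simps ring.simps
      by (rule restrict_ext) (simp add: N.M.l_neg ahom_closed[OF mod_hom_ahom[OF f]])
    ultimately show "\<exists>g\<in>null_maps M N. g \<oplus>\<^bsub>Hom ?C M N\<^esub> f = \<zero>\<^bsub>Hom ?C M N\<^esub>" by blast
  qed
next
  let ?C = "torsionless_cat :: ('a eps_module, 'a \<Rightarrow> 'a) precat"
  fix L M N f g assume L: "L \<in> Obj ?C" and M: "M \<in> Obj ?C" and N: "N \<in> Obj ?C"
    and f: "f \<in> factoring_through_projective Z_eps L M" and g: "g \<in> mor ?C M N"
  then obtain a b and P :: "'a eps_module" where ab: "f = compose (carrier L) b a" "fg_projective Z_eps P" "a \<in> mod_hom Z_eps L P" "b \<in> mod_hom Z_eps P M"
    unfolding factoring_through_projective_def by blast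
  have gh: "g \<in> mod_hom Z_eps M N" using g by (simp add: torsionless_cat_simps)
  have P: "module Z_eps P" using ab by (simp add: fg_projective_def)
  have "Cmp ?C L M N g f = compose (carrier L) (compose (carrier P) g b) a"
    unfolding torsionless_cat_simps ab(1) compose_def
    by (rule restrict_ext) (simp add: ahom_closed[OF mod_hom_ahom[OF ab(3)]])
  then show "Cmp ?C L M N g f \<in> factoring_through_projective Z_eps L N"
    unfolding factoring_through_projective_def using ab mod_hom_compose[OF ab(4) gh P] by blast
next
  let ?C = "torsionless_cat :: ('a eps_module, 'a \<Rightarrow> 'a) precat"
  fix L M N f g assume L: "L \<in> Obj ?C" and M: "M \<in> Obj ?C" and N: "N \<in> Obj ?C"
    and f: "f \<in> mor ?C L M" and g: "g \<in> factoring_through_projective Z_eps M N"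
  then obtain a b and P :: "'a eps_module" where ab: "g = compose (carrier M) b a" "fg_projective Z_eps P" "a \<in> mod_hom Z_eps M P" "b \<in> mod_hom Z_eps P N"
    unfolding factoring_through_projective_def by blast
  have fh: "f \<in> mod_hom Z_eps L M" using f by (simp add: torsionless_cat_simps)
  have mL: "module Z_eps L" using L by (simp add: Obj_torsionless_cat tmod_def)
  have "Cmp ?C L M N g f = compose (carrier L) b (compose (carrier L) a f)"
    unfolding torsionless_cat_simps ab(1) compose_def
    by (rule restrict_ext) (simp add: ahom_closed[OF mod_hom_ahom[OF fh]])
  then show "Cmp ?C L M N g f \<in> factoring_through_projective Z_eps L N"
    unfolding factoring_through_projective_def using ab mod_hom_compose[OF fh ab(3) mL] by blast
qed

section \<open>Complexes up to homotopy\<close>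

lemma complex_cat_simps:
  "Obj (complex_cat R) = {X. bounded_complex R X}"
  "mor (complex_cat R) X Y = chain_maps R X Y"
  "\<zero>\<^bsub>Hom (complex_cat R) X Y\<^esub> = (\<lambda>n. \<lambda>x\<in>elts X n. \<zero>\<^bsub>cob Y n\<^esub>)"
  "f \<oplus>\<^bsub>Hom (complex_cat R) X Y\<^esub> g = (\<lambda>n. \<lambda>x\<in>elts X n. f n x \<oplus>\<^bsub>cob Y n\<^esub> g n x)"
  "Ident (complex_cat R) X = (\<lambda>n. \<lambda>x\<in>elts X n. x)"
  "Cmp (complex_cat R) X Y Z g f = (\<lambda>n. compose (elts X n) (g n) (f n))"
  by (simp_all add: complex_cat_def)

lemma complexD:
  assumes "bounded_complex R X"
  shows "fg_module R (cob X n)" "module R (cob X n)" "abelian_group (cob X n)"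
    and "cdiff X n \<in> mod_hom R (cob X n) (cob X (n + 1))" "cdiff X n \<in> ahom (cob X n) (cob X (n + 1))"
    and "x \<in> elts X n \<Longrightarrow> cdiff X (n + 1) (cdiff X n x) = \<zero>\<^bsub>cob X (n + 2)\<^esub>"
    and "finite {n. elts X n \<noteq> {\<zero>\<^bsub>cob X n\<^esub>}}"
proof -
  show "fg_module R (cob X n)" and d: "cdiff X n \<in> mod_hom R (cob X n) (cob X (n + 1))"
    and "x \<in> elts X n \<Longrightarrow> cdiff X (n + 1) (cdiff X n x) = \<zero>\<^bsub>cob X (n + 2)\<^esub>"
    and "finite {n. elts X n \<noteq> {\<zero>\<^bsub>cob X n\<^esub>}}"
    using assms by (simp_all add: bounded_complex_def)
  then show m: "module R (cob X n)" by (simp add: fg_module_def)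
  show "abelian_group (cob X n)" using m by (simp add: module_def)
  show "cdiff X n \<in> ahom (cob X n) (cob X (n + 1))" by (rule mod_hom_ahom[OF d])
qed

lemma chain_mapsD:
  assumes "f \<in> chain_maps R X Y"
  shows "f n \<in> mod_hom R (cob X n) (cob Y n)" "f n \<in> ahom (cob X n) (cob Y n)"
    and "x \<in> elts X n \<Longrightarrow> f n x \<in> elts Y n"
    and "x \<in> elts X n \<Longrightarrow> f (n + 1) (cdiff X n x) = cdiff Y n (f n x)"
  using assms mod_hom_ahom[of "f n" R "cob X n" "cob Y n"] ahom_closed[of "f n" "cob X n" "cob Y n" x]
  by (simp_all add: chain_maps_def)

lemma chain_mapsI:
  assumes "\<And>n. f n \<in> mod_hom R (cob X n) (cob Y n)"
    and "\<And>n x. x \<in> elts X n \<Longrightarrow> f (n + 1) (cdiff X n x) = cdiff Y n (f n x)"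
  shows "f \<in> chain_maps R X Y"
  using assms by (simp add: chain_maps_def)

lemma chain_maps_eqI:
  assumes "cring R" "f \<in> chain_maps R X Y" "g \<in> chain_maps R X Z" "\<And>n x. x \<in> elts X n \<Longrightarrow> f n x = g n x"
  shows "f = g"
  using mod_hom_eqI[OF assms(1) chain_mapsD(1)[OF assms(2)] chain_mapsD(1)[OF assms(3)] assms(4)] by blast

lemma chain_maps_compose:
  assumes X: "bounded_complex R X" and f: "f \<in> chain_maps R X Y" and g: "g \<in> chain_maps R Y Z"
  shows "(\<lambda>n. compose (elts X n) (g n) (f n)) \<in> chain_maps R X Z" (is "?f \<in> _")
proof (rule chain_mapsI)
  fix n
  show "?f n \<in> mod_hom R (cob X n) (cob Z n)"
    by (rule mod_hom_compose[OF chain_mapsD(1)[OF f] chain_mapsD(1)[OF g] complexD(2)[OF X]])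
  fix x assume x: "x \<in> elts X n"
  then have "cdiff X n x \<in> elts X (n + 1)" by (rule ahom_closed[OF complexD(5)[OF X]])
  then show "?f (n + 1) (cdiff X n x) = cdiff Z n (?f n x)"
    using x by (simp add: compose_def chain_mapsD(3,4)[OF f] chain_mapsD(4)[OF g])
qed

context
  fixes R :: "('r, 'k) ring_scheme" assumes R: "cring R"
begin

lemma chain_maps_zero:
  assumes X: "bounded_complex R X" and Y: "bounded_complex R Y"
  shows "(\<lambda>n. \<lambda>x\<in>elts X n. \<zero>\<^bsub>cob Y n\<^esub>) \<in> chain_maps R X Y" (is "?f \<in> _")
proof (rule chain_mapsI)
  fix n
  show "?f n \<in> mod_hom R (cob X n) (cob Y n)"
    by (rule mod_hom_zero[OF R complexD(2)[OF X] complexD(2)[OF Y]])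
  fix x assume x: "x \<in> elts X n"
  then have "cdiff X n x \<in> elts X (n + 1)" by (rule ahom_closed[OF complexD(5)[OF X]])
  then show "?f (n + 1) (cdiff X n x) = cdiff Y n (?f n x)"
    using x by (simp add: ahom_zero[OF complexD(5)[OF Y] complexD(3)[OF Y] complexD(3)[OF Y]])
qed

lemma chain_maps_add:
  assumes X: "bounded_complex R X" and Y: "bounded_complex R Y" and f: "f \<in> chain_maps R X Y" and g: "g \<in> chain_maps R X Y"
  shows "(\<lambda>n. \<lambda>x\<in>elts X n. f n x \<oplus>\<^bsub>cob Y n\<^esub> g n x) \<in> chain_maps R X Y" (is "?f \<in> _")
proof (rule chain_mapsI)
  fix n
  show "?f n \<in> mod_hom R (cob X n) (cob Y n)"
    by (rule mod_hom_add[OF R complexD(2)[OF X] complexD(2)[OF Y] chain_mapsD(1)[OF f] chain_mapsD(1)[OF g]])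
  fix x assume x: "x \<in> elts X n"
  then have "cdiff X n x \<in> elts X (n + 1)" by (rule ahom_closed[OF complexD(5)[OF X]])
  then show "?f (n + 1) (cdiff X n x) = cdiff Y n (?f n x)"
    using x by (simp add: ahom_add[OF complexD(5)[OF Y]] chain_mapsD(3,4)[OF f] chain_mapsD(3,4)[OF g])
qed

lemma chain_maps_neg:
  assumes X: "bounded_complex R X" and Y: "bounded_complex R Y" and f: "f \<in> chain_maps R X Y"
  shows "(\<lambda>n. \<lambda>x\<in>elts X n. \<ominus>\<^bsub>cob Y n\<^esub> f n x) \<in> chain_maps R X Y" (is "?f \<in> _")
proof (rule chain_mapsI)
  fix n
  show "?f n \<in> mod_hom R (cob X n) (cob Y n)"
    by (rule mod_hom_neg[OF R complexD(2)[OF X] complexD(2)[OF Y] chain_mapsD(1)[OF f]])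
  fix x assume x: "x \<in> elts X n"
  then have "cdiff X n x \<in> elts X (n + 1)" by (rule ahom_closed[OF complexD(5)[OF X]])
  then show "?f (n + 1) (cdiff X n x) = cdiff Y n (?f n x)"
    using x by (simp add: ahom_neg[OF complexD(5)[OF Y] complexD(3)[OF Y] complexD(3)[OF Y]] chain_mapsD(3,4)[OF f])
qed

lemma preadditive_complex_cat: "preadditive (complex_cat R :: (('r, 'a) cochain, int \<Rightarrow> 'a \<Rightarrow> 'a) precat)"
proof (intro preadditive.intro category.intro preadditive_axioms.intro)
  let ?C = "complex_cat R :: (('r, 'a) cochain, int \<Rightarrow> 'a \<Rightarrow> 'a) precat"
  fix X assume "X \<in> Obj ?C"
  then have X: "bounded_complex R X" by (simp add: complex_cat_simps)
  have "(\<lambda>x\<in>elts X n. x) \<in> mod_hom R (cob X n) (cob X n)" for n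
  proof -
    interpret module R "cob X n" by (rule complexD(2)[OF X])
    show ?thesis by (simp add: mod_hom_def)
  qed
  then show "Ident ?C X \<in> mor ?C X X"
    using ahom_closed[OF complexD(5)[OF X]] by (simp add: complex_cat_simps chain_maps_def)
next
  let ?C = "complex_cat R :: (('r, 'a) cochain, int \<Rightarrow> 'a \<Rightarrow> 'a) precat"
  show "Cmp ?C X Y Z g f \<in> mor ?C X Z" if "X \<in> Obj ?C" "f \<in> mor ?C X Y" "g \<in> mor ?C Y Z" for X Y Z f g
    using that chain_maps_compose by (simp add: complex_cat_simps)
next
  let ?C = "complex_cat R :: (('r, 'a) cochain, int \<Rightarrow> 'a \<Rightarrow> 'a) precat"
  fix X Y f assume "X \<in> Obj ?C" "Y \<in> Obj ?C" "f \<in> mor ?C X Y"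
  then have f: "f \<in> chain_maps R X Y" by (simp add: complex_cat_simps)
  have u: "f n x = undefined" if "x \<notin> elts X n" for n x
    by (rule extensional_arb[OF ahom_extensional[OF chain_mapsD(2)[OF f]] that])
  show "Cmp ?C X Y Y (Ident ?C Y) f = f" "Cmp ?C X X Y f (Ident ?C X) = f"
    unfolding complex_cat_simps compose_def
    by (intro ext, simp add: restrict_def u chain_mapsD(3)[OF f])+
next
  let ?C = "complex_cat R :: (('r, 'a) cochain, int \<Rightarrow> 'a \<Rightarrow> 'a) precat"
  fix W X Y Z f g h assume "f \<in> mor ?C W X"
  then have f: "f \<in> chain_maps R W X" by (simp add: complex_cat_simps)
  show "Cmp ?C W Y Z h (Cmp ?C W X Y g f) = Cmp ?C W X Z (Cmp ?C X Y Z h g) f"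
    unfolding complex_cat_simps compose_def by (intro ext) (simp add: restrict_def chain_mapsD(3)[OF f])
next
  let ?C = "complex_cat R :: (('r, 'a) cochain, int \<Rightarrow> 'a \<Rightarrow> 'a) precat"
  fix X Y assume "X \<in> Obj ?C" "Y \<in> Obj ?C"
  then have X: "bounded_complex R X" and Y: "bounded_complex R Y" by (simp_all add: complex_cat_simps)
  note ag = complexD(3)[OF Y]
  let ?H = "Hom ?C X Y"
  show "abelian_group ?H"
  proof (rule abelian_groupI)
    fix f assume "f \<in> carrier ?H"
    then have f: "f \<in> chain_maps R X Y" by (simp add: complex_cat_simps)
    show "\<exists>g\<in>carrier ?H. g \<oplus>\<^bsub>?H\<^esub> f = \<zero>\<^bsub>?H\<^esub>"
    proof
      show "(\<lambda>n. \<lambda>x\<in>elts X n. \<ominus>\<^bsub>cob Y n\<^esub> f n x) \<in> carrier ?H"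
        using chain_maps_neg[OF X Y f] by (simp add: complex_cat_simps)
      show "(\<lambda>n. \<lambda>x\<in>elts X n. \<ominus>\<^bsub>cob Y n\<^esub> f n x) \<oplus>\<^bsub>?H\<^esub> f = \<zero>\<^bsub>?H\<^esub>"
        unfolding complex_cat_simps
        by (intro ext) (simp add: restrict_def abelian_group.l_neg[OF ag] chain_mapsD(3)[OF f])
    qed
    have u: "f n x = undefined" if "x \<notin> elts X n" for n x
      by (rule extensional_arb[OF ahom_extensional[OF chain_mapsD(2)[OF f]] that])
    show "\<zero>\<^bsub>?H\<^esub> \<oplus>\<^bsub>?H\<^esub> f = f"
      unfolding complex_cat_simps
      by (intro ext) (simp add: restrict_def u abelian_groupE(5)[OF ag] chain_mapsD(3)[OF f])
  next
    fix f g assume "f \<in> carrier ?H" "g \<in> carrier ?H"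
    then have fg: "f \<in> chain_maps R X Y" "g \<in> chain_maps R X Y" by (simp_all add: complex_cat_simps)
    show "f \<oplus>\<^bsub>?H\<^esub> g \<in> carrier ?H" using chain_maps_add[OF X Y fg] by (simp add: complex_cat_simps)
    show "f \<oplus>\<^bsub>?H\<^esub> g = g \<oplus>\<^bsub>?H\<^esub> f"
      unfolding complex_cat_simps
      by (intro ext restrict_ext) (simp add: abelian_groupE(4)[OF ag] chain_mapsD(3)[OF fg(1)] chain_mapsD(3)[OF fg(2)])
  next
    fix f g h assume "f \<in> carrier ?H" "g \<in> carrier ?H" "h \<in> carrier ?H"
    then have fg: "f \<in> chain_maps R X Y" "g \<in> chain_maps R X Y" "h \<in> chain_maps R X Y" by (simp_all add: complex_cat_simps)
    show "f \<oplus>\<^bsub>?H\<^esub> g \<oplus>\<^bsub>?H\<^esub> h = f \<oplus>\<^bsub>?H\<^esub> (g \<oplus>\<^bsub>?H\<^esub> h)"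
      unfolding complex_cat_simps
      by (intro ext) (simp add: restrict_def abelian_groupE(3)[OF ag] chain_mapsD(3)[OF fg(1)] chain_mapsD(3)[OF fg(2)] chain_mapsD(3)[OF fg(3)])
  next
    show "\<zero>\<^bsub>?H\<^esub> \<in> carrier ?H" using chain_maps_zero[OF X Y] by (simp add: complex_cat_simps)
  qed
next
  let ?C = "complex_cat R :: (('r, 'a) cochain, int \<Rightarrow> 'a \<Rightarrow> 'a) precat"
  fix X Y Z f g g' assume "f \<in> mor ?C X Y"
  then have f: "f \<in> chain_maps R X Y" by (simp add: complex_cat_simps)
  show "Cmp ?C X Y Z (g \<oplus>\<^bsub>Hom ?C Y Z\<^esub> g') f = Cmp ?C X Y Z g f \<oplus>\<^bsub>Hom ?C X Z\<^esub> Cmp ?C X Y Z g' f"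
    unfolding complex_cat_simps compose_def by (intro ext) (simp add: restrict_def chain_mapsD(3)[OF f])
next
  let ?C = "complex_cat R :: (('r, 'a) cochain, int \<Rightarrow> 'a \<Rightarrow> 'a) precat"
  fix X Y Z f f' g assume "f \<in> mor ?C X Y" "f' \<in> mor ?C X Y" "g \<in> mor ?C Y Z"
  then have f: "f \<in> chain_maps R X Y" "f' \<in> chain_maps R X Y" and g: "g \<in> chain_maps R Y Z" by (simp_all add: complex_cat_simps)
  show "Cmp ?C X Y Z g (f \<oplus>\<^bsub>Hom ?C X Y\<^esub> f') = Cmp ?C X Y Z g f \<oplus>\<^bsub>Hom ?C X Z\<^esub> Cmp ?C X Y Z g f'"
    unfolding complex_cat_simps compose_def
    by (intro ext) (simp add: restrict_def chain_mapsD(3)[OF f(1)] chain_mapsD(3)[OF f(2)] ahom_add[OF chain_mapsD(2)[OF g]])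
qed

end

lemma complex_prev:
  assumes "bounded_complex R X"
  shows "cdiff X (n - 1) \<in> ahom (cob X (n - 1)) (cob X n)"
    and "x \<in> elts X (n - 1) \<Longrightarrow> cdiff X (n - 1) x \<in> elts X n"
    and "x \<in> elts X n \<Longrightarrow> cdiff X n x \<in> elts X (n + 1)"
    and "x \<in> elts X (n - 1) \<Longrightarrow> cdiff X n (cdiff X (n - 1) x) = \<zero>\<^bsub>cob X (n + 1)\<^esub>"
proof -
  show d: "cdiff X (n - 1) \<in> ahom (cob X (n - 1)) (cob X n)"
    using complexD(5)[OF assms, of "n - 1"] by simp
  show "x \<in> elts X (n - 1) \<Longrightarrow> cdiff X (n - 1) x \<in> elts X n"
    by (rule ahom_closed[OF d])
  show "x \<in> elts X n \<Longrightarrow> cdiff X n x \<in> elts X (n + 1)"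
    by (rule ahom_closed[OF complexD(5)[OF assms]])
  have "n - 1 + 1 = n" "n - 1 + 2 = n + 1" by simp_all
  then show "x \<in> elts X (n - 1) \<Longrightarrow> cdiff X n (cdiff X (n - 1) x) = \<zero>\<^bsub>cob X (n + 1)\<^esub>"
    using complexD(6)[OF assms, of x "n - 1"] by metis
qed

lemma chain_map_prev:
  assumes "f \<in> chain_maps R X Y" "x \<in> elts X (n - 1)"
  shows "f n (cdiff X (n - 1) x) = cdiff Y (n - 1) (f (n - 1) x)"
  using chain_mapsD(4)[OF assms(1), of x "n - 1"] assms(2) by simp

lemma null_homotopicI:
  assumes "f \<in> chain_maps R X Y" "\<And>n. h n \<in> mod_hom R (cob X n) (cob Y (n - 1))"
    and "\<And>n x. x \<in> elts X n \<Longrightarrow> f n x = hmap X Y h n x"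
  shows "f \<in> null_homotopic R X Y"
  using assms unfolding null_homotopic_def by blast

text \<open>Homotopies add and negate degree by degree, and composing a homotopy with a chain map on
  either side gives a homotopy for the composite.\<close>

lemma cat_ideal_homotopy:
  assumes R: "cring R"
  shows "cat_ideal (complex_cat R :: (('r, 'a) cochain, int \<Rightarrow> 'a \<Rightarrow> 'a) precat) (null_homotopic R)"
proof (intro cat_ideal.intro cat_ideal_axioms.intro)
  let ?C = "complex_cat R :: (('r, 'a) cochain, int \<Rightarrow> 'a \<Rightarrow> 'a) precat"
  show C: "preadditive ?C" by (rule preadditive_complex_cat[OF R])
  fix X Y assume XY: "X \<in> Obj ?C" "Y \<in> Obj ?C"
  then have X: "bounded_complex R X" and Y: "bounded_complex R Y" by (simp_all add: complex_cat_simps)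
  note mX = complexD(2)[OF X] and mY = complexD(2)[OF Y]
  note gX = complexD(3)[OF X] and gY = complexD(3)[OF Y]
  note dX = complex_prev[OF X] and dY = complex_prev[OF Y]
  show "subgroup (null_homotopic R X Y) (add_monoid (Hom ?C X Y))"
  proof (rule subgroup_add_monoidI[OF preadditive.Hom_abelian_group[OF C XY]])
    show "null_homotopic R X Y \<subseteq> mor ?C X Y" by (auto simp: complex_cat_simps null_homotopic_def)
    show "\<zero>\<^bsub>Hom ?C X Y\<^esub> \<in> null_homotopic R X Y"
      unfolding complex_cat_simps
    proof (rule null_homotopicI[OF chain_maps_zero[OF R X Y], where h = "\<lambda>n. \<lambda>x\<in>elts X n. \<zero>\<^bsub>cob Y (n - 1)\<^esub>"])
      show "(\<lambda>x\<in>elts X n. \<zero>\<^bsub>cob Y (n - 1)\<^esub>) \<in> mod_hom R (cob X n) (cob Y (n - 1))" for n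
        by (rule mod_hom_zero[OF R mX mY])
      fix n x assume x: "x \<in> elts X n"
      then show "(\<lambda>x\<in>elts X n. \<zero>\<^bsub>cob Y n\<^esub>) x = cdiff Y (n - 1) ((\<lambda>x\<in>elts X n. \<zero>\<^bsub>cob Y (n - 1)\<^esub>) x)
          \<oplus>\<^bsub>cob Y n\<^esub> (\<lambda>x\<in>elts X (n + 1). \<zero>\<^bsub>cob Y (n + 1 - 1)\<^esub>) (cdiff X n x)"
        using dX(3)[OF x] abelian_groupE(2,5)[OF gY[of n]] by (simp add: ahom_zero[OF dY(1) gY gY])
    qed
  next
    fix f g assume "f \<in> null_homotopic R X Y" "g \<in> null_homotopic R X Y"
    then obtain h k where f: "f \<in> chain_maps R X Y" and h: "\<And>n. h n \<in> mod_hom R (cob X n) (cob Y (n - 1))"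
      and fh: "\<And>n x. x \<in> elts X n \<Longrightarrow> f n x = hmap X Y h n x"
      and g: "g \<in> chain_maps R X Y" and k: "\<And>n. k n \<in> mod_hom R (cob X n) (cob Y (n - 1))"
      and gk: "\<And>n x. x \<in> elts X n \<Longrightarrow> g n x = hmap X Y k n x"
      unfolding null_homotopic_def by blast
    show "f \<oplus>\<^bsub>Hom ?C X Y\<^esub> g \<in> null_homotopic R X Y"
      unfolding complex_cat_simps
    proof (rule null_homotopicI[OF chain_maps_add[OF R X Y f g], where h = "\<lambda>n. \<lambda>x\<in>elts X n. h n x \<oplus>\<^bsub>cob Y (n - 1)\<^esub> k n x"])
      show "(\<lambda>x\<in>elts X n. h n x \<oplus>\<^bsub>cob Y (n - 1)\<^esub> k n x) \<in> mod_hom R (cob X n) (cob Y (n - 1))" for n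
        by (rule mod_hom_add[OF R mX mY h k])
      fix n x assume x: "x \<in> elts X n"
      interpret Yn: abelian_group "cob Y n" by (rule gY)
      note hc = ahom_closed[OF mod_hom_ahom[OF h[of n]] x] ahom_closed[OF mod_hom_ahom[OF k[of n]] x]
      have hc': "h (n + 1) (cdiff X n x) \<in> elts Y n" "k (n + 1) (cdiff X n x) \<in> elts Y n"
        using ahom_closed[OF mod_hom_ahom[OF h[of "n + 1"]] dX(3)[OF x]] ahom_closed[OF mod_hom_ahom[OF k[of "n + 1"]] dX(3)[OF x]] by simp_all
      show "(\<lambda>x\<in>elts X n. f n x \<oplus>\<^bsub>cob Y n\<^esub> g n x) x = cdiff Y (n - 1) ((\<lambda>x\<in>elts X n. h n x \<oplus>\<^bsub>cob Y (n - 1)\<^esub> k n x) x)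
          \<oplus>\<^bsub>cob Y n\<^esub> (\<lambda>x\<in>elts X (n + 1). h (n + 1) x \<oplus>\<^bsub>cob Y (n + 1 - 1)\<^esub> k (n + 1) x) (cdiff X n x)"
        using x dX(3)[OF x] hc hc' dY(2) by (simp add: fh gk ahom_add[OF dY(1)] Yn.a_ac)
    qed
  next
    fix f assume "f \<in> null_homotopic R X Y"
    then obtain h where f: "f \<in> chain_maps R X Y" and h: "\<And>n. h n \<in> mod_hom R (cob X n) (cob Y (n - 1))"
      and fh: "\<And>n x. x \<in> elts X n \<Longrightarrow> f n x = hmap X Y h n x"
      unfolding null_homotopic_def by blast
    have "(\<lambda>n. \<lambda>x\<in>elts X n. \<ominus>\<^bsub>cob Y n\<^esub> f n x) \<in> null_homotopic R X Y"
    proof (rule null_homotopicI[OF chain_maps_neg[OF R X Y f], where h = "\<lambda>n. \<lambda>x\<in>elts X n. \<ominus>\<^bsub>cob Y (n - 1)\<^esub> h n x"])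
      show "(\<lambda>x\<in>elts X n. \<ominus>\<^bsub>cob Y (n - 1)\<^esub> h n x) \<in> mod_hom R (cob X n) (cob Y (n - 1))" for n
        by (rule mod_hom_neg[OF R mX mY h])
      fix n x assume x: "x \<in> elts X n"
      interpret Yn: abelian_group "cob Y n" by (rule gY)
      note hc = ahom_closed[OF mod_hom_ahom[OF h[of n]] x]
      have hc': "h (n + 1) (cdiff X n x) \<in> elts Y n"
        using ahom_closed[OF mod_hom_ahom[OF h[of "n + 1"]] dX(3)[OF x]] by simp
      show "(\<lambda>x\<in>elts X n. \<ominus>\<^bsub>cob Y n\<^esub> f n x) x = cdiff Y (n - 1) ((\<lambda>x\<in>elts X n. \<ominus>\<^bsub>cob Y (n - 1)\<^esub> h n x) x)
          \<oplus>\<^bsub>cob Y n\<^esub> (\<lambda>x\<in>elts X (n + 1). \<ominus>\<^bsub>cob Y (n + 1 - 1)\<^esub> h (n + 1) x) (cdiff X n x)"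
        using x dX(3)[OF x] hc hc' dY(2) by (simp add: fh ahom_neg[OF dY(1) gY gY] Yn.minus_add)
    qed
    moreover have "(\<lambda>n. \<lambda>x\<in>elts X n. \<ominus>\<^bsub>cob Y n\<^esub> f n x) \<oplus>\<^bsub>Hom ?C X Y\<^esub> f = \<zero>\<^bsub>Hom ?C X Y\<^esub>"
      unfolding complex_cat_simps
      by (intro ext) (simp add: restrict_def abelian_group.l_neg[OF gY] chain_mapsD(3)[OF f])
    ultimately show "\<exists>g\<in>null_homotopic R X Y. g \<oplus>\<^bsub>Hom ?C X Y\<^esub> f = \<zero>\<^bsub>Hom ?C X Y\<^esub>" by blast
  qed
next
  let ?C = "complex_cat R :: (('r, 'a) cochain, int \<Rightarrow> 'a \<Rightarrow> 'a) precat"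
  fix X Y Z f g assume "X \<in> Obj ?C" "Y \<in> Obj ?C" "Z \<in> Obj ?C" and f0: "f \<in> null_homotopic R X Y" and "g \<in> mor ?C Y Z"
  then have X: "bounded_complex R X" and Y: "bounded_complex R Y" and Z: "bounded_complex R Z" and g: "g \<in> chain_maps R Y Z"
    by (simp_all add: complex_cat_simps)
  obtain h where f: "f \<in> chain_maps R X Y" and h: "\<And>n. h n \<in> mod_hom R (cob X n) (cob Y (n - 1))"
    and fh: "\<And>n x. x \<in> elts X n \<Longrightarrow> f n x = hmap X Y h n x"
    using f0 unfolding null_homotopic_def by blast
  show "Cmp ?C X Y Z g f \<in> null_homotopic R X Z"
    unfolding complex_cat_simps
  proof (rule null_homotopicI[OF chain_maps_compose[OF X f g], where h = "\<lambda>n. compose (elts X n) (g (n - 1)) (h n)"])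
    show "compose (elts X n) (g (n - 1)) (h n) \<in> mod_hom R (cob X n) (cob Z (n - 1))" for n
      by (rule mod_hom_compose[OF h chain_mapsD(1)[OF g] complexD(2)[OF X]])
    fix n x assume x: "x \<in> elts X n"
    note hc = ahom_closed[OF mod_hom_ahom[OF h[of n]] x] and dx = complex_prev(3)[OF X x]
    have hc': "h (n + 1) (cdiff X n x) \<in> elts Y n" using ahom_closed[OF mod_hom_ahom[OF h[of "n + 1"]] dx] by simp
    show "compose (elts X n) (g n) (f n) x = cdiff Z (n - 1) (compose (elts X n) (g (n - 1)) (h n) x)
      \<oplus>\<^bsub>cob Z n\<^esub> compose (elts X (n + 1)) (g (n + 1 - 1)) (h (n + 1)) (cdiff X n x)"
      using x dx hc hc' complex_prev(2)[OF Y hc]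
      by (simp add: compose_def fh ahom_add[OF chain_mapsD(2)[OF g]] chain_map_prev[OF g])
  qed
next
  let ?C = "complex_cat R :: (('r, 'a) cochain, int \<Rightarrow> 'a \<Rightarrow> 'a) precat"
  fix X Y Z f g assume "X \<in> Obj ?C" "Y \<in> Obj ?C" "Z \<in> Obj ?C" and "f \<in> mor ?C X Y" and g0: "g \<in> null_homotopic R Y Z"
  then have X: "bounded_complex R X" and Y: "bounded_complex R Y" and Z: "bounded_complex R Z" and f: "f \<in> chain_maps R X Y"
    by (simp_all add: complex_cat_simps)
  obtain h where g: "g \<in> chain_maps R Y Z" and h: "\<And>n. h n \<in> mod_hom R (cob Y n) (cob Z (n - 1))"
    and gh: "\<And>n x. x \<in> elts Y n \<Longrightarrow> g n x = hmap Y Z h n x"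
    using g0 unfolding null_homotopic_def by blast
  show "Cmp ?C X Y Z g f \<in> null_homotopic R X Z"
    unfolding complex_cat_simps
  proof (rule null_homotopicI[OF chain_maps_compose[OF X f g], where h = "\<lambda>n. compose (elts X n) (h n) (f n)"])
    show "compose (elts X n) (h n) (f n) \<in> mod_hom R (cob X n) (cob Z (n - 1))" for n
      by (rule mod_hom_compose[OF chain_mapsD(1)[OF f] h complexD(2)[OF X]])
    fix n x assume x: "x \<in> elts X n"
    show "compose (elts X n) (g n) (f n) x = cdiff Z (n - 1) (compose (elts X n) (h n) (f n) x)
      \<oplus>\<^bsub>cob Z n\<^esub> compose (elts X (n + 1)) (h (n + 1)) (f (n + 1)) (cdiff X n x)"
      using x complex_prev(3)[OF X x]
      by (simp add: compose_def gh chain_mapsD(3)[OF f] chain_mapsD(4)[OF f])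
  qed
qed

interpretation K: cat_ideal "Cpx" "null_homotopic \<Z>"
  rewrites "quotient_cat Cpx (null_homotopic \<Z>) = Htp"
  by (rule cat_ideal_homotopy[OF int_is_cring]) (simp add: homotopy_cat_def)

section \<open>Quasi-isomorphisms\<close>

lemma asub_coboundaries:
  assumes X: "bounded_complex R X" shows "asub (coboundaries X n) (cob X n)"
proof -
  note g = complexD(3)[OF X] and d = complex_prev[OF X]
  show ?thesis
    unfolding asub_def coboundaries_def
  proof (intro conjI ballI)
    show "cdiff X (n - 1) ` elts X (n - 1) \<subseteq> elts X n" using d(2) by auto
    show "\<zero>\<^bsub>cob X n\<^esub> \<in> cdiff X (n - 1) ` elts X (n - 1)"
      using imageI[OF abelian_groupE(2)[OF g[of "n - 1"]], of "cdiff X (n - 1)"] ahom_zero[OF d(1) g g] by simp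
  next
    fix x y assume "x \<in> cdiff X (n - 1) ` elts X (n - 1)" "y \<in> cdiff X (n - 1) ` elts X (n - 1)"
    then obtain a b where a: "a \<in> elts X (n - 1)" "b \<in> elts X (n - 1)" "x = cdiff X (n - 1) a" "y = cdiff X (n - 1) b" by blast
    then have "x \<oplus>\<^bsub>cob X n\<^esub> y = cdiff X (n - 1) (a \<oplus>\<^bsub>cob X (n - 1)\<^esub> b)" by (simp add: ahom_add[OF d(1)])
    then show "x \<oplus>\<^bsub>cob X n\<^esub> y \<in> cdiff X (n - 1) ` elts X (n - 1)"
      using abelian_groupE(1)[OF g a(1,2)] by blast
  next
    fix x assume "x \<in> cdiff X (n - 1) ` elts X (n - 1)"
    then obtain a where a: "a \<in> elts X (n - 1)" "x = cdiff X (n - 1) a" by blast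
    then have "\<ominus>\<^bsub>cob X n\<^esub> x = cdiff X (n - 1) (\<ominus>\<^bsub>cob X (n - 1)\<^esub> a)" by (simp add: ahom_neg[OF d(1) g g])
    then show "\<ominus>\<^bsub>cob X n\<^esub> x \<in> cdiff X (n - 1) ` elts X (n - 1)"
      using abelian_group.a_inv_closed[OF g a(1)] by blast
  qed
qed

lemma coboundaries_coset_eq:
  assumes X: "bounded_complex R X" and x: "x \<in> elts X n" and y: "y \<in> elts X n"
  shows "coboundaries X n +>\<^bsub>cob X n\<^esub> x = coboundaries X n +>\<^bsub>cob X n\<^esub> y
    \<longleftrightarrow> (\<exists>z\<in>elts X (n - 1). x = y \<oplus>\<^bsub>cob X n\<^esub> cdiff X (n - 1) z)"
proof -
  interpret abelian_group "cob X n" by (rule complexD(3)[OF X])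
  let ?B = "coboundaries X n"
  note a = asub_coboundaries[OF X, of n]
  have "subgroup ?B (add_monoid (cob X n))"
  proof (rule subgroup_add_monoidI[OF abelian_group_axioms])
    show "\<exists>y\<in>?B. y \<oplus>\<^bsub>cob X n\<^esub> x = \<zero>\<^bsub>cob X n\<^esub>" if "x \<in> ?B" for x
      using that a l_neg by (intro bexI[of _ "\<ominus>\<^bsub>cob X n\<^esub> x"]) (auto simp: asub_def)
  qed (use a in \<open>auto simp: asub_def\<close>)
  then interpret B: abelian_subgroup ?B "cob X n"
    by (intro abelian_subgroupI3 additive_subgroup.intro abelian_group_axioms)
  have "?B +>\<^bsub>cob X n\<^esub> x = ?B +>\<^bsub>cob X n\<^esub> y \<longleftrightarrow> x \<in> ?B +>\<^bsub>cob X n\<^esub> y"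
    using a_repr_independence[OF _ y B.a_subgroup, of x] B.a_rcos_self[OF x] by blast
  also have "\<dots> \<longleftrightarrow> x \<oplus>\<^bsub>cob X n\<^esub> \<ominus>\<^bsub>cob X n\<^esub> y \<in> ?B" by (rule B.a_rcos_module[OF y x])
  also have "\<dots> \<longleftrightarrow> (\<exists>z\<in>elts X (n - 1). x \<oplus>\<^bsub>cob X n\<^esub> \<ominus>\<^bsub>cob X n\<^esub> y = cdiff X (n - 1) z)"
    by (auto simp: coboundaries_def)
  also have "\<dots> \<longleftrightarrow> (\<exists>z\<in>elts X (n - 1). x = y \<oplus>\<^bsub>cob X n\<^esub> cdiff X (n - 1) z)"
  proof (rule bex_cong[OF refl])
    fix z assume "z \<in> elts X (n - 1)"
    then have "cdiff X (n - 1) z \<in> elts X n" by (rule complex_prev(2)[OF X])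
    then show "x \<oplus>\<^bsub>cob X n\<^esub> \<ominus>\<^bsub>cob X n\<^esub> y = cdiff X (n - 1) z \<longleftrightarrow> x = y \<oplus>\<^bsub>cob X n\<^esub> cdiff X (n - 1) z"
      using x y by (metis a_comm a_inv_closed add.inv_solve_right)
  qed
  finally show ?thesis .
qed

text \<open>The union in \<open>quasi_iso\<close> is a single coset because \<open>f\<close> maps
  coboundaries to coboundaries. The induced map is additive, so injectivity needs testing at zero
  only, and surjectivity means surjectivity on cocycles up to a coboundary.\<close>

lemma quasi_iso_iff:
  assumes X: "bounded_complex R X" and Y: "bounded_complex R Y" and f: "f \<in> chain_maps R X Y"
  shows "quasi_iso X Y f \<longleftrightarrow>
    (\<forall>n. (\<forall>x\<in>cocycles X n. f n x \<in> coboundaries Y n \<longrightarrow> x \<in> coboundaries X n) \<and>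
         (\<forall>y\<in>cocycles Y n. \<exists>x\<in>cocycles X n. \<exists>z\<in>elts Y (n - 1). y = f n x \<oplus>\<^bsub>cob Y n\<^esub> cdiff Y (n - 1) z))"
proof -
  note fc = chain_mapsD(3)[OF f] and fa = ahom_add[OF chain_mapsD(2)[OF f]]
  note gX = complexD(3)[OF X] and gY = complexD(3)[OF Y]
  have "bij_betw (\<lambda>K. \<Union>z\<in>K. coboundaries Y n +>\<^bsub>cob Y n\<^esub> f n z) (cohomology X n) (cohomology Y n) \<longleftrightarrow>
    (\<forall>x\<in>cocycles X n. f n x \<in> coboundaries Y n \<longrightarrow> x \<in> coboundaries X n) \<and>
         (\<forall>y\<in>cocycles Y n. \<exists>x\<in>cocycles X n. \<exists>z\<in>elts Y (n - 1). y = f n x \<oplus>\<^bsub>cob Y n\<^esub> cdiff Y (n - 1) z)" for n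
  proof -
    interpret Xn: abelian_group "cob X n" by (rule gX)
    interpret Yn: abelian_group "cob Y n" by (rule gY)
    define a where "a z = coboundaries X n +>\<^bsub>cob X n\<^esub> z" for z
    define b where "b z = coboundaries Y n +>\<^bsub>cob Y n\<^esub> z" for z
    define g where "g K = (\<Union>z\<in>K. b (f n z))" for K
    have Zc: "x \<in> elts X n" if "x \<in> cocycles X n" for x using that by (simp add: cocycles_def)
    have ZcY: "x \<in> elts Y n" if "x \<in> cocycles Y n" for x using that by (simp add: cocycles_def)
    have a_eq: "a x = a y \<longleftrightarrow> (\<exists>z\<in>elts X (n - 1). x = y \<oplus>\<^bsub>cob X n\<^esub> cdiff X (n - 1) z)"
      if "x \<in> elts X n" "y \<in> elts X n" for x y
      unfolding a_def by (rule coboundaries_coset_eq[OF X that])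
    have b_eq: "b x = b y \<longleftrightarrow> (\<exists>z\<in>elts Y (n - 1). x = y \<oplus>\<^bsub>cob Y n\<^esub> cdiff Y (n - 1) z)"
      if "x \<in> elts Y n" "y \<in> elts Y n" for x y
      unfolding b_def by (rule coboundaries_coset_eq[OF Y that])
    have fz: "f n x \<in> cocycles Y n" if "x \<in> cocycles X n" for x
      using that fc[of x n] chain_mapsD(4)[OF f, of x n] ahom_zero[OF chain_mapsD(2)[OF f] gX gY, of "n + 1"]
      by (simp add: cocycles_def)
    have ga: "g (a x) = b (f n x)" if x: "x \<in> elts X n" for x
    proof -
      have "b (f n x') = b (f n x)" if x': "x' \<in> a x" for x'
      proof -
        obtain c where c: "c \<in> coboundaries X n" "x' = c \<oplus>\<^bsub>cob X n\<^esub> x"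
          using x' by (auto simp: a_def a_r_coset_def')
        obtain z where z: "z \<in> elts X (n - 1)" "c = cdiff X (n - 1) z" using c(1) by (auto simp: coboundaries_def)
        have cc: "c \<in> elts X n" using complex_prev(2)[OF X z(1)] z(2) by simp
        have "f n x' = f n x \<oplus>\<^bsub>cob Y n\<^esub> cdiff Y (n - 1) (f (n - 1) z)"
        proof -
          have "f n x' = f n c \<oplus>\<^bsub>cob Y n\<^esub> f n x" unfolding c(2) by (rule fa[OF cc x])
          also have "f n c = cdiff Y (n - 1) (f (n - 1) z)" unfolding z(2) by (rule chain_map_prev[OF f z(1)])
          finally show ?thesis
            using Yn.a_comm[OF fc[OF x] complex_prev(2)[OF Y fc[OF z(1)]]] by simp
        qed
        then show ?thesis using b_eq[of "f n x'" "f n x"] fc[OF x] fc[of x' n] c(2) cc x fc[OF z(1)] by auto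
      qed
      moreover have "x \<in> a x"
      proof -
        have "\<zero>\<^bsub>cob X n\<^esub> \<in> coboundaries X n" using asub_coboundaries[OF X, of n] by (simp add: asub_def)
        then show ?thesis unfolding a_def a_r_coset_def' using x by force
      qed
      ultimately have "g (a x) = (\<Union>z\<in>a x. b (f n x))" unfolding g_def by (intro SUP_cong refl)
      then show ?thesis using \<open>x \<in> a x\<close> by auto
    qed
    have "bij_betw g (a ` cocycles X n) (b ` cocycles Y n) \<longleftrightarrow>
      (\<forall>x\<in>cocycles X n. \<forall>y\<in>cocycles X n. b (f n x) = b (f n y) \<longrightarrow> a x = a y) \<and>
      (\<forall>y\<in>cocycles Y n. \<exists>x\<in>cocycles X n. b (f n x) = b y)"
    proof -
      have gi: "g ` a ` cocycles X n = (\<lambda>x. b (f n x)) ` cocycles X n"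
        unfolding image_image by (rule image_cong[OF refl]) (simp add: ga Zc)
      have "inj_on g (a ` cocycles X n) \<longleftrightarrow> (\<forall>x\<in>cocycles X n. \<forall>y\<in>cocycles X n. b (f n x) = b (f n y) \<longrightarrow> a x = a y)"
        unfolding inj_on_def by (simp add: ga Zc)
      moreover have "(\<lambda>x. b (f n x)) ` cocycles X n = b ` cocycles Y n \<longleftrightarrow> (\<forall>y\<in>cocycles Y n. \<exists>x\<in>cocycles X n. b (f n x) = b y)"
      proof
        assume e: "(\<lambda>x. b (f n x)) ` cocycles X n = b ` cocycles Y n"
        show "\<forall>y\<in>cocycles Y n. \<exists>x\<in>cocycles X n. b (f n x) = b y"
        proof
          fix y assume "y \<in> cocycles Y n"
          then have "b y \<in> (\<lambda>x. b (f n x)) ` cocycles X n" unfolding e by (rule imageI)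
          then show "\<exists>x\<in>cocycles X n. b (f n x) = b y" by force
        qed
      next
        assume "\<forall>y\<in>cocycles Y n. \<exists>x\<in>cocycles X n. b (f n x) = b y"
        then show "(\<lambda>x. b (f n x)) ` cocycles X n = b ` cocycles Y n" using fz by (force simp: image_iff)
      qed
      ultimately show ?thesis unfolding bij_betw_def gi by (simp only:)
    qed
    also have "\<dots> \<longleftrightarrow> (\<forall>x\<in>cocycles X n. f n x \<in> coboundaries Y n \<longrightarrow> x \<in> coboundaries X n) \<and>
         (\<forall>y\<in>cocycles Y n. \<exists>x\<in>cocycles X n. \<exists>z\<in>elts Y (n - 1). y = f n x \<oplus>\<^bsub>cob Y n\<^esub> cdiff Y (n - 1) z)"
    proof (rule conj_cong)
      have f0: "f n \<zero>\<^bsub>cob X n\<^esub> = \<zero>\<^bsub>cob Y n\<^esub>" by (rule ahom_zero[OF chain_mapsD(2)[OF f] gX gY])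
      have z0: "\<zero>\<^bsub>cob X n\<^esub> \<in> cocycles X n"
        using ahom_zero[OF complexD(5)[OF X] gX gX, of n] by (simp add: cocycles_def)
      have cbX: "x \<in> coboundaries X n \<longleftrightarrow> a x = a \<zero>\<^bsub>cob X n\<^esub>" if "x \<in> elts X n" for x
        using a_eq[OF that Xn.zero_closed] complex_prev(2)[OF X] by (auto simp: coboundaries_def)
      have cbY: "x \<in> coboundaries Y n \<longleftrightarrow> b x = b \<zero>\<^bsub>cob Y n\<^esub>" if "x \<in> elts Y n" for x
        using b_eq[OF that Yn.zero_closed] complex_prev(2)[OF Y] by (auto simp: coboundaries_def)
      show "(\<forall>x\<in>cocycles X n. \<forall>y\<in>cocycles X n. b (f n x) = b (f n y) \<longrightarrow> a x = a y)
        \<longleftrightarrow> (\<forall>x\<in>cocycles X n. f n x \<in> coboundaries Y n \<longrightarrow> x \<in> coboundaries X n)"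
      proof (intro iffI ballI impI)
        fix x assume H: "\<forall>x\<in>cocycles X n. \<forall>y\<in>cocycles X n. b (f n x) = b (f n y) \<longrightarrow> a x = a y"
          and x: "x \<in> cocycles X n" and fx: "f n x \<in> coboundaries Y n"
        have "b (f n x) = b (f n \<zero>\<^bsub>cob X n\<^esub>)" using fx cbY[OF fc[OF Zc[OF x]]] f0 by simp
        then show "x \<in> coboundaries X n" using H x z0 cbX[OF Zc[OF x]] by blast
      next
        fix x y assume H: "\<forall>x\<in>cocycles X n. f n x \<in> coboundaries Y n \<longrightarrow> x \<in> coboundaries X n"
          and x: "x \<in> cocycles X n" and y: "y \<in> cocycles X n" and e: "b (f n x) = b (f n y)"
        note xc = Zc[OF x] and yc = Zc[OF y]
        obtain z where z: "z \<in> elts Y (n - 1)" "f n x = f n y \<oplus>\<^bsub>cob Y n\<^esub> cdiff Y (n - 1) z"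
          using e b_eq[OF fc[OF xc] fc[OF yc]] by blast
        have dz: "cdiff Y (n - 1) z \<in> elts Y n" by (rule complex_prev(2)[OF Y z(1)])
        \<comment> \<open>Equality of two classes is reduced to the vanishing of the class of the
          difference.\<close>
        let ?w = "x \<oplus>\<^bsub>cob X n\<^esub> \<ominus>\<^bsub>cob X n\<^esub> y"
        have "f n ?w = cdiff Y (n - 1) z"
        proof -
          have "f n ?w = f n x \<oplus>\<^bsub>cob Y n\<^esub> \<ominus>\<^bsub>cob Y n\<^esub> f n y"
            using xc yc by (simp add: fa ahom_neg[OF chain_mapsD(2)[OF f] gX gY])
          also have "\<dots> = cdiff Y (n - 1) z"
            unfolding z(2) using fc[OF yc] dz by (metis Yn.a_comm Yn.a_inv_closed Yn.a_closed Yn.add.inv_solve_right')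
          finally show ?thesis .
        qed
        then have "f n ?w \<in> coboundaries Y n" using z(1) by (simp add: coboundaries_def)
        moreover have "?w \<in> cocycles X n"
        proof -
          interpret X1: abelian_group "cob X (n + 1)" by (rule gX)
          show ?thesis using x y
            by (simp add: cocycles_def ahom_add[OF complexD(5)[OF X]] ahom_neg[OF complexD(5)[OF X] gX gX] X1.r_neg)
        qed
        ultimately have "?w \<in> coboundaries X n" using H by blast
        then obtain v where v: "v \<in> elts X (n - 1)" "?w = cdiff X (n - 1) v" by (auto simp: coboundaries_def)
        have "x = y \<oplus>\<^bsub>cob X n\<^esub> ?w" using xc yc by (simp add: Xn.a_lcomm[of y x] Xn.r_neg)
        then show "a x = a y" using a_eq[OF xc yc] v by auto
      qed
      show "(\<forall>y\<in>cocycles Y n. \<exists>x\<in>cocycles X n. b (f n x) = b y)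
        \<longleftrightarrow> (\<forall>y\<in>cocycles Y n. \<exists>x\<in>cocycles X n. \<exists>z\<in>elts Y (n - 1). y = f n x \<oplus>\<^bsub>cob Y n\<^esub> cdiff Y (n - 1) z)"
      proof (intro ball_cong bex_cong refl)
        fix x y assume y: "y \<in> cocycles Y n" and x: "x \<in> cocycles X n"
        show "b (f n x) = b y \<longleftrightarrow> (\<exists>z\<in>elts Y (n - 1). y = f n x \<oplus>\<^bsub>cob Y n\<^esub> cdiff Y (n - 1) z)"
          unfolding b_eq[OF ZcY[OF y] fc[OF Zc[OF x]], symmetric] by (rule eq_commute)
      qed
    qed
    finally show ?thesis unfolding cohomology_def a_def b_def g_def .
  qed
  then show ?thesis unfolding quasi_iso_def by simp
qed

section \<open>Projective complexes of abelian groups\<close>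

text \<open>Bounded complexes of free groups of finite rank. They will be the objects
  \<open>Pr\<close> of \<open>enough_projectives\<close>.\<close>

definition tff_complex :: "(int, 'a) cochain \<Rightarrow> bool" where
  "tff_complex P \<longleftrightarrow> bounded_complex \<Z> P \<and> (\<forall>n. tff (cob P n) (elts P n))"

lemma (in abelian_group) eq_add_imp_minus:
  assumes "b \<in> carrier G" "c \<in> carrier G" "a = b \<oplus> c" shows "a \<oplus> \<ominus> c = b"
  using assms by (simp add: a_assoc r_neg)

lemma (in abelian_group) solve_add:
  assumes c: "a \<in> carrier G" "b \<in> carrier G" "c \<in> carrier G" "p \<in> carrier G" "q \<in> carrier G"
    and e: "a \<oplus> \<ominus> b \<oplus> \<ominus> c = p \<oplus> q"
  shows "a = (c \<oplus> p) \<oplus> (q \<oplus> b)"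
proof -
  have "a \<oplus> \<ominus> b \<oplus> \<ominus> c \<oplus> c = a \<oplus> \<ominus> b" using c by (simp add: a_assoc l_neg)
  moreover have "a \<oplus> \<ominus> b \<oplus> b = a" using c by (simp add: a_assoc l_neg)
  ultimately have "a = p \<oplus> q \<oplus> c \<oplus> b" using e by simp
  then show ?thesis using c by (simp add: a_ac)
qed

lemma asub_cocycles:
  assumes X: "bounded_complex R X" shows "asub (cocycles X n) (cob X n)"
proof -
  note g = complexD(3)[OF X] and d = complexD(5)[OF X]
  interpret Xn: abelian_group "cob X n" by (rule g)
  interpret X1: abelian_group "cob X (n + 1)" by (rule g)
  show ?thesis unfolding asub_def cocycles_def
    using ahom_zero[OF d g g, of n] ahom_add[OF d, of _ n] ahom_neg[OF d g g, of _ n] X1.minus_equality[of "\<zero>\<^bsub>cob X (n + 1)\<^esub>" "\<zero>\<^bsub>cob X (n + 1)\<^esub>"]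
    by auto
qed

lemma quasi_isoD:
  assumes X: "bounded_complex R X" and Y: "bounded_complex R Y" and f: "f \<in> chain_maps R X Y" and q: "quasi_iso X Y f"
  shows "\<lbrakk>x \<in> elts X n; cdiff X n x = \<zero>\<^bsub>cob X (n + 1)\<^esub>; y \<in> elts Y (n - 1); f n x = cdiff Y (n - 1) y\<rbrakk>
      \<Longrightarrow> \<exists>w\<in>elts X (n - 1). x = cdiff X (n - 1) w"
    and "\<lbrakk>y \<in> elts Y n; cdiff Y n y = \<zero>\<^bsub>cob Y (n + 1)\<^esub>\<rbrakk>
      \<Longrightarrow> \<exists>x\<in>elts X n. \<exists>z\<in>elts Y (n - 1). cdiff X n x = \<zero>\<^bsub>cob X (n + 1)\<^esub> \<and> y = f n x \<oplus>\<^bsub>cob Y n\<^esub> cdiff Y (n - 1) z"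
proof -
  have Q: "\<forall>x\<in>cocycles X n. f n x \<in> coboundaries Y n \<longrightarrow> x \<in> coboundaries X n"
    "\<forall>y\<in>cocycles Y n. \<exists>x\<in>cocycles X n. \<exists>z\<in>elts Y (n - 1). y = f n x \<oplus>\<^bsub>cob Y n\<^esub> cdiff Y (n - 1) z" for n
    using q quasi_iso_iff[OF X Y f] by blast+
  show "\<exists>w\<in>elts X (n - 1). x = cdiff X (n - 1) w"
    if "x \<in> elts X n" "cdiff X n x = \<zero>\<^bsub>cob X (n + 1)\<^esub>" "y \<in> elts Y (n - 1)" "f n x = cdiff Y (n - 1) y"
  proof -
    have "x \<in> cocycles X n" "f n x \<in> coboundaries Y n" using that by (simp_all add: cocycles_def coboundaries_def)
    then have "x \<in> coboundaries X n" using Q(1) by blast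
    then show ?thesis by (auto simp: coboundaries_def)
  qed
  show "\<exists>x\<in>elts X n. \<exists>z\<in>elts Y (n - 1). cdiff X n x = \<zero>\<^bsub>cob X (n + 1)\<^esub> \<and> y = f n x \<oplus>\<^bsub>cob Y n\<^esub> cdiff Y (n - 1) z"
    if "y \<in> elts Y n" "cdiff Y n y = \<zero>\<^bsub>cob Y (n + 1)\<^esub>"
  proof -
    have "y \<in> cocycles Y n" using that by (simp add: cocycles_def)
    then obtain x z where "x \<in> cocycles X n" "z \<in> elts Y (n - 1)" "y = f n x \<oplus>\<^bsub>cob Y n\<^esub> cdiff Y (n - 1) z" using Q(2) by blast
    then show ?thesis by (auto simp: cocycles_def)
  qed
qed

lemma quasi_isoI:
  assumes X: "bounded_complex R X" and Y: "bounded_complex R Y" and f: "f \<in> chain_maps R X Y"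
    and 1: "\<And>n x y. \<lbrakk>x \<in> elts X n; cdiff X n x = \<zero>\<^bsub>cob X (n + 1)\<^esub>; y \<in> elts Y (n - 1); f n x = cdiff Y (n - 1) y\<rbrakk>
      \<Longrightarrow> \<exists>w\<in>elts X (n - 1). x = cdiff X (n - 1) w"
    and 2: "\<And>n y. \<lbrakk>y \<in> elts Y n; cdiff Y n y = \<zero>\<^bsub>cob Y (n + 1)\<^esub>\<rbrakk>
      \<Longrightarrow> \<exists>x\<in>elts X n. \<exists>z\<in>elts Y (n - 1). cdiff X n x = \<zero>\<^bsub>cob X (n + 1)\<^esub> \<and> y = f n x \<oplus>\<^bsub>cob Y n\<^esub> cdiff Y (n - 1) z"
  shows "quasi_iso X Y f"
  unfolding quasi_iso_iff[OF X Y f]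
proof (intro allI conjI ballI impI)
  fix n x assume x: "x \<in> cocycles X n" and "f n x \<in> coboundaries Y n"
  then obtain y where y: "y \<in> elts Y (n - 1)" "f n x = cdiff Y (n - 1) y" by (auto simp: coboundaries_def)
  have "\<exists>w\<in>elts X (n - 1). x = cdiff X (n - 1) w"
    by (rule 1[OF _ _ y]) (use x in \<open>simp_all add: cocycles_def\<close>)
  then show "x \<in> coboundaries X n" by (auto simp: coboundaries_def)
next
  fix n y assume "y \<in> cocycles Y n"
  then have "y \<in> elts Y n" "cdiff Y n y = \<zero>\<^bsub>cob Y (n + 1)\<^esub>" by (simp_all add: cocycles_def)
  from 2[OF this] show "\<exists>x\<in>cocycles X n. \<exists>z\<in>elts Y (n - 1). y = f n x \<oplus>\<^bsub>cob Y n\<^esub> cdiff Y (n - 1) z"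
    unfolding cocycles_def by blast
qed

text \<open>Both lifting statements are proved degreewise: first on the cocycles of \<open>P\<close>, then on all of \<open>P\<close>,
  which works because the coboundaries of \<open>P\<close> are again projective (\<open>\<int>\<close> is hereditary).\<close>

lemma lift_exists:
  assumes P: "tff_complex P" and W: "bounded_complex \<Z> W" and X: "bounded_complex \<Z> X"
    and s: "s \<in> chain_maps \<Z> W X" and q: "quasi_iso W X s" and f: "f \<in> chain_maps \<Z> P X"
  obtains f' h where "f' \<in> chain_maps \<Z> P W" "\<And>n. h n \<in> ahom (cob P n) (cob X (n - 1))"
    "\<And>n x. x \<in> elts P n \<Longrightarrow> f n x = s n (f' n x) \<oplus>\<^bsub>cob X n\<^esub> (hmap P X h n x)"
proof -
  have P': "bounded_complex \<Z> P" and t: "\<And>n. tff (cob P n) (elts P n)" using P by (auto simp: tff_complex_def)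
  note gP = complexD(3)[OF P'] and gW = complexD(3)[OF W] and gX = complexD(3)[OF X]
  note dP = complex_prev[OF P'] and dW = complex_prev[OF W] and dX = complex_prev[OF X]
  note dPa = complexD(5)[OF P'] and dWa = complexD(5)[OF W] and dXa = complexD(5)[OF X]
  note sc = chain_mapsD(3)[OF s] and sa = chain_mapsD(2)[OF s] and fc = chain_mapsD(3)[OF f] and fa = chain_mapsD(2)[OF f]
  note QI = quasi_isoD[OF W X s q]
  let ?Z = "\<lambda>n. {x \<in> elts P n. cdiff P n x = \<zero>\<^bsub>cob P (n + 1)\<^esub>}"
  have Z: "asub (?Z n) (cob P n)" for n using asub_cocycles[OF P', of n] by (simp add: cocycles_def)
  define Q where "Q n p \<longleftrightarrow> fst p \<in> ahom (zmod (cob P n) (?Z n)) (cob W n) \<and> snd p \<in> ahom (zmod (cob P n) (?Z n)) (cob X (n - 1)) \<and>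
      (\<forall>x\<in>?Z n. cdiff W n (fst p x) = \<zero>\<^bsub>cob W (n + 1)\<^esub> \<and> f n x = s n (fst p x) \<oplus>\<^bsub>cob X n\<^esub> cdiff X (n - 1) (snd p x))" for n p
  have "\<exists>a e. a \<in> ahom (zmod (cob P n) (?Z n)) (cob W n) \<and> e \<in> ahom (zmod (cob P n) (?Z n)) (cob X (n - 1)) \<and>
      (\<forall>x\<in>?Z n. cdiff W n (a x) = \<zero>\<^bsub>cob W (n + 1)\<^esub> \<and> f n x = s n (a x) \<oplus>\<^bsub>cob X n\<^esub> cdiff X (n - 1) (e x))" for n
  proof -
    interpret Xn: abelian_group "cob X n" by (rule gX)
    interpret Wn: abelian_group "cob W n" by (rule gW)
    interpret Xp: abelian_group "cob X (n - 1)" by (rule gX)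
    interpret W1: abelian_group "cob W (n + 1)" by (rule gW)
    have mz: "\<ominus>\<^bsub>cob W (n + 1)\<^esub> \<zero>\<^bsub>cob W (n + 1)\<^esub> = \<zero>\<^bsub>cob W (n + 1)\<^esub>" by (rule W1.minus_equality) simp_all
    \<comment> \<open>For a cocycle \<open>x\<close> the value \<open>f x\<close> is a cocycle of
      \<open>X\<close>. Surjectivity of \<open>s\<close> on cohomology provides a cocycle
      \<open>w\<close> and a correction \<open>y\<close>, and the relation between them is
      additive.\<close>
    define R where "R x w y \<longleftrightarrow> w \<in> elts W n \<and> y \<in> elts X (n - 1) \<and>
      cdiff W n w = \<zero>\<^bsub>cob W (n + 1)\<^esub> \<and> f n x = s n w \<oplus>\<^bsub>cob X n\<^esub> cdiff X (n - 1) y" for x w y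
    obtain a e where "a \<in> ahom (zmod (cob P n) (?Z n)) (cob W n)" "e \<in> ahom (zmod (cob P n) (?Z n)) (cob X (n - 1))"
      "\<And>x. x \<in> ?Z n \<Longrightarrow> R x (a x) (e x)"
    proof (rule select[where R = R, OF gP Z tff_mono[OF t] gW gX])
      fix x assume x: "x \<in> ?Z n"
      have "cdiff X n (f n x) = \<zero>\<^bsub>cob X (n + 1)\<^esub>"
        using chain_mapsD(4)[OF f, of x n] x ahom_zero[OF fa gP gX, of "n + 1"] by simp
      then show "\<exists>w y. R x w y" using QI(2)[of "f n x" n] fc[of x n] x unfolding R_def by blast
    next
      fix x w y assume "x \<in> ?Z n" "R x w y"
      then show "R (\<ominus>\<^bsub>cob P n\<^esub> x) (\<ominus>\<^bsub>cob W n\<^esub> w) (\<ominus>\<^bsub>cob X (n - 1)\<^esub> y)"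
        unfolding R_def using sc[of w n] dX(2)[of y n]
        by (simp add: ahom_neg[OF fa gP gX] ahom_neg[OF sa gW gX] ahom_neg[OF dX(1) gX gX] ahom_neg[OF dWa gW gW] Xn.minus_add mz)
    next
      fix x w y x' w' y' assume "x \<in> ?Z n" "x' \<in> ?Z n" "R x w y" "R x' w' y'"
      then show "R (x \<oplus>\<^bsub>cob P n\<^esub> x') (w \<oplus>\<^bsub>cob W n\<^esub> w') (y \<oplus>\<^bsub>cob X (n - 1)\<^esub> y')"
        unfolding R_def using sc[of w n] dX(2)[of y n] sc[of w' n] dX(2)[of y' n]
        by (simp add: ahom_add[OF fa] ahom_add[OF sa] ahom_add[OF dX(1)] ahom_add[OF dWa] Xn.a_ac)
    qed (auto simp: R_def)
    then show ?thesis unfolding R_def by blast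
  qed
  \<comment> \<open>The choices are made in all degrees at once and independently of each other; no
    induction over the degrees occurs.\<close>
  then have "\<forall>n. \<exists>p. Q n p" unfolding Q_def by (simp add: split_paired_Ex)
  from choice[OF this] obtain p where p: "\<forall>n. Q n (p n)" ..
  define a e where "a n = fst (p n)" and "e n = snd (p n)" for n
  have a: "a n \<in> ahom (zmod (cob P n) (?Z n)) (cob W n)" and e: "e n \<in> ahom (zmod (cob P n) (?Z n)) (cob X (n - 1))" for n
    using p by (simp_all add: Q_def a_def e_def)
  have ae: "cdiff W n (a n x) = \<zero>\<^bsub>cob W (n + 1)\<^esub>" "f n x = s n (a n x) \<oplus>\<^bsub>cob X n\<^esub> cdiff X (n - 1) (e n x)" if "x \<in> ?Z n" for n x
    using spec[OF p, of n] that unfolding Q_def a_def e_def by blast+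
  have ac: "a n x \<in> elts W n" "e n x \<in> elts X (n - 1)" if "x \<in> ?Z n" for n x
    using ahom_closed[OF a[of n], of x] ahom_closed[OF e[of n], of x] that by simp_all
  have aa: "a n (x \<oplus>\<^bsub>cob P n\<^esub> y) = a n x \<oplus>\<^bsub>cob W n\<^esub> a n y" "e n (x \<oplus>\<^bsub>cob P n\<^esub> y) = e n x \<oplus>\<^bsub>cob X (n - 1)\<^esub> e n y" if "x \<in> ?Z n" "y \<in> ?Z n" for n x y
    using ahom_add[OF a[of n], of x y] ahom_add[OF e[of n], of x y] that by simp_all
  have an: "a n (\<ominus>\<^bsub>cob P n\<^esub> x) = \<ominus>\<^bsub>cob W n\<^esub> a n x" "e n (\<ominus>\<^bsub>cob P n\<^esub> x) = \<ominus>\<^bsub>cob X (n - 1)\<^esub> e n x" if "x \<in> ?Z n" for n x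
    using ahom_neg[OF a abelian_group_zmod[OF gP Z] gW, of x n] ahom_neg[OF e abelian_group_zmod[OF gP Z] gX, of x n] that
      a_inv_zmod[OF gP Z, of x n] by simp_all
  have az: "a n \<zero>\<^bsub>cob P n\<^esub> = \<zero>\<^bsub>cob W n\<^esub>" "e n \<zero>\<^bsub>cob P n\<^esub> = \<zero>\<^bsub>cob X (n - 1)\<^esub>" for n
    using ahom_zero[OF a abelian_group_zmod[OF gP Z] gW, of n] ahom_zero[OF e abelian_group_zmod[OF gP Z] gX, of n] by simp_all
  have dZ: "cdiff P n x \<in> ?Z (n + 1)" if "x \<in> elts P n" for n x
    using dP(3)[OF that] complexD(6)[OF P' that] by (simp add: add.assoc)
  define Q' where "Q' n p \<longleftrightarrow> fst p \<in> ahom (cob P n) (cob W n) \<and> snd p \<in> ahom (cob P n) (cob X (n - 1)) \<and>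
      (\<forall>x\<in>elts P n. cdiff W n (fst p x) = a (n + 1) (cdiff P n x) \<and>
        f n x = s n (fst p x) \<oplus>\<^bsub>cob X n\<^esub> (cdiff X (n - 1) (snd p x) \<oplus>\<^bsub>cob X n\<^esub> e (n + 1) (cdiff P n x))) \<and>
      (\<forall>x\<in>?Z n. fst p x = a n x) \<and> (\<forall>x\<in>?Z n. snd p x = e n x)" for n p
  have "\<exists>f' h. f' \<in> ahom (cob P n) (cob W n) \<and> h \<in> ahom (cob P n) (cob X (n - 1)) \<and>
      (\<forall>x\<in>elts P n. cdiff W n (f' x) = a (n + 1) (cdiff P n x) \<and>
        f n x = s n (f' x) \<oplus>\<^bsub>cob X n\<^esub> (cdiff X (n - 1) (h x) \<oplus>\<^bsub>cob X n\<^esub> e (n + 1) (cdiff P n x))) \<and>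
      (\<forall>x\<in>?Z n. f' x = a n x) \<and> (\<forall>x\<in>?Z n. h x = e n x)" for n
  proof -
    interpret Xn: abelian_group "cob X n" by (rule gX)
    interpret Wn: abelian_group "cob W n" by (rule gW)
    interpret X1: abelian_group "cob X (n + 1)" by (rule gX)
    interpret W1: abelian_group "cob W (n + 1)" by (rule gW)
    \<comment> \<open>The values at the cocycle dx are already fixed as \<open>a\<close> and
      \<open>e\<close>. Still to be found are \<open>w\<close> with boundary a(dx), which makes the
      lift a chain map, and the value \<open>y\<close> of the homotopy.\<close>
    define R where "R x w y \<longleftrightarrow> w \<in> elts W n \<and> y \<in> elts X (n - 1) \<and>
      cdiff W n w = a (n + 1) (cdiff P n x) \<and>
      f n x = s n w \<oplus>\<^bsub>cob X n\<^esub> (cdiff X (n - 1) y \<oplus>\<^bsub>cob X n\<^esub> e (n + 1) (cdiff P n x))" for x w y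
    have ec: "e (n + 1) (cdiff P n x) \<in> elts X n" "a (n + 1) (cdiff P n x) \<in> elts W (n + 1)"
      if "x \<in> elts P n" for x using ac[OF dZ[OF that]] by simp_all
    have ea: "e (n + 1) (cdiff P n (x \<oplus>\<^bsub>cob P n\<^esub> y)) = e (n + 1) (cdiff P n x) \<oplus>\<^bsub>cob X n\<^esub> e (n + 1) (cdiff P n y)"
      "a (n + 1) (cdiff P n (x \<oplus>\<^bsub>cob P n\<^esub> y)) = a (n + 1) (cdiff P n x) \<oplus>\<^bsub>cob W (n + 1)\<^esub> a (n + 1) (cdiff P n y)"
      if "x \<in> elts P n" "y \<in> elts P n" for x y
      using aa[OF dZ[OF that(1)] dZ[OF that(2)]] by (simp_all add: ahom_add[OF dPa that])
    have en: "e (n + 1) (cdiff P n (\<ominus>\<^bsub>cob P n\<^esub> x)) = \<ominus>\<^bsub>cob X n\<^esub> e (n + 1) (cdiff P n x)"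
      "a (n + 1) (cdiff P n (\<ominus>\<^bsub>cob P n\<^esub> x)) = \<ominus>\<^bsub>cob W (n + 1)\<^esub> a (n + 1) (cdiff P n x)"
      if "x \<in> elts P n" for x
      using an[OF dZ[OF that]] by (simp_all add: ahom_neg[OF dPa gP gP that])
    obtain f' h where "f' \<in> ahom (cob P n) (cob W n)" "h \<in> ahom (cob P n) (cob X (n - 1))"
      "\<And>x. x \<in> elts P n \<Longrightarrow> R x (f' x) (h x)"
      "\<And>x. \<lbrakk>x \<in> elts P n; cdiff P n x = \<zero>\<^bsub>cob P (n + 1)\<^esub>\<rbrakk> \<Longrightarrow> f' x = a n x \<and> h x = e n x"
    proof (rule select_extend[where R = R, OF gP t gP dPa tff_mono[OF t] gW gX a e])
      show "cdiff P n ` elts P n \<subseteq> elts P (n + 1)" using dP(3) by blast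
    next
      fix x assume x: "x \<in> elts P n" "cdiff P n x = \<zero>\<^bsub>cob P (n + 1)\<^esub>"
      then have x': "x \<in> ?Z n" by simp
      have "cdiff X (n - 1) (e n x) \<in> elts X n" by (rule dX(2)[OF ac(2)[OF x']])
      then show "R x (a n x) (e n x)" unfolding R_def using ac[OF x'] ae[OF x'] x az[of "n + 1"] by simp
    next
      fix x assume x: "x \<in> elts P n"
      let ?k = "cdiff P n x"
      have k: "?k \<in> ?Z (n + 1)" by (rule dZ[OF x])
      have ek: "e (n + 1) ?k \<in> elts X n" and ak: "a (n + 1) ?k \<in> elts W (n + 1)" using ec[OF x] by simp_all
      have fk: "cdiff X n (f n x) = s (n + 1) (a (n + 1) ?k) \<oplus>\<^bsub>cob X (n + 1)\<^esub> cdiff X n (e (n + 1) ?k)"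
        using ae(2)[OF k] chain_mapsD(4)[OF f x] by simp
      \<comment> \<open>The cocycle a(dx) of \<open>W\<close> becomes a coboundary in
        \<open>X\<close>, so by injectivity on cohomology it is itself the boundary of some
        \<open>w0\<close>.\<close>
      have sk: "s (n + 1) (a (n + 1) ?k) = cdiff X n (f n x \<oplus>\<^bsub>cob X n\<^esub> \<ominus>\<^bsub>cob X n\<^esub> e (n + 1) ?k)"
        using X1.eq_add_imp_minus[OF sc[OF ak] dX(3)[OF ek] fk] fc[OF x] ek
        by (simp add: ahom_add[OF dXa] ahom_neg[OF dXa gX gX])
      have "\<exists>w\<in>elts W (n + 1 - 1). a (n + 1) ?k = cdiff W (n + 1 - 1) w"
        by (rule QI(1)[where y = "f n x \<oplus>\<^bsub>cob X n\<^esub> \<ominus>\<^bsub>cob X n\<^esub> e (n + 1) ?k"])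
          (use ak ae(1)[OF k] fc[OF x] ek sk in simp_all)
      then obtain w0 where w0: "w0 \<in> elts W n" "a (n + 1) ?k = cdiff W n w0" by auto
      \<comment> \<open>What is still missing is a cocycle. By surjectivity on cohomology it equals
        s(z) + dy with a cocycle \<open>z\<close>, and adding \<open>z\<close> to \<open>w0\<close>
        leaves the boundary of \<open>w0\<close> unchanged.\<close>
      let ?u = "f n x \<oplus>\<^bsub>cob X n\<^esub> \<ominus>\<^bsub>cob X n\<^esub> e (n + 1) ?k \<oplus>\<^bsub>cob X n\<^esub> \<ominus>\<^bsub>cob X n\<^esub> s n w0"
      have uc: "f n x \<oplus>\<^bsub>cob X n\<^esub> \<ominus>\<^bsub>cob X n\<^esub> e (n + 1) ?k \<in> elts X n" using fc[OF x] ek by simp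
      have "cdiff X n ?u = s (n + 1) (cdiff W n w0) \<oplus>\<^bsub>cob X (n + 1)\<^esub> \<ominus>\<^bsub>cob X (n + 1)\<^esub> cdiff X n (s n w0)"
        using uc sc[OF w0(1)] sk w0(2) by (simp add: ahom_add[OF dXa, of "f n x \<oplus>\<^bsub>cob X n\<^esub> \<ominus>\<^bsub>cob X n\<^esub> e (n + 1) ?k"] ahom_neg[OF dXa gX gX])
      also have "\<dots> = \<zero>\<^bsub>cob X (n + 1)\<^esub>"
        unfolding chain_mapsD(4)[OF s w0(1)] by (rule X1.r_neg[OF dX(3)[OF sc[OF w0(1)]]])
      finally have du: "cdiff X n ?u = \<zero>\<^bsub>cob X (n + 1)\<^esub>" .
      have uC: "?u \<in> elts X n" using uc sc[OF w0(1)] by simp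
      obtain z y where z: "z \<in> elts W n" "y \<in> elts X (n - 1)" "cdiff W n z = \<zero>\<^bsub>cob W (n + 1)\<^esub>"
        "?u = s n z \<oplus>\<^bsub>cob X n\<^esub> cdiff X (n - 1) y"
        using QI(2)[OF uC du] by blast
      have "f n x = (s n w0 \<oplus>\<^bsub>cob X n\<^esub> s n z) \<oplus>\<^bsub>cob X n\<^esub> (cdiff X (n - 1) y \<oplus>\<^bsub>cob X n\<^esub> e (n + 1) ?k)"
        by (rule Xn.solve_add[OF fc[OF x] ek sc[OF w0(1)] sc[OF z(1)] dX(2)[OF z(2)] z(4)])
      then have "R x (w0 \<oplus>\<^bsub>cob W n\<^esub> z) y"
        unfolding R_def using w0 z dW(3)[OF w0(1)] by (simp add: ahom_add[OF sa] ahom_add[OF dWa])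
      then show "\<exists>w y. R x w y" by blast
    next
      fix x w y assume "x \<in> elts P n" "R x w y"
      then show "R (\<ominus>\<^bsub>cob P n\<^esub> x) (\<ominus>\<^bsub>cob W n\<^esub> w) (\<ominus>\<^bsub>cob X (n - 1)\<^esub> y)"
        unfolding R_def using sc[of w n] dX(2)[of y n] ec[of x] en[of x]
        by (simp add: ahom_neg[OF fa gP gX] ahom_neg[OF sa gW gX] ahom_neg[OF dX(1) gX gX] ahom_neg[OF dWa gW gW] Xn.minus_add abelian_group.a_inv_closed[OF gX])
    next
      fix x w y x' w' y' assume "x \<in> elts P n" "x' \<in> elts P n" "R x w y" "R x' w' y'"
      then show "R (x \<oplus>\<^bsub>cob P n\<^esub> x') (w \<oplus>\<^bsub>cob W n\<^esub> w') (y \<oplus>\<^bsub>cob X (n - 1)\<^esub> y')"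
        unfolding R_def using sc[of w n] dX(2)[of y n] sc[of w' n] dX(2)[of y' n] ec[of x] ec[of x'] ea[of x x']
        by (simp add: ahom_add[OF fa] ahom_add[OF sa] ahom_add[OF dX(1)] ahom_add[OF dWa] abelian_groupE(1)[OF gX] Xn.a_ac)
    qed (auto simp: R_def)
    then show ?thesis unfolding R_def by blast
  qed
  then have "\<forall>n. \<exists>p. Q' n p" unfolding Q'_def by (simp add: split_paired_Ex)
  from choice[OF this] obtain p' where p': "\<forall>n. Q' n (p' n)" ..
  define f' h where "f' n = fst (p' n)" and "h n = snd (p' n)" for n
  have f': "f' n \<in> ahom (cob P n) (cob W n)" and h: "h n \<in> ahom (cob P n) (cob X (n - 1))" for n
    using p' by (simp_all add: Q'_def f'_def h_def)
  have r: "cdiff W n (f' n x) = a (n + 1) (cdiff P n x)"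
    "f n x = s n (f' n x) \<oplus>\<^bsub>cob X n\<^esub> (cdiff X (n - 1) (h n x) \<oplus>\<^bsub>cob X n\<^esub> e (n + 1) (cdiff P n x))" if "x \<in> elts P n" for n x
    using spec[OF p', of n] that unfolding Q'_def f'_def h_def by blast+
  have ext: "f' n x = a n x" "h n x = e n x" if "x \<in> ?Z n" for n x
    using spec[OF p', of n] that unfolding Q'_def f'_def h_def by blast+
  show ?thesis
  proof (rule that)
    show "f' \<in> chain_maps \<Z> P W"
    proof (rule chain_mapsI)
      show "f' n \<in> mod_hom \<Z> (cob P n) (cob W n)" for n
        using f'[of n] mod_hom_int[OF complexD(2)[OF P'] complexD(2)[OF W], of n n] by simp
      fix n x assume x: "x \<in> elts P n"
      show "f' (n + 1) (cdiff P n x) = cdiff W n (f' n x)" using r(1)[OF x] ext(1)[OF dZ[OF x]] by simp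
    qed
    show "h n \<in> ahom (cob P n) (cob X (n - 1))" for n by (rule h)
    fix n x assume x: "x \<in> elts P n"
    show "f n x = s n (f' n x) \<oplus>\<^bsub>cob X n\<^esub> (hmap P X h n x)"
      using r(2)[OF x] ext(2)[OF dZ[OF x]] by simp
  qed
qed

lemma lift_null:
  assumes P: "tff_complex P" and W: "bounded_complex \<Z> W" and X: "bounded_complex \<Z> X"
    and s: "s \<in> chain_maps \<Z> W X" and q: "quasi_iso W X s" and f: "f \<in> chain_maps \<Z> P W"
    and h: "\<And>n. h n \<in> ahom (cob P n) (cob X (n - 1))"
    and sf: "\<And>n x. x \<in> elts P n \<Longrightarrow> s n (f n x) = hmap P X h n x"
  shows "f \<in> null_homotopic \<Z> P W"
proof -
  have P': "bounded_complex \<Z> P" and t: "\<And>n. tff (cob P n) (elts P n)" using P by (auto simp: tff_complex_def)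
  note gP = complexD(3)[OF P'] and gW = complexD(3)[OF W] and gX = complexD(3)[OF X]
  note dP = complex_prev[OF P'] and dW = complex_prev[OF W] and dX = complex_prev[OF X]
  note dPa = complexD(5)[OF P'] and dWa = complexD(5)[OF W] and dXa = complexD(5)[OF X]
  note sc = chain_mapsD(3)[OF s] and sa = chain_mapsD(2)[OF s] and fc = chain_mapsD(3)[OF f] and fa = chain_mapsD(2)[OF f]
  note QI = quasi_isoD[OF W X s q] and hc = ahom_closed[OF h]
  let ?Z = "\<lambda>n. {x \<in> elts P n. cdiff P n x = \<zero>\<^bsub>cob P (n + 1)\<^esub>}"
  have Z: "asub (?Z n) (cob P n)" for n using asub_cocycles[OF P', of n] by (simp add: cocycles_def)
  define Q where "Q n p \<longleftrightarrow> fst p \<in> ahom (zmod (cob P n) (?Z n)) (cob W (n - 1)) \<and> snd p \<in> ahom (zmod (cob P n) (?Z n)) (cob X (n - 1 - 1)) \<and>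
      (\<forall>x\<in>?Z n. f n x = cdiff W (n - 1) (fst p x) \<and> s (n - 1) (fst p x) = h n x \<oplus>\<^bsub>cob X (n - 1)\<^esub> cdiff X (n - 1 - 1) (snd p x))" for n p
  have "\<exists>a e. a \<in> ahom (zmod (cob P n) (?Z n)) (cob W (n - 1)) \<and> e \<in> ahom (zmod (cob P n) (?Z n)) (cob X (n - 1 - 1)) \<and>
      (\<forall>x\<in>?Z n. f n x = cdiff W (n - 1) (a x) \<and> s (n - 1) (a x) = h n x \<oplus>\<^bsub>cob X (n - 1)\<^esub> cdiff X (n - 1 - 1) (e x))" for n
  proof -
    interpret Xn: abelian_group "cob X n" by (rule gX)
    interpret Wn: abelian_group "cob W n" by (rule gW)
    interpret W1: abelian_group "cob W (n + 1)" by (rule gW)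
    interpret Xp: abelian_group "cob X (n - 1)" by (rule gX)
    interpret Wp: abelian_group "cob W (n - 1)" by (rule gW)
    have dX2: "cdiff X (n - 2) \<in> ahom (cob X (n - 2)) (cob X (n - 1))" using dX(1)[of "n - 1"] by simp
    \<comment> \<open>For a cocycle \<open>x\<close> the value \<open>w\<close> must bound
      \<open>f x\<close>. Its image under \<open>s\<close> is required to be \<open>h x\<close> up
      to a coboundary, since this makes the extension to all of \<open>P\<close> solvable.\<close>
    define R where "R x w y \<longleftrightarrow> w \<in> elts W (n - 1) \<and> y \<in> elts X (n - 1 - 1) \<and>
      f n x = cdiff W (n - 1) w \<and> s (n - 1) w = h n x \<oplus>\<^bsub>cob X (n - 1)\<^esub> cdiff X (n - 1 - 1) y" for x w y
    obtain a e where "a \<in> ahom (zmod (cob P n) (?Z n)) (cob W (n - 1))" "e \<in> ahom (zmod (cob P n) (?Z n)) (cob X (n - 1 - 1))"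
      "\<And>x. x \<in> ?Z n \<Longrightarrow> R x (a x) (e x)"
    proof (rule select[where R = R, OF gP Z tff_mono[OF t] gW gX])
      fix x assume x: "x \<in> ?Z n"
      then have xP: "x \<in> elts P n" by simp
      have z: "h (n + 1) \<zero>\<^bsub>cob P (n + 1)\<^esub> = \<zero>\<^bsub>cob X n\<^esub>" using ahom_zero[OF h gP gX, of "n + 1"] by simp
      have sfx: "s n (f n x) = cdiff X (n - 1) (h n x)"
        using sf[OF xP] x z dX(2)[OF hc[OF xP]] by simp
      have dfx: "cdiff W n (f n x) = \<zero>\<^bsub>cob W (n + 1)\<^esub>"
        using chain_mapsD(4)[OF f xP] x ahom_zero[OF fa gP gW, of "n + 1"] by simp
      obtain w0 where w0: "w0 \<in> elts W (n - 1)" "f n x = cdiff W (n - 1) w0"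
        using QI(1)[OF fc[OF xP] dfx hc[OF xP] sfx] by blast
      \<comment> \<open>Injectivity on cohomology gives a first bound \<open>w0\<close>. Its image
        differs from \<open>h x\<close> by a cocycle, and by surjectivity this is the image of a
        cocycle \<open>z\<close> up to a coboundary; so \<open>w0\<close> minus \<open>z\<close> is
        a suitable bound.\<close>
      let ?u = "s (n - 1) w0 \<oplus>\<^bsub>cob X (n - 1)\<^esub> \<ominus>\<^bsub>cob X (n - 1)\<^esub> h n x"
      have uC: "?u \<in> elts X (n - 1)" using sc[OF w0(1)] hc[OF xP] by simp
      have du: "cdiff X (n - 1) ?u = \<zero>\<^bsub>cob X (n - 1 + 1)\<^esub>"
        using sc[OF w0(1)] hc[OF xP] dX(2)[OF hc[OF xP]] sfx w0(2) chain_map_prev[OF s w0(1)]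
        by (simp add: ahom_add[OF dX(1)] ahom_neg[OF dX(1) gX gX] Xn.r_neg)
      obtain z y where zy: "z \<in> elts W (n - 1)" "y \<in> elts X (n - 1 - 1)"
        "cdiff W (n - 1) z = \<zero>\<^bsub>cob W (n - 1 + 1)\<^esub>" "?u = s (n - 1) z \<oplus>\<^bsub>cob X (n - 1)\<^esub> cdiff X (n - 1 - 1) y"
        using QI(2)[OF uC du] by blast
      have dy: "cdiff X (n - 1 - 1) y \<in> elts X (n - 1)" by (rule dX(2)[OF zy(2)])
      have mz: "\<ominus>\<^bsub>cob W n\<^esub> \<zero>\<^bsub>cob W n\<^esub> = \<zero>\<^bsub>cob W n\<^esub>" by (rule Wn.minus_equality) simp_all
      have "s (n - 1) w0 = ?u \<oplus>\<^bsub>cob X (n - 1)\<^esub> h n x"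
        using sc[OF w0(1)] hc[OF xP] by (simp add: Xp.a_assoc Xp.l_neg)
      then have "s (n - 1) w0 = (h n x \<oplus>\<^bsub>cob X (n - 1)\<^esub> cdiff X (n - 1 - 1) y) \<oplus>\<^bsub>cob X (n - 1)\<^esub> s (n - 1) z"
        unfolding zy(4) using sc[OF zy(1)] hc[OF xP] dy by (simp add: Xp.a_ac)
      then have "s (n - 1) w0 \<oplus>\<^bsub>cob X (n - 1)\<^esub> \<ominus>\<^bsub>cob X (n - 1)\<^esub> s (n - 1) z = h n x \<oplus>\<^bsub>cob X (n - 1)\<^esub> cdiff X (n - 1 - 1) y"
        by (intro Xp.eq_add_imp_minus) (use sc[OF zy(1)] hc[OF xP] dy in simp_all)
      then have "R x (w0 \<oplus>\<^bsub>cob W (n - 1)\<^esub> \<ominus>\<^bsub>cob W (n - 1)\<^esub> z) y"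
        unfolding R_def using w0 zy dW(2)[OF w0(1)] mz
        by (simp add: ahom_add[OF sa] ahom_neg[OF sa gW gX] ahom_add[OF dW(1)] ahom_neg[OF dW(1) gW gW])
      then show "\<exists>w y. R x w y" by blast
    next
      fix x w y assume "x \<in> ?Z n" "R x w y"
      then show "R (\<ominus>\<^bsub>cob P n\<^esub> x) (\<ominus>\<^bsub>cob W (n - 1)\<^esub> w) (\<ominus>\<^bsub>cob X (n - 1 - 1)\<^esub> y)"
        unfolding R_def using dX(2)[of y "n - 1"] hc[of x n]
        by (simp add: ahom_neg[OF fa gP gW] ahom_neg[OF sa gW gX] ahom_neg[OF dX2 gX gX] ahom_neg[OF dW(1) gW gW] ahom_neg[OF h gP gX]
            Xp.minus_add abelian_group.a_inv_closed[OF gX])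
    next
      fix x w y x' w' y' assume "x \<in> ?Z n" "x' \<in> ?Z n" "R x w y" "R x' w' y'"
      then show "R (x \<oplus>\<^bsub>cob P n\<^esub> x') (w \<oplus>\<^bsub>cob W (n - 1)\<^esub> w') (y \<oplus>\<^bsub>cob X (n - 1 - 1)\<^esub> y')"
        unfolding R_def using dX(2)[of y "n - 1"] dX(2)[of y' "n - 1"] hc[of x n] hc[of x' n]
        by (simp add: ahom_add[OF fa] ahom_add[OF sa] ahom_add[OF dX2] ahom_add[OF dW(1)] ahom_add[OF h]
            Xp.a_ac abelian_groupE(1)[OF gX])
    qed (auto simp: R_def)
    then show ?thesis unfolding R_def by blast
  qed
  then have "\<forall>n. \<exists>p. Q n p" unfolding Q_def by (simp add: split_paired_Ex)
  from choice[OF this] obtain p where p: "\<forall>n. Q n (p n)" ..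
  define a e where "a n = fst (p n)" and "e n = snd (p n)" for n
  have a: "a n \<in> ahom (zmod (cob P n) (?Z n)) (cob W (n - 1))" and e: "e n \<in> ahom (zmod (cob P n) (?Z n)) (cob X (n - 1 - 1))" for n
    using p by (simp_all add: Q_def a_def e_def)
  have ae: "f n x = cdiff W (n - 1) (a n x)" "s (n - 1) (a n x) = h n x \<oplus>\<^bsub>cob X (n - 1)\<^esub> cdiff X (n - 1 - 1) (e n x)" if "x \<in> ?Z n" for n x
    using spec[OF p, of n] that unfolding Q_def a_def e_def by blast+
  have ac: "a n x \<in> elts W (n - 1)" "e n x \<in> elts X (n - 1 - 1)" if "x \<in> ?Z n" for n x
    using ahom_closed[OF a[of n], of x] ahom_closed[OF e[of n], of x] that by simp_all
  have aa: "a n (x \<oplus>\<^bsub>cob P n\<^esub> y) = a n x \<oplus>\<^bsub>cob W (n - 1)\<^esub> a n y" if "x \<in> ?Z n" "y \<in> ?Z n" for n x y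
    using ahom_add[OF a[of n], of x y] that by simp
  have an: "a n (\<ominus>\<^bsub>cob P n\<^esub> x) = \<ominus>\<^bsub>cob W (n - 1)\<^esub> a n x" if "x \<in> ?Z n" for n x
    using ahom_neg[OF a abelian_group_zmod[OF gP Z] gW, of x n] that a_inv_zmod[OF gP Z, of x n] by simp
  have az: "a n \<zero>\<^bsub>cob P n\<^esub> = \<zero>\<^bsub>cob W (n - 1)\<^esub>" for n
    using ahom_zero[OF a abelian_group_zmod[OF gP Z] gW, of n] by simp
  have dZ: "cdiff P n x \<in> ?Z (n + 1)" if "x \<in> elts P n" for n x
    using dP(3)[OF that] complexD(6)[OF P' that] by (simp add: add.assoc)
  define Q' where "Q' n g \<longleftrightarrow> g \<in> ahom (cob P n) (cob W (n - 1)) \<and>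
      (\<forall>x\<in>elts P n. f n x = cdiff W (n - 1) (g x) \<oplus>\<^bsub>cob W n\<^esub> a (n + 1) (cdiff P n x)) \<and> (\<forall>x\<in>?Z n. g x = a n x)" for n g
  have "\<exists>g. Q' n g" for n
  proof -
    interpret Xn: abelian_group "cob X n" by (rule gX)
    interpret Wn: abelian_group "cob W n" by (rule gW)
    interpret W1: abelian_group "cob W (n + 1)" by (rule gW)
    define R where "R x w y \<longleftrightarrow> w \<in> elts W (n - 1) \<and> y \<in> elts W (n - 1) \<and>
      f n x = cdiff W (n - 1) w \<oplus>\<^bsub>cob W n\<^esub> a (n + 1) (cdiff P n x)" for x w y
    have ac': "a (n + 1) (cdiff P n x) \<in> elts W n" if "x \<in> elts P n" for x using ac(1)[OF dZ[OF that]] by simp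
    have aa': "a (n + 1) (cdiff P n (x \<oplus>\<^bsub>cob P n\<^esub> y)) = a (n + 1) (cdiff P n x) \<oplus>\<^bsub>cob W n\<^esub> a (n + 1) (cdiff P n y)"
      if "x \<in> elts P n" "y \<in> elts P n" for x y
      using aa[OF dZ[OF that(1)] dZ[OF that(2)]] by (simp add: ahom_add[OF dPa that])
    have an': "a (n + 1) (cdiff P n (\<ominus>\<^bsub>cob P n\<^esub> x)) = \<ominus>\<^bsub>cob W n\<^esub> a (n + 1) (cdiff P n x)" if "x \<in> elts P n" for x
      using an[OF dZ[OF that]] by (simp add: ahom_neg[OF dPa gP gP that])
    obtain g g' where "g \<in> ahom (cob P n) (cob W (n - 1))" "g' \<in> ahom (cob P n) (cob W (n - 1))"
      "\<And>x. x \<in> elts P n \<Longrightarrow> R x (g x) (g' x)"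
      "\<And>x. \<lbrakk>x \<in> elts P n; cdiff P n x = \<zero>\<^bsub>cob P (n + 1)\<^esub>\<rbrakk> \<Longrightarrow> g x = a n x \<and> g' x = a n x"
    proof (rule select_extend[where R = R, OF gP t gP dPa tff_mono[OF t] gW gW a a])
      show "cdiff P n ` elts P n \<subseteq> elts P (n + 1)" using dP(3) by blast
    next
      fix x assume x: "x \<in> elts P n" "cdiff P n x = \<zero>\<^bsub>cob P (n + 1)\<^esub>"
      then have x': "x \<in> ?Z n" by simp
      show "R x (a n x) (a n x)" unfolding R_def using ac(1)[OF x'] ae(1)[OF x'] x az[of "n + 1"] dW(2)[OF ac(1)[OF x']] by simp
    next
      fix x assume x: "x \<in> elts P n"
      let ?k = "cdiff P n x"
      have k: "?k \<in> ?Z (n + 1)" by (rule dZ[OF x])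
      have ak: "a (n + 1) ?k \<in> elts W n" and ek: "e (n + 1) ?k \<in> elts X (n - 1)"
        using ac[OF k] by simp_all
      have hk: "h (n + 1) ?k \<in> elts X n" using hc[OF dP(3)[OF x]] by simp
      have sak: "s n (a (n + 1) ?k) = h (n + 1) ?k \<oplus>\<^bsub>cob X n\<^esub> cdiff X (n - 1) (e (n + 1) ?k)" using ae(2)[OF k] by simp
      \<comment> \<open>Removing a(dx) leaves a cocycle whose image under \<open>s\<close> is the
        boundary of h(x) - e(dx). By injectivity on cohomology it is a coboundary in
        \<open>W\<close>.\<close>
      let ?v = "f n x \<oplus>\<^bsub>cob W n\<^esub> \<ominus>\<^bsub>cob W n\<^esub> a (n + 1) ?k"
      have vC: "?v \<in> elts W n" using fc[OF x] ak by simp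
      have "cdiff W n (f n x) = cdiff W n (a (n + 1) ?k)"
        using ae(1)[OF k] chain_mapsD(4)[OF f x] by simp
      then have dv: "cdiff W n ?v = \<zero>\<^bsub>cob W (n + 1)\<^esub>"
        using fc[OF x] ak dW(3)[OF ak] by (simp add: ahom_add[OF dWa] ahom_neg[OF dWa gW gW] W1.r_neg)
      have dh: "cdiff X (n - 1) (h n x) \<in> elts X n" and de: "cdiff X (n - 1) (e (n + 1) ?k) \<in> elts X n"
        using dX(2)[OF hc[OF x]] dX(2)[OF ek] .
      have "s n ?v = (cdiff X (n - 1) (h n x) \<oplus>\<^bsub>cob X n\<^esub> h (n + 1) ?k) \<oplus>\<^bsub>cob X n\<^esub> \<ominus>\<^bsub>cob X n\<^esub> (h (n + 1) ?k \<oplus>\<^bsub>cob X n\<^esub> cdiff X (n - 1) (e (n + 1) ?k))"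
        using fc[OF x] ak by (simp add: ahom_add[OF sa] ahom_neg[OF sa gW gX] sf[OF x] sak)
      also have "\<dots> = cdiff X (n - 1) (h n x) \<oplus>\<^bsub>cob X n\<^esub> (h (n + 1) ?k \<oplus>\<^bsub>cob X n\<^esub> \<ominus>\<^bsub>cob X n\<^esub> h (n + 1) ?k) \<oplus>\<^bsub>cob X n\<^esub> \<ominus>\<^bsub>cob X n\<^esub> cdiff X (n - 1) (e (n + 1) ?k)"
        using dh hk de by (simp add: Xn.minus_add Xn.a_assoc)
      also have "\<dots> = cdiff X (n - 1) (h n x \<oplus>\<^bsub>cob X (n - 1)\<^esub> \<ominus>\<^bsub>cob X (n - 1)\<^esub> e (n + 1) ?k)"
        using dh hk de hc[OF x] ek abelian_group.a_inv_closed[OF gX ek] by (simp add: Xn.r_neg ahom_add[OF dX(1)] ahom_neg[OF dX(1) gX gX])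
      finally have sv: "s n ?v = cdiff X (n - 1) (h n x \<oplus>\<^bsub>cob X (n - 1)\<^esub> \<ominus>\<^bsub>cob X (n - 1)\<^esub> e (n + 1) ?k)" .
      have "h n x \<oplus>\<^bsub>cob X (n - 1)\<^esub> \<ominus>\<^bsub>cob X (n - 1)\<^esub> e (n + 1) ?k \<in> elts X (n - 1)"
        using hc[OF x] abelian_group.a_inv_closed[OF gX ek] abelian_groupE(1)[OF gX] by simp
      from QI(1)[OF vC dv this sv] obtain w where w: "w \<in> elts W (n - 1)" "?v = cdiff W (n - 1) w" by blast
      have "f n x = ?v \<oplus>\<^bsub>cob W n\<^esub> a (n + 1) ?k" using fc[OF x] ak by (simp add: Wn.a_assoc Wn.l_neg)
      then have "R x w w" unfolding R_def using w by simp
      then show "\<exists>w y. R x w y" by blast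
    next
      fix x w y assume "x \<in> elts P n" "R x w y"
      then show "R (\<ominus>\<^bsub>cob P n\<^esub> x) (\<ominus>\<^bsub>cob W (n - 1)\<^esub> w) (\<ominus>\<^bsub>cob W (n - 1)\<^esub> y)"
        unfolding R_def using dW(2)[of w n] ac'[of x] an'[of x]
        by (simp add: ahom_neg[OF fa gP gW] ahom_neg[OF dW(1) gW gW] Wn.minus_add abelian_group.a_inv_closed[OF gW])
    next
      fix x w y x' w' y' assume "x \<in> elts P n" "x' \<in> elts P n" "R x w y" "R x' w' y'"
      then show "R (x \<oplus>\<^bsub>cob P n\<^esub> x') (w \<oplus>\<^bsub>cob W (n - 1)\<^esub> w') (y \<oplus>\<^bsub>cob W (n - 1)\<^esub> y')"
        unfolding R_def using dW(2)[of w n] dW(2)[of w' n] ac'[of x] ac'[of x'] aa'[of x x']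
        by (simp add: ahom_add[OF fa] ahom_add[OF dW(1)] abelian_groupE(1)[OF gW] Wn.a_ac)
    qed (auto simp: R_def)
    then show ?thesis unfolding R_def Q'_def by blast
  qed
  then have "\<forall>n. \<exists>g. Q' n g" by blast
  from choice[OF this] obtain g where g: "\<forall>n. Q' n (g n)" ..
  show ?thesis
  proof (rule null_homotopicI[OF f])
    show "g n \<in> mod_hom \<Z> (cob P n) (cob W (n - 1))" for n
      using g mod_hom_int[OF complexD(2)[OF P'] complexD(2)[OF W], of n "n - 1"] by (simp add: Q'_def)
    fix n x assume x: "x \<in> elts P n"
    have "g (n + 1) (cdiff P n x) = a (n + 1) (cdiff P n x)" using spec[OF g, of "n + 1"] dZ[OF x] unfolding Q'_def by blast
    then show "f n x = hmap P W g n x"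
      using spec[OF g, of n] x unfolding Q'_def by simp
  qed
qed

section \<open>Projective resolutions\<close>

lemma module_free_int: "module \<Z> (free_module \<Z> r)"
  by (rule module_free_module[OF int_is_cring])

lemma free_int_simps:
  "carrier (free_module \<Z> r) = {..<r} \<rightarrow>\<^sub>E UNIV" "\<zero>\<^bsub>free_module \<Z> r\<^esub> = (\<lambda>i\<in>{..<r}. 0)"
  "v \<oplus>\<^bsub>free_module \<Z> r\<^esub> w = (\<lambda>i\<in>{..<r}. v i + w i)"
  by (simp_all add: free_module_def)

lemma tff_free_int: "tff (free_module \<Z> r) (carrier (free_module \<Z> r))"
proof (rule tff_finite[of "{..<r}" _ _ "\<lambda>i v. v i"])
  show "int_hom (free_module \<Z> r) (carrier (free_module \<Z> r)) (\<lambda>v. v j)" if "j \<in> {..<r}" for j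
    using that by (simp add: int_hom_def free_int_simps)
  fix v assume v: "v \<in> carrier (free_module \<Z> r)" "\<And>j. j \<in> {..<r} \<Longrightarrow> v j = 0"
  then show "v = \<zero>\<^bsub>free_module \<Z> r\<^esub>"
    using PiE_restrict_eqI[of v "{..<r}" UNIV "\<lambda>_. 0"] by (simp add: free_int_simps)
qed simp

text \<open>A finite set of generators gives the map from Z^r. The last clause assigns rank 0 to the
  zero group, which keeps the resolution of a bounded complex bounded.\<close>

lemma fg_int_surjection:
  fixes M (structure)
  assumes M: "fg_module \<Z> M"
  obtains r q where "q \<in> ahom (free_module \<Z> r) M" "q ` carrier (free_module \<Z> r) = carrier M"
    "carrier M = {\<zero>} \<Longrightarrow> r = 0"
proof (cases "carrier M = {\<zero>}")
  case True
  have m: "module \<Z> M" using M by (simp add: fg_module_def)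
  interpret M: module \<Z> M by (rule m)
  interpret F: module \<Z> "free_module \<Z> 0" by (rule module_free_int)
  show thesis
  proof (rule that[of "\<lambda>v\<in>carrier (free_module \<Z> 0). \<zero>" 0])
    show "(\<lambda>v\<in>carrier (free_module \<Z> 0). \<zero>) \<in> ahom (free_module \<Z> 0) M"
      by (rule ahom_restrictI[OF F.abelian_group_axioms]) simp_all
    show "(\<lambda>v\<in>carrier (free_module \<Z> 0). \<zero>) ` carrier (free_module \<Z> 0) = carrier M"
      using True by (auto simp: free_int_simps)
  qed simp
next
  case False
  have m: "module \<Z> M" using M by (simp add: fg_module_def)
  interpret M: module \<Z> M by (rule m)
  obtain A where A: "finite A" "A \<subseteq> carrier M" "\<And>N. submodule N \<Z> M \<Longrightarrow> A \<subseteq> N \<Longrightarrow> N = carrier M"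
    using M by (auto simp: fg_module_def)
  obtain a where a: "bij_betw a {0..<card A} A" using ex_bij_betw_nat_finite[OF A(1)] by blast
  define r where "r = card A"
  interpret F: module \<Z> "free_module \<Z> r" by (rule module_free_int)
  have aM: "a j \<in> carrier M" if "j < r" for j using a A(2) that by (auto simp: bij_betw_def r_def)
  define q where "q = (\<lambda>v\<in>carrier (free_module \<Z> r). finsum M (\<lambda>j. [(v j :: int)] \<cdot> a j) {..<r})"
  have c: "[(k :: int)] \<cdot> a j \<in> carrier M" if "j < r" for k j using aM[OF that] by simp
  have q: "q \<in> ahom (free_module \<Z> r) M"
    unfolding q_def
  proof (rule ahom_restrictI[OF F.abelian_group_axioms])
    fix v assume "v \<in> carrier (free_module \<Z> r)"
    show "finsum M (\<lambda>j. [(v j :: int)] \<cdot> a j) {..<r} \<in> carrier M" by (rule M.finsum_closed) (simp add: Pi_def c)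
  next
    fix v w assume "v \<in> carrier (free_module \<Z> r)" "w \<in> carrier (free_module \<Z> r)"
    have "finsum M (\<lambda>j. [((v \<oplus>\<^bsub>free_module \<Z> r\<^esub> w) j :: int)] \<cdot> a j) {..<r}
        = finsum M (\<lambda>j. [(v j :: int)] \<cdot> a j \<oplus> [(w j :: int)] \<cdot> a j) {..<r}"
      by (rule M.finsum_cong'[OF refl]) (simp_all add: Pi_def c free_int_simps(3) M.add.int_pow_mult aM)
    also have "\<dots> = finsum M (\<lambda>j. [(v j :: int)] \<cdot> a j) {..<r} \<oplus> finsum M (\<lambda>j. [(w j :: int)] \<cdot> a j) {..<r}"
      by (rule M.finsum_addf) (simp_all add: Pi_def c)
    finally show "finsum M (\<lambda>j. [((v \<oplus>\<^bsub>free_module \<Z> r\<^esub> w) j :: int)] \<cdot> a j) {..<r} =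
      finsum M (\<lambda>j. [(v j :: int)] \<cdot> a j) {..<r} \<oplus> finsum M (\<lambda>j. [(w j :: int)] \<cdot> a j) {..<r}" .
  qed
  note gF = F.abelian_group_axioms and gM = M.abelian_group_axioms
  let ?N = "q ` carrier (free_module \<Z> r)"
  have "submodule ?N \<Z> M"
  proof (rule M.submoduleI)
    show "?N \<subseteq> carrier M" using ahom_closed[OF q] by blast
    show "\<zero> \<in> ?N" using imageI[OF F.zero_closed, of q] ahom_zero[OF q gF gM] by simp
  next
    fix x assume "x \<in> ?N"
    then obtain v where v: "v \<in> carrier (free_module \<Z> r)" "x = q v" by blast
    then show "\<ominus> x \<in> ?N" using imageI[OF F.a_inv_closed[OF v(1)], of q] ahom_neg[OF q gF gM v(1)] by simp
  next
    fix x y assume "x \<in> ?N" "y \<in> ?N"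
    then obtain v w where v: "v \<in> carrier (free_module \<Z> r)" "x = q v" "w \<in> carrier (free_module \<Z> r)" "y = q w" by blast
    then show "x \<oplus> y \<in> ?N" using imageI[OF F.a_closed[OF v(1,3)], of q] ahom_add[OF q v(1,3)] by simp
  next
    fix k x assume "x \<in> ?N"
    then obtain v where v: "v \<in> carrier (free_module \<Z> r)" "x = q v" by blast
    then have "k \<odot> x = q ([k] \<cdot>\<^bsub>free_module \<Z> r\<^esub> v)"
      using ahom_int_pow[OF q gF gM v(1)] module_int_smult[OF m] ahom_closed[OF q v(1)] by simp
    moreover have "[k] \<cdot>\<^bsub>free_module \<Z> r\<^esub> v \<in> carrier (free_module \<Z> r)" using v(1) by simp
    ultimately show "k \<odot> x \<in> ?N" by blast
  qed
  moreover have "A \<subseteq> ?N"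
  proof
    fix x assume "x \<in> A"
    then obtain i where i: "i < r" "x = a i" using bij_betw_imp_surj_on[OF a] by (metis atLeastLessThan_iff imageE r_def)
    define v where "v = (\<lambda>j\<in>{..<r}. if j = i then 1 else 0 :: int)"
    have v: "v \<in> carrier (free_module \<Z> r)" by (simp add: v_def free_int_simps)
    have "finsum M (\<lambda>j. [(v j :: int)] \<cdot> a j) {..<r} = [(v i :: int)] \<cdot> a i"
    proof (rule M.finsum_single)
      fix j assume "j \<in> {..<r}" "j \<noteq> i"
      then show "[(v j :: int)] \<cdot> a j = \<zero>" by (simp add: v_def) (simp add: add_pow_def)
    qed (use i c in auto)
    also have "\<dots> = a i" using i(1) aM[OF i(1)] by (simp add: v_def M.add.int_pow_1)
    finally have "q v = x" using v i(2) by (simp add: q_def)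
    then show "x \<in> ?N" using v by blast
  qed
  ultimately have "?N = carrier M" by (rule A(3))
  then show thesis using that[OF q] False by blast
qed

section \<open>Direct sums, copies and preimages for the construction of resolutions\<close>

definition pair_group :: "('a, 'x) ring_scheme \<Rightarrow> ('b, 'y) ring_scheme \<Rightarrow> ('a \<times> 'b) ring" where
  "pair_group G H = \<lparr>carrier = carrier G \<times> carrier H, mult = undefined, one = undefined,
    zero = (\<zero>\<^bsub>G\<^esub>, \<zero>\<^bsub>H\<^esub>), add = (\<lambda>(u, v) (u', v'). (u \<oplus>\<^bsub>G\<^esub> u', v \<oplus>\<^bsub>H\<^esub> v'))\<rparr>"

lemma pair_group_simps:
  "carrier (pair_group G H) = carrier G \<times> carrier H" "\<zero>\<^bsub>pair_group G H\<^esub> = (\<zero>\<^bsub>G\<^esub>, \<zero>\<^bsub>H\<^esub>)"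
  "(u, v) \<oplus>\<^bsub>pair_group G H\<^esub> (u', v') = (u \<oplus>\<^bsub>G\<^esub> u', v \<oplus>\<^bsub>H\<^esub> v')"
  by (simp_all add: pair_group_def)

lemma abelian_group_pair:
  assumes "abelian_group G" "abelian_group H" shows "abelian_group (pair_group G H)"
proof -
  interpret G: abelian_group G by fact
  interpret H: abelian_group H by fact
  show ?thesis
  proof (rule abelian_groupI)
    fix x assume "x \<in> carrier (pair_group G H)"
    then obtain u v where x: "x = (u, v)" "u \<in> carrier G" "v \<in> carrier H" by (auto simp: pair_group_simps)
    then have "(\<ominus>\<^bsub>G\<^esub> u, \<ominus>\<^bsub>H\<^esub> v) \<oplus>\<^bsub>pair_group G H\<^esub> x = \<zero>\<^bsub>pair_group G H\<^esub>" by (simp add: pair_group_simps G.l_neg H.l_neg)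
    then show "\<exists>y\<in>carrier (pair_group G H). y \<oplus>\<^bsub>pair_group G H\<^esub> x = \<zero>\<^bsub>pair_group G H\<^esub>"
      using x by (intro bexI[of _ "(\<ominus>\<^bsub>G\<^esub> u, \<ominus>\<^bsub>H\<^esub> v)"]) (simp_all add: pair_group_simps)
  qed (auto simp: pair_group_simps G.a_ac H.a_ac)
qed

lemma tff_pair:
  assumes "tff G (carrier G)" "tff H (carrier H)" shows "tff (pair_group G H) (carrier (pair_group G H))"
proof -
  obtain m :: nat and c where c: "\<forall>j<m. int_hom G (carrier G) (c j)" "\<forall>x\<in>carrier G. (\<forall>j<m. c j x = 0) \<longrightarrow> x = \<zero>\<^bsub>G\<^esub>"
    using assms(1) unfolding tff_def by blast
  obtain n :: nat and d where d: "\<forall>j<n. int_hom H (carrier H) (d j)" "\<forall>x\<in>carrier H. (\<forall>j<n. d j x = 0) \<longrightarrow> x = \<zero>\<^bsub>H\<^esub>"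
    using assms(2) unfolding tff_def by blast
  let ?J = "Inl ` {..<m} \<union> Inr ` {..<n} :: (nat + nat) set"
  let ?c = "case_sum (\<lambda>j x. c j (fst x)) (\<lambda>j x. d j (snd x))"
  show ?thesis
  proof (rule tff_finite[of ?J _ _ ?c])
    show "int_hom (pair_group G H) (carrier (pair_group G H)) (?c j)" if "j \<in> ?J" for j
      using that c(1) d(1) by (auto simp: int_hom_def pair_group_simps)
    fix x assume x: "x \<in> carrier (pair_group G H)" and z: "\<And>j. j \<in> ?J \<Longrightarrow> ?c j x = 0"
    obtain u v where uv: "x = (u, v)" "u \<in> carrier G" "v \<in> carrier H" using x by (auto simp: pair_group_simps)
    have "c j u = 0" if "j < m" for j using z[of "Inl j"] that uv(1) by simp
    moreover have "d j v = 0" if "j < n" for j using z[of "Inr j"] that uv(1) by simp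
    ultimately show "x = \<zero>\<^bsub>pair_group G H\<^esub>" using c(2) d(2) uv by (simp add: pair_group_simps)
  qed simp
qed

lemma tff_transport:
  assumes M: "module R M" and t: "tff M (carrier M)" and e: "inj_on e (carrier M)"
  shows "tff (transport e M) (carrier (transport e M))"
proof -
  let ?i = "inv_into (carrier M) e"
  note ts = transport_simps[OF e]
  interpret module R M by (rule M)
  show ?thesis
  proof (rule tff_inj[where f = ?i, OF t])
    fix x assume "x \<in> carrier (transport e M)"
    then show "?i x \<in> carrier M" using e by (auto simp: ts)
  next
    fix x y assume "x \<in> carrier (transport e M)" "y \<in> carrier (transport e M)"
    then show "?i (x \<oplus>\<^bsub>transport e M\<^esub> y) = ?i x \<oplus>\<^bsub>M\<^esub> ?i y" using e by (auto simp: ts)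
  next
    fix x assume "x \<in> carrier (transport e M)" "?i x = \<zero>\<^bsub>M\<^esub>"
    then show "x = \<zero>\<^bsub>transport e M\<^esub>" using e by (auto simp: ts)
  qed
qed

lemma asub_preimage:
  assumes G: "abelian_group G" and H: "abelian_group H" and q: "q \<in> ahom G H" and B: "asub B H"
  shows "asub {x \<in> carrier G. q x \<in> B} G"
proof -
  interpret G: abelian_group G by (rule G)
  show ?thesis using B by (auto simp: asub_def ahom_add[OF q] ahom_neg[OF q G H] ahom_zero[OF q G H])
qed

text \<open>The resolution of \<open>X\<close> splits degreewise: \<open>P\<^sup>n = F\<^sup>n \<oplus> K\<^sup>n\<^sup>+\<^sup>1\<close> with \<open>d(f, k) = (k, 0)\<close>, where \<open>F\<^sup>n\<close> and
  \<open>K\<^sup>n\<close> are the preimages of cocycles and coboundaries in a free group mapping onto \<open>X\<^sup>n\<close>.\<close>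

lemma resolution_exists:
  fixes X :: "(int, 'a::infinite) cochain"
  assumes X: "bounded_complex \<Z> X"
  obtains P p where "tff_complex P" "p \<in> chain_maps \<Z> P X" "quasi_iso P X p"
proof -
  note gX = complexD(3)[OF X] and dX = complex_prev[OF X] and dXa = complexD(5)[OF X]
  \<comment> \<open>A free cover of each term is chosen separately, without any compatibility
    between the degrees.\<close>
  define Q where "Q n rq \<longleftrightarrow> snd rq \<in> ahom (free_module \<Z> (fst rq)) (cob X n) \<and>
    snd rq ` carrier (free_module \<Z> (fst rq)) = elts X n \<and>
    (elts X n = {\<zero>\<^bsub>cob X n\<^esub>} \<longrightarrow> fst rq = 0)" for n rq
  have "\<exists>rq. Q n rq" for n
  proof -
    obtain r q where "q \<in> ahom (free_module \<Z> r) (cob X n)" "q ` carrier (free_module \<Z> r) = elts X n"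
      "elts X n = {\<zero>\<^bsub>cob X n\<^esub>} \<Longrightarrow> r = 0"
      by (rule fg_int_surjection[OF complexD(1)[OF X, of n]]) auto
    then show ?thesis by (intro exI[of _ "(r, q)"]) (simp add: Q_def)
  qed
  then have "\<forall>n. \<exists>rq. Q n rq" by blast
  from choice[OF this] obtain rq where rq: "\<forall>n. Q n (rq n)" ..
  define G where "G n = free_module \<Z> (fst (rq n))" for n
  define q where "q n = snd (rq n)" for n
  have q: "q n \<in> ahom (G n) (cob X n)" and qs: "q n ` carrier (G n) = elts X n"
    and r0: "elts X n = {\<zero>\<^bsub>cob X n\<^esub>} \<Longrightarrow> carrier (G n) = {\<zero>\<^bsub>G n\<^esub>}" for n
    using spec[OF rq, of n] by (auto simp: Q_def G_def q_def free_int_simps)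
  have gG: "abelian_group (G n)" for n using module_free_int by (simp add: G_def module_def)
  have tG: "tff (G n) (carrier (G n))" for n by (simp add: G_def tff_free_int)
  define F where "F n = {x \<in> carrier (G n). q n x \<in> cocycles X n}" for n
  define K where "K n = {x \<in> carrier (G n). q n x \<in> coboundaries X n}" for n
  have F: "asub (F n) (G n)" for n unfolding F_def by (rule asub_preimage[OF gG gX q asub_cocycles[OF X]])
  have K: "asub (K n) (G n)" for n unfolding K_def by (rule asub_preimage[OF gG gX q asub_coboundaries[OF X]])
  have KF: "K n \<subseteq> F n" for n
  proof
    fix k assume "k \<in> K n"
    then obtain y where "k \<in> carrier (G n)" "y \<in> elts X (n - 1)" "q n k = cdiff X (n - 1) y" by (auto simp: K_def coboundaries_def)
    then show "k \<in> F n" using dX(2)[of y n] dX(4)[of y n] by (simp add: F_def cocycles_def)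
  qed
  \<comment> \<open>\<open>K n\<close> is free, so the cover restricted to it lifts through the
    differential of \<open>X\<close>. This lift is the second component of the map from the
    resolution to \<open>X\<close>.\<close>
  define L where "L n l \<longleftrightarrow> l \<in> ahom (zmod (G n) (K n)) (cob X (n - 1)) \<and> (\<forall>k\<in>K n. cdiff X (n - 1) (l k) = q n k)" for n l
  have "\<exists>l. L n l" for n
  proof -
    interpret Xp: abelian_group "cob X (n - 1)" by (rule gX)
    interpret Gn: abelian_group "G n" by (rule gG)
    obtain l l' where "l \<in> ahom (zmod (G n) (K n)) (cob X (n - 1))" "l' \<in> ahom (zmod (G n) (K n)) (cob X (n - 1))"
      "\<And>k. k \<in> K n \<Longrightarrow> l k \<in> elts X (n - 1) \<and> l' k \<in> elts X (n - 1) \<and> cdiff X (n - 1) (l k) = q n k"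
    proof (rule select[where R = "\<lambda>k y z. y \<in> elts X (n - 1) \<and> z \<in> elts X (n - 1) \<and> cdiff X (n - 1) y = q n k",
          OF gG K tff_mono[OF tG] gX gX])
      show "K n \<subseteq> carrier (G n)" by (auto simp: K_def)
      fix k assume "k \<in> K n"
      then obtain y where "y \<in> elts X (n - 1)" "q n k = cdiff X (n - 1) y" by (auto simp: K_def coboundaries_def)
      then show "\<exists>y z. y \<in> elts X (n - 1) \<and> z \<in> elts X (n - 1) \<and> cdiff X (n - 1) y = q n k" by auto
    next
      fix k y z assume "k \<in> K n" "y \<in> elts X (n - 1) \<and> z \<in> elts X (n - 1) \<and> cdiff X (n - 1) y = q n k"
      then show "\<ominus>\<^bsub>cob X (n - 1)\<^esub> y \<in> elts X (n - 1) \<and> \<ominus>\<^bsub>cob X (n - 1)\<^esub> z \<in> elts X (n - 1) \<and> cdiff X (n - 1) (\<ominus>\<^bsub>cob X (n - 1)\<^esub> y) = q n (\<ominus>\<^bsub>G n\<^esub> k)"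
        by (simp add: K_def ahom_neg[OF dX(1) gX gX] ahom_neg[OF q gG gX])
    next
      fix k y z k' y' z' assume "k \<in> K n" "k' \<in> K n" "y \<in> elts X (n - 1) \<and> z \<in> elts X (n - 1) \<and> cdiff X (n - 1) y = q n k"
        "y' \<in> elts X (n - 1) \<and> z' \<in> elts X (n - 1) \<and> cdiff X (n - 1) y' = q n k'"
      then show "y \<oplus>\<^bsub>cob X (n - 1)\<^esub> y' \<in> elts X (n - 1) \<and> z \<oplus>\<^bsub>cob X (n - 1)\<^esub> z' \<in> elts X (n - 1) \<and> cdiff X (n - 1) (y \<oplus>\<^bsub>cob X (n - 1)\<^esub> y') = q n (k \<oplus>\<^bsub>G n\<^esub> k')"
        by (simp add: K_def ahom_add[OF dX(1)] ahom_add[OF q])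
    qed auto
    then show ?thesis unfolding L_def by blast
  qed
  then have "\<forall>n. \<exists>l. L n l" by blast
  from choice[OF this] obtain l where l: "\<forall>n. L n (l n)" ..
  have la: "l n \<in> ahom (zmod (G n) (K n)) (cob X (n - 1))" and dl: "k \<in> K n \<Longrightarrow> cdiff X (n - 1) (l n k) = q n k" for n k
    using spec[OF l, of n] by (simp_all add: L_def)
  define D where "D n = pair_group (zmod (G n) (F n)) (zmod (G (n + 1)) (K (n + 1)))" for n
  have gD: "abelian_group (D n)" for n unfolding D_def by (intro abelian_group_pair abelian_group_zmod gG F K)
  have Fc: "F n \<subseteq> carrier (G n)" and Kc: "K n \<subseteq> carrier (G n)" for n by (auto simp: F_def K_def)
  have tD: "tff (D n) (carrier (D n))" for n
    unfolding D_def by (rule tff_pair) (simp_all add: tff_mono[OF tG Fc] tff_mono[OF tG Kc])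
  define E where "E n = zmod (D n) (carrier (D n))" for n
  have Es: "carrier (E n) = F n \<times> K (n + 1)" "\<zero>\<^bsub>E n\<^esub> = (\<zero>\<^bsub>G n\<^esub>, \<zero>\<^bsub>G (n + 1)\<^esub>)"
    "(f, k) \<oplus>\<^bsub>E n\<^esub> (f', k') = (f \<oplus>\<^bsub>G n\<^esub> f', k \<oplus>\<^bsub>G (n + 1)\<^esub> k')" for n f k f' k'
    by (simp_all add: E_def D_def pair_group_simps)
  have mE: "module \<Z> (E n)" for n unfolding E_def by (rule module_zmod[OF gD asub_carrier[OF gD]])
  have tE: "tff (E n) (carrier (E n))" for n using tD by (simp add: E_def)
  \<comment> \<open>Each term is countable and is copied into \<open>'a\<close> by an injection of
    its own.\<close>
  have "\<exists>e :: (nat \<Rightarrow> int) \<times> (nat \<Rightarrow> int) \<Rightarrow> 'a. inj_on e (carrier (E n))" for n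
    by (rule ex_inj_on_infinite, rule countable_tff[OF _ asub_carrier tE]) (use mE in \<open>simp_all add: module_def\<close>)
  then have "\<forall>n. \<exists>e :: (nat \<Rightarrow> int) \<times> (nat \<Rightarrow> int) \<Rightarrow> 'a. inj_on e (carrier (E n))" by blast
  from choice[OF this] obtain e :: "int \<Rightarrow> (nat \<Rightarrow> int) \<times> (nat \<Rightarrow> int) \<Rightarrow> 'a" where e: "\<forall>n. inj_on (e n) (carrier (E n))" ..
  have e: "inj_on (e n) (carrier (E n))" for n using e by blast
  let ?i = "\<lambda>n. inv_into (carrier (E n)) (e n)"
  define T where "T n = transport (e n) (E n)" for n
  have mT: "module \<Z> (T n)" and tT: "tff (T n) (carrier (T n))" for n
    unfolding T_def by (rule module_transport[OF mE e], rule tff_transport[OF mE tE e])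
  have gT: "abelian_group (T n)" for n using mT by (simp add: module_def)
  note ts = transport_simps[OF e, folded T_def]
  have ei: "?i n (e n (f, k)) = (f, k)" if "f \<in> F n" "k \<in> K (n + 1)" for n f k
    using that e[of n] by (simp add: Es)
  have eT: "e n (f, k) \<in> carrier (T n)" if "f \<in> F n" "k \<in> K (n + 1)" for n f k
    using that by (simp add: ts Es)
  have cT: "\<exists>f k. f \<in> F n \<and> k \<in> K (n + 1) \<and> y = e n (f, k)" if "y \<in> carrier (T n)" for n y
    using that by (auto simp: ts Es)
  have addT: "e n (f, k) \<oplus>\<^bsub>T n\<^esub> e n (f', k') = e n (f \<oplus>\<^bsub>G n\<^esub> f', k \<oplus>\<^bsub>G (n + 1)\<^esub> k')"
    if "f \<in> F n" "k \<in> K (n + 1)" "f' \<in> F n" "k' \<in> K (n + 1)" for n f k f' k'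
    using that by (simp add: ts(3) Es)
  have F0: "\<zero>\<^bsub>G n\<^esub> \<in> F n" and K0: "\<zero>\<^bsub>G n\<^esub> \<in> K n" and Fa: "f \<in> F n \<Longrightarrow> f' \<in> F n \<Longrightarrow> f \<oplus>\<^bsub>G n\<^esub> f' \<in> F n"
    and Ka: "f \<in> K n \<Longrightarrow> f' \<in> K n \<Longrightarrow> f \<oplus>\<^bsub>G n\<^esub> f' \<in> K n" for n f f'
    using F[of n] K[of n] by (auto simp: asub_def)
  have zT: "\<zero>\<^bsub>T n\<^esub> = e n (\<zero>\<^bsub>G n\<^esub>, \<zero>\<^bsub>G (n + 1)\<^esub>)" for n by (simp add: ts Es)
  define P where "P = \<lparr>cob = T, cdiff = (\<lambda>n. \<lambda>y\<in>carrier (T n). e (n + 1) (snd (?i n y), \<zero>\<^bsub>G (n + 2)\<^esub>))\<rparr>"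
  have Pc: "cob P = T" by (simp add: P_def)
  have dP: "cdiff P n (e n (f, k)) = e (n + 1) (k, \<zero>\<^bsub>G (n + 2)\<^esub>)" if "f \<in> F n" "k \<in> K (n + 1)" for n f k
    using that by (simp add: P_def eT ei)
  \<comment> \<open>At (f, k) the value is q(f) + l(k). Its boundary is q(k), since q(f) is a
    cocycle and l lifts q; and q(k) is also the value at d(f, k) = (k, 0).\<close>
  define p where "p n = (\<lambda>y\<in>carrier (T n). q n (fst (?i n y)) \<oplus>\<^bsub>cob X n\<^esub> l (n + 1) (snd (?i n y)))" for n
  have pe: "p n (e n (f, k)) = q n f \<oplus>\<^bsub>cob X n\<^esub> l (n + 1) k" if "f \<in> F n" "k \<in> K (n + 1)" for n f k
    using that by (simp add: p_def eT ei)
  have qc: "q n f \<in> elts X n" if "f \<in> F n" for n f using ahom_closed[OF q] Fc that by blast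
  have lc: "l (n + 1) k \<in> elts X n" if "k \<in> K (n + 1)" for n k using ahom_closed[OF la, of k "n + 1"] that by simp
  have lz: "l (n + 1) \<zero>\<^bsub>G (n + 1)\<^esub> = \<zero>\<^bsub>cob X n\<^esub>" for n
    using ahom_zero[OF la abelian_group_zmod[OF gG K] gX, of "n + 1"] by simp
  have ladd: "l (n + 1) (k \<oplus>\<^bsub>G (n + 1)\<^esub> k') = l (n + 1) k \<oplus>\<^bsub>cob X n\<^esub> l (n + 1) k'" if "k \<in> K (n + 1)" "k' \<in> K (n + 1)" for n k k'
    using ahom_add[OF la, of k "n + 1" k'] that by simp
  have qadd: "q n (f \<oplus>\<^bsub>G n\<^esub> f') = q n f \<oplus>\<^bsub>cob X n\<^esub> q n f'" if "f \<in> F n" "f' \<in> F n" for n f f'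
    using ahom_add[OF q, of f n f'] Fc that by blast
  have dPh: "cdiff P n \<in> ahom (T n) (T (n + 1))" for n
  proof (rule ahomI)
    show "cdiff P n \<in> extensional (carrier (T n))" by (simp add: P_def)
  next
    fix x assume "x \<in> carrier (T n)"
    then obtain f k where x: "f \<in> F n" "k \<in> K (n + 1)" "x = e n (f, k)" using cT by blast
    then show "cdiff P n x \<in> carrier (T (n + 1))" using eT[of k "n + 1" "\<zero>\<^bsub>G (n + 2)\<^esub>"] KF[of "n + 1"] K0[of "n + 2"] dP[OF x(1,2)] by (auto simp: add.assoc)
  next
    fix x y assume "x \<in> carrier (T n)" "y \<in> carrier (T n)"
    then obtain f k f' k' where x: "f \<in> F n" "k \<in> K (n + 1)" "x = e n (f, k)" and y: "f' \<in> F n" "k' \<in> K (n + 1)" "y = e n (f', k')"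
      using cT by meson
    have "k \<in> F (n + 1)" "k' \<in> F (n + 1)" using KF x y by blast+
    then have "e (n + 1) (k, \<zero>\<^bsub>G (n + 2)\<^esub>) \<oplus>\<^bsub>T (n + 1)\<^esub> e (n + 1) (k', \<zero>\<^bsub>G (n + 2)\<^esub>) = e (n + 1) (k \<oplus>\<^bsub>G (n + 1)\<^esub> k', \<zero>\<^bsub>G (n + 2)\<^esub>)"
      using addT[of k "n + 1" "\<zero>\<^bsub>G (n + 2)\<^esub>" k' "\<zero>\<^bsub>G (n + 2)\<^esub>"] K0[of "n + 2"] abelian_groupE(5)[OF gG abelian_groupE(2)[OF gG], of "n + 2"] by (simp add: add.assoc)
    then show "cdiff P n (x \<oplus>\<^bsub>T n\<^esub> y) = cdiff P n x \<oplus>\<^bsub>T (n + 1)\<^esub> cdiff P n y"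
      using x y addT[OF x(1,2) y(1,2)] dP[OF Fa[OF x(1) y(1)] Ka[OF x(2) y(2)]] dP[OF x(1,2)] dP[OF y(1,2)] by simp
  qed
  have dd: "cdiff P (n + 1) (cdiff P n x) = \<zero>\<^bsub>T (n + 2)\<^esub>" if y: "x \<in> carrier (T n)" for n x
  proof -
    obtain f k where x: "f \<in> F n" "k \<in> K (n + 1)" "x = e n (f, k)" using cT[OF y] by blast
    have "k \<in> F (n + 1)" using KF x by blast
    then show ?thesis
      using dP[OF x(1,2)] dP[of k "n + 1" "\<zero>\<^bsub>G (n + 2)\<^esub>"] K0[of "n + 2"] zT[of "n + 2"] x(3) by (simp add: add.assoc)
  qed
  \<comment> \<open>The term in degree n depends on \<open>X\<close> in degrees n and n + 1 only,
    hence all but finitely many terms are zero.\<close>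
  have triv: "carrier (T n) = {\<zero>\<^bsub>T n\<^esub>}" if "elts X n = {\<zero>\<^bsub>cob X n\<^esub>}" "elts X (n + 1) = {\<zero>\<^bsub>cob X (n + 1)\<^esub>}" for n
  proof -
    have "F n = {\<zero>\<^bsub>G n\<^esub>}" "K (n + 1) = {\<zero>\<^bsub>G (n + 1)\<^esub>}" using r0[OF that(1)] r0[OF that(2)] Fc[of n] Kc[of "n + 1"] F0[of n] K0[of "n + 1"] by blast+
    then show ?thesis by (simp add: ts Es)
  qed
  have fin: "finite {n. carrier (T n) \<noteq> {\<zero>\<^bsub>T n\<^esub>}}"
  proof (rule finite_subset)
    let ?S = "{n. elts X n \<noteq> {\<zero>\<^bsub>cob X n\<^esub>}}"
    show "{n. carrier (T n) \<noteq> {\<zero>\<^bsub>T n\<^esub>}} \<subseteq> ?S \<union> (\<lambda>n. n - 1) ` ?S"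
    proof
      fix n assume "n \<in> {n. carrier (T n) \<noteq> {\<zero>\<^bsub>T n\<^esub>}}"
      then have "n \<in> ?S \<or> n + 1 \<in> ?S" using triv[of n] by auto
      then show "n \<in> ?S \<union> (\<lambda>n. n - 1) ` ?S" using image_eqI[of n "\<lambda>n. n - 1" "n + 1" ?S] by auto
    qed
    show "finite (?S \<union> (\<lambda>n. n - 1) ` ?S)" using complexD(7)[OF X] by simp
  qed
  have bP: "bounded_complex \<Z> P"
    unfolding bounded_complex_def Pc using fg_module_tff[OF mT tT] dPh dd fin mod_hom_int[OF mT mT] by simp
  have ph: "p \<in> chain_maps \<Z> P X"
  proof (rule chain_mapsI)
    fix n
    interpret Xn: abelian_group "cob X n" by (rule gX)
    have "p n \<in> ahom (T n) (cob X n)"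
    proof (rule ahomI)
      show "p n \<in> extensional (carrier (T n))" by (simp add: p_def)
      fix x assume "x \<in> carrier (T n)"
      then obtain f k where x: "f \<in> F n" "k \<in> K (n + 1)" "x = e n (f, k)" using cT by blast
      then show "p n x \<in> elts X n" using pe[OF x(1,2)] qc lc by simp
    next
      fix x y assume "x \<in> carrier (T n)" "y \<in> carrier (T n)"
      then obtain f k f' k' where x: "f \<in> F n" "k \<in> K (n + 1)" "x = e n (f, k)" and y: "f' \<in> F n" "k' \<in> K (n + 1)" "y = e n (f', k')"
        using cT by meson
      show "p n (x \<oplus>\<^bsub>T n\<^esub> y) = p n x \<oplus>\<^bsub>cob X n\<^esub> p n y"
        using addT[OF x(1,2) y(1,2)] pe[OF Fa[OF x(1) y(1)] Ka[OF x(2) y(2)]] pe[OF x(1,2)] pe[OF y(1,2)] x y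
          qc[OF x(1)] qc[OF y(1)] lc[OF x(2)] lc[OF y(2)] by (simp add: qadd ladd Xn.a_ac)
    qed
    then show "p n \<in> mod_hom \<Z> (cob P n) (cob X n)" using mod_hom_int[OF mT complexD(2)[OF X]] by (simp add: Pc)
    fix x assume "x \<in> elts P n"
    then obtain f k where x: "f \<in> F n" "k \<in> K (n + 1)" "x = e n (f, k)" using cT[of x n] unfolding Pc by blast
    have kF: "k \<in> F (n + 1)" using KF x by blast
    have "p (n + 1) (cdiff P n x) = q (n + 1) k"
      using dP[OF x(1,2)] pe[OF kF, of "\<zero>\<^bsub>G (n + 2)\<^esub>"] K0[of "n + 2"] lz[of "n + 1"] x(3) qc[OF kF] abelian_group.axioms(1)[OF gX]
        abelian_monoid.r_zero[OF abelian_group.axioms(1)[OF gX] qc[OF kF]] by (simp add: add.assoc)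
    moreover have "cdiff X n (p n x) = q (n + 1) k"
    proof -
      have "cdiff X n (q n f) = \<zero>\<^bsub>cob X (n + 1)\<^esub>" using x(1) by (simp add: F_def cocycles_def)
      moreover have "cdiff X n (l (n + 1) k) = q (n + 1) k" using dl[OF x(2)] by simp
      ultimately show ?thesis using pe[OF x(1,2)] x(3) qc[OF x(1)] lc[OF x(2)] abelian_groupE(5)[OF gX qc[OF kF]]
        by (simp add: ahom_add[OF dXa])
    qed
    ultimately show "p (n + 1) (cdiff P n x) = cdiff X n (p n x)" by simp
  qed
  \<comment> \<open>The cocycles of \<open>P\<close> are the pairs (f, 0), and the coboundaries are
    those with f in \<open>K n\<close>. As \<open>K n\<close> is the full preimage of the
    coboundaries and \<open>q n\<close> is onto, the map on cohomology is bijective.\<close>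
  have "quasi_iso P X p"
  proof (rule quasi_isoI[OF bP X ph])
    fix n x y assume x0: "x \<in> elts P n" and dx: "cdiff P n x = \<zero>\<^bsub>cob P (n + 1)\<^esub>" and y: "y \<in> elts X (n - 1)" "p n x = cdiff X (n - 1) y"
    obtain f k where x: "f \<in> F n" "k \<in> K (n + 1)" "x = e n (f, k)" using cT[of x n] x0 unfolding Pc by blast
    have kF: "k \<in> F (n + 1)" using KF x by blast
    have "e (n + 1) (k, \<zero>\<^bsub>G (n + 2)\<^esub>) = e (n + 1) (\<zero>\<^bsub>G (n + 1)\<^esub>, \<zero>\<^bsub>G (n + 2)\<^esub>)"
      using dx dP[OF x(1,2)] zT[of "n + 1"] x(3) by (simp add: Pc add.assoc)
    then have "k = \<zero>\<^bsub>G (n + 1)\<^esub>"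
      using inj_onD[OF e[of "n + 1"]] kF F0[of "n + 1"] K0[of "n + 2"] by (fastforce simp: Es add.assoc)
    then have "q n f = cdiff X (n - 1) y"
      using y(2) pe[OF x(1,2)] x(3) lz[of n] abelian_monoid.r_zero[OF abelian_group.axioms(1)[OF gX] qc[OF x(1)]] by simp
    then have fK: "f \<in> K n" using x(1) y(1) by (auto simp: K_def F_def coboundaries_def)
    have "cdiff P (n - 1) (e (n - 1) (\<zero>\<^bsub>G (n - 1)\<^esub>, f)) = x"
      using dP[OF F0[of "n - 1"], of f] fK x(3) \<open>k = \<zero>\<^bsub>G (n + 1)\<^esub>\<close> by (simp add: add.commute)
    moreover have "e (n - 1) (\<zero>\<^bsub>G (n - 1)\<^esub>, f) \<in> carrier (T (n - 1))" using eT[OF F0[of "n - 1"], of f] fK by simp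
    ultimately show "\<exists>w\<in>elts P (n - 1). x = cdiff P (n - 1) w" unfolding Pc by (intro bexI[of _ "e (n - 1) (\<zero>\<^bsub>G (n - 1)\<^esub>, f)"]) (rule sym)
  next
    fix n y assume y: "y \<in> elts X n" "cdiff X n y = \<zero>\<^bsub>cob X (n + 1)\<^esub>"
    obtain f where f: "f \<in> carrier (G n)" "q n f = y" using y(1) unfolding qs[of n, symmetric] by (elim imageE) simp
    then have fF: "f \<in> F n" using y by (simp add: F_def cocycles_def)
    let ?x = "e n (f, \<zero>\<^bsub>G (n + 1)\<^esub>)"
    note r_zero = abelian_monoid.r_zero[OF abelian_group.axioms(1)[OF gX]]
    have "p n ?x = y" using pe[OF fF K0] lz[of n] f(2) r_zero[OF y(1)] by simp
    moreover have "cdiff P n ?x = \<zero>\<^bsub>T (n + 1)\<^esub>" using dP[OF fF K0] zT[of "n + 1"] by (simp add: add.assoc)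
    moreover have "cdiff X (n - 1) \<zero>\<^bsub>cob X (n - 1)\<^esub> = \<zero>\<^bsub>cob X n\<^esub>" by (rule ahom_zero[OF dX(1) gX gX])
    ultimately have "cdiff P n ?x = \<zero>\<^bsub>T (n + 1)\<^esub> \<and> y = p n ?x \<oplus>\<^bsub>cob X n\<^esub> cdiff X (n - 1) \<zero>\<^bsub>cob X (n - 1)\<^esub>"
      using r_zero[OF y(1)] by simp
    then show "\<exists>x\<in>elts P n. \<exists>z\<in>elts X (n - 1). cdiff P n x = \<zero>\<^bsub>cob P (n + 1)\<^esub> \<and> y = p n x \<oplus>\<^bsub>cob X n\<^esub> cdiff X (n - 1) z"
      unfolding Pc using eT[OF fF K0] abelian_groupE(2)[OF gX[of "n - 1"]] by (intro bexI)
  qed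
  moreover have "tff_complex P" using bP tT by (simp add: tff_complex_def Pc)
  ultimately show ?thesis using that ph by blast
qed

section \<open>The derived category\<close>

text \<open>Membership of the difference in the ideal, rewritten without subtraction and with
  homotopies from \<open>ahom\<close>, which is the form in which the lifting lemmas deliver
  them.\<close>

lemma cls_homotopy_iff:
  assumes P: "bounded_complex \<Z> P" and X: "bounded_complex \<Z> X" and f: "f \<in> chain_maps \<Z> P X" and g: "g \<in> chain_maps \<Z> P X"
  shows "K.cls P X f = K.cls P X g \<longleftrightarrow> (\<exists>h. (\<forall>n. h n \<in> ahom (cob P n) (cob X (n - 1))) \<and>
    (\<forall>n. \<forall>x\<in>elts P n. f n x = g n x \<oplus>\<^bsub>cob X n\<^esub> (hmap P X h n x)))"
proof -
  let ?C = "Cpx"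
  let ?fg = "\<lambda>n. \<lambda>x\<in>elts P n. f n x \<oplus>\<^bsub>cob X n\<^esub> \<ominus>\<^bsub>cob X n\<^esub> g n x"
  have O: "P \<in> Obj ?C" "X \<in> Obj ?C" using P X by (simp_all add: complex_cat_simps)
  have H: "f \<in> mor ?C P X" "g \<in> mor ?C P X" using f g by (simp_all add: complex_cat_simps)
  interpret H: abelian_group "Hom ?C P X" by (rule K.Hom_abelian_group[OF O])
  note g' = chain_maps_neg[OF int_is_cring P X g]
  have fg: "?fg \<in> chain_maps \<Z> P X"
    using chain_maps_add[OF int_is_cring P X f g'] by (simp add: restrict_def cong: if_cong)
  have "\<ominus>\<^bsub>Hom ?C P X\<^esub> g = (\<lambda>n. \<lambda>x\<in>elts P n. \<ominus>\<^bsub>cob X n\<^esub> g n x)"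
  proof (rule H.minus_equality)
    show "(\<lambda>n. \<lambda>x\<in>elts P n. \<ominus>\<^bsub>cob X n\<^esub> g n x) \<oplus>\<^bsub>Hom ?C P X\<^esub> g = \<zero>\<^bsub>Hom ?C P X\<^esub>"
      using abelian_group.l_neg[OF complexD(3)[OF X] chain_mapsD(3)[OF g]] by (auto simp: complex_cat_simps fun_eq_iff)
  qed (use g g' in \<open>simp_all add: complex_cat_simps\<close>)
  then have "f \<ominus>\<^bsub>Hom ?C P X\<^esub> g = ?fg" by (auto simp: a_minus_def complex_cat_simps fun_eq_iff)
  then have "K.cls P X f = K.cls P X g \<longleftrightarrow> ?fg \<in> null_homotopic \<Z> P X" using K.cls_eq_iff[OF O H(2,1)] by simp
  also have "\<dots> \<longleftrightarrow> (\<exists>h. (\<forall>n. h n \<in> ahom (cob P n) (cob X (n - 1))) \<and>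
    (\<forall>n. \<forall>x\<in>elts P n. f n x \<oplus>\<^bsub>cob X n\<^esub> \<ominus>\<^bsub>cob X n\<^esub> g n x = hmap P X h n x))"
    using fg mod_hom_int[OF complexD(2)[OF P] complexD(2)[OF X]] by (simp add: null_homotopic_def)
  also have "\<dots> \<longleftrightarrow> (\<exists>h. (\<forall>n. h n \<in> ahom (cob P n) (cob X (n - 1))) \<and>
    (\<forall>n. \<forall>x\<in>elts P n. f n x = g n x \<oplus>\<^bsub>cob X n\<^esub> (hmap P X h n x)))"
  proof (rule ex_cong1, rule conj_cong[OF refl], intro all_cong1 ball_cong[OF refl])
    fix h n x assume h: "\<forall>n. h n \<in> ahom (cob P n) (cob X (n - 1))" and x: "x \<in> elts P n"
    interpret Xn: abelian_group "cob X n" by (rule complexD(3)[OF X])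
    let ?v = "hmap P X h n x"
    have "cdiff X (n - 1) (h n x) \<in> elts X n" using complex_prev(2)[OF X ahom_closed[OF spec[OF h] x]] .
    moreover have "h (n + 1) (cdiff P n x) \<in> elts X n"
      using ahom_closed[OF spec[OF h, of "n + 1"] complex_prev(3)[OF P x]] by simp
    ultimately have v: "?v \<in> elts X n" by simp
    have c: "f n x \<in> elts X n" "g n x \<in> elts X n" using chain_mapsD(3)[OF f x] chain_mapsD(3)[OF g x] .
    show "f n x \<oplus>\<^bsub>cob X n\<^esub> \<ominus>\<^bsub>cob X n\<^esub> g n x = ?v \<longleftrightarrow> f n x = g n x \<oplus>\<^bsub>cob X n\<^esub> ?v"
    proof
      assume "f n x \<oplus>\<^bsub>cob X n\<^esub> \<ominus>\<^bsub>cob X n\<^esub> g n x = ?v"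
      then show "f n x = g n x \<oplus>\<^bsub>cob X n\<^esub> ?v" using c by (metis Xn.a_comm Xn.a_assoc Xn.a_inv_closed Xn.l_neg Xn.r_zero)
    next
      assume e: "f n x = g n x \<oplus>\<^bsub>cob X n\<^esub> ?v"
      show "f n x \<oplus>\<^bsub>cob X n\<^esub> \<ominus>\<^bsub>cob X n\<^esub> g n x = ?v"
        by (rule Xn.eq_add_imp_minus[OF v c(2)]) (simp only: e Xn.a_comm[OF v c(2)])
    qed
  qed
  finally show ?thesis .
qed

lemma quasi_isosE:
  assumes "bounded_complex \<Z> X" "bounded_complex \<Z> Y" "F \<in> quasi_isos \<Z> X Y"
  obtains f where "f \<in> chain_maps \<Z> X Y" "quasi_iso X Y f" "F = K.cls X Y f"
proof -
  have O: "X \<in> Obj Cpx" "Y \<in> Obj Cpx" using assms by (simp_all add: complex_cat_simps)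
  obtain f where f: "F \<in> mor Htp X Y" "f \<in> F" "quasi_iso X Y f" using assms by (auto simp: quasi_isos_def)
  obtain g where g: "g \<in> mor Cpx X Y" "F = K.cls X Y g" by (rule K.Hom_Q_cases[OF O f(1)])
  have "f \<in> mor Cpx X Y" "K.cls X Y f = K.cls X Y g" using f(2) g(2) K.mem_cls_iff[OF O g(1)] by simp_all
  then show ?thesis using that[of f] f(3) g(2) by (simp add: complex_cat_simps)
qed

lemma cls_quasi_isos:
  assumes "bounded_complex \<Z> X" "bounded_complex \<Z> Y" "f \<in> chain_maps \<Z> X Y" "quasi_iso X Y f"
  shows "K.cls X Y f \<in> quasi_isos \<Z> X Y"
  using assms K.cls_self[of X Y f] K.cls_closed[of X Y f] by (auto simp: quasi_isos_def complex_cat_simps)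

lemma quasi_iso_compose:
  assumes X: "bounded_complex \<Z> X" and Y: "bounded_complex \<Z> Y" and Z: "bounded_complex \<Z> Z"
    and f: "f \<in> chain_maps \<Z> X Y" "quasi_iso X Y f" and g: "g \<in> chain_maps \<Z> Y Z" "quasi_iso Y Z g"
  shows "quasi_iso X Z (\<lambda>n. compose (elts X n) (g n) (f n))"
proof (rule quasi_isoI[OF X Z chain_maps_compose[OF X f(1) g(1)]])
  fix n x y assume x: "x \<in> elts X n" "cdiff X n x = \<zero>\<^bsub>cob X (n + 1)\<^esub>" "y \<in> elts Z (n - 1)"
    "compose (elts X n) (g n) (f n) x = cdiff Z (n - 1) y"
  have fx: "f n x \<in> elts Y n" by (rule chain_mapsD(3)[OF f(1) x(1)])
  have dfx: "cdiff Y n (f n x) = \<zero>\<^bsub>cob Y (n + 1)\<^esub>"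
    using chain_mapsD(4)[OF f(1) x(1)] x(2) ahom_zero[OF chain_mapsD(2)[OF f(1)] complexD(3)[OF X] complexD(3)[OF Y]] by simp
  obtain w where w: "w \<in> elts Y (n - 1)" "f n x = cdiff Y (n - 1) w"
    using quasi_isoD(1)[OF Y Z g fx dfx x(3)] x(1,4) by (auto simp: compose_def)
  show "\<exists>w\<in>elts X (n - 1). x = cdiff X (n - 1) w" by (rule quasi_isoD(1)[OF X Y f x(1,2) w])
next
  fix n y assume y: "y \<in> elts Z n" "cdiff Z n y = \<zero>\<^bsub>cob Z (n + 1)\<^esub>"
  interpret Zn: abelian_group "cob Z n" by (rule complexD(3)[OF Z])
  obtain u v where u: "u \<in> elts Y n" "v \<in> elts Z (n - 1)" "cdiff Y n u = \<zero>\<^bsub>cob Y (n + 1)\<^esub>"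
    "y = g n u \<oplus>\<^bsub>cob Z n\<^esub> cdiff Z (n - 1) v" using quasi_isoD(2)[OF Y Z g y] by blast
  obtain x w where x: "x \<in> elts X n" "w \<in> elts Y (n - 1)" "cdiff X n x = \<zero>\<^bsub>cob X (n + 1)\<^esub>"
    "u = f n x \<oplus>\<^bsub>cob Y n\<^esub> cdiff Y (n - 1) w" using quasi_isoD(2)[OF X Y f u(1,3)] by blast
  have fx: "f n x \<in> elts Y n" by (rule chain_mapsD(3)[OF f(1) x(1)])
  have gw: "g (n - 1) w \<in> elts Z (n - 1)" by (rule chain_mapsD(3)[OF g(1) x(2)])
  have gfx: "g n (f n x) \<in> elts Z n" by (rule chain_mapsD(3)[OF g(1) fx])
  have "g n u = g n (f n x) \<oplus>\<^bsub>cob Z n\<^esub> cdiff Z (n - 1) (g (n - 1) w)"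
    using ahom_add[OF chain_mapsD(2)[OF g(1)] fx complex_prev(2)[OF Y x(2)]] chain_map_prev[OF g(1) x(2)] x(4) by simp
  then have "y = compose (elts X n) (g n) (f n) x \<oplus>\<^bsub>cob Z n\<^esub> cdiff Z (n - 1) (g (n - 1) w \<oplus>\<^bsub>cob Z (n - 1)\<^esub> v)"
    using x(1) u(4) gfx complex_prev(2)[OF Z gw] complex_prev(2)[OF Z u(2)]
    by (simp add: compose_def Zn.a_assoc ahom_add[OF complex_prev(1)[OF Z] gw u(2)])
  then show "\<exists>x\<in>elts X n. \<exists>z\<in>elts Z (n - 1). cdiff X n x = \<zero>\<^bsub>cob X (n + 1)\<^esub> \<and>
      y = compose (elts X n) (g n) (f n) x \<oplus>\<^bsub>cob Z n\<^esub> cdiff Z (n - 1) z"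
    using x(1,3) abelian_groupE(1)[OF complexD(3)[OF Z] gw u(2)] by (intro bexI conjI)
qed

lemma quasi_iso_ident:
  assumes X: "bounded_complex \<Z> X"
  shows "quasi_iso X X (\<lambda>n. \<lambda>x\<in>elts X n. x)"
proof (rule quasi_isoI[OF X X])
  show "(\<lambda>n. \<lambda>x\<in>elts X n. x) \<in> chain_maps \<Z> X X" using K.Ident_closed[of X] X by (simp add: complex_cat_simps)
  fix n x assume x: "x \<in> elts X n" "cdiff X n x = \<zero>\<^bsub>cob X (n + 1)\<^esub>"
  interpret Xn: abelian_group "cob X n" by (rule complexD(3)[OF X])
  have "cdiff X (n - 1) \<zero>\<^bsub>cob X (n - 1)\<^esub> = \<zero>\<^bsub>cob X n\<^esub>"
    by (rule ahom_zero[OF complex_prev(1)[OF X] complexD(3)[OF X] complexD(3)[OF X]])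
  then have "x = (\<lambda>x\<in>elts X n. x) x \<oplus>\<^bsub>cob X n\<^esub> cdiff X (n - 1) \<zero>\<^bsub>cob X (n - 1)\<^esub>" using x by simp
  then show "\<exists>x'\<in>elts X n. \<exists>z\<in>elts X (n - 1). cdiff X n x' = \<zero>\<^bsub>cob X (n + 1)\<^esub> \<and>
      x = (\<lambda>x\<in>elts X n. x) x' \<oplus>\<^bsub>cob X n\<^esub> cdiff X (n - 1) z"
    using x abelian_groupE(2)[OF complexD(3)[OF X, of "n - 1"]] by (intro bexI conjI)
qed auto

lemma Obj_complex_cat: "X \<in> Obj (complex_cat R) \<longleftrightarrow> bounded_complex R X" by (simp add: complex_cat_simps)

text \<open>In the homotopy category lifts exist by \<open>lift_exists\<close> and are unique by
  \<open>lift_null\<close>, applied to the difference of two lifts; \<open>resolution_exists\<close>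
  provides the resolutions.\<close>

lemma enough_projectives_homotopy:
  "enough_projectives (Htp :: ((int, 'a::infinite) cochain, _) precat) (quasi_isos \<Z>) {P. tff_complex P}"
proof (intro enough_projectives.intro enough_projectives_axioms.intro)
  let ?H = "Htp :: ((int, 'a) cochain, _) precat"
  show "preadditive ?H" by (rule K.preadditive_Q)
  show "s \<in> quasi_isos \<Z> X Y \<Longrightarrow> s \<in> mor ?H X Y" for s X Y by (simp add: quasi_isos_def)
  show "Ident ?H X \<in> quasi_isos \<Z> X X" if X: "X \<in> Obj ?H" for X
  proof -
    have X: "bounded_complex \<Z> X" using X by (simp add: Obj_complex_cat)
    then show ?thesis unfolding K.Ident_Q
      by (intro cls_quasi_isos) (use quasi_iso_ident[OF X] K.Ident_closed[of X] in \<open>simp_all add: complex_cat_simps\<close>)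
  qed
  show "Cmp ?H X Y Z t s \<in> quasi_isos \<Z> X Z"
    if XYZ: "X \<in> Obj ?H" "Y \<in> Obj ?H" "Z \<in> Obj ?H" and s: "s \<in> quasi_isos \<Z> X Y" and t: "t \<in> quasi_isos \<Z> Y Z" for X Y Z s t
  proof -
    have b: "bounded_complex \<Z> X" "bounded_complex \<Z> Y" "bounded_complex \<Z> Z" using XYZ by (simp_all add: Obj_complex_cat)
    obtain f where f: "f \<in> chain_maps \<Z> X Y" "quasi_iso X Y f" "s = K.cls X Y f" by (rule quasi_isosE[OF b(1,2) s])
    obtain g where g: "g \<in> chain_maps \<Z> Y Z" "quasi_iso Y Z g" "t = K.cls Y Z g" by (rule quasi_isosE[OF b(2,3) t])
    have "Cmp ?H X Y Z t s = K.cls X Z (\<lambda>n. compose (elts X n) (g n) (f n))"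
      using K.Cmp_Q[of X Y Z f g] b f g by (simp add: complex_cat_simps)
    then show ?thesis using cls_quasi_isos[OF b(1,3) chain_maps_compose[OF b(1) f(1) g(1)] quasi_iso_compose[OF b f(1,2) g(1,2)]] by simp
  qed
  show "P \<in> {P. tff_complex P} \<Longrightarrow> P \<in> Obj ?H" for P by (simp add: Obj_complex_cat tff_complex_def)
  show "\<exists>P\<in>{P. tff_complex P}. \<exists>p. p \<in> quasi_isos \<Z> P X" if X: "X \<in> Obj ?H" for X
  proof -
    have X: "bounded_complex \<Z> X" using X by (simp add: Obj_complex_cat)
    obtain P p where p: "tff_complex P" "p \<in> chain_maps \<Z> P X" "quasi_iso P X p" by (rule resolution_exists[OF X])
    then have "K.cls P X p \<in> quasi_isos \<Z> P X" by (intro cls_quasi_isos X) (simp_all add: tff_complex_def)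
    then show ?thesis using p(1) by blast
  qed
  fix P W X s F assume P: "P \<in> {P. tff_complex P}" and WX: "W \<in> Obj ?H" "X \<in> Obj ?H" and s: "s \<in> quasi_isos \<Z> W X"
    and F: "F \<in> mor ?H P X"
  have P: "tff_complex P" using P by simp
  have b: "bounded_complex \<Z> P" "bounded_complex \<Z> W" "bounded_complex \<Z> X" using P WX by (simp_all add: Obj_complex_cat tff_complex_def)
  note O = b[folded Obj_complex_cat]
  obtain \<sigma> where \<sigma>: "\<sigma> \<in> chain_maps \<Z> W X" "quasi_iso W X \<sigma>" "s = K.cls W X \<sigma>" by (rule quasi_isosE[OF b(2,3) s])
  obtain f where f: "f \<in> chain_maps \<Z> P X" "F = K.cls P X f" using K.Hom_Q_cases[OF O(1,3) F] by (auto simp: complex_cat_simps)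
  have C: "Cmp ?H P W X s (K.cls P W u) = K.cls P X (\<lambda>n. compose (elts P n) (\<sigma> n) (u n))" if "u \<in> chain_maps \<Z> P W" for u
    using K.Cmp_Q[OF O, of u \<sigma>] that \<sigma> by (simp add: complex_cat_simps)
  show "\<exists>!u. u \<in> mor ?H P W \<and> Cmp ?H P W X s u = F"
  proof (rule ex_ex1I)
    obtain f' h where f': "f' \<in> chain_maps \<Z> P W" "\<And>n. h n \<in> ahom (cob P n) (cob X (n - 1))"
      "\<And>n x. x \<in> elts P n \<Longrightarrow> f n x = \<sigma> n (f' n x) \<oplus>\<^bsub>cob X n\<^esub> (hmap P X h n x)"
      by (rule lift_exists[OF P b(2,3) \<sigma>(1,2) f(1)]) (rule that)
    have "K.cls P X f = K.cls P X (\<lambda>n. compose (elts P n) (\<sigma> n) (f' n))"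
      unfolding cls_homotopy_iff[OF b(1,3) f(1) chain_maps_compose[OF b(1) f'(1) \<sigma>(1)]]
      using f'(2,3) by (intro exI[of _ h]) (simp add: compose_def)
    then show "\<exists>u. u \<in> mor ?H P W \<and> Cmp ?H P W X s u = F"
      using C[OF f'(1)] f(2) K.cls_closed[OF O(1,2), of f'] f'(1) by (intro exI[of _ "K.cls P W f'"]) (simp add: complex_cat_simps)
  next
    fix u v assume uv: "u \<in> mor ?H P W \<and> Cmp ?H P W X s u = F" "v \<in> mor ?H P W \<and> Cmp ?H P W X s v = F"
    obtain f where f: "f \<in> chain_maps \<Z> P W" "u = K.cls P W f" using K.Hom_Q_cases[OF O(1,2), of u] uv(1) by (auto simp: complex_cat_simps)
    obtain g where g: "g \<in> chain_maps \<Z> P W" "v = K.cls P W g" using K.Hom_Q_cases[OF O(1,2), of v] uv(2) by (auto simp: complex_cat_simps)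
    have Hf: "f \<in> mor Cpx P W" "g \<in> mor Cpx P W" using f g by (simp_all add: complex_cat_simps)
    interpret H: abelian_group "Hom Cpx P W" by (rule K.Hom_abelian_group[OF O(1,2)])
    define k where "k = f \<ominus>\<^bsub>Hom Cpx P W\<^esub> g"
    have k: "k \<in> mor Cpx P W" unfolding k_def using Hf by simp
    then have k': "k \<in> chain_maps \<Z> P W" by (simp add: complex_cat_simps)
    have "f = k \<oplus>\<^bsub>Hom Cpx P W\<^esub> g" unfolding k_def a_minus_def using Hf by (simp add: H.a_assoc H.l_neg)
    then have fk: "f n x = k n x \<oplus>\<^bsub>cob W n\<^esub> g n x" if "x \<in> elts P n" for n x
      using that by (simp add: complex_cat_simps)
    have "K.cls P X (\<lambda>n. compose (elts P n) (\<sigma> n) (f n)) = K.cls P X (\<lambda>n. compose (elts P n) (\<sigma> n) (g n))"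
      using uv C[OF f(1)] C[OF g(1)] f(2) g(2) by simp
    then obtain h where h: "\<And>n. h n \<in> ahom (cob P n) (cob X (n - 1))"
      "\<And>n x. x\<in>elts P n \<Longrightarrow> \<sigma> n (f n x) = \<sigma> n (g n x) \<oplus>\<^bsub>cob X n\<^esub> (hmap P X h n x)"
      unfolding cls_homotopy_iff[OF b(1,3) chain_maps_compose[OF b(1) f(1) \<sigma>(1)] chain_maps_compose[OF b(1) g(1) \<sigma>(1)]]
      by (auto simp: compose_def)
    have "k \<in> null_homotopic \<Z> P W"
    proof (rule lift_null[OF P b(2,3) \<sigma>(1,2) k' h(1)])
      fix n x assume x: "x \<in> elts P n"
      interpret Xn: abelian_group "cob X n" by (rule complexD(3)[OF b(3)])
      have c: "\<sigma> n (k n x) \<in> elts X n" "\<sigma> n (g n x) \<in> elts X n"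
        "cdiff X (n - 1) (h n x) \<in> elts X n" "h (n + 1) (cdiff P n x) \<in> elts X n"
        using chain_mapsD(3)[OF \<sigma>(1) chain_mapsD(3)[OF k' x]] chain_mapsD(3)[OF \<sigma>(1) chain_mapsD(3)[OF g(1) x]]
          complex_prev(2)[OF b(3) ahom_closed[OF h(1) x]]
          ahom_closed[OF h(1)[of "n + 1"] complex_prev(3)[OF b(1) x]] by simp_all
      have "\<sigma> n (g n x) \<oplus>\<^bsub>cob X n\<^esub> \<sigma> n (k n x) = \<sigma> n (g n x) \<oplus>\<^bsub>cob X n\<^esub> (hmap P X h n x)"
        unfolding h(2)[OF x, symmetric] fk[OF x] ahom_add[OF chain_mapsD(2)[OF \<sigma>(1)] chain_mapsD(3)[OF k' x] chain_mapsD(3)[OF g(1) x]]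
        using c by (simp add: Xn.a_comm)
      then show "\<sigma> n (k n x) = hmap P X h n x" using c by simp
    qed
    then show "u = v" unfolding f(2) g(2) using K.cls_eq_iff[OF O(1,2) Hf(2,1)] by (simp add: k_def)
  qed
qed

interpretation D: enough_projectives "Htp :: ((int, 'a::infinite) cochain, _) precat" "quasi_isos \<Z>" "{P. tff_complex P}"
  rewrites "localization Htp (quasi_isos \<Z>) = (Der :: ((int, 'a) cochain, _) precat)"
  by (rule enough_projectives_homotopy) (simp add: derived_cat_def)

section \<open>The shift\<close>

text \<open>The sign (-1)^k. It depends on the parity of \<open>k\<close> only, so negative
  exponents are covered too.\<close>

definition signed :: "int \<Rightarrow> ('a, 'b) ring_scheme \<Rightarrow> 'a \<Rightarrow> 'a" where
  "signed k G x = (if even k then x else \<ominus>\<^bsub>G\<^esub> x)"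

lemma signed_even: "even (i - j) \<Longrightarrow> signed i G = signed j G"
  by (auto simp: signed_def fun_eq_iff)

lemma signed_0 [simp]: "signed 0 G x = x"
  by (simp add: signed_def)

context abelian_group
begin

lemma signed_closed [simp]: "x \<in> carrier G \<Longrightarrow> signed k G x \<in> carrier G"
  by (simp add: signed_def)

lemma signed_zero [simp]: "signed k G \<zero> = \<zero>"
  by (simp add: signed_def minus_equality)

lemma signed_add: "x \<in> carrier G \<Longrightarrow> y \<in> carrier G \<Longrightarrow> signed k G (x \<oplus> y) = signed k G x \<oplus> signed k G y"
  by (simp add: signed_def minus_add)

lemma signed_signed: "x \<in> carrier G \<Longrightarrow> signed i G (signed j G x) = signed (i + j) G x"
  by (auto simp: signed_def)

lemma signed_twice [simp]: "x \<in> carrier G \<Longrightarrow> signed i G (signed i G x) = x"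
  by (auto simp: signed_def)

lemma signed_eq_zero_iff: "x \<in> carrier G \<Longrightarrow> signed k G x = \<zero> \<longleftrightarrow> x = \<zero>"
  using signed_twice[of x k] by (metis signed_zero)

end

lemma ahom_signed:
  assumes "f \<in> ahom G H" "abelian_group G" "abelian_group H" "x \<in> carrier G"
  shows "f (signed k G x) = signed k H (f x)"
  using ahom_neg[OF assms] by (simp add: signed_def)

lemma cob_shift [simp]:
  "cob (shift k X) n = cob X (n + k)"
  by (simp add: shift_def)

lemma cob_shift_Suc: "cob (shift k X) (n + 1) = cob X (n + k + 1)"
  and cob_shift_prev: "cob (shift k X) (n - 1) = cob X (n + k - 1)"
  by (simp_all add: algebra_simps)

lemma cdiff_shift: "x \<in> elts X (n + k) \<Longrightarrow> cdiff (shift k X) n x = signed k (cob X (n + k + 1)) (cdiff X (n + k) x)"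
  by (simp add: shift_def signed_def)

text \<open>The index n - 1 + k has to appear as n + k - 1 in the groups that depend on it; here and
  in the next lemma this arithmetic is done once and for all.\<close>

lemma cdiff_shift_prev:
  assumes "x \<in> elts X (n + k - 1)"
  shows "cdiff (shift k X) (n - 1) x = signed k (cob X (n + k)) (cdiff X (n + k - 1) x)"
proof -
  have "n - 1 + k = n + k - 1" "n + k - 1 + 1 = n + k" by simp_all
  from cdiff_shift[of x X "n - 1" k, unfolded this, OF assms] show ?thesis .
qed

lemma cdiff_shift_Suc:
  assumes "x \<in> elts X (n + k + 1)"
  shows "cdiff (shift k X) (n + 1) x = signed k (cob X (n + k + 2)) (cdiff X (n + k + 1) x)"
proof -
  have "n + 1 + k = n + k + 1" "n + k + 1 + 1 = n + k + 2" by simp_all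
  from cdiff_shift[of x X "n + 1" k, unfolded this, OF assms] show ?thesis .
qed

lemma bounded_complex_shift:
  assumes X: "bounded_complex \<Z> X"
  shows "bounded_complex \<Z> (shift k X)"
proof -
  note g = complexD(3)[OF X] and d = complexD(5)[OF X]
  have m: "cdiff (shift k X) n \<in> mod_hom \<Z> (cob (shift k X) n) (cob (shift k X) (n + 1))" for n
  proof -
    interpret A: abelian_group "cob X (n + k + 1)" by (rule g)
    have "cdiff (shift k X) n \<in> ahom (cob X (n + k)) (cob X (n + k + 1))"
    proof (rule ahomI)
      show "cdiff (shift k X) n \<in> extensional (elts X (n + k))" by (simp add: shift_def)
    next
      fix x assume "x \<in> elts X (n + k)"
      then show "cdiff (shift k X) n x \<in> elts X (n + k + 1)" using ahom_closed[OF d] by (simp add: cdiff_shift)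
    next
      fix x y assume "x \<in> elts X (n + k)" "y \<in> elts X (n + k)"
      then show "cdiff (shift k X) n (x \<oplus>\<^bsub>cob X (n + k)\<^esub> y) = cdiff (shift k X) n x \<oplus>\<^bsub>cob X (n + k + 1)\<^esub> cdiff (shift k X) n y"
        using ahom_closed[OF d] abelian_groupE(1)[OF g[of "n + k"]] by (simp add: cdiff_shift ahom_add[OF d] A.signed_add)
    qed
    then show ?thesis
      unfolding cob_shift_Suc unfolding cob_shift using mod_hom_int[OF complexD(2)[OF X] complexD(2)[OF X]] by simp
  qed
  have "cdiff (shift k X) (n + 1) (cdiff (shift k X) n x) = \<zero>\<^bsub>cob X (n + 2 + k)\<^esub>" if x: "x \<in> elts X (n + k)" for n x
  proof -
    have e: "n + 2 + k = n + k + 2" by simp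
    interpret A: abelian_group "cob X (n + k + 1)" by (rule g)
    interpret B: abelian_group "cob X (n + k + 2)" by (rule g)
    have dx: "cdiff X (n + k) x \<in> elts X (n + k + 1)" by (rule ahom_closed[OF d x])
    have d': "cdiff X (n + k + 1) \<in> ahom (cob X (n + k + 1)) (cob X (n + k + 2))" using d[of "n + k + 1"] by (simp add: add.assoc)
    have "cdiff X (n + k + 1) (cdiff X (n + k) x) = \<zero>\<^bsub>cob X (n + k + 2)\<^esub>"
      using complexD(6)[OF X x] by (simp add: add.assoc)
    then show ?thesis unfolding e cdiff_shift[OF x] cdiff_shift_Suc[OF A.signed_closed[OF dx]]
      by (simp add: ahom_signed[OF d' A.abelian_group_axioms B.abelian_group_axioms dx])
  qed
  moreover have "finite {n. elts X (n + k) \<noteq> {\<zero>\<^bsub>cob X (n + k)\<^esub>}}"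
  proof (rule finite_subset)
    show "finite ((\<lambda>n. n - k) ` {n. elts X n \<noteq> {\<zero>\<^bsub>cob X n\<^esub>}})" using complexD(7)[OF X] by simp
    show "{n. elts X (n + k) \<noteq> {\<zero>\<^bsub>cob X (n + k)\<^esub>}} \<subseteq> (\<lambda>n. n - k) ` {n. elts X n \<noteq> {\<zero>\<^bsub>cob X n\<^esub>}}"
    proof
      fix n assume "n \<in> {n. elts X (n + k) \<noteq> {\<zero>\<^bsub>cob X (n + k)\<^esub>}}"
      then show "n \<in> (\<lambda>n. n - k) ` {n. elts X n \<noteq> {\<zero>\<^bsub>cob X n\<^esub>}}" by (intro image_eqI[of _ _ "n + k"]) simp_all
    qed
  qed
  ultimately show ?thesis using m complexD(1)[OF X] by (simp add: bounded_complex_def)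
qed

lemma tff_complex_shift: "tff_complex P \<Longrightarrow> tff_complex (shift k P)"
  by (simp add: tff_complex_def bounded_complex_shift)

lemma shift_0:
  assumes X: "bounded_complex \<Z> X" shows "shift 0 X = X"
proof (rule cochain.equality)
  show "cdiff (shift 0 X) = cdiff X"
    using ahom_extensional[OF complexD(5)[OF X]] by (intro ext) (simp add: shift_def extensional_restrict)
qed (simp_all add: shift_def)

text \<open>The strictness on which composition in the orbit category relies. The signs multiply,
  and extensionality settles the values of the differentials outside the carriers.\<close>

lemma shift_shift:
  assumes X: "bounded_complex \<Z> X" shows "shift i (shift j X) = shift (i + j) X"
proof (rule cochain.equality)
  show "cob (shift i (shift j X)) = cob (shift (i + j) X)" by (simp add: fun_eq_iff add.assoc)
  show "cdiff (shift i (shift j X)) = cdiff (shift (i + j) X)"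
  proof (intro ext)
    fix n x
    have e: "n + i + j = n + (i + j)" "n + i + j + 1 = n + (i + j) + 1" by simp_all
    interpret A: abelian_group "cob X (n + (i + j) + 1)" by (rule complexD(3)[OF X])
    show "cdiff (shift i (shift j X)) n x = cdiff (shift (i + j) X) n x"
    proof (cases "x \<in> carrier (cob X (n + (i + j)))")
      case True
      then have dx: "cdiff X (n + (i + j)) x \<in> carrier (cob X (n + (i + j) + 1))" by (rule ahom_closed[OF complexD(5)[OF X]])
      have "cdiff (shift i (shift j X)) n x = signed i (cob (shift j X) (n + i + 1)) (cdiff (shift j X) (n + i) x)"
        by (rule cdiff_shift) (use True in \<open>simp add: e\<close>)
      also have "\<dots> = signed i (cob X (n + (i + j) + 1)) (signed j (cob X (n + (i + j) + 1)) (cdiff X (n + (i + j)) x))"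
        using cdiff_shift[of x X "n + i" j] True by (simp only: e cob_shift_Suc)
      finally show ?thesis using cdiff_shift[OF True] by (simp add: A.signed_signed[OF dx])
    next
      case False
      then have "x \<notin> elts X (n + i + j)" by (simp add: add.assoc)
      with False show ?thesis by (simp add: shift_def)
    qed
  qed
qed simp

lemma shift_inverse: "bounded_complex \<Z> X \<Longrightarrow> shift (- k) (shift k X) = X"
  by (simp add: shift_shift shift_0)

lemma shift_map_inverse [simp]: "shift_map (- k) (shift_map k f) = f" "shift_map k (shift_map (- k) f) = f"
  by (simp_all add: shift_map_def)

lemma shift_class_inverse [simp]: "shift_class (- k) (shift_class k F) = F" "shift_class k (shift_class (- k) F) = F"
  by (simp_all add: shift_class_def image_image)

lemma shift_map_chain_maps:
  assumes X: "bounded_complex \<Z> X" and Y: "bounded_complex \<Z> Y" and f: "f \<in> chain_maps \<Z> X Y"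
  shows "shift_map k f \<in> chain_maps \<Z> (shift k X) (shift k Y)"
proof (rule chain_mapsI)
  fix n
  show "shift_map k f n \<in> mod_hom \<Z> (cob (shift k X) n) (cob (shift k Y) n)" using chain_mapsD(1)[OF f] by (simp add: shift_map_def)
  fix x assume "x \<in> elts (shift k X) n"
  then have x: "x \<in> elts X (n + k)" by simp
  have dx: "cdiff X (n + k) x \<in> elts X (n + k + 1)" by (rule ahom_closed[OF complexD(5)[OF X] x])
  have e: "n + 1 + k = n + k + 1" by simp
  show "shift_map k f (n + 1) (cdiff (shift k X) n x) = cdiff (shift k Y) n (shift_map k f n x)"
    unfolding shift_map_def e cdiff_shift[OF x] cdiff_shift[OF chain_mapsD(3)[OF f x]]
      ahom_signed[OF chain_mapsD(2)[OF f] complexD(3)[OF X] complexD(3)[OF Y] dx] chain_mapsD(4)[OF f x] ..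
qed

lemma cls_shift_map:
  assumes X: "bounded_complex \<Z> X" and Y: "bounded_complex \<Z> Y" and f: "f \<in> chain_maps \<Z> X Y" and g: "g \<in> chain_maps \<Z> X Y"
    and fg: "K.cls X Y f = K.cls X Y g"
  shows "K.cls (shift k X) (shift k Y) (shift_map k f) = K.cls (shift k X) (shift k Y) (shift_map k g)"
proof -
  note gX = complexD(3)[OF X] and gY = complexD(3)[OF Y]
  obtain h where h: "\<And>n. h n \<in> ahom (cob X n) (cob Y (n - 1))"
    "\<And>n x. x \<in> elts X n \<Longrightarrow> f n x = g n x \<oplus>\<^bsub>cob Y n\<^esub> (hmap X Y h n x)"
    using fg unfolding cls_homotopy_iff[OF X Y f g] by blast
  \<comment> \<open>The sign (-1)^k on the homotopy cancels the sign of the shifted differentials on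
    both sides.\<close>
  define h' where "h' n = (\<lambda>x\<in>elts X (n + k). signed k (cob Y (n + k - 1)) (h (n + k) x))" for n
  show ?thesis
    unfolding cls_homotopy_iff[OF bounded_complex_shift[OF X] bounded_complex_shift[OF Y] shift_map_chain_maps[OF X Y f] shift_map_chain_maps[OF X Y g]]
  proof (intro exI[of _ h'] conjI allI ballI)
    fix n
    interpret Y1: abelian_group "cob Y (n + k - 1)" by (rule gY)
    interpret Y0: abelian_group "cob Y (n + k)" by (rule gY)
    show "h' n \<in> ahom (cob (shift k X) n) (cob (shift k Y) (n - 1))"
      unfolding cob_shift_prev unfolding cob_shift h'_def using ahom_closed[OF h(1)[of "n + k"]]
      by (intro ahom_restrictI gX) (simp_all add: ahom_add[OF h(1)] Y1.signed_add)
    fix x assume "x \<in> elts (shift k X) n"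
    then have x: "x \<in> elts X (n + k)" by simp
    have hx: "h (n + k) x \<in> elts Y (n + k - 1)" by (rule ahom_closed[OF h(1) x])
    have dx: "cdiff X (n + k) x \<in> elts X (n + k + 1)" by (rule ahom_closed[OF complexD(5)[OF X] x])
    interpret X1: abelian_group "cob X (n + k + 1)" by (rule gX)
    have e: "n + 1 + k = n + k + 1" "n + k + 1 - 1 = n + k" by simp_all
    have 1: "cdiff (shift k Y) (n - 1) (h' n x) = cdiff Y (n + k - 1) (h (n + k) x)"
      using x hx complex_prev(2)[OF Y hx]
      by (simp add: h'_def cdiff_shift_prev ahom_signed[OF complex_prev(1)[OF Y] gY gY])
    have "h (n + k + 1) (cdiff X (n + k) x) \<in> elts Y (n + k)" using ahom_closed[OF h(1)[of "n + k + 1"] dx] by simp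
    moreover have "h (n + k + 1) \<in> ahom (cob X (n + k + 1)) (cob Y (n + k))" using h(1)[of "n + k + 1"] by simp
    ultimately have 2: "h' (n + 1) (cdiff (shift k X) n x) = h (n + k + 1) (cdiff X (n + k) x)"
      using dx unfolding h'_def e cdiff_shift[OF x] by (simp add: ahom_signed[OF _ gX gY])
    show "shift_map k f n x = shift_map k g n x \<oplus>\<^bsub>cob (shift k Y) n\<^esub> (cdiff (shift k Y) (n - 1) (h' n x) \<oplus>\<^bsub>cob (shift k Y) n\<^esub> h' (n + 1) (cdiff (shift k X) n x))"
      unfolding 1 2 using h(2)[OF x] by (simp add: shift_map_def)
  qed
qed

text \<open>Shifting preserves homotopy, which gives one inclusion for every \<open>k\<close>; the
  same inclusion for the inverse shift gives the other.\<close>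

lemma shift_class_cls:
  assumes X: "bounded_complex \<Z> X" and Y: "bounded_complex \<Z> Y" and f: "f \<in> chain_maps \<Z> X Y"
  shows "shift_class k (K.cls X Y f) = K.cls (shift k X) (shift k Y) (shift_map k f)"
proof -
  have m: "g \<in> K.cls X Y f \<longleftrightarrow> g \<in> chain_maps \<Z> X Y \<and> K.cls X Y g = K.cls X Y f"
    if "bounded_complex \<Z> X" "bounded_complex \<Z> Y" "f \<in> chain_maps \<Z> X Y" for X Y :: "(int, 'a) cochain" and f g
    using K.mem_cls_iff[of X Y f g] that by (simp add: complex_cat_simps)
  have sub: "shift_map k g \<in> K.cls (shift k X) (shift k Y) (shift_map k f)"
    if "bounded_complex \<Z> X" "bounded_complex \<Z> Y" "f \<in> chain_maps \<Z> X Y" "g \<in> K.cls X Y f" for X Y :: "(int, 'a) cochain" and f g k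
    using that cls_shift_map[of X Y g f k] shift_map_chain_maps[of X Y _ k] by (simp add: m bounded_complex_shift)
  show ?thesis
  proof (intro equalityI subsetI)
    fix g assume "g \<in> shift_class k (K.cls X Y f)"
    then show "g \<in> K.cls (shift k X) (shift k Y) (shift_map k f)" using sub[OF X Y f] by (auto simp: shift_class_def)
  next
    fix g assume "g \<in> K.cls (shift k X) (shift k Y) (shift_map k f)"
    from sub[OF bounded_complex_shift[OF X] bounded_complex_shift[OF Y] shift_map_chain_maps[OF X Y f] this, of "- k"]
    have "shift_map (- k) g \<in> K.cls X Y f" by (simp add: shift_inverse X Y)
    then show "g \<in> shift_class k (K.cls X Y f)" unfolding shift_class_def by (intro image_eqI[of _ _ "shift_map (- k) g"]) simp_all
  qed
qed

lemma quasi_iso_shift: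
  assumes X: "bounded_complex \<Z> X" and Y: "bounded_complex \<Z> Y" and f: "f \<in> chain_maps \<Z> X Y" and q: "quasi_iso X Y f"
  shows "quasi_iso (shift k X) (shift k Y) (shift_map k f)"
proof (rule quasi_isoI[OF bounded_complex_shift[OF X] bounded_complex_shift[OF Y] shift_map_chain_maps[OF X Y f]])
  note gX = complexD(3)[OF X] and gY = complexD(3)[OF Y]
  fix n x y assume x: "x \<in> elts (shift k X) n" and dx: "cdiff (shift k X) n x = \<zero>\<^bsub>cob (shift k X) (n + 1)\<^esub>"
    and y: "y \<in> elts (shift k Y) (n - 1)" and fx: "shift_map k f n x = cdiff (shift k Y) (n - 1) y"
  have x: "x \<in> elts X (n + k)" using x by simp
  have y: "y \<in> elts Y (n + k - 1)" using y unfolding cob_shift_prev .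
  interpret X0: abelian_group "cob X (n + k)" by (rule gX)
  interpret X1: abelian_group "cob X (n + k + 1)" by (rule gX)
  interpret Xp: abelian_group "cob X (n + k - 1)" by (rule gX)
  interpret Yp: abelian_group "cob Y (n + k - 1)" by (rule gY)
  have dx': "cdiff X (n + k) x = \<zero>\<^bsub>cob X (n + k + 1)\<^esub>"
    using dx complex_prev(3)[OF X x] unfolding cob_shift_Suc cdiff_shift[OF x] by (simp add: X1.signed_eq_zero_iff)
  have fx': "f (n + k) x = cdiff Y (n + k - 1) (signed k (cob Y (n + k - 1)) y)"
    using fx unfolding cdiff_shift_prev[OF y] ahom_signed[OF complex_prev(1)[OF Y] gY gY y] by (simp add: shift_map_def)
  obtain w where w: "w \<in> elts X (n + k - 1)" "x = cdiff X (n + k - 1) w"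
    using quasi_isoD(1)[OF X Y f q x dx' Yp.signed_closed[OF y] fx'] by blast
  have "x = cdiff (shift k X) (n - 1) (signed k (cob X (n + k - 1)) w)"
    unfolding cdiff_shift_prev[OF Xp.signed_closed[OF w(1)]] ahom_signed[OF complex_prev(1)[OF X] gX gX w(1)]
    using complex_prev(2)[OF X w(1)] w(2) by simp
  then show "\<exists>w\<in>elts (shift k X) (n - 1). x = cdiff (shift k X) (n - 1) w"
    unfolding cob_shift_prev using Xp.signed_closed[OF w(1)] by blast
next
  note gX = complexD(3)[OF X] and gY = complexD(3)[OF Y]
  fix n y assume y: "y \<in> elts (shift k Y) n" and dy: "cdiff (shift k Y) n y = \<zero>\<^bsub>cob (shift k Y) (n + 1)\<^esub>"
  have y: "y \<in> elts Y (n + k)" using y by simp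
  interpret Y1: abelian_group "cob Y (n + k + 1)" by (rule gY)
  interpret Yp: abelian_group "cob Y (n + k - 1)" by (rule gY)
  interpret Y0: abelian_group "cob Y (n + k)" by (rule gY)
  interpret X1: abelian_group "cob X (n + k + 1)" by (rule gX)
  have dy': "cdiff Y (n + k) y = \<zero>\<^bsub>cob Y (n + k + 1)\<^esub>"
    using dy complex_prev(3)[OF Y y] unfolding cob_shift_Suc cdiff_shift[OF y] by (simp add: Y1.signed_eq_zero_iff)
  obtain x z where x: "x \<in> elts X (n + k)" "z \<in> elts Y (n + k - 1)" "cdiff X (n + k) x = \<zero>\<^bsub>cob X (n + k + 1)\<^esub>"
    "y = f (n + k) x \<oplus>\<^bsub>cob Y (n + k)\<^esub> cdiff Y (n + k - 1) z" using quasi_isoD(2)[OF X Y f q y dy'] by blast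
  have sz: "signed k (cob Y (n + k - 1)) z \<in> elts Y (n + k - 1)" using x(2) by simp
  have "cdiff (shift k Y) (n - 1) (signed k (cob Y (n + k - 1)) z) = cdiff Y (n + k - 1) z"
    unfolding cdiff_shift_prev[OF sz] ahom_signed[OF complex_prev(1)[OF Y] gY gY x(2)]
    using complex_prev(2)[OF Y x(2)] by simp
  then have e: "y = shift_map k f n x \<oplus>\<^bsub>cob (shift k Y) n\<^esub> cdiff (shift k Y) (n - 1) (signed k (cob Y (n + k - 1)) z)"
    using x(4) by (simp add: shift_map_def)
  have d: "cdiff (shift k X) n x = \<zero>\<^bsub>cob (shift k X) (n + 1)\<^esub>" unfolding cob_shift_Suc cdiff_shift[OF x(1)] using x(3) by simp
  show "\<exists>x\<in>elts (shift k X) n. \<exists>z\<in>elts (shift k Y) (n - 1). cdiff (shift k X) n x = \<zero>\<^bsub>cob (shift k X) (n + 1)\<^esub> \<and>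
      y = shift_map k f n x \<oplus>\<^bsub>cob (shift k Y) n\<^esub> cdiff (shift k Y) (n - 1) z"
    by (rule bexI[of _ x], rule bexI[of _ "signed k (cob Y (n + k - 1)) z"], rule conjI[OF d e], unfold cob_shift_prev, rule sz)
      (simp add: x(1))
qed

lemma shift_class_Hom:
  assumes X: "bounded_complex \<Z> X" and Y: "bounded_complex \<Z> Y" and F: "F \<in> mor Htp X Y"
  shows "shift_class k F \<in> mor Htp (shift k X) (shift k Y)"
proof -
  obtain f where "f \<in> chain_maps \<Z> X Y" "F = K.cls X Y f"
    using K.Hom_Q_cases[of X Y F] X Y F by (auto simp: complex_cat_simps)
  then show ?thesis
    using shift_class_cls[OF X Y] K.cls_closed[of "shift k X" "shift k Y" "shift_map k f"] shift_map_chain_maps[OF X Y]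
      bounded_complex_shift[OF X] bounded_complex_shift[OF Y] by (simp add: complex_cat_simps)
qed

lemma shift_class_Cmp:
  assumes X: "bounded_complex \<Z> X" and Y: "bounded_complex \<Z> Y" and Z: "bounded_complex \<Z> Z"
    and F: "F \<in> mor Htp X Y" and G: "G \<in> mor Htp Y Z"
  shows "shift_class k (Cmp Htp X Y Z G F)
    = Cmp Htp (shift k X) (shift k Y) (shift k Z) (shift_class k G) (shift_class k F)"
proof -
  obtain f where f: "f \<in> chain_maps \<Z> X Y" "F = K.cls X Y f"
    using K.Hom_Q_cases[of X Y F] X Y F by (auto simp: complex_cat_simps)
  obtain g where g: "g \<in> chain_maps \<Z> Y Z" "G = K.cls Y Z g"
    using K.Hom_Q_cases[of Y Z G] Y Z G by (auto simp: complex_cat_simps)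
  have "shift_map k (Cmp Cpx X Y Z g f) = Cmp Cpx (shift k X) (shift k Y) (shift k Z) (shift_map k g) (shift_map k f)"
    by (simp add: complex_cat_simps shift_map_def)
  then show ?thesis
    using f g shift_map_chain_maps[OF X Y f(1), of k] shift_map_chain_maps[OF Y Z g(1), of k] chain_maps_compose[OF X f(1) g(1)]
      K.Cmp_Q[of X Y Z f g] K.Cmp_Q[of "shift k X" "shift k Y" "shift k Z" "shift_map k f" "shift_map k g"]
      bounded_complex_shift[OF X, of k] bounded_complex_shift[OF Y, of k] bounded_complex_shift[OF Z, of k]
      shift_class_cls[OF X Y f(1), of k] shift_class_cls[OF Y Z g(1), of k] shift_class_cls[OF X Z chain_maps_compose[OF X f(1) g(1)], of k] X Y Z
    by (simp add: complex_cat_simps)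
qed

lemma shift_class_quasi_isos:
  assumes X: "bounded_complex \<Z> X" and Y: "bounded_complex \<Z> Y" and F: "F \<in> quasi_isos \<Z> X Y"
  shows "shift_class k F \<in> quasi_isos \<Z> (shift k X) (shift k Y)"
proof -
  obtain f where f: "f \<in> chain_maps \<Z> X Y" "quasi_iso X Y f" "F = K.cls X Y f" by (rule quasi_isosE[OF X Y F])
  show ?thesis unfolding f(3) shift_class_cls[OF X Y f(1)]
    by (intro cls_quasi_isos bounded_complex_shift X Y shift_map_chain_maps quasi_iso_shift f)
qed

text \<open>Shifting its roofs one by one sends a class into the class of the shifted fraction, and
  the inverse shift sends that class back. So the image under the shift is a full class.\<close>

lemma shift_derived_frac:
  fixes X Y P :: "(int, 'a::infinite) cochain"
  assumes P: "tff_complex P" and X: "bounded_complex \<Z> X" and Y: "bounded_complex \<Z> Y" and p: "p \<in> quasi_isos \<Z> P X"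
    and a: "a \<in> mor Htp P Y"
  shows "shift_derived k (D.frac P p X Y a) = D.frac (shift k P) (shift_class k p) (shift k X) (shift k Y) (shift_class k a)"
proof -
  have sub: "(shift k W, shift_class k s, shift_class k f) \<in> D.frac (shift k P) (shift_class k p) (shift k X) (shift k Y) (shift_class k a)"
    if P: "tff_complex P" and X: "bounded_complex \<Z> X" and Y: "bounded_complex \<Z> Y" and p: "p \<in> quasi_isos \<Z> P X"
      and a: "a \<in> mor Htp P Y" and r: "(W, s, f) \<in> D.frac P p X Y a"
    for P X Y W :: "(int, 'a) cochain" and p a s f k
  proof -
    note b = bounded_complex_shift
    have P': "bounded_complex \<Z> P" using P by (simp add: tff_complex_def)
    have "(W, s, f) \<in> roofs Htp (quasi_isos \<Z>) X Y \<and> D.represents P p X Y (W, s, f) a"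
      using D.mem_frac_iff[of P X Y p a "(W, s, f)"] P X Y p a r by (simp add: Obj_complex_cat)
    then obtain u where W: "bounded_complex \<Z> W" and s: "s \<in> quasi_isos \<Z> W X" and f: "f \<in> mor Htp W Y"
      and u: "u \<in> mor Htp P W" "Cmp Htp P W X s u = p" "Cmp Htp P W Y f u = a"
      by (auto simp: roofs_def D.represents_def Obj_complex_cat)
    have s': "s \<in> mor Htp W X" using s by (simp add: quasi_isos_def)
    have "D.represents (shift k P) (shift_class k p) (shift k X) (shift k Y) (shift k W, shift_class k s, shift_class k f) (shift_class k a)"
      using shift_class_Hom[OF P' W u(1), of k] shift_class_Cmp[OF P' W X u(1) s', of k] shift_class_Cmp[OF P' W Y u(1) f, of k] u(2,3)
      by (auto simp: D.represents_def)
    moreover have "(shift k W, shift_class k s, shift_class k f) \<in> roofs Htp (quasi_isos \<Z>) (shift k X) (shift k Y)"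
      using b[OF W] shift_class_quasi_isos[OF W X s] shift_class_Hom[OF W Y f] by (simp add: roofs_def Obj_complex_cat)
    ultimately show ?thesis
      using D.mem_frac_iff[of "shift k P" "shift k X" "shift k Y" "shift_class k p" "shift_class k a" "(shift k W, shift_class k s, shift_class k f)"]
        tff_complex_shift[OF P] b[OF X] b[OF Y] shift_class_quasi_isos[OF P' X p] shift_class_Hom[OF P' Y a] by (simp add: Obj_complex_cat)
  qed
  have P': "bounded_complex \<Z> P" using P by (simp add: tff_complex_def)
  show ?thesis
  proof (intro equalityI subsetI)
    fix r assume "r \<in> shift_derived k (D.frac P p X Y a)"
    then show "r \<in> D.frac (shift k P) (shift_class k p) (shift k X) (shift k Y) (shift_class k a)"
      using sub[OF P X Y p a] by (auto simp: shift_derived_def)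
  next
    fix r assume r: "r \<in> D.frac (shift k P) (shift_class k p) (shift k X) (shift k Y) (shift_class k a)"
    obtain W s f where rW: "r = (W, s, f)" by (cases r)
    have c: "tff_complex (shift k P)" "bounded_complex \<Z> (shift k X)" "bounded_complex \<Z> (shift k Y)"
      "shift_class k p \<in> quasi_isos \<Z> (shift k P) (shift k X)" "shift_class k a \<in> mor Htp (shift k P) (shift k Y)"
      using tff_complex_shift[OF P] bounded_complex_shift X Y shift_class_quasi_isos[OF P' X p] shift_class_Hom[OF P' Y a] by auto
    have "bounded_complex \<Z> W"
      using D.mem_frac_iff[of "shift k P" "shift k X" "shift k Y" "shift_class k p" "shift_class k a" "(W, s, f)"] c r rW
      by (simp add: Obj_complex_cat roofs_def)
    then have W: "shift k (shift (- k) W) = W" using shift_inverse[of W "- k"] by simp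
    have "(shift (- k) W, shift_class (- k) s, shift_class (- k) f) \<in> D.frac P p X Y a"
      using sub[OF c r[unfolded rW], of "- k"] by (simp add: shift_inverse P' X Y)
    then show "r \<in> shift_derived k (D.frac P p X Y a)"
      unfolding shift_derived_def rW by (intro image_eqI[of _ _ "(shift (- k) W, shift_class (- k) s, shift_class (- k) f)"]) (simp_all add: W)
  qed
qed

section \<open>Total modules\<close>

text \<open>
  A complex \<open>R\<close> of free groups is folded into the \<open>\<int>[\<epsilon>]\<close>-module \<open>\<Oplus>\<^sub>n R\<^sup>n\<close> on which \<open>\<epsilon>\<close> acts
  by \<open>(-1)\<^sup>n d\<close> on \<open>R\<^sup>n\<close>. With this sign the components of degree \<open>i\<close> of a \<open>\<int>[\<epsilon>]\<close>-linear map form a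
  chain map into the \<open>i\<close>-th shift without any further sign.
\<close>

locale total =
  fixes M :: "'a eps_module" and R :: "(int, 'a) cochain" and pr :: "int \<Rightarrow> 'a \<Rightarrow> 'a"
  assumes tmod: "tmod M" and tff_complex: "tff_complex R" and pr: "pr n \<in> ahom M (cob R n)"
    and ex1: "(\<And>n. y n \<in> elts R n) \<Longrightarrow> \<exists>!x. x \<in> carrier M \<and> (\<forall>n. pr n x = y n)"
    and pr_ep: "x \<in> carrier M \<Longrightarrow> pr (n + 1) (ep M x) = signed n (cob R (n + 1)) (cdiff R n (pr n x))"
begin

lemma module: "module Z_eps M" using tmod by (simp add: tmod_def)
lemma agM: "abelian_group M" using module by (simp add: module_def)
lemma bounded: "bounded_complex \<Z> R" using tff_complex by (simp add: tff_complex_def)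
lemmas agR = complexD(3)[OF bounded]
lemmas pr_closed = ahom_closed[OF pr]

lemma eqI:
  assumes "x \<in> carrier M" "y \<in> carrier M" "\<And>n. pr n x = pr n y" shows "x = y"
proof -
  have "\<exists>!z. z \<in> carrier M \<and> (\<forall>n. pr n z = pr n y)" using ex1[of "\<lambda>n. pr n y"] pr_closed assms(2) by blast
  then show ?thesis using assms by blast
qed

text \<open>The inclusion of the summand in degree \<open>k\<close>. By \<open>ex1\<close> the
  module is the product of all terms of \<open>R\<close>, which is a finite direct sum because
  \<open>R\<close> is bounded.\<close>

definition emb :: "int \<Rightarrow> 'a \<Rightarrow> 'a" where
  "emb k = (\<lambda>a\<in>elts R k. THE x. x \<in> carrier M \<and> (\<forall>n. pr n x = (if n = k then a else \<zero>\<^bsub>cob R n\<^esub>)))"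

lemma emb_closed: "a \<in> elts R k \<Longrightarrow> emb k a \<in> carrier M"
  and pr_emb: "a \<in> elts R k \<Longrightarrow> pr n (emb k a) = (if n = k then a else \<zero>\<^bsub>cob R n\<^esub>)"
proof -
  assume a: "a \<in> elts R k"
  have "\<exists>!x. x \<in> carrier M \<and> (\<forall>n. pr n x = (if n = k then a else \<zero>\<^bsub>cob R n\<^esub>))"
    by (rule ex1) (simp add: a abelian_groupE(2)[OF agR])
  from theI'[OF this] have "emb k a \<in> carrier M \<and> (\<forall>n. pr n (emb k a) = (if n = k then a else \<zero>\<^bsub>cob R n\<^esub>))"
    using a by (simp add: emb_def)
  then show "emb k a \<in> carrier M" "pr n (emb k a) = (if n = k then a else \<zero>\<^bsub>cob R n\<^esub>)" by blast+
qed

lemma emb: "emb k \<in> ahom (cob R k) M"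
proof (rule ahomI)
  fix a b assume ab: "a \<in> elts R k" "b \<in> elts R k"
  note s = abelian_groupE(1)[OF agR ab]
  show "emb k (a \<oplus>\<^bsub>cob R k\<^esub> b) = emb k a \<oplus>\<^bsub>M\<^esub> emb k b"
  proof (rule eqI[OF emb_closed[OF s] abelian_groupE(1)[OF agM emb_closed[OF ab(1)] emb_closed[OF ab(2)]]])
    fix n
    interpret Rn: abelian_group "cob R n" by (rule agR)
    show "pr n (emb k (a \<oplus>\<^bsub>cob R k\<^esub> b)) = pr n (emb k a \<oplus>\<^bsub>M\<^esub> emb k b)"
      using ab s by (simp add: ahom_add[OF pr] emb_closed pr_emb)
  qed
qed (simp_all add: emb_closed, simp add: emb_def)

text \<open>\<open>pr_ep\<close> describes \<epsilon> through the projections; this is the same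
  description through the inclusions.\<close>

lemma emb_ep:
  assumes a: "a \<in> elts R k"
  shows "ep M (emb k a) = emb (k + 1) (signed k (cob R (k + 1)) (cdiff R k a))"
proof -
  interpret R1: abelian_group "cob R (k + 1)" by (rule agR)
  have da: "signed k (cob R (k + 1)) (cdiff R k a) \<in> elts R (k + 1)"
    using complex_prev(3)[OF bounded a] by simp
  show ?thesis
  proof (rule eqI[OF ep_closed[OF module emb_closed[OF a]] emb_closed[OF da]])
    fix n
    interpret Rn: abelian_group "cob R n" by (rule agR)
    have d0: "cdiff R (n - 1) \<zero>\<^bsub>cob R (n - 1)\<^esub> = \<zero>\<^bsub>cob R n\<^esub>"
      by (rule ahom_zero[OF complex_prev(1)[OF bounded] agR agR])
    have "pr n (ep M (emb k a)) = signed (n - 1) (cob R n) (cdiff R (n - 1) (pr (n - 1) (emb k a)))"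
      using pr_ep[OF emb_closed[OF a], of "n - 1"] by simp
    then show "pr n (ep M (emb k a)) = pr n (emb (k + 1) (signed k (cob R (k + 1)) (cdiff R k a)))"
      unfolding pr_emb[OF da] pr_emb[OF a] using d0 by auto
  qed
qed

definition supp :: "int set" where "supp = {n. elts R n \<noteq> {\<zero>\<^bsub>cob R n\<^esub>}}"

lemma finite_supp: "finite supp" unfolding supp_def by (rule complexD(7)[OF bounded])

lemma not_supp: "n \<notin> supp \<Longrightarrow> a \<in> elts R n \<Longrightarrow> a = \<zero>\<^bsub>cob R n\<^esub>" by (simp add: supp_def)

text \<open>The set \<open>A\<close> is left free so that the sum can run over degrees adapted to a
  given map as well as over the support of \<open>R\<close>.\<close>

lemma decomposition:
  assumes x: "x \<in> carrier M" and A: "finite A" "\<And>n. n \<notin> A \<Longrightarrow> pr n x = \<zero>\<^bsub>cob R n\<^esub>"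
  shows "x = finsum M (\<lambda>n. emb n (pr n x)) A"
proof (rule eqI[OF x])
  interpret M: abelian_group M by (rule agM)
  have c: "emb n (pr n x) \<in> carrier M" for n by (rule emb_closed[OF pr_closed[OF x]])
  then show "finsum M (\<lambda>n. emb n (pr n x)) A \<in> carrier M" by (simp add: Pi_def)
  fix m
  interpret Rm: abelian_group "cob R m" by (rule agR)
  have "pr m (finsum M (\<lambda>n. emb n (pr n x)) A) = finsum (cob R m) (\<lambda>n. pr m (emb n (pr n x))) A"
    by (rule ahom_finsum[OF pr agM agR c])
  also have "\<dots> = pr m (emb m (pr m x))"
    by (rule Rm.finsum_single[OF A(1)]) (simp_all add: pr_emb[OF pr_closed[OF x]] pr_closed[OF x], simp add: A(2))
  finally show "pr m x = pr m (finsum M (\<lambda>n. emb n (pr n x)) A)" by (simp add: pr_emb[OF pr_closed[OF x]])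
qed

lemma decomposition_supp: "x \<in> carrier M \<Longrightarrow> x = finsum M (\<lambda>n. emb n (pr n x)) supp"
  by (rule decomposition[OF _ finite_supp]) (use not_supp pr_closed in blast)+

end

section \<open>Maps between total modules as matrices, and their diagonals as chain maps\<close>

locale two_totals = A: total M R pr + B: total N Q qr
  for M :: "'a eps_module" and R pr and N :: "'a eps_module" and Q qr
begin

lemma hom_eqI:
  assumes f: "f \<in> ahom M N" and g: "g \<in> ahom M N"
    and e: "\<And>k m a. a \<in> elts R k \<Longrightarrow> qr m (f (A.emb k a)) = qr m (g (A.emb k a))"
  shows "f = g"
proof (rule ahom_eqI[OF f g])
  fix x assume x: "x \<in> carrier M"
  have c: "A.emb n (pr n x) \<in> carrier M" for n by (rule A.emb_closed[OF A.pr_closed[OF x]])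
  have "f (A.emb n (pr n x)) = g (A.emb n (pr n x))" for n
    by (rule B.eqI) (simp_all add: ahom_closed[OF f c] ahom_closed[OF g c] e A.pr_closed[OF x])
  then have "f (finsum M (\<lambda>n. A.emb n (pr n x)) A.supp) = g (finsum M (\<lambda>n. A.emb n (pr n x)) A.supp)"
    by (simp add: ahom_finsum[OF f A.agM B.agM c] ahom_finsum[OF g A.agM B.agM c])
  then show "f x = g x" unfolding A.decomposition_supp[OF x, symmetric] .
qed

text \<open>Only finitely many columns are nonzero, so each row can be summed over the support of
  \<open>R\<close>; hence every matrix of additive maps belongs to a map.\<close>

lemma ahom_from_components:
  assumes g: "\<And>k m. g k m \<in> ahom (cob R k) (cob Q m)"
  obtains f where "f \<in> ahom M N" "\<And>k m a. a \<in> elts R k \<Longrightarrow> qr m (f (A.emb k a)) = g k m a"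
proof -
  let ?s = "\<lambda>m x. finsum (cob Q m) (\<lambda>k. g k m (pr k x)) A.supp"
  have gc: "g k m (pr k x) \<in> elts Q m" if "x \<in> carrier M" for k m x
    by (rule ahom_closed[OF g A.pr_closed[OF that]])
  have sc: "?s m x \<in> elts Q m" if "x \<in> carrier M" for m x
  proof -
    interpret Qm: abelian_group "cob Q m" by (rule B.agR)
    show ?thesis using gc[OF that] by simp
  qed
  define f where "f = (\<lambda>x\<in>carrier M. THE z. z \<in> carrier N \<and> (\<forall>m. qr m z = ?s m x))"
  have f: "f x \<in> carrier N \<and> (\<forall>m. qr m (f x) = ?s m x)" if "x \<in> carrier M" for x
    using theI'[OF B.ex1[of "\<lambda>m. ?s m x", OF sc[OF that]]] that by (simp add: f_def)
  have "f \<in> ahom M N"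
  proof (rule ahomI)
    fix x y assume xy: "x \<in> carrier M" "y \<in> carrier M"
    note s = abelian_groupE(1)[OF A.agM xy]
    show "f (x \<oplus>\<^bsub>M\<^esub> y) = f x \<oplus>\<^bsub>N\<^esub> f y"
    proof (rule B.eqI)
      show "f (x \<oplus>\<^bsub>M\<^esub> y) \<in> carrier N" "f x \<oplus>\<^bsub>N\<^esub> f y \<in> carrier N"
        using f[OF s] f[OF xy(1)] f[OF xy(2)] abelian_groupE(1)[OF B.agM] by blast+
      fix m
      interpret Qm: abelian_group "cob Q m" by (rule B.agR)
      have "?s m (x \<oplus>\<^bsub>M\<^esub> y) = ?s m x \<oplus>\<^bsub>cob Q m\<^esub> ?s m y"
        using gc[OF xy(1)] gc[OF xy(2)]
        by (simp add: ahom_add[OF A.pr xy] ahom_add[OF g] A.pr_closed xy Qm.finsum_addf)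
      then show "qr m (f (x \<oplus>\<^bsub>M\<^esub> y)) = qr m (f x \<oplus>\<^bsub>N\<^esub> f y)"
        using f[OF s] f[OF xy(1)] f[OF xy(2)] by (simp add: ahom_add[OF B.pr])
    qed
  qed (use f in blast, simp add: f_def)
  moreover have "qr m (f (A.emb k a)) = g k m a" if a: "a \<in> elts R k" for k m a
  proof -
    interpret Qm: abelian_group "cob Q m" by (rule B.agR)
    have gz: "g n m \<zero>\<^bsub>cob R n\<^esub> = \<zero>\<^bsub>cob Q m\<^esub>" for n by (rule ahom_zero[OF g A.agR B.agR])
    have "qr m (f (A.emb k a)) = ?s m (A.emb k a)" using f[OF A.emb_closed[OF a]] by blast
    also have "\<dots> = g k m (pr k (A.emb k a))"
    proof (rule Qm.finsum_single[OF A.finite_supp])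
      show "g n m (pr n (A.emb k a)) = \<zero>\<^bsub>cob Q m\<^esub>" if "n \<noteq> k" for n using that gz by (simp add: A.pr_emb[OF a])
      show "g k m (pr k (A.emb k a)) = \<zero>\<^bsub>cob Q m\<^esub>" if "k \<notin> A.supp" using A.not_supp[OF that a] gz[of k] A.pr_emb[OF a, of k] by simp
    qed (rule gc[OF A.emb_closed[OF a]])
    finally show ?thesis by (simp add: A.pr_emb[OF a])
  qed
  ultimately show ?thesis by (rule that)
qed

text \<open>The diagonal of degree \<open>i\<close> in the matrix of \<open>f\<close>.\<close>

definition comp :: "('a \<Rightarrow> 'a) \<Rightarrow> int \<Rightarrow> int \<Rightarrow> 'a \<Rightarrow> 'a" where
  "comp f i n = (\<lambda>a\<in>elts R n. qr (n + i) (f (A.emb n a)))"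

lemma comp_ahom: "f \<in> ahom M N \<Longrightarrow> comp f i n \<in> ahom (cob R n) (cob Q (n + i))"
  unfolding comp_def using A.emb_closed ahom_closed[of f M N] B.pr_closed
  by (intro ahom_restrictI A.agR) (auto simp: ahom_add[OF A.emb] ahom_add[OF B.pr] ahom_add[of f M N])

text \<open>In degree n the action of \<epsilon> on the source carries the sign (-1)^n, and on the
  target the sign with exponent n + i. Their product is (-1)^i, the sign in the differential of the
  shift by \<open>i\<close>.\<close>

lemma comp_chain_map:
  assumes f: "f \<in> mod_hom Z_eps M N"
  shows "comp f i \<in> chain_maps \<Z> R (shift i Q)"
proof (rule chain_mapsI)
  have fa: "f \<in> ahom M N" and fe: "\<And>x. x \<in> carrier M \<Longrightarrow> f (ep M x) = ep N (f x)"
    using f mod_hom_Z_eps[OF A.module B.module] by auto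
  fix n
  show "comp f i n \<in> mod_hom \<Z> (cob R n) (cob (shift i Q) n)"
    using comp_ahom[OF fa] mod_hom_int[OF complexD(2)[OF A.bounded] complexD(2)[OF B.bounded]] by simp
  fix a assume a: "a \<in> elts R n"
  interpret R1: abelian_group "cob R (n + 1)" by (rule A.agR)
  interpret Q1: abelian_group "cob Q (n + i + 1)" by (rule B.agR)
  have da: "cdiff R n a \<in> elts R (n + 1)" by (rule complex_prev(3)[OF A.bounded a])
  have x: "A.emb n a \<in> carrier M" by (rule A.emb_closed[OF a])
  have y: "f (A.emb n a) \<in> carrier N" by (rule ahom_closed[OF fa x])
  have q: "qr (n + i) (f (A.emb n a)) \<in> elts Q (n + i)" by (rule B.pr_closed[OF y])
  have dq: "cdiff Q (n + i) (qr (n + i) (f (A.emb n a))) \<in> elts Q (n + i + 1)" by (rule complex_prev(3)[OF B.bounded q])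
  have e: "A.emb (n + 1) (cdiff R n a) = signed n M (ep M (A.emb n a))"
    unfolding A.emb_ep[OF a] using da by (simp add: ahom_signed[OF A.emb A.agR A.agM, symmetric])
  have n: "n + 1 + i = n + i + 1" by simp
  have "comp f i (n + 1) (cdiff R n a) = qr (n + i + 1) (f (signed n M (ep M (A.emb n a))))"
    using da by (simp only: comp_def restrict_apply e n if_True)
  also have "\<dots> = signed n (cob Q (n + i + 1)) (qr (n + i + 1) (ep N (f (A.emb n a))))"
    by (simp add: ahom_signed[OF fa A.agM B.agM] ahom_signed[OF B.pr B.agM B.agR] fe x y ep_closed A.module B.module)
  also have "\<dots> = signed n (cob Q (n + i + 1)) (signed (n + i) (cob Q (n + i + 1)) (cdiff Q (n + i) (qr (n + i) (f (A.emb n a)))))"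
    unfolding B.pr_ep[OF y] ..
  also have "\<dots> = cdiff (shift i Q) n (comp f i n a)"
    using a dq q signed_even[of "n + (n + i)" i "cob Q (n + i + 1)"] by (simp add: Q1.signed_signed comp_def cdiff_shift)
  finally show "comp f i (n + 1) (cdiff R n a) = cdiff (shift i Q) n (comp f i n a)" .
qed

lemma comp_surj:
  assumes g: "\<And>i. g i \<in> chain_maps \<Z> R (shift i Q)"
  obtains f where "f \<in> mod_hom Z_eps M N" "\<And>i. comp f i = g i"
proof -
  have "g (m - k) k \<in> ahom (cob R k) (cob Q m)" for k m using chain_mapsD(2)[OF g[of "m - k"], of k] by simp
  then obtain f where f: "f \<in> ahom M N" "\<And>k m a. a \<in> elts R k \<Longrightarrow> qr m (f (A.emb k a)) = g (m - k) k a"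
    by (rule ahom_from_components) (rule that)
  have gc: "g i n a \<in> elts Q (n + i)" if "a \<in> elts R n" for i n a
    using chain_mapsD(3)[OF g that] by simp
  \<comment> \<open>As an equality of two additive maps, compatibility with \<epsilon> can be
    checked entry by entry through \<open>hom_eqI\<close>.\<close>
  let ?e = "\<lambda>x\<in>carrier M. ep M x" and ?e' = "\<lambda>x\<in>carrier N. ep N x"
  have e: "?e \<in> ahom M M" and e': "?e' \<in> ahom N N"
    by (intro ahom_restrictI A.agM B.agM; simp add: ep_closed ep_add A.module B.module)+
  have fe: "compose (carrier M) f ?e = compose (carrier M) ?e' f"
  proof (rule hom_eqI[OF ahom_compose[OF e f(1) A.agM] ahom_compose[OF f(1) e' A.agM]])
    fix k m a assume a: "a \<in> elts R k"
    interpret R1: abelian_group "cob R (k + 1)" by (rule A.agR)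
    interpret Qm: abelian_group "cob Q m" by (rule B.agR)
    define i where "i = m - (k + 1)"
    have m: "m = k + i + 1" "m - 1 - k = i" "k + i = m - 1" by (simp_all add: i_def)
    have da: "cdiff R k a \<in> elts R (k + 1)" by (rule complex_prev(3)[OF A.bounded a])
    note x = A.emb_closed[OF a]
    note y = ahom_closed[OF f(1) x]
    have dg: "cdiff Q (m - 1) (g i k a) \<in> elts Q m"
      using complex_prev(3)[OF B.bounded gc[OF a], of i] by (simp add: m(3))
    have "qr m (f (ep M (A.emb k a))) = g i (k + 1) (signed k (cob R (k + 1)) (cdiff R k a))"
      unfolding A.emb_ep[OF a] i_def by (rule f(2)) (simp add: da)
    also have "\<dots> = signed k (cob Q m) (g i (k + 1) (cdiff R k a))"
    proof -
      have "g i (k + 1) \<in> ahom (cob R (k + 1)) (cob Q m)" using chain_mapsD(2)[OF g[of i], of "k + 1"] by (simp add: i_def)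
      from ahom_signed[OF this A.agR B.agR da] show ?thesis .
    qed
    also have "g i (k + 1) (cdiff R k a) = signed i (cob Q m) (cdiff Q (m - 1) (g i k a))"
      using chain_mapsD(4)[OF g[of i] a] cdiff_shift[OF gc[OF a], of i] m(3) by simp
    also have "signed k (cob Q m) (signed i (cob Q m) (cdiff Q (m - 1) (g i k a))) = signed (m - 1) (cob Q m) (cdiff Q (m - 1) (g i k a))"
      by (simp add: Qm.signed_signed[OF dg] m(3))
    also have "\<dots> = qr m (ep N (f (A.emb k a)))"
      using B.pr_ep[OF y, of "m - 1"] f(2)[OF a, of "m - 1"] by (simp add: m(2))
    finally show "qr m (compose (carrier M) f ?e (A.emb k a)) = qr m (compose (carrier M) ?e' f (A.emb k a))"
      using x y by (simp add: compose_def)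
  qed
  have "f (ep M x) = ep N (f x)" if "x \<in> carrier M" for x
    using fun_cong[OF fe, of x] that ahom_closed[OF f(1) that] by (simp add: compose_def)
  then have "f \<in> mod_hom Z_eps M N" using f(1) mod_hom_Z_eps[OF A.module B.module] by blast
  moreover have "comp f i = g i" for i
  proof
    fix n
    show "comp f i n = g i n"
      by (rule ahom_eqI[OF comp_ahom[OF f(1)] chain_mapsD(2)[OF g]]) (simp add: comp_def f(2))
  qed
  ultimately show ?thesis by (rule that)
qed

text \<open>The part of degree \<open>i\<close> of \<epsilon>h + h\<epsilon>. When the entries of
  \<open>h\<close> out of degree n are multiplied by the sign with exponent n - 1, the first term
  becomes the shifted differential after the homotopy. In the second term the entry starts in degree
  n + 1, so its sign has exponent n.\<close>

lemma comp_homotopy: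
  assumes h: "h \<in> ahom M N" and a: "a \<in> elts R n"
  shows "qr (n + i) (ep N (h (A.emb n a)) \<oplus>\<^bsub>N\<^esub> h (ep M (A.emb n a))) =
    cdiff (shift i Q) (n - 1) (signed (n - 1) (cob Q (n + i - 1)) (qr (n + i - 1) (h (A.emb n a)))) \<oplus>\<^bsub>cob Q (n + i)\<^esub>
    signed n (cob Q (n + i)) (qr (n + i) (h (A.emb (n + 1) (cdiff R n a))))"
proof -
  interpret Qp: abelian_group "cob Q (n + i - 1)" by (rule B.agR)
  interpret Q0: abelian_group "cob Q (n + i)" by (rule B.agR)
  have da: "cdiff R n a \<in> elts R (n + 1)" by (rule complex_prev(3)[OF A.bounded a])
  note x = A.emb_closed[OF a]
  note y = ahom_closed[OF h x]
  note q = B.pr_closed[OF y, of "n + i - 1"]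
  note x1 = A.emb_closed[OF da]
  note dq = complex_prev(2)[OF B.bounded q]
  have 1: "cdiff (shift i Q) (n - 1) (signed (n - 1) (cob Q (n + i - 1)) (qr (n + i - 1) (h (A.emb n a))))
    = signed (n + i - 1) (cob Q (n + i)) (cdiff Q (n + i - 1) (qr (n + i - 1) (h (A.emb n a))))"
    unfolding cdiff_shift_prev[OF Qp.signed_closed[OF q]] ahom_signed[OF complex_prev(1)[OF B.bounded] B.agR B.agR q]
      Q0.signed_signed[OF dq] by (rule arg_cong[of _ _ "\<lambda>s. s _"], rule signed_even) simp
  have 2: "A.emb (n + 1) (signed n (cob R (n + 1)) (cdiff R n a)) = signed n M (A.emb (n + 1) (cdiff R n a))"
    by (rule ahom_signed[OF A.emb A.agR A.agM da])
  have 3: "qr (n + i) (ep N (h (A.emb n a))) = signed (n + i - 1) (cob Q (n + i)) (cdiff Q (n + i - 1) (qr (n + i - 1) (h (A.emb n a))))"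
    using B.pr_ep[OF y, of "n + i - 1"] by simp
  have 4: "qr (n + i) (h (ep M (A.emb n a))) = signed n (cob Q (n + i)) (qr (n + i) (h (A.emb (n + 1) (cdiff R n a))))"
    unfolding A.emb_ep[OF a] 2 ahom_signed[OF h A.agM B.agM x1] ahom_signed[OF B.pr B.agM B.agR ahom_closed[OF h x1]] ..
  show ?thesis
    using ahom_add[OF B.pr ep_closed[OF B.module y] ahom_closed[OF h ep_closed[OF A.module x]]] by (simp only: 1 3 4)
qed

lemma comp_null_iff:
  assumes f: "f \<in> mod_hom Z_eps M N"
  shows "f \<in> null_maps M N \<longleftrightarrow> (\<forall>i. comp f i \<in> null_homotopic \<Z> R (shift i Q))"
proof
  have fa: "f \<in> ahom M N" using f mod_hom_Z_eps[OF A.module B.module] by auto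
  note mh = mod_hom_int[OF complexD(2)[OF A.bounded] complexD(2)[OF B.bounded]]
  note da = complex_prev(3)[OF A.bounded]
  {
    assume "f \<in> null_maps M N"
    then obtain h where h: "h \<in> ahom M N" "\<forall>x\<in>carrier M. f x = ep N (h x) \<oplus>\<^bsub>N\<^esub> h (ep M x)" by (rule null_mapsE)
    show "\<forall>i. comp f i \<in> null_homotopic \<Z> R (shift i Q)"
    proof
      fix i
      define H where "H n = (\<lambda>a\<in>elts R n. signed (n - 1) (cob Q (n + i - 1)) (qr (n + i - 1) (h (A.emb n a))))" for n
      show "comp f i \<in> null_homotopic \<Z> R (shift i Q)"
      proof (rule null_homotopicI[OF comp_chain_map[OF f]])
        fix n
        interpret Qp: abelian_group "cob Q (n + i - 1)" by (rule B.agR)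
        have "H n \<in> ahom (cob R n) (cob Q (n + i - 1))"
          unfolding H_def using A.emb_closed ahom_closed[OF h(1)] B.pr_closed[of _ "n + i - 1"]
          by (intro ahom_restrictI A.agR)
            (simp_all add: ahom_add[OF A.emb] ahom_add[OF B.pr] ahom_add[OF h(1)] Qp.signed_add)
        then show "H n \<in> mod_hom \<Z> (cob R n) (cob (shift i Q) (n - 1))" unfolding cob_shift_prev mh .
        fix a assume a: "a \<in> elts R n"
        have "n + 1 + i - 1 = n + i" "n + 1 - 1 = n" by simp_all
        then have "H (n + 1) (cdiff R n a) = signed n (cob Q (n + i)) (qr (n + i) (h (A.emb (n + 1) (cdiff R n a))))"
          using da[OF a] by (simp only: H_def restrict_apply if_True)
        then show "comp f i n a = cdiff (shift i Q) (n - 1) (H n a) \<oplus>\<^bsub>cob (shift i Q) n\<^esub> H (n + 1) (cdiff R n a)"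
          using comp_homotopy[OF h(1) a, of i] h(2) A.emb_closed[OF a] a by (simp add: comp_def H_def)
      qed
    qed
  }
  assume n: "\<forall>i. comp f i \<in> null_homotopic \<Z> R (shift i Q)"
  have "\<forall>i. \<exists>h. (\<forall>n. h n \<in> mod_hom \<Z> (cob R n) (cob (shift i Q) (n - 1))) \<and>
    (\<forall>n. \<forall>a\<in>elts R n. comp f i n a = cdiff (shift i Q) (n - 1) (h n a) \<oplus>\<^bsub>cob (shift i Q) n\<^esub> h (n + 1) (cdiff R n a))"
    using n unfolding null_homotopic_def by blast
  from choice[OF this] obtain H where H: "\<forall>i. (\<forall>n. H i n \<in> mod_hom \<Z> (cob R n) (cob (shift i Q) (n - 1))) \<and>
    (\<forall>n. \<forall>a\<in>elts R n. comp f i n a = cdiff (shift i Q) (n - 1) (H i n a) \<oplus>\<^bsub>cob (shift i Q) n\<^esub> H i (n + 1) (cdiff R n a))" ..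
  have Ha: "H i n \<in> ahom (cob R n) (cob Q (n + i - 1))" for i n
    using H unfolding cob_shift_prev mh by blast
  \<comment> \<open>The homotopy for degree i leads from degree k to degree k + i - 1, so the entry
    from k to m belongs to i = m + 1 - k.\<close>
  define G where "G k m = (\<lambda>a\<in>elts R k. signed (k - 1) (cob Q m) (H (m + 1 - k) k a))" for k m
  have "G k m \<in> ahom (cob R k) (cob Q m)" for k m
  proof -
    interpret Qm: abelian_group "cob Q m" by (rule B.agR)
    have "H (m + 1 - k) k \<in> ahom (cob R k) (cob Q m)" using Ha[of "m + 1 - k" k] by simp
    then show ?thesis unfolding G_def
      by (intro ahom_restrictI A.agR) (simp_all add: ahom_add[of _ "cob R k" "cob Q m"] Qm.signed_add ahom_closed[of _ "cob R k" "cob Q m"])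
  qed
  then obtain h where h: "h \<in> ahom M N" "\<And>k m a. a \<in> elts R k \<Longrightarrow> qr m (h (A.emb k a)) = G k m a"
    by (rule ahom_from_components) (rule that)
  have c: "ep N (h x) \<in> carrier N" "h (ep M x) \<in> carrier N" if "x \<in> carrier M" for x
    using ahom_closed[OF h(1)] ep_closed[OF A.module] ep_closed[OF B.module] that by blast+
  let ?g = "\<lambda>x\<in>carrier M. ep N (h x) \<oplus>\<^bsub>N\<^esub> h (ep M x)"
  interpret N: abelian_group N by (rule B.agM)
  have ga: "?g \<in> ahom M N"
  proof (intro ahom_restrictI A.agM)
    fix x y assume x: "x \<in> carrier M" and y: "y \<in> carrier M"
    show "ep N (h x) \<oplus>\<^bsub>N\<^esub> h (ep M x) \<in> carrier N" using c[OF x] by simp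
    show "ep N (h (x \<oplus>\<^bsub>M\<^esub> y)) \<oplus>\<^bsub>N\<^esub> h (ep M (x \<oplus>\<^bsub>M\<^esub> y)) = ep N (h x) \<oplus>\<^bsub>N\<^esub> h (ep M x) \<oplus>\<^bsub>N\<^esub> (ep N (h y) \<oplus>\<^bsub>N\<^esub> h (ep M y))"
      using c[OF x] c[OF y] ahom_closed[OF h(1) x] ahom_closed[OF h(1) y] ep_closed[OF A.module x] ep_closed[OF A.module y] x y
      by (simp add: ahom_add[OF h(1)] ep_add[OF A.module] ep_add[OF B.module] N.a_ac)
  qed
  have fg: "f = ?g"
  proof (rule hom_eqI[OF fa ga])
    fix k m a assume a: "a \<in> elts R k"
    define i where "i = m - k"
    have m: "m = k + i" by (simp add: i_def)
    interpret Qp: abelian_group "cob Q (k + i - 1)" by (rule B.agR)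
    interpret Q0: abelian_group "cob Q (k + i)" by (rule B.agR)
    have Hc: "H i k a \<in> elts Q (k + i - 1)" by (rule ahom_closed[OF Ha a])
    have Hd: "H i (k + 1) (cdiff R k a) \<in> elts Q (k + i)"
      using ahom_closed[OF Ha da[OF a], of i] by simp
    have "signed (k - 1) (cob Q (k + i - 1)) (qr (k + i - 1) (h (A.emb k a))) = H i k a"
      unfolding h(2)[OF a] G_def using a Hc by simp
    moreover have "signed k (cob Q (k + i)) (qr (k + i) (h (A.emb (k + 1) (cdiff R k a)))) = H i (k + 1) (cdiff R k a)"
      unfolding h(2)[OF da[OF a]] G_def using da[OF a] Hd by simp
    ultimately have "qr (k + i) (ep N (h (A.emb k a)) \<oplus>\<^bsub>N\<^esub> h (ep M (A.emb k a))) = comp f i k a"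
      using comp_homotopy[OF h(1) a, of i] H a by simp
    then show "qr m (f (A.emb k a)) = qr m (?g (A.emb k a))"
      using A.emb_closed[OF a] a by (simp add: comp_def m)
  qed
  show "f \<in> null_maps M N"
    by (rule null_mapsI[OF f h(1)]) (subst fg, simp)
qed

text \<open>A finite set of degrees that contains all nonzero diagonals and depends on the two
  complexes but not on the map.\<close>

definition degrees :: "int set" where "degrees = (\<lambda>(m, k). m - k) ` (B.supp \<times> A.supp)"

lemma finite_degrees: "finite degrees" by (simp add: degrees_def A.finite_supp B.finite_supp)

lemma pr_not_degrees:
  assumes f: "f \<in> ahom M N" and a: "a \<in> elts R k" and m: "m - k \<notin> degrees"
  shows "qr m (f (A.emb k a)) = \<zero>\<^bsub>cob Q m\<^esub>"
proof (cases "k \<in> A.supp")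
  case True
  then have "m \<notin> B.supp" using m by (force simp: degrees_def)
  then show ?thesis by (rule B.not_supp[OF _ B.pr_closed[OF ahom_closed[OF f A.emb_closed[OF a]]]])
next
  case False
  then have "a = \<zero>\<^bsub>cob R k\<^esub>" by (rule A.not_supp[OF _ a])
  then show ?thesis
    by (simp add: ahom_zero[OF A.emb A.agR A.agM] ahom_zero[OF f A.agM B.agM] ahom_zero[OF B.pr B.agM B.agR])
qed

end

text \<open>Multiplication of matrices along diagonals: the intermediate element is decomposed into
  its components in the degrees k + i for i in \<open>J\<close>, outside which it vanishes.\<close>

lemma comp_compose:
  assumes "total M R pr" "total N Q qr" "total L S sr"
    and f: "f \<in> ahom M N" and g: "g \<in> ahom N L" and J: "finite J" "two_totals.degrees R Q \<subseteq> J" and a: "a \<in> elts R k"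
  shows "two_totals.comp M R pr sr (compose (carrier M) g f) n k a =
    finsum (cob S (k + n)) (\<lambda>i. two_totals.comp N Q qr sr g (n - i) (k + i) (two_totals.comp M R pr qr f i k a)) J"
proof -
  interpret A: total M R pr by fact
  interpret B: total N Q qr by fact
  interpret C: total L S sr by fact
  interpret AB: two_totals M R pr N Q qr ..
  interpret BC: two_totals N Q qr L S sr ..
  interpret AC: two_totals M R pr L S sr ..
  interpret Sm: abelian_group "cob S (k + n)" by (rule C.agR)
  let ?z = "f (A.emb k a)"
  have z: "?z \<in> carrier N" by (rule ahom_closed[OF f A.emb_closed[OF a]])
  let ?A = "(\<lambda>i. k + i) ` J"
  have "qr m ?z = \<zero>\<^bsub>cob Q m\<^esub>" if "m \<notin> ?A" for m
  proof -
    have "m - k \<notin> J" using that image_eqI[of m "\<lambda>i. k + i" "m - k" J] by auto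
    then show ?thesis using J by (intro AB.pr_not_degrees[OF f a]) auto
  qed
  then have "?z = finsum N (\<lambda>m. B.emb m (qr m ?z)) ?A" by (intro B.decomposition z) (use J in auto)
  then have "sr (k + n) (g ?z) = sr (k + n) (g (finsum N (\<lambda>m. B.emb m (qr m ?z)) ?A))" by simp
  also have "\<dots> = finsum (cob S (k + n)) (\<lambda>m. sr (k + n) (g (B.emb m (qr m ?z)))) ?A"
    using ahom_closed[OF g] B.emb_closed B.pr_closed z
    by (simp add: ahom_finsum[OF g B.agM C.agM] ahom_finsum[OF C.pr C.agM C.agR])
  also have "\<dots> = finsum (cob S (k + n)) (\<lambda>i. sr (k + n) (g (B.emb (k + i) (qr (k + i) ?z)))) J"
    by (rule Sm.finsum_reindex) (auto intro!: C.pr_closed ahom_closed[OF g] B.emb_closed B.pr_closed z)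
  also have "\<dots> = finsum (cob S (k + n)) (\<lambda>i. BC.comp g (n - i) (k + i) (AB.comp f i k a)) J"
    using a B.pr_closed[OF z] by (intro Sm.finsum_cong') (auto simp: AB.comp_def BC.comp_def intro!: C.pr_closed ahom_closed[OF g] B.emb_closed)
  finally show ?thesis using a A.emb_closed[OF a] by (simp add: AC.comp_def compose_def)
qed

text \<open>The product of all terms is their direct sum, since all but finitely many are zero. It
  lives on functions from the integers and is copied into \<open>'a\<close> by countability.\<close>

lemma ex_total_module:
  fixes R :: "(int, 'a::infinite) cochain"
  assumes R: "tff_complex R"
  obtains M pr where "total M R pr"
proof -
  have bR: "bounded_complex \<Z> R" and t: "\<And>n. tff (cob R n) (elts R n)" using R by (auto simp: tff_complex_def)
  note gR = complexD(3)[OF bR] and d = complex_prev[OF bR]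
  define G :: "(int \<Rightarrow> 'a) ring" where "G = \<lparr>carrier = {y. \<forall>n. y n \<in> elts R n}, mult = undefined, one = undefined,
    zero = (\<lambda>n. \<zero>\<^bsub>cob R n\<^esub>), add = (\<lambda>y z n. y n \<oplus>\<^bsub>cob R n\<^esub> z n)\<rparr>"
  have Gs: "y \<in> carrier G \<longleftrightarrow> (\<forall>n. y n \<in> elts R n)" "\<zero>\<^bsub>G\<^esub> = (\<lambda>n. \<zero>\<^bsub>cob R n\<^esub>)"
    "y \<oplus>\<^bsub>G\<^esub> z = (\<lambda>n. y n \<oplus>\<^bsub>cob R n\<^esub> z n)" for y z by (simp_all add: G_def)
  have gG: "abelian_group G"
  proof (rule abelian_groupI)
    fix x assume "x \<in> carrier G"
    then show "\<exists>y\<in>carrier G. y \<oplus>\<^bsub>G\<^esub> x = \<zero>\<^bsub>G\<^esub>"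
      by (intro bexI[of _ "\<lambda>n. \<ominus>\<^bsub>cob R n\<^esub> x n"]) (simp_all add: Gs abelian_group.l_neg[OF gR] abelian_group.a_inv_closed[OF gR])
  next
    fix x y z assume "x \<in> carrier G" "y \<in> carrier G" "z \<in> carrier G"
    then show "x \<oplus>\<^bsub>G\<^esub> y \<oplus>\<^bsub>G\<^esub> z = x \<oplus>\<^bsub>G\<^esub> (y \<oplus>\<^bsub>G\<^esub> z)"
      unfolding Gs by (intro ext) (rule abelian_groupE(3)[OF gR]; simp)
  next
    fix x y assume "x \<in> carrier G" "y \<in> carrier G"
    then show "x \<oplus>\<^bsub>G\<^esub> y = y \<oplus>\<^bsub>G\<^esub> x"
      unfolding Gs by (intro ext) (rule abelian_groupE(4)[OF gR]; simp)
  qed (simp_all add: Gs abelian_groupE(1,2,5)[OF gR])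
  \<comment> \<open>The component in degree n comes from degree n - 1, which accounts for the
    exponent of the sign.\<close>
  define e where "e y n = signed (n - 1) (cob R n) (cdiff R (n - 1) (y (n - 1)))" for y n
  have ec: "e y \<in> carrier G" if "y \<in> carrier G" for y
    using that d(2) abelian_group.signed_closed[OF gR] by (simp add: Gs e_def)
  have eadd: "e (y \<oplus>\<^bsub>G\<^esub> z) = e y \<oplus>\<^bsub>G\<^esub> e z" if "y \<in> carrier G" "z \<in> carrier G" for y z
    using that d(2) by (intro ext) (simp add: Gs e_def ahom_add[OF d(1)] abelian_group.signed_add[OF gR])
  have ee: "e (e y) = \<zero>\<^bsub>G\<^esub>" if "y \<in> carrier G" for y
  proof -
    have "e (e y) n = \<zero>\<^bsub>cob R n\<^esub>" for n
    proof -
      interpret Rn: abelian_group "cob R n" by (rule gR)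
      have y: "y (n - 1 - 1) \<in> elts R (n - 1 - 1)" using that by (simp add: Gs)
      have "cdiff R (n - 1) (cdiff R (n - 1 - 1) (y (n - 1 - 1))) = \<zero>\<^bsub>cob R n\<^esub>" using d(4)[OF y] by simp
      then show ?thesis
        unfolding e_def ahom_signed[OF d(1) gR gR d(2)[OF y]] by simp
    qed
    then show ?thesis by (simp add: Gs fun_eq_iff)
  qed
  let ?M = "emod G e"
  have mM: "module Z_eps ?M" and epM: "\<And>x. x \<in> carrier G \<Longrightarrow> ep ?M x = e x" using module_emod[OF gG ec eadd ee] by blast+
  have tM: "tff ?M (carrier ?M)"
  proof -
    have "\<forall>n. \<exists>Nc :: nat \<times> (nat \<Rightarrow> 'a \<Rightarrow> int). (\<forall>j<fst Nc. int_hom (cob R n) (elts R n) (snd Nc j)) \<and>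
      (\<forall>x\<in>elts R n. (\<forall>j<fst Nc. snd Nc j x = 0) \<longrightarrow> x = \<zero>\<^bsub>cob R n\<^esub>)"
      using t unfolding tff_def by (simp add: split_paired_Ex)
    from choice[OF this] obtain Nc :: "int \<Rightarrow> nat \<times> (nat \<Rightarrow> 'a \<Rightarrow> int)" where
      Nc: "\<forall>n. (\<forall>j<fst (Nc n). int_hom (cob R n) (elts R n) (snd (Nc n) j)) \<and>
        (\<forall>x\<in>elts R n. (\<forall>j<fst (Nc n). snd (Nc n) j x = 0) \<longrightarrow> x = \<zero>\<^bsub>cob R n\<^esub>)" ..
    \<comment> \<open>Coordinates are collected over the finitely many degrees with a nonzero
      term.\<close>
    let ?S = "{n. elts R n \<noteq> {\<zero>\<^bsub>cob R n\<^esub>}}"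
    show ?thesis
    proof (rule tff_finite[of "Sigma ?S (\<lambda>n. {..<fst (Nc n)})" _ _ "\<lambda>(n, j) y. snd (Nc n) j (y n)"])
      show "finite (Sigma ?S (\<lambda>n. {..<fst (Nc n)}))" using complexD(7)[OF bR] by simp
      fix j assume "j \<in> Sigma ?S (\<lambda>n. {..<fst (Nc n)})"
      then show "int_hom ?M (carrier ?M) (case j of (n, j) \<Rightarrow> \<lambda>y. snd (Nc n) j (y n))"
        using Nc by (auto simp: int_hom_def Gs)
    next
      fix y assume y: "y \<in> carrier ?M" and z: "\<And>j. j \<in> Sigma ?S (\<lambda>n. {..<fst (Nc n)}) \<Longrightarrow> (case j of (n, j) \<Rightarrow> \<lambda>y. snd (Nc n) j (y n)) y = 0"
      have "y n = \<zero>\<^bsub>cob R n\<^esub>" for n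
      proof (cases "n \<in> ?S")
        case True
        then have "\<forall>j<fst (Nc n). snd (Nc n) j (y n) = 0" using z[of "(n, _)"] by simp
        then show ?thesis using Nc y by (simp add: Gs)
      next
        case False
        then show ?thesis using spec[OF iffD1[OF Gs(1) y[unfolded emod_simps]], of n] by simp
      qed
      then show "y = \<zero>\<^bsub>?M\<^esub>" by (simp add: Gs fun_eq_iff)
    qed
  qed
  have "countable (carrier ?M)"
    using countable_tff[OF _ asub_carrier tM] mM by (simp add: module_def)
  then obtain t :: "(int \<Rightarrow> 'a) \<Rightarrow> 'a" where inj: "inj_on t (carrier ?M)" using ex_inj_on_infinite by blast
  let ?T = "transport t ?M" and ?i = "inv_into (carrier ?M) t"
  note ts = transport_simps[OF inj]
  have ti: "?i (t y) = y" if "y \<in> carrier G" for y using inj that by simp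
  have cT: "x \<in> carrier ?T \<longleftrightarrow> (\<exists>y\<in>carrier G. x = t y)" for x by (auto simp: ts(1))
  have mT: "module Z_eps ?T" by (rule module_transport[OF mM inj])
  have gT: "abelian_group ?T" using mT by (simp add: module_def)
  define pr where "pr n = (\<lambda>x\<in>carrier ?T. ?i x n)" for n
  have pt: "pr n (t y) = y n" if "y \<in> carrier G" for y n using that ti[OF that] cT[of "t y"] by (auto simp: pr_def)
  have "total ?T R pr"
  proof
    show "tmod ?T" using mT tff_transport[OF mM tM inj] by (simp add: tmod_def)
    show "tff_complex R" by fact
    show "pr n \<in> ahom ?T (cob R n)" for n
    proof (rule ahomI)
      show "pr n \<in> extensional (carrier ?T)" by (simp add: pr_def)
      show "pr n x \<in> elts R n" if "x \<in> carrier ?T" for x using that pt unfolding cT by (auto simp: Gs)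
      fix x y assume "x \<in> carrier ?T" "y \<in> carrier ?T"
      then obtain u v where uv: "u \<in> carrier G" "v \<in> carrier G" "x = t u" "y = t v" unfolding cT by blast
      then have "x \<oplus>\<^bsub>?T\<^esub> y = t (u \<oplus>\<^bsub>G\<^esub> v)" using ts(3)[of u v] by simp
      then show "pr n (x \<oplus>\<^bsub>?T\<^esub> y) = pr n x \<oplus>\<^bsub>cob R n\<^esub> pr n y"
        using pt[OF uv(1)] pt[OF uv(2)] pt[OF abelian_groupE(1)[OF gG uv(1,2)]] uv(3,4) by (simp add: Gs)
    qed
    show "\<exists>!x. x \<in> carrier ?T \<and> (\<forall>n. pr n x = y n)" if "\<And>n. y n \<in> elts R n" for y
    proof (rule ex1I)
      have y: "y \<in> carrier G" using that by (simp add: Gs)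
      then show "t y \<in> carrier ?T \<and> (\<forall>n. pr n (t y) = y n)" using pt cT by blast
      fix x assume x: "x \<in> carrier ?T \<and> (\<forall>n. pr n x = y n)"
      then obtain u where u: "u \<in> carrier G" "x = t u" using cT by blast
      then have "u n = y n" for n using x pt[OF u(1), of n] by simp
      then have "u = y" by (rule ext)
      then show "x = t y" using u by simp
    qed
    fix x n assume "x \<in> carrier ?T"
    then obtain u where u: "u \<in> carrier G" "x = t u" using cT by blast
    have "ep ?T x = t (e u)" using epM[OF u(1)] ts(4)[of u "ze 0 1"] u by (simp add: ep_def)
    then show "pr (n + 1) (ep ?T x) = signed n (cob R (n + 1)) (cdiff R n (pr n x))"
      using pt[OF u(1)] pt[OF ec[OF u(1)]] u(2) by (simp add: e_def)
  qed
  then show ?thesis by (rule that)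
qed

text \<open>
  A module in \<^const>\<open>tmod\<close> is the total module of the inclusion of the image of \<open>\<epsilon>\<close> into its kernel,
  in degrees \<open>-1\<close> and \<open>0\<close>, because the image is free and \<open>\<epsilon>\<close> therefore has a section.
\<close>

lemma ex_total_complex:
  fixes M :: "'a eps_module" (structure)
  assumes M: "tmod M"
  obtains R pr where "total M R pr"
proof -
  have mM: "module Z_eps M" and tM: "tff M (carrier M)" using M by (auto simp: tmod_def)
  interpret M: module Z_eps M by (rule mM)
  note gM = M.abelian_group_axioms
  note epc = ep_closed[OF mM] and epa = ep_add[OF mM] and epp = ep_ep[OF mM] and epz = ep_zero[OF mM]
  let ?e = "\<lambda>x\<in>carrier M. ep M x"
  have e: "?e \<in> ahom M M" by (intro ahom_restrictI gM epc epa)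
  have epn: "ep M (\<ominus> x) = \<ominus> ep M x" if "x \<in> carrier M" for x
    using ahom_neg[OF e gM gM that] that by simp
  define A where "A n = (if n = 0 then {x \<in> carrier M. ep M x = \<zero>} else if n = - 1 then ep M ` carrier M else {\<zero>})" for n :: int
  have A: "asub (A n) M" for n
  proof -
    have "asub {x \<in> carrier M. ep M x = \<zero>} M" by (simp add: asub_def epz epa epn)
    moreover have "asub (ep M ` carrier M) M"
      unfolding asub_def
    proof (intro conjI ballI)
      show "\<zero> \<in> ep M ` carrier M" using epz by (intro image_eqI[of _ _ "\<zero>"]) simp_all
      show "\<ominus> x \<in> ep M ` carrier M" if x: "x \<in> ep M ` carrier M" for x
      proof -
        obtain u where "u \<in> carrier M" "x = ep M u" using x by (elim imageE) simp
        then show ?thesis by (intro image_eqI[of _ _ "\<ominus> u"]) (simp_all add: epn)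
      qed
      show "x \<oplus> y \<in> ep M ` carrier M" if xy: "x \<in> ep M ` carrier M" "y \<in> ep M ` carrier M" for x y
      proof -
        obtain u v where "u \<in> carrier M" "x = ep M u" "v \<in> carrier M" "y = ep M v" using xy by (elim imageE) simp
        then show ?thesis by (intro image_eqI[of _ _ "u \<oplus> v"]) (simp_all add: epa)
      qed
    qed (use epc in auto)
    ultimately show ?thesis using asub_zero[OF gM] by (simp add: A_def)
  qed
  have AM: "A n \<subseteq> carrier M" for n using A by (simp add: asub_def)
  obtain \<sigma> \<sigma>' where s: "\<sigma> \<in> ahom (zmod M (A (-1))) M" "\<sigma>' \<in> ahom (zmod M (A (-1))) M"
    "\<And>b. b \<in> A (-1) \<Longrightarrow> \<sigma> b \<in> carrier M \<and> \<sigma>' b \<in> carrier M \<and> ep M (\<sigma> b) = b"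
  proof (rule select[where R = "\<lambda>b y z. y \<in> carrier M \<and> z \<in> carrier M \<and> ep M y = b", OF gM A tff_mono[OF tM AM] gM gM])
    show "\<exists>y z. y \<in> carrier M \<and> z \<in> carrier M \<and> ep M y = b" if "b \<in> A (-1)" for b using that by (auto simp: A_def)
  qed (auto simp: epa epn)
  have sa: "\<sigma> (b \<oplus> b') = \<sigma> b \<oplus> \<sigma> b'" if "b \<in> A (-1)" "b' \<in> A (-1)" for b b' using ahom_add[OF s(1)] that by simp
  have sz: "\<sigma> \<zero> = \<zero>" using ahom_zero[OF s(1) abelian_group_zmod[OF gM A] gM] by simp
  have im: "ep M x \<in> A (-1)" if "x \<in> carrier M" for x using that by (simp add: A_def)
  have sc: "\<sigma> (ep M x) \<in> carrier M" "ep M (\<sigma> (ep M x)) = ep M x" if "x \<in> carrier M" for x using s(3)[OF im[OF that]] by blast+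
  \<comment> \<open>The differential is minus the inclusion, because in degree -1 the action of
    \<epsilon> is minus the differential and has to become the inclusion itself.\<close>
  define R :: "(int, 'a) cochain" where
    "R = \<lparr>cob = (\<lambda>n. zmod M (A n)), cdiff = (\<lambda>n. \<lambda>b\<in>A n. if n = - 1 then \<ominus> b else \<zero>)\<rparr>"
  have Rc: "cob R n = zmod M (A n)" and Rd: "b \<in> A n \<Longrightarrow> cdiff R n b = (if n = - 1 then \<ominus> b else \<zero>)" for n b
    by (simp_all add: R_def)
  have mR: "module \<Z> (cob R n)" for n unfolding Rc by (rule module_zmod[OF gM A])
  have gR: "abelian_group (cob R n)" for n using mR by (simp add: module_def)
  have zA: "\<zero> \<in> A n" for n using A by (simp add: asub_def)
  have neg0: "\<ominus> b \<in> A 0" if "b \<in> A (- 1)" for b using that by (auto simp: A_def epn epp epc)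
  have "cdiff R n \<in> ahom (cob R n) (cob R (n + 1))" for n
  proof (rule ahomI)
    show "cdiff R n \<in> extensional (elts R n)" by (simp add: R_def)
    show "cdiff R n b \<in> elts R (n + 1)" if "b \<in> elts R n" for b
    proof -
      have b: "b \<in> A n" using that by (simp add: Rc)
      show ?thesis using neg0 zA[of "n + 1"] b by (cases "n = - 1") (simp_all add: Rd Rc)
    qed
    fix b b' assume "b \<in> elts R n" "b' \<in> elts R n"
    then have b: "b \<in> A n" "b' \<in> A n" by (simp_all add: Rc)
    then have bM: "b \<in> carrier M" "b' \<in> carrier M" and bb: "b \<oplus> b' \<in> A n" using AM[of n] A[of n] by (auto simp: asub_def)
    show "cdiff R n (b \<oplus>\<^bsub>cob R n\<^esub> b') = cdiff R n b \<oplus>\<^bsub>cob R (n + 1)\<^esub> cdiff R n b'"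
      using bM by (simp add: Rc Rd[OF b(1)] Rd[OF b(2)] Rd[OF bb] M.minus_add)
  qed
  moreover have "cdiff R (n + 1) (cdiff R n b) = \<zero>" if "b \<in> A n" for n b
  proof (cases "n = - 1")
    case True
    then have "\<ominus> b \<in> A 0" using that neg0 by simp
    then show ?thesis using True that Rd[of "\<ominus> b" 0] by (simp add: Rd)
  next
    case False
    then show ?thesis using that Rd[OF zA[of "n + 1"]] by (simp add: Rd)
  qed
  moreover have "finite {n. elts R n \<noteq> {\<zero>\<^bsub>cob R n\<^esub>}}"
    by (rule finite_subset[of _ "{0, -1}"]) (auto simp: Rc A_def)
  moreover have tR: "tff (cob R n) (elts R n)" for n using tff_mono[OF tM AM] by (simp add: Rc)
  ultimately have R: "tff_complex R"
    using fg_module_tff[OF mR tR] mod_hom_int[OF mR mR] by (simp add: tff_complex_def bounded_complex_def Rc)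
  \<comment> \<open>From the splitting x = (x - \<sigma>(\<epsilon>x)) + \<sigma>(\<epsilon>x): the
    first part lies in the kernel of \<epsilon> and is the component in degree 0, the second is
    recorded by \<epsilon>x in degree -1.\<close>
  define pr where "pr n = (\<lambda>x\<in>carrier M. if n = 0 then x \<oplus> \<ominus> \<sigma> (ep M x) else if n = - 1 then ep M x else \<zero>)" for n :: int
  have "total M R pr"
  proof
    show "pr n \<in> ahom M (cob R n)" for n
      unfolding pr_def
    proof (intro ahom_restrictI gM)
      fix x y assume x: "x \<in> carrier M" and y: "y \<in> carrier M"
      let ?p = "\<lambda>x. if n = 0 then x \<oplus> \<ominus> \<sigma> (ep M x) else if n = - 1 then ep M x else \<zero>"
      show "?p x \<in> elts R n" using x sc[OF x] epc[OF x] by (auto simp: Rc A_def epa epn M.r_neg)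
      show "?p (x \<oplus> y) = ?p x \<oplus>\<^bsub>cob R n\<^esub> ?p y"
        using x y sc(1)[OF x] sc(1)[OF y] by (simp add: Rc epa sa im M.minus_add M.a_ac)
    qed
    show "\<exists>!x. x \<in> carrier M \<and> (\<forall>n. pr n x = y n)" if y: "\<And>n. y n \<in> elts R n" for y
    proof (rule ex1I)
      have y0: "y 0 \<in> carrier M" "ep M (y 0) = \<zero>" using y[of 0] by (auto simp: Rc A_def)
      have y1: "y (- 1) \<in> A (- 1)" using y[of "-1"] by (simp add: Rc)
      have y1M: "y (- 1) \<in> carrier M" using y1 AM by blast
      have yn: "y n = \<zero>" if "n \<noteq> 0" "n \<noteq> - 1" for n using y[of n] that by (simp add: Rc A_def)
      have sy: "\<sigma> (y (- 1)) \<in> carrier M" "ep M (\<sigma> (y (- 1))) = y (- 1)" using s(3)[OF y1] by blast+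
      let ?x = "y 0 \<oplus> \<sigma> (y (- 1))"
      have x: "?x \<in> carrier M" using y0 sy by simp
      have ex: "ep M ?x = y (- 1)" using y0 sy y1M by (simp add: epa)
      show "?x \<in> carrier M \<and> (\<forall>n. pr n ?x = y n)"
      proof (intro conjI allI x)
        fix n show "pr n ?x = y n" using x ex yn[of n] y0 sy by (simp add: pr_def M.a_assoc M.r_neg)
      qed
      fix z assume z: "z \<in> carrier M \<and> (\<forall>n. pr n z = y n)"
      then have zM: "z \<in> carrier M" and pz: "pr n z = y n" for n by blast+
      have ez: "ep M z = y (- 1)" and z0: "z \<oplus> \<ominus> \<sigma> (ep M z) = y 0"
        using pz[of "-1"] pz[of 0] zM by (simp_all add: pr_def)
      show "z = ?x" using zM sy by (simp add: z0[symmetric] ez M.a_assoc M.l_neg)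
    qed
    fix x and n :: int assume x: "x \<in> carrier M"
    consider "n = - 1" | "n = 0" | "n = - 2" | "n \<noteq> - 1" "n \<noteq> 0" "n \<noteq> - 2" by blast
    then show "pr (n + 1) (ep M x) = signed n (cob R (n + 1)) (cdiff R n (pr n x))"
    proof cases
      case 1
      have a: "ep M x \<in> A 0" using x epc epp by (simp add: A_def)
      then have "\<ominus> ep M x \<in> A 0" using A[of 0] by (simp add: asub_def)
      then have "\<ominus>\<^bsub>zmod M (A 0)\<^esub> (\<ominus> ep M x) = ep M x" using a_inv_zmod[OF gM A] epc[OF x] by simp
      then show ?thesis using 1 x epc[OF x] epp[OF x] sz im[OF x] by (simp add: pr_def Rd Rc signed_def)
    next
      case 2
      have "pr 0 x \<in> A 0" using x sc[OF x] epc[OF x] by (simp add: pr_def A_def epa epn M.r_neg)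
      then show ?thesis
        using 2 epc[OF x] by (simp add: Rd pr_def)
    next
      case 3
      have "\<ominus>\<^bsub>zmod M (A (- 1))\<^esub> \<zero> = \<zero>" using a_inv_zmod[OF gM A zA] M.minus_equality[of "\<zero>" "\<zero>"] by simp
      then show ?thesis using 3 epc[OF x] epp[OF x] x by (simp add: pr_def Rd zA Rc signed_def)
    next
      case 4
      have "\<ominus>\<^bsub>zmod M (A (n + 1))\<^esub> \<zero> = \<zero>" using a_inv_zmod[OF gM A zA] M.minus_equality[of "\<zero>" "\<zero>"] by simp
      then show ?thesis using 4 epc[OF x] x by (simp add: pr_def Rd zA Rc signed_def)
    qed
  qed (fact M R)+
  then show ?thesis by (rule that)
qed

section \<open>The equivalence\<close>

lemma (in abelian_group) minus_eq_zero_iff: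
  assumes "x \<in> carrier G" "y \<in> carrier G" shows "x \<ominus> y = \<zero> \<longleftrightarrow> x = y"
proof
  assume "x \<ominus> y = \<zero>"
  moreover have "x = x \<ominus> y \<oplus> y" using assms by (simp add: a_minus_def a_assoc l_neg)
  ultimately show "x = y" using assms by simp
qed (use assms in \<open>simp add: a_minus_def r_neg\<close>)

text \<open>Composition with \<open>q\<close> is bijective on maps out of \<open>P\<close>, so
  sending c to q c p^-1 is an additive bijection from the maps \<open>P\<close> to \<open>Q\<close>
  in \<open>C\<close> onto the maps \<open>X\<close> to \<open>Y\<close> in the
  localization.\<close>

lemma (in enough_projectives)
  assumes P: "P \<in> Pr" "X \<in> Obj C" "Y \<in> Obj C" "p \<in> S P X" and Q: "Q \<in> Obj C" "q \<in> S Q Y"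
  shows frac_lift_image: "(\<lambda>c. frac P p X Y (Cmp C P Q Y q c)) ` mor C P Q = mor D X Y"
    and frac_lift_eq_iff: "\<lbrakk>c \<in> mor C P Q; d \<in> mor C P Q\<rbrakk>
      \<Longrightarrow> frac P p X Y (Cmp C P Q Y q c) = frac P p X Y (Cmp C P Q Y q d) \<longleftrightarrow> c = d"
    and frac_lift_add: "\<lbrakk>c \<in> mor C P Q; d \<in> mor C P Q\<rbrakk>
      \<Longrightarrow> frac P p X Y (Cmp C P Q Y q (c \<oplus>\<^bsub>Hom C P Q\<^esub> d))
        = frac P p X Y (Cmp C P Q Y q c) \<oplus>\<^bsub>Hom D X Y\<^esub> frac P p X Y (Cmp C P Q Y q d)"
proof -
  have PO: "P \<in> Obj C" by (rule Pr_Obj[OF P(1)])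
  have q: "q \<in> mor C Q Y" by (rule S_Hom[OF Q(1) P(3) Q(2)])
  note cl = Cmp_closed[OF PO Q(1) P(3) _ q]
  show "(\<lambda>c. frac P p X Y (Cmp C P Q Y q c)) ` mor C P Q = mor D X Y"
    unfolding carrier_Hom_D[OF P]
  proof (intro equalityI subsetI)
    fix F assume "F \<in> (\<lambda>c. frac P p X Y (Cmp C P Q Y q c)) ` mor C P Q"
    then show "F \<in> frac P p X Y ` mor C P Y" using cl by (elim imageE) simp
  next
    fix F assume "F \<in> frac P p X Y ` mor C P Y"
    then obtain a where a: "F = frac P p X Y a" "a \<in> mor C P Y" by (rule imageE)
    obtain c where "c \<in> mor C P Q" "Cmp C P Q Y q c = a"
      using ex1_implies_ex[OF lift_unique[OF P(1) Q(1) P(3) Q(2) a(2)]] by (elim exE conjE)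
    then show "F \<in> (\<lambda>c. frac P p X Y (Cmp C P Q Y q c)) ` mor C P Q"
      unfolding a(1) by (intro image_eqI[of _ _ c]) simp_all
  qed
  show "frac P p X Y (Cmp C P Q Y q c) = frac P p X Y (Cmp C P Q Y q d) \<longleftrightarrow> c = d"
    if cd: "c \<in> mor C P Q" "d \<in> mor C P Q"
    unfolding frac_inj[OF P cl[OF cd(1)] cl[OF cd(2)]]
    using lift_unique[OF P(1) Q(1) P(3) Q(2) cl[OF cd(1)]] cd by (metis (no_types))
  show "frac P p X Y (Cmp C P Q Y q (c \<oplus>\<^bsub>Hom C P Q\<^esub> d))
      = frac P p X Y (Cmp C P Q Y q c) \<oplus>\<^bsub>Hom D X Y\<^esub> frac P p X Y (Cmp C P Q Y q d)"
    if cd: "c \<in> mor C P Q" "d \<in> mor C P Q"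
    unfolding add_D[OF P cl[OF cd(1)] cl[OF cd(2)]] Cmp_add_right[OF PO Q(1) P(3) cd q] ..
qed

interpretation T: cat_ideal "torsionless_cat :: (((nat \<Rightarrow> int) set, 'a::infinite) module, 'a \<Rightarrow> 'a) precat" "factoring_through_projective Z_eps"
  rewrites "quotient_cat (torsionless_cat :: ('a eps_module, 'a \<Rightarrow> 'a) precat) (factoring_through_projective Z_eps)
    = stable_cat Z_eps (torsionless Z_eps)"
  by (rule cat_ideal_stable) (simp add: stable_cat_def)

lemma carrier_Hom_complex: "mor (complex_cat R) X Y = chain_maps R X Y"
  by (simp add: complex_cat_simps)

text \<open>Evaluation at a fixed element is an additive function of the chain map and therefore
  passes through finite sums.\<close>

lemma finsum_chain_maps:
  assumes X: "bounded_complex \<Z> X" and Y: "bounded_complex \<Z> Y" and c: "\<And>i. i \<in> J \<Longrightarrow> c i \<in> chain_maps \<Z> X Y" and a: "a \<in> elts X k"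
  shows "finsum (Hom Cpx X Y) c J k a = finsum (cob Y k) (\<lambda>i. c i k a) J"
proof -
  interpret H: abelian_group "Hom Cpx X Y" by (rule K.Hom_abelian_group) (simp_all add: Obj_complex_cat X Y)
  interpret Y: abelian_group "cob Y k" by (rule complexD(3)[OF Y])
  let ?ev = "\<lambda>f\<in>mor Cpx X Y. f k a"
  have ev: "?ev \<in> ahom (Hom Cpx X Y) (cob Y k)"
    using a by (intro ahom_restrictI H.abelian_group_axioms) (simp_all add: complex_cat_simps chain_mapsD(3))
  have c': "c i \<in> mor Cpx X Y" if "i \<in> J" for i using c[OF that] by (simp add: carrier_Hom_complex)
  have "?ev (finsum (Hom Cpx X Y) c J) = finsum (cob Y k) (\<lambda>i. ?ev (c i)) J"
    by (rule ahom_finsum[OF ev H.abelian_group_axioms Y.abelian_group_axioms c'])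
  moreover have "finsum (cob Y k) (\<lambda>i. ?ev (c i)) J = finsum (cob Y k) (\<lambda>i. c i k a) J"
    using c' chain_mapsD(3)[OF c a] by (intro Y.finsum_cong') auto
  moreover have "finsum (Hom Cpx X Y) c J \<in> mor Cpx X Y" using c' by (intro H.finsum_closed) blast
  ultimately show ?thesis by simp
qed

text \<open>An index of the span: \<open>R\<close> folds to \<open>M\<close> and resolves
  \<open>X\<close> through the quasi-isomorphism \<open>p\<close>.\<close>

locale folding = total M R pr for M :: "((nat \<Rightarrow> int) set, 'a::infinite) module" and R pr +
  fixes X :: "(int, 'a) cochain" and p :: "int \<Rightarrow> 'a \<Rightarrow> 'a"
  assumes X: "bounded_complex \<Z> X" and p: "p \<in> chain_maps \<Z> R X" and qi: "quasi_iso R X p"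
begin

lemma p_quasi_isos: "K.cls R X p \<in> quasi_isos \<Z> R X"
  by (rule cls_quasi_isos[OF bounded X p qi])

lemma p_shift_quasi_isos: "shift_class i (K.cls R X p) \<in> quasi_isos \<Z> (shift i R) (shift i X)"
  by (rule shift_class_quasi_isos[OF bounded X p_quasi_isos])

end

locale two_foldings = A: folding M R pr X p + B: folding N Q qr Y q
  for M :: "((nat \<Rightarrow> int) set, 'a::infinite) module" and R pr X p
    and N :: "'a eps_module" and Q qr Y q
begin

sublocale two_totals M R pr N Q qr ..

text \<open>The morphism q[i] c p^-1 from X to Y[i] in the derived category.\<close>

definition roof :: "int \<Rightarrow> (int \<Rightarrow> 'a \<Rightarrow> 'a) \<Rightarrow> (int, 'a) derived_mor" where
  "roof i c = D.frac R (K.cls R X p) X (shift i Y)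
     (Cmp Htp R (shift i Q) (shift i Y) (shift_class i (K.cls Q Y q)) (K.cls R (shift i Q) c))"

lemma objects:
  "R \<in> {P. tff_complex P}" "X \<in> Obj Htp" "shift i Y \<in> Obj Htp"
  "K.cls R X p \<in> quasi_isos \<Z> R X" "shift i Q \<in> Obj Htp"
  "shift_class i (K.cls Q Y q) \<in> quasi_isos \<Z> (shift i Q) (shift i Y)"
  using A.tff_complex A.X A.p_quasi_isos B.p_shift_quasi_isos bounded_complex_shift[OF B.X] bounded_complex_shift[OF B.bounded]
  by (simp_all add: Obj_complex_cat)

lemma RO: "R \<in> Obj Cpx" "shift i Q \<in> Obj Cpx"
  using A.bounded bounded_complex_shift[OF B.bounded] by (simp_all add: Obj_complex_cat)

lemma cls_closed: "c \<in> chain_maps \<Z> R (shift i Q) \<Longrightarrow> K.cls R (shift i Q) c \<in> mor Htp R (shift i Q)"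
  using K.cls_closed[OF RO] by (simp add: carrier_Hom_complex)

lemma roof_closed: "c \<in> chain_maps \<Z> R (shift i Q) \<Longrightarrow> roof i c \<in> mor Der X (shift i Y)"
  unfolding roof_def D.frac_lift_image[OF objects, symmetric] using cls_closed by (rule imageI)

lemma roof_surj:
  assumes "F \<in> mor Der X (shift i Y)"
  obtains c where "c \<in> chain_maps \<Z> R (shift i Q)" "F = roof i c"
proof -
  obtain C where "F = D.frac R (K.cls R X p) X (shift i Y)
     (Cmp Htp R (shift i Q) (shift i Y) (shift_class i (K.cls Q Y q)) C)" "C \<in> mor Htp R (shift i Q)"
    using assms unfolding D.frac_lift_image[OF objects, symmetric] by (elim imageE) simp
  moreover obtain c where "c \<in> chain_maps \<Z> R (shift i Q)" "C = K.cls R (shift i Q) c"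
    using K.Hom_Q_cases[OF RO \<open>C \<in> _\<close>] unfolding carrier_Hom_complex by blast
  ultimately show ?thesis using that unfolding roof_def by blast
qed

lemma roof_eq_iff:
  assumes "c \<in> chain_maps \<Z> R (shift i Q)" "d \<in> chain_maps \<Z> R (shift i Q)"
  shows "roof i c = roof i d \<longleftrightarrow> K.cls R (shift i Q) c = K.cls R (shift i Q) d"
  unfolding roof_def by (rule D.frac_lift_eq_iff[OF objects cls_closed[OF assms(1)] cls_closed[OF assms(2)]])

lemma roof_add:
  assumes c: "c \<in> chain_maps \<Z> R (shift i Q)" and d: "d \<in> chain_maps \<Z> R (shift i Q)"
  shows "roof i (c \<oplus>\<^bsub>Hom Cpx R (shift i Q)\<^esub> d) = roof i c \<oplus>\<^bsub>Hom Der X (shift i Y)\<^esub> roof i d"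
  unfolding roof_def D.frac_lift_add[OF objects cls_closed[OF c] cls_closed[OF d], symmetric]
    K.add_Q[OF RO c[folded carrier_Hom_complex] d[folded carrier_Hom_complex]] ..

lemma abelian_groups:
  "abelian_group (Hom Cpx R (shift i Q))" "abelian_group (Hom Der X (shift i Y))"
  by (rule K.Hom_abelian_group[OF RO], rule D.abelian_group_Hom_D[OF objects(2,3)])

lemma roof_ahom:
  "(\<lambda>c\<in>mor Cpx R (shift i Q). roof i c) \<in> ahom (Hom Cpx R (shift i Q)) (Hom Der X (shift i Y))"
  by (rule ahom_restrictI[OF abelian_groups(1)]; unfold carrier_Hom_complex) (fact roof_closed roof_add)+

lemma roof_zero_iff:
  assumes c: "c \<in> chain_maps \<Z> R (shift i Q)"
  shows "roof i c = \<zero>\<^bsub>Hom Der X (shift i Y)\<^esub> \<longleftrightarrow> c \<in> null_homotopic \<Z> R (shift i Q)"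
proof -
  have z: "\<zero>\<^bsub>Hom Cpx R (shift i Q)\<^esub> \<in> chain_maps \<Z> R (shift i Q)"
    using abelian_groupE(2)[OF abelian_groups(1)] by (simp add: carrier_Hom_complex)
  have "roof i \<zero>\<^bsub>Hom Cpx R (shift i Q)\<^esub> = \<zero>\<^bsub>Hom Der X (shift i Y)\<^esub>"
    using ahom_zero[OF roof_ahom[of i] abelian_groups(1)[of i] abelian_groups(2)[of i]] z by (simp add: carrier_Hom_complex)
  then have "roof i c = \<zero>\<^bsub>Hom Der X (shift i Y)\<^esub> \<longleftrightarrow> K.cls R (shift i Q) c = \<zero>\<^bsub>Hom Htp R (shift i Q)\<^esub>"
    using roof_eq_iff[OF c z] K.zero_Q[OF RO] by simp
  then show ?thesis using K.cls_zero_iff[OF RO] c by (simp add: carrier_Hom_complex)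
qed

definition unfold_map :: "('a \<Rightarrow> 'a) \<Rightarrow> int \<Rightarrow> (int, 'a) derived_mor" where
  "unfold_map f i = roof i (comp f i)"

lemma TO: "M \<in> Obj torsionless_cat" "N \<in> Obj torsionless_cat"
  using A.tmod B.tmod by (simp_all add: Obj_torsionless_cat)

lemma carrier_Hom_T: "mor torsionless_cat M N = mod_hom Z_eps M N" by (simp add: torsionless_cat_simps)

lemma mod_hom_ahom': "f \<in> mod_hom Z_eps M N \<Longrightarrow> f \<in> ahom M N"
  by (rule mod_hom_ahom)

lemma comp_add:
  assumes f: "f \<in> mod_hom Z_eps M N" and g: "g \<in> mod_hom Z_eps M N"
  shows "comp (f \<oplus>\<^bsub>Hom torsionless_cat M N\<^esub> g) i = comp f i \<oplus>\<^bsub>Hom Cpx R (shift i Q)\<^esub> comp g i"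
proof (intro ext)
  fix n a
  show "comp (f \<oplus>\<^bsub>Hom torsionless_cat M N\<^esub> g) i n a = (comp f i \<oplus>\<^bsub>Hom Cpx R (shift i Q)\<^esub> comp g i) n a"
    using A.emb_closed[of a n] ahom_closed[OF mod_hom_ahom'[OF f]] ahom_closed[OF mod_hom_ahom'[OF g]]
    by (simp add: comp_def complex_cat_simps torsionless_cat_simps ahom_add[OF B.pr] restrict_def)
qed

lemma unfold_ahom:
  "(\<lambda>f\<in>mor torsionless_cat M N. unfold_map f i) \<in> ahom (Hom torsionless_cat M N) (Hom Der X (shift i Y))"
proof (rule ahom_restrictI[OF T.Hom_abelian_group[OF TO]]; unfold carrier_Hom_T unfold_map_def)
  show "roof i (comp f i) \<in> mor Der X (shift i Y)" if "f \<in> mod_hom Z_eps M N" for f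
    by (rule roof_closed[OF comp_chain_map[OF that]])
  fix f g assume f: "f \<in> mod_hom Z_eps M N" and g: "g \<in> mod_hom Z_eps M N"
  show "roof i (comp (f \<oplus>\<^bsub>Hom torsionless_cat M N\<^esub> g) i) = roof i (comp f i) \<oplus>\<^bsub>Hom Der X (shift i Y)\<^esub> roof i (comp g i)"
    unfolding comp_add[OF f g] by (rule roof_add[OF comp_chain_map[OF f] comp_chain_map[OF g]])
qed

text \<open>A roof is zero when its chain map is null-homotopic; all diagonals are null-homotopic
  when the map has the form \<epsilon>h + h\<epsilon>; and these maps are the ones that factor
  through a projective.\<close>

lemma unfold_zero_iff:
  assumes f: "f \<in> mod_hom Z_eps M N"
  shows "(\<forall>i. unfold_map f i = \<zero>\<^bsub>Hom Der X (shift i Y)\<^esub>) \<longleftrightarrow> f \<in> factoring_through_projective Z_eps M N"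
  unfolding unfold_map_def roof_zero_iff[OF comp_chain_map[OF f]] comp_null_iff[OF f, symmetric]
    factoring_eq_null_maps[OF A.module B.tmod] ..

text \<open>Additivity reduces the question to the kernel, that is, to
  \<open>unfold_zero_iff\<close> for the difference.\<close>

lemma unfold_eq_iff:
  assumes f: "f \<in> mod_hom Z_eps M N" and g: "g \<in> mod_hom Z_eps M N"
  shows "unfold_map f = unfold_map g \<longleftrightarrow> T.cls M N f = T.cls M N g"
proof -
  interpret H: abelian_group "Hom torsionless_cat M N" by (rule T.Hom_abelian_group[OF TO])
  note f' = f[folded carrier_Hom_T] and g' = g[folded carrier_Hom_T]
  let ?d = "f \<ominus>\<^bsub>Hom torsionless_cat M N\<^esub> g"
  have d': "?d \<in> mor torsionless_cat M N" using f' g' by (rule H.minus_closed)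
  have "unfold_map f i = unfold_map g i \<longleftrightarrow> unfold_map ?d i = \<zero>\<^bsub>Hom Der X (shift i Y)\<^esub>" for i
  proof -
    interpret D: abelian_group "Hom Der X (shift i Y)" by (rule abelian_groups(2))
    have "unfold_map ?d i = unfold_map f i \<ominus>\<^bsub>Hom Der X (shift i Y)\<^esub> unfold_map g i"
      using ahom_minus[OF unfold_ahom H.abelian_group_axioms D.abelian_group_axioms f' g'] f' g' d' by simp
    moreover have "unfold_map f i \<in> mor Der X (shift i Y)" "unfold_map g i \<in> mor Der X (shift i Y)"
      unfolding unfold_map_def by (rule roof_closed[OF comp_chain_map], fact)+
    ultimately show ?thesis by (simp add: D.minus_eq_zero_iff)
  qed
  then have "unfold_map f = unfold_map g \<longleftrightarrow> (\<forall>i. unfold_map ?d i = \<zero>\<^bsub>Hom Der X (shift i Y)\<^esub>)"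
    by (simp add: fun_eq_iff)
  then show ?thesis using unfold_zero_iff[OF d'[unfolded carrier_Hom_T]] T.cls_eq_iff[OF TO g' f'] by simp
qed

lemma unfold_not_degrees:
  assumes f: "f \<in> mod_hom Z_eps M N" and i: "i \<notin> degrees"
  shows "unfold_map f i = \<zero>\<^bsub>Hom Der X (shift i Y)\<^esub>"
proof -
  have "comp f i = \<zero>\<^bsub>Hom Cpx R (shift i Q)\<^esub>"
    using pr_not_degrees[OF mod_hom_ahom'[OF f]] i by (intro ext) (simp add: comp_def complex_cat_simps restrict_def)
  then have "unfold_map f i = roof i \<zero>\<^bsub>Hom Cpx R (shift i Q)\<^esub>" by (simp add: unfold_map_def)
  then show ?thesis
    using ahom_zero[OF roof_ahom[of i] abelian_groups(1)[of i] abelian_groups(2)[of i]] abelian_groupE(2)[OF abelian_groups(1)[of i]] by simp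
qed

lemma orbit_Hom: "\<phi> \<in> mor (derived_orbit_cat \<Z>) X Y \<longleftrightarrow>
    (\<forall>i. \<phi> i \<in> mor Der X (shift i Y)) \<and> finite {i. \<phi> i \<noteq> \<zero>\<^bsub>Hom Der X (shift i Y)\<^esub>}"
  by (simp add: derived_orbit_cat_def orbit_cat_def)

lemma unfold_closed:
  assumes f: "f \<in> mod_hom Z_eps M N"
  shows "unfold_map f \<in> mor (derived_orbit_cat \<Z>) X Y"
  unfolding orbit_Hom
proof
  show "\<forall>i. unfold_map f i \<in> mor Der X (shift i Y)"
    using roof_closed[OF comp_chain_map[OF f]] by (simp add: unfold_map_def)
  show "finite {i. unfold_map f i \<noteq> \<zero>\<^bsub>Hom Der X (shift i Y)\<^esub>}"
    by (rule finite_subset[OF _ finite_degrees]) (use unfold_not_degrees[OF f] in blast)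
qed

text \<open>Each component is the roof of some chain map out of \<open>R\<close>, and by
  \<open>comp_surj\<close> the chain maps chosen in all degrees are the diagonals of one linear
  map.\<close>

lemma unfold_surj:
  assumes "\<phi> \<in> mor (derived_orbit_cat \<Z>) X Y"
  obtains f where "f \<in> mod_hom Z_eps M N" "unfold_map f = \<phi>"
proof -
  have "\<exists>c. c \<in> chain_maps \<Z> R (shift i Q) \<and> \<phi> i = roof i c" for i
    using roof_surj[of "\<phi> i" i] assms unfolding orbit_Hom by blast
  then have "\<forall>i. \<exists>c. c \<in> chain_maps \<Z> R (shift i Q) \<and> \<phi> i = roof i c" by blast
  from choice[OF this] obtain c where c: "\<forall>i. c i \<in> chain_maps \<Z> R (shift i Q) \<and> \<phi> i = roof i (c i)" ..
  then obtain f where f: "f \<in> mod_hom Z_eps M N" "\<And>i. comp f i = c i" using comp_surj[of c] by blast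
  then have "unfold_map f = \<phi>" using c by (intro ext) (simp add: unfold_map_def)
  with f(1) show ?thesis by (rule that)
qed

text \<open>By \<open>unfold_eq_iff\<close> the result does not depend on the representative
  picked.\<close>

definition unfold_class :: "('a \<Rightarrow> 'a) set \<Rightarrow> int \<Rightarrow> (int, 'a) derived_mor" where
  "unfold_class F = unfold_map (SOME f. f \<in> F)"

lemma unfold_class_cls:
  assumes f: "f \<in> mod_hom Z_eps M N"
  shows "unfold_class (T.cls M N f) = unfold_map f"
proof -
  note f' = f[folded carrier_Hom_T]
  have "(SOME g. g \<in> T.cls M N f) \<in> T.cls M N f" by (rule someI[of "\<lambda>g. g \<in> T.cls M N f", OF T.cls_self[OF TO f']])
  then have g: "(SOME g. g \<in> T.cls M N f) \<in> mod_hom Z_eps M N" "T.cls M N (SOME g. g \<in> T.cls M N f) = T.cls M N f"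
    unfolding T.mem_cls_iff[OF TO f'] carrier_Hom_T by blast+
  show ?thesis unfolding unfold_class_def using unfold_eq_iff[OF g(1) f] g(2) by blast
qed

lemma bij_unfold_class:
  "bij_betw unfold_class (carrier (Hom (stable_cat Z_eps (torsionless Z_eps)) M N)) (mor (derived_orbit_cat \<Z>) X Y)"
proof (rule bij_betwI')
  fix F G assume F: "F \<in> carrier (Hom (stable_cat Z_eps (torsionless Z_eps)) M N)" and G: "G \<in> carrier (Hom (stable_cat Z_eps (torsionless Z_eps)) M N)"
  obtain f where f: "f \<in> mod_hom Z_eps M N" "F = T.cls M N f" using T.Hom_Q_cases[OF TO F] unfolding carrier_Hom_T by blast
  obtain g where g: "g \<in> mod_hom Z_eps M N" "G = T.cls M N g" using T.Hom_Q_cases[OF TO G] unfolding carrier_Hom_T by blast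
  show "unfold_class F = unfold_class G \<longleftrightarrow> F = G"
    unfolding f(2) g(2) unfold_class_cls[OF f(1)] unfold_class_cls[OF g(1)] by (rule unfold_eq_iff[OF f(1) g(1)])
  show "unfold_class F \<in> mor (derived_orbit_cat \<Z>) X Y"
    unfolding f(2) unfold_class_cls[OF f(1)] by (rule unfold_closed[OF f(1)])
next
  fix \<phi> assume "\<phi> \<in> mor (derived_orbit_cat \<Z>) X Y"
  then obtain f where f: "f \<in> mod_hom Z_eps M N" "unfold_map f = \<phi>" by (rule unfold_surj)
  then show "\<exists>F\<in>carrier (Hom (stable_cat Z_eps (torsionless Z_eps)) M N). \<phi> = unfold_class F"
    using T.cls_closed[OF TO, of f] unfold_class_cls[OF f(1)] unfolding carrier_Hom_T by (intro bexI[of _ "T.cls M N f"]) simp_all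
qed

end

lemma (in folding) two_foldings_self: "two_foldings M R pr X p M R pr X p" ..

text \<open>The identity matrix has only the diagonal of degree 0, and there the roof is p
  p^-1.\<close>

lemma (in folding) unfold_Ident:
  "two_foldings.unfold_map M R pr X p R pr X p (Ident torsionless_cat M) = Ident (derived_orbit_cat \<Z>) X"
proof
  interpret S: two_foldings M R pr X p M R pr X p by (rule two_foldings_self)
  fix i
  have id: "(\<lambda>x\<in>carrier M. x) \<in> mod_hom Z_eps M M"
    using T.Ident_closed[OF S.TO(1)] by (simp add: torsionless_cat_simps)
  show "S.unfold_map (Ident torsionless_cat M) i = Ident (derived_orbit_cat \<Z>) X i"
  proof (cases "i = 0")
    case True
    have c: "S.comp (\<lambda>x\<in>carrier M. x) 0 = Ident Cpx R"
      by (intro ext) (simp add: S.comp_def complex_cat_simps restrict_def emb_closed pr_emb)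
    have sc: "shift_class 0 F = F" for F by (simp add: shift_class_def shift_map_def)
    have "Cmp Htp R R X (K.cls R X p) (K.cls R R (Ident Cpx R)) = K.cls R X p"
      unfolding K.Ident_Q[symmetric]
      by (rule category.Cmp_Ident_right[OF preadditive.axioms(1)[OF K.preadditive_Q]])
        (use bounded X K.cls_closed[of R X p] p in \<open>simp_all add: Obj_complex_cat carrier_Hom_complex\<close>)
    then have "S.unfold_map (Ident torsionless_cat M) 0 = D.frac R (K.cls R X p) X X (K.cls R X p)"
      by (simp add: S.unfold_map_def S.roof_def torsionless_cat_simps c sc shift_0[OF X] shift_0[OF bounded])
    also have "\<dots> = Ident Der X" using D.Ident_D[OF S.objects(1,2,4)] by simp
    finally show ?thesis using True by (simp add: derived_orbit_cat_def orbit_cat_def)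
  next
    case False
    have c: "S.comp (\<lambda>x\<in>carrier M. x) i = \<zero>\<^bsub>Hom Cpx R (shift i R)\<^esub>"
      using False by (intro ext) (simp add: S.comp_def complex_cat_simps restrict_def emb_closed pr_emb)
    have "S.comp (\<lambda>x\<in>carrier M. x) i \<in> null_homotopic \<Z> R (shift i R)"
      by (rule iffD1[OF K.cls_zero_iff[OF S.RO S.comp_chain_map[OF id, folded carrier_Hom_complex]]]) (simp only: c K.zero_Q[OF S.RO])
    then have "S.unfold_map (Ident torsionless_cat M) i = \<zero>\<^bsub>Hom Der X (shift i X)\<^esub>"
      using S.roof_zero_iff[OF S.comp_chain_map[OF id]] by (simp add: S.unfold_map_def torsionless_cat_simps)
    then show ?thesis using False by (simp add: derived_orbit_cat_def orbit_cat_def)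
  qed
qed

section \<open>Compatibility of unfolding with composition\<close>

locale three_foldings = A: folding M R pr X p + B: folding N Q qr Y q + C: folding L S sr Z s
  for M :: "((nat \<Rightarrow> int) set, 'a::infinite) module" and R pr X p
    and N :: "'a eps_module" and Q qr Y q
    and L :: "'a eps_module" and S sr Z s
begin

sublocale AB: two_foldings M R pr X p N Q qr Y q ..
sublocale BC: two_foldings N Q qr Y q L S sr Z s ..
sublocale AC: two_foldings M R pr X p L S sr Z s ..

lemma shift_chain_map:
  assumes "d \<in> chain_maps \<Z> Q (shift j S)"
  shows "shift_map i d \<in> chain_maps \<Z> (shift i Q) (shift (i + j) S)"
  using shift_map_chain_maps[OF B.bounded bounded_complex_shift[OF C.bounded] assms, of i] by (simp add: shift_shift[OF C.bounded])

text \<open>\<open>Cmp_D\<close> applies with the shifted resolution Q[i] of Y[i] in the middle: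
  \<open>c\<close> is a map into Q[i], and d[i] starts there. Strictness of the shift identifies
  S[j][i] with S[i + j].\<close>

lemma roof_compose:
  assumes c: "c \<in> chain_maps \<Z> R (shift i Q)" and d: "d \<in> chain_maps \<Z> Q (shift j S)"
  shows "Cmp Der X (shift i Y) (shift (i + j) Z) (shift_derived i (BC.roof j d)) (AB.roof i c)
    = AC.roof (i + j) (Cmp Cpx R (shift i Q) (shift (i + j) S) (shift_map i d) c)"
proof -
  let ?H = "Htp :: ((int, 'a) cochain, _) precat"
  let ?d = "K.cls Q (shift j S) d" and ?s = "K.cls S Z s"
  note bQ = bounded_complex_shift[OF B.bounded] and bS = bounded_complex_shift[OF C.bounded] and bZ = bounded_complex_shift[OF C.X]
  note dH = BC.cls_closed[OF d]
  have sH: "shift_class j ?s \<in> mor ?H (shift j S) (shift j Z)"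
    using C.p_shift_quasi_isos by (simp add: quasi_isos_def)
  have aH: "Cmp ?H Q (shift j S) (shift j Z) (shift_class j ?s) ?d \<in> mor ?H Q (shift j Z)"
    by (rule category.Cmp_closed[OF preadditive.axioms(1)[OF K.preadditive_Q]])
      (simp_all add: Obj_complex_cat B.bounded bS bZ dH sH)
  let ?b = "Cmp ?H (shift i Q) (shift (i + j) S) (shift (i + j) Z) (shift_class (i + j) ?s) (K.cls (shift i Q) (shift (i + j) S) (shift_map i d))"
  have ss: "shift_class i (shift_class j ?s) = shift_class (i + j) ?s"
    by (simp add: shift_class_def shift_map_def image_image add.assoc)
  have b: "shift_class i (Cmp ?H Q (shift j S) (shift j Z) (shift_class j ?s) ?d) = ?b"
    unfolding shift_class_Cmp[OF B.bounded bS bZ dH sH] ss shift_class_cls[OF B.bounded bS d] shift_shift[OF C.bounded] shift_shift[OF C.X] ..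
  have bH: "?b \<in> carrier (Hom ?H (shift i Q) (shift (i + j) Z))"
    using shift_class_Hom[OF B.bounded bZ aH, of i] unfolding b shift_shift[OF C.X] .
  have 1: "shift_derived i (BC.roof j d) = D.frac (shift i Q) (shift_class i (K.cls Q Y q)) (shift i Y) (shift (i + j) Z) ?b"
    unfolding BC.roof_def shift_derived_frac[OF B.tff_complex B.X bZ B.p_quasi_isos aH] b shift_shift[OF C.X] ..
  have "Cmp Der X (shift i Y) (shift (i + j) Z) (shift_derived i (BC.roof j d)) (AB.roof i c)
    = D.frac R (K.cls R X p) X (shift (i + j) Z) (Cmp ?H R (shift i Q) (shift (i + j) Z) ?b (K.cls R (shift i Q) c))"
    unfolding 1 AB.roof_def
    by (rule D.Cmp_D[OF AB.objects(1-4) _ _ AB.objects(6) AB.cls_closed[OF c] bH])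
      (simp_all add: tff_complex_shift[OF B.tff_complex] Obj_complex_cat bZ)
  also have "Cmp ?H R (shift i Q) (shift (i + j) Z) ?b (K.cls R (shift i Q) c) =
    Cmp ?H R (shift (i + j) S) (shift (i + j) Z) (shift_class (i + j) ?s)
      (Cmp ?H R (shift i Q) (shift (i + j) S) (K.cls (shift i Q) (shift (i + j) S) (shift_map i d)) (K.cls R (shift i Q) c))"
    by (rule category.Cmp_assoc[OF preadditive.axioms(1)[OF K.preadditive_Q], symmetric])
      (use C.p_shift_quasi_isos K.cls_closed[of "shift i Q" "shift (i + j) S"] shift_chain_map[OF d, of i] AB.cls_closed[OF c]
        in \<open>simp_all add: Obj_complex_cat A.bounded bQ bS bZ quasi_isos_def carrier_Hom_complex\<close>)
  also have "Cmp ?H R (shift i Q) (shift (i + j) S) (K.cls (shift i Q) (shift (i + j) S) (shift_map i d)) (K.cls R (shift i Q) c)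
    = K.cls R (shift (i + j) S) (Cmp Cpx R (shift i Q) (shift (i + j) S) (shift_map i d) c)"
    by (rule K.Cmp_Q) (use c shift_chain_map[OF d, of i] in \<open>simp_all add: Obj_complex_cat A.bounded bQ bS carrier_Hom_complex\<close>)
  finally show ?thesis by (simp only: AC.roof_def)
qed

text \<open>Composition in the orbit category is a convolution over degrees, and so is the product
  of matrices along diagonals. The ranges differ: the former runs over the components of
  \<open>f\<close> that are nonzero in the derived category, the latter over all of
  \<open>degrees\<close>.\<close>

lemma unfold_compose:
  assumes f: "f \<in> mod_hom Z_eps M N" and g: "g \<in> mod_hom Z_eps N L"
  shows "AC.unfold_map (compose (carrier M) g f) = Cmp (derived_orbit_cat \<Z>) X Y Z (BC.unfold_map g) (AB.unfold_map f)"
proof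
  fix n
  let ?C = "Cpx :: ((int, 'a) cochain, _) precat" and ?D = "Der :: ((int, 'a) cochain, _) precat"
  let ?K = "Hom ?C R (shift n S)" and ?G = "Hom ?D X (shift n Z)"
  let ?A = "{i. AB.unfold_map f i \<noteq> \<zero>\<^bsub>Hom ?D X (shift i Y)\<^esub>}"
  define t where "t i = Cmp ?C R (shift i Q) (shift n S) (shift_map i (BC.comp g (n - i))) (AB.comp f i)" for i
  interpret G: abelian_group ?G by (rule AC.abelian_groups(2))
  interpret K': abelian_group ?K by (rule AC.abelian_groups(1))
  have cf: "AB.comp f i \<in> chain_maps \<Z> R (shift i Q)" for i by (rule AB.comp_chain_map[OF f])
  have sg: "shift_map i (BC.comp g (n - i)) \<in> chain_maps \<Z> (shift i Q) (shift n S)" for i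
    using shift_chain_map[OF BC.comp_chain_map[OF g, of "n - i"], of i] by simp
  have tK: "t i \<in> carrier ?K" for i
    unfolding t_def by (rule K.Cmp_closed) (simp_all add: AB.RO AC.RO carrier_Hom_complex cf sg)
  then have tC: "t i \<in> chain_maps \<Z> R (shift n S)" for i by (simp only: carrier_Hom_complex)
  have tm: "Cmp ?D X (shift i Y) (shift n Z) (shift_derived i (BC.unfold_map g (n - i))) (AB.unfold_map f i) = AC.roof n (t i)" for i
    using roof_compose[OF cf BC.comp_chain_map[OF g], of i "n - i"] by (simp add: AB.unfold_map_def BC.unfold_map_def t_def)
  \<comment> \<open>A diagonal of \<open>f\<close> can be nonzero as a chain map and still vanish in
    the derived category. Its contribution is then null-homotopic, so enlarging the range adds only
    zeros.\<close>
  have neutral: "AC.roof n (t i) = \<zero>\<^bsub>?G\<^esub>" if "i \<notin> ?A" for i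
  proof -
    have "AB.comp f i \<in> null_homotopic \<Z> R (shift i Q)"
      using that AB.roof_zero_iff[OF cf] by (simp add: AB.unfold_map_def)
    then have "t i \<in> null_homotopic \<Z> R (shift n S)"
      unfolding t_def by (intro K.I_Cmp_left) (simp_all add: AB.RO AC.RO carrier_Hom_complex sg)
    then show ?thesis using AC.roof_zero_iff[OF tC] by simp
  qed
  have fin: "finsum ?K t AB.degrees = AC.comp (compose (carrier M) g f) n"
  proof (rule chain_maps_eqI[OF int_is_cring])
    show "finsum ?K t AB.degrees \<in> chain_maps \<Z> R (shift n S)"
      using K'.finsum_closed[of t AB.degrees] tK by (simp only: carrier_Hom_complex Pi_I)
    show "AC.comp (compose (carrier M) g f) n \<in> chain_maps \<Z> R (shift n S)"
      by (rule AC.comp_chain_map[OF mod_hom_compose[OF f g A.module]])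
    fix k a assume a: "a \<in> elts R k"
    have "finsum ?K t AB.degrees k a = finsum (cob S (k + n)) (\<lambda>i. t i k a) AB.degrees"
      using finsum_chain_maps[OF A.bounded bounded_complex_shift[OF C.bounded] tC a] by simp
    also have "\<dots> = finsum (cob S (k + n)) (\<lambda>i. BC.comp g (n - i) (k + i) (AB.comp f i k a)) AB.degrees"
      using a by (simp add: t_def complex_cat_simps compose_def shift_map_def)
    also have "\<dots> = AC.comp (compose (carrier M) g f) n k a"
      by (rule comp_compose[OF A.total_axioms B.total_axioms C.total_axioms AB.mod_hom_ahom'[OF f] BC.mod_hom_ahom'[OF g]
          AB.finite_degrees order_refl a, symmetric])
    finally show "finsum ?K t AB.degrees k a = AC.comp (compose (carrier M) g f) n k a" .
  qed
  have "Cmp (derived_orbit_cat \<Z>) X Y Z (BC.unfold_map g) (AB.unfold_map f) n =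
    finsum ?G (\<lambda>i. Cmp ?D X (shift i Y) (shift n Z) (shift_derived i (BC.unfold_map g (n - i))) (AB.unfold_map f i)) ?A"
    by (simp add: derived_orbit_cat_def orbit_cat_def)
  also have "\<dots> = finsum ?G (\<lambda>i. AC.roof n (t i)) AB.degrees"
    unfolding tm
  proof (rule G.add.finprod_mono_neutral_cong_left)
    show "?A \<subseteq> AB.degrees" using AB.unfold_not_degrees[OF f] by blast
  qed (use AB.finite_degrees neutral AC.roof_closed[OF tC] in auto)
  also have "\<dots> = AC.roof n (finsum ?K t AB.degrees)"
    using ahom_finsum[OF AC.roof_ahom[of n] K'.abelian_group_axioms G.abelian_group_axioms, of AB.degrees t] tK
      K'.finsum_closed[of t AB.degrees] by simp
  finally show "AC.unfold_map (compose (carrier M) g f) n = Cmp (derived_orbit_cat \<Z>) X Y Z (BC.unfold_map g) (AB.unfold_map f) n"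
    unfolding AC.unfold_map_def fin ..
qed

end

text \<open>The span is formed by all foldings. A module is linked to a complex that folds to it,
  resolved by the identity; a complex is linked to the total module of a free resolution. Hence both
  projections are onto.\<close>

lemma stable_equivalent_orbit:
  "equivalent_categories
     (stable_cat Z_eps (torsionless Z_eps :: (_, 'a::infinite) module set))
     (derived_orbit_cat \<Z> :: ((int, 'a) cochain, _) precat)"
proof (rule equivalent_categories_span)
  let ?S = "stable_cat Z_eps (torsionless Z_eps :: (_, 'a) module set)"
  let ?D = "derived_orbit_cat \<Z> :: ((int, 'a) cochain, _) precat"
  let ?E = "{(M, R, pr, X, p). folding M R pr X p} :: ('a eps_module \<times> (int, 'a) cochain \<times> (int \<Rightarrow> 'a \<Rightarrow> 'a) \<times> (int, 'a) cochain \<times> (int \<Rightarrow> 'a \<Rightarrow> 'a)) set"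
  let ?U = "fst :: 'a eps_module \<times> (int, 'a) cochain \<times> (int \<Rightarrow> 'a \<Rightarrow> 'a) \<times> (int, 'a) cochain \<times> (int \<Rightarrow> 'a \<Rightarrow> 'a) \<Rightarrow> _"
  let ?V = "\<lambda>(M, R, pr, X, p). X"
  let ?\<Phi> = "\<lambda>(M, R, pr, X, p) (N, Q, qr, Y, q). two_foldings.unfold_class M R pr X p Q qr Y q"
  show "category ?S" by (rule preadditive.axioms(1)[OF T.preadditive_Q])
  have SO: "M \<in> Obj ?S \<longleftrightarrow> tmod M" for M :: "'a eps_module" by (simp add: Obj_torsionless_cat)
  have DO: "X \<in> Obj ?D \<longleftrightarrow> bounded_complex \<Z> X" for X :: "(int, 'a) cochain"
    by (simp add: derived_orbit_cat_def orbit_cat_def Obj_complex_cat)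
  show "?U e \<in> Obj ?S" if "e \<in> ?E" for e
    using that unfolding SO by (auto simp: folding_def total_def)
  show "?V e \<in> Obj ?D" if "e \<in> ?E" for e
    using that unfolding DO by (auto simp: folding_def folding_axioms_def)
  show "\<exists>e\<in>?E. ?U e = M" if M: "M \<in> Obj ?S" for M
  proof -
    obtain R pr where t: "total M R pr" using ex_total_complex[OF M[unfolded SO]] .
    then interpret total M R pr .
    have "folding M R pr R (\<lambda>n. \<lambda>x\<in>elts R n. x)"
      using t bounded quasi_iso_ident[OF bounded] K.Ident_closed[of R]
      by (simp add: folding_def folding_axioms_def complex_cat_simps)
    then show ?thesis by (intro bexI[of _ "(M, R, pr, R, \<lambda>n. \<lambda>x\<in>elts R n. x)"]) simp_all
  qed
  show "\<exists>e\<in>?E. ?V e = X" if X: "X \<in> Obj ?D" for X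
  proof -
    obtain R p where R: "tff_complex R" "p \<in> chain_maps \<Z> R X" "quasi_iso R X p"
      using resolution_exists[OF X[unfolded DO]] .
    obtain M pr where t: "total M R pr" using ex_total_module[OF R(1)] .
    then have "folding M R pr X p" using R X by (simp add: folding_def folding_axioms_def DO)
    then show ?thesis by (intro bexI[of _ "(M, R, pr, X, p)"]) simp_all
  qed
  show "bij_betw (?\<Phi> e e') (mor ?S (?U e) (?U e')) (mor ?D (?V e) (?V e'))" if "e \<in> ?E" "e' \<in> ?E" for e e'
  proof -
    obtain M R pr X p where e: "e = (M, R, pr, X, p)" by (cases e)
    obtain N Q qr Y q where e': "e' = (N, Q, qr, Y, q)" by (cases e')
    interpret two_foldings M R pr X p N Q qr Y q
      using that by (simp add: e e' two_foldings_def)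
    show ?thesis using bij_unfold_class by (simp add: e e')
  qed
  show "?\<Phi> e e (Ident ?S (?U e)) = Ident ?D (?V e)" if "e \<in> ?E" for e
  proof -
    obtain M R pr X p where e: "e = (M, R, pr, X, p)" by (cases e)
    interpret folding M R pr X p using that by (simp add: e)
    interpret S: two_foldings M R pr X p M R pr X p by (rule two_foldings_self)
    have "Ident torsionless_cat M \<in> mod_hom Z_eps M M" using T.Ident_closed[OF S.TO(1)] by (simp only: S.carrier_Hom_T)
    then have "S.unfold_class (Ident ?S M) = Ident ?D X" unfolding T.Ident_Q by (simp only: S.unfold_class_cls unfold_Ident)
    then show ?thesis by (simp add: e)
  qed
  show "?\<Phi> e e'' (Cmp ?S (?U e) (?U e') (?U e'') G F) = Cmp ?D (?V e) (?V e') (?V e'') (?\<Phi> e' e'' G) (?\<Phi> e e' F)"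
    if "e \<in> ?E" "e' \<in> ?E" "e'' \<in> ?E" "F \<in> mor ?S (?U e) (?U e')" "G \<in> mor ?S (?U e') (?U e'')" for e e' e'' F G
  proof -
    obtain M R pr X p where e: "e = (M, R, pr, X, p)" by (cases e)
    obtain N Q qr Y q where e': "e' = (N, Q, qr, Y, q)" by (cases e')
    obtain L S sr Z s where e'': "e'' = (L, S, sr, Z, s)" by (cases e'')
    interpret three_foldings M R pr X p N Q qr Y q L S sr Z s
      using that by (simp add: e e' e'' three_foldings_def)
    have F: "F \<in> mor ?S M N" and G: "G \<in> mor ?S N L" using that by (simp_all add: e e' e'')
    obtain f where f: "f \<in> mod_hom Z_eps M N" "F = T.cls M N f" using T.Hom_Q_cases[OF AB.TO F] unfolding AB.carrier_Hom_T by blast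
    obtain g where g: "g \<in> mod_hom Z_eps N L" "G = T.cls N L g" using T.Hom_Q_cases[OF BC.TO G] unfolding BC.carrier_Hom_T by blast
    have "Cmp ?S M N L G F = T.cls M L (compose (carrier M) g f)"
      unfolding f(2) g(2) T.Cmp_Q[OF AB.TO BC.TO(2) f(1)[folded AB.carrier_Hom_T] g(1)[folded BC.carrier_Hom_T]] torsionless_cat_simps ..
    then have "AC.unfold_class (Cmp ?S M N L G F) = Cmp ?D X Y Z (BC.unfold_class G) (AB.unfold_class F)"
      unfolding f(2) g(2)
      by (simp only: AC.unfold_class_cls[OF mod_hom_compose[OF f(1) g(1) A.module]] AB.unfold_class_cls[OF f(1)]
          BC.unfold_class_cls[OF g(1)] unfold_compose[OF f(1) g(1)])
    then show ?thesis by (simp add: e e' e'')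
  qed
qed

lemma equivalent_categories_refl:
  assumes "category C" shows "equivalent_categories C C"
proof (rule equivalent_categories_span[where E = "Obj C" and U = "\<lambda>X. X" and V = "\<lambda>X. X" and \<Phi> = "\<lambda>X Y f. f", OF assms])
qed (auto simp: bij_betw_def)

theorem theorem1p2p1:
  shows "equivalent_categories
           (stable_cat Z_eps (Gorenstein_projective Z_eps :: (_, 'a::infinite) module set))
           (stable_cat Z_eps (torsionless Z_eps :: (_, 'a) module set)) \<and>
         equivalent_categories
           (stable_cat Z_eps (torsionless Z_eps :: (_, 'a) module set))
           (derived_orbit_cat \<Z> :: ((int, 'a) cochain, _) precat) \<and>
         equivalent_categories
           (stable_cat Z_eps (Gorenstein_projective Z_eps :: (_, 'a) module set))
           (derived_orbit_cat \<Z> :: ((int, 'a) cochain, _) precat)"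
  unfolding stable_Gorenstein_projective_eq
  using equivalent_categories_refl[OF preadditive.axioms(1)[OF T.preadditive_Q]] stable_equivalent_orbit by blast

end
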